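(* No non-trivial Boolean formal space $S$ can be compact unless excluded middle is accepted: in $\mathrm{CZF}^*$, if some non-trivial Boolean formal space is compact then [R]EM holds; in each of $\mathrm{CTT}^*$, HHA, IZF, if some non-trivial Boolean formal space is compact then EM holds.
   Context: Systems. CZF is Aczel's constructive set theory; CTT is Martin-Löf's constructive type theory; IZF is CZF with full separation and powerset; HHA is intuitionistic higher-order Heyting arithmetic (topos logic). $\mathrm{CZF}^*$ denotes an arbitrary fixed extension of CZF consistent with the scheme GUP-CZF: for every set $I$, $(\forall x)(\exists y\in I)A(x,y)\to(\exists y\in I)(\forall x)A(x,y)$. $\mathrm{CTT}^*$ denotes an arbitrary fixed extension of CTT consistent with GUP-CTT: for every set $I$, every $R$ mapping a proposition and an element of $I$ to a proposition, and every $F$ from propositions to $I$ with $R(P,F(P))$ for all $P$, there is $\bar i\in I$ with $R(P,\bar i)$ for all $P$. EM: $P\vee\neg P$ for all propositions $P$. [R]EM: $(\forall p\in\mathsf{Pow}(\{\top\}))\,p\cup p^*=\{\top\}$, where $\mathsf{Pow}(\{\top\})$ is the class of subsets of $\{\top\}$ and $p^*\equiv\{x\in\{\top\}:x\notin p\}$. Formal spaces. A formal space is a pair $(S,\vartriangleleft)$ with $S$ a set and $\vartriangleleft$ a relation (a class in CZF) between elements and subsets of $S$ such that: $a\in U$ implies $a\vartriangleleft U$; $a\vartriangleleft U$ and $U\vartriangleleft V$ imply $a\vartriangleleft V$; $a\vartriangleleft U$ and $a\vartriangleleft V$ imply $a\vartriangleleft U\downarrow V$; and (in CZF) $\{a\in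 S:a\vartriangleleft U\}$ is a set for every $U\subseteq S$. Here $U\vartriangleleft V$ means $(\forall u\in U)\,u\vartriangleleft V$, $U\downarrow V\equiv\{d\in S:(\exists u\in U)\,d\vartriangleleft\{u\}\ \&\ (\exists v\in V)\,d\vartriangleleft\{v\}\}$, and $a\downarrow U$ means $\{a\}\downarrow U$. The pseudocomplement of $U\subseteq S$ is $U^*\equiv\{a\in S:a\downarrow U\vartriangleleft\emptyset\}$. $S$ is non-trivial if $\neg(S\vartriangleleft\emptyset)$; Boolean if $S\vartriangleleft U\cup U^*$ for all $U\subseteq S$; compact if $S\vartriangleleft U$ implies $S\vartriangleleft u_0$ for some finite (i.e. finitely listed, $u_0=\{x_1,\dots,x_n\}$, $n\ge 0$) $u_0\subseteq U$. (One may always assume that $S$ has a top element $1_S$, i.e. $S\vartriangleleft\{1_S\}$; then $S$ may be replaced by $1_S$ on the left of these conditions.) *)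

theory Defs
  imports Main
begin

text \<open>
  The four systems are deeply embedded as derivability relations with de Bruijn indices.  To keep
  concrete formulas readable they are written in higher-order abstract syntax: an expression is a
  function of the number of binders above it, and a variable bound at depth \<open>n\<close> is the function
  \<open>\<lambda>m. m - Suc n\<close>, which yields its de Bruijn index at each deeper level \<open>m\<close>.  A closed
  expression \<open>e\<close> denotes the de Bruijn term \<open>e 0\<close>.
\<close>


section \<open>First-order set theories: CZF and IZF\<close>

datatype fm =
    FMem nat nat
  | FEq nat nat
  | FBot
  | FAnd fm fm
  | FOr fm fm
  | FImp fm fm
  | FAll fm
  | FEx fm

definition up :: "(nat \<Rightarrow> nat) \<Rightarrow> nat \<Rightarrow> nat" where
  "up r = case_nat 0 (\<lambda>k. Suc (r k))"

primrec ren :: "(nat \<Rightarrow> nat) \<Rightarrow> fm \<Rightarrow> fm" where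
  "ren r (FMem x y) = FMem (r x) (r y)"
| "ren r (FEq x y) = FEq (r x) (r y)"
| "ren r FBot = FBot"
| "ren r (FAnd p q) = FAnd (ren r p) (ren r q)"
| "ren r (FOr p q) = FOr (ren r p) (ren r q)"
| "ren r (FImp p q) = FImp (ren r p) (ren r q)"
| "ren r (FAll p) = FAll (ren (up r) p)"
| "ren r (FEx p) = FEx (ren (up r) p)"

abbreviation fm_inst :: "nat \<Rightarrow> fm \<Rightarrow> fm" where
  "fm_inst y p \<equiv> ren (case_nat y id) p"

text \<open>
  Intuitionistic first-order logic with equality.  The only terms are variables, so substitution is
  renaming.  Non-logical axioms may have free variables and stand for their universal closures.
\<close>

inductive nd :: "fm set \<Rightarrow> fm list \<Rightarrow> fm \<Rightarrow> bool" for T where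
  Ax: "p \<in> T \<Longrightarrow> nd T H (ren r p)"
| Hyp: "p \<in> set H \<Longrightarrow> nd T H p"
| BotE: "nd T H FBot \<Longrightarrow> nd T H p"
| AndI: "nd T H p \<Longrightarrow> nd T H q \<Longrightarrow> nd T H (FAnd p q)"
| AndE1: "nd T H (FAnd p q) \<Longrightarrow> nd T H p"
| AndE2: "nd T H (FAnd p q) \<Longrightarrow> nd T H q"
| OrI1: "nd T H p \<Longrightarrow> nd T H (FOr p q)"
| OrI2: "nd T H q \<Longrightarrow> nd T H (FOr p q)"
| OrE: "nd T H (FOr p q) \<Longrightarrow> nd T (p # H) r \<Longrightarrow> nd T (q # H) r \<Longrightarrow> nd T H r"
| ImpI: "nd T (p # H) q \<Longrightarrow> nd T H (FImp p q)"
| ImpE: "nd T H (FImp p q) \<Longrightarrow> nd T H p \<Longrightarrow> nd T H q"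
| AllI: "nd T (map (ren Suc) H) p \<Longrightarrow> nd T H (FAll p)"
| AllE: "nd T H (FAll p) \<Longrightarrow> nd T H (fm_inst y p)"
| ExI: "nd T H (fm_inst y p) \<Longrightarrow> nd T H (FEx p)"
| ExE: "nd T H (FEx p) \<Longrightarrow> nd T (p # map (ren Suc) H) (ren Suc q) \<Longrightarrow> nd T H q"
| EqI: "nd T H (FEq x x)"
| EqE: "nd T H (FEq x y) \<Longrightarrow> nd T H (fm_inst x p) \<Longrightarrow> nd T H (fm_inst y p)"

type_synonym form = "nat \<Rightarrow> fm"
type_synonym var = "nat \<Rightarrow> nat"

definition s_mem :: "var \<Rightarrow> var \<Rightarrow> form" (infix "\<in>\<^sub>s" 50) where
  "(x \<in>\<^sub>s y) = (\<lambda>n. FMem (x n) (y n))"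
definition s_eq :: "var \<Rightarrow> var \<Rightarrow> form" (infix "=\<^sub>s" 50) where
  "(x =\<^sub>s y) = (\<lambda>n. FEq (x n) (y n))"
definition s_bot :: form where
  "s_bot = (\<lambda>n. FBot)"
definition s_and :: "form \<Rightarrow> form \<Rightarrow> form" (infixr "\<and>\<^sub>s" 35) where
  "(p \<and>\<^sub>s q) = (\<lambda>n. FAnd (p n) (q n))"
definition s_or :: "form \<Rightarrow> form \<Rightarrow> form" (infixr "\<or>\<^sub>s" 30) where
  "(p \<or>\<^sub>s q) = (\<lambda>n. FOr (p n) (q n))"
definition s_imp :: "form \<Rightarrow> form \<Rightarrow> form" (infixr "\<longrightarrow>\<^sub>s" 25) where
  "(p \<longrightarrow>\<^sub>s q) = (\<lambda>n. FImp (p n) (q n))"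
definition s_iff :: "form \<Rightarrow> form \<Rightarrow> form" (infixr "\<longleftrightarrow>\<^sub>s" 25) where
  "(p \<longleftrightarrow>\<^sub>s q) = ((p \<longrightarrow>\<^sub>s q) \<and>\<^sub>s (q \<longrightarrow>\<^sub>s p))"
definition s_not :: "form \<Rightarrow> form" ("\<not>\<^sub>s _" [40] 40) where
  "(\<not>\<^sub>s p) = (p \<longrightarrow>\<^sub>s s_bot)"
definition s_all :: "(var \<Rightarrow> form) \<Rightarrow> form" (binder "\<forall>\<^sub>s" 10) where
  "s_all P = (\<lambda>n. FAll (P (\<lambda>m. m - Suc n) (Suc n)))"
definition s_ex :: "(var \<Rightarrow> form) \<Rightarrow> form" (binder "\<exists>\<^sub>s" 10) where
  "s_ex P = (\<lambda>n. FEx (P (\<lambda>m. m - Suc n) (Suc n)))"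

definition s_ball :: "var \<Rightarrow> (var \<Rightarrow> form) \<Rightarrow> form" where
  "s_ball a P = (\<forall>\<^sub>s x. x \<in>\<^sub>s a \<longrightarrow>\<^sub>s P x)"
definition s_bex :: "var \<Rightarrow> (var \<Rightarrow> form) \<Rightarrow> form" where
  "s_bex a P = (\<exists>\<^sub>s x. x \<in>\<^sub>s a \<and>\<^sub>s P x)"
definition s_sub :: "var \<Rightarrow> var \<Rightarrow> form" (infix "\<subseteq>\<^sub>s" 50) where
  "(a \<subseteq>\<^sub>s b) = s_ball a (\<lambda>x. x \<in>\<^sub>s b)"

text \<open>
  \<open>inst p [x\<^sub>0, \<dots>, x\<^sub>k]\<close> is the formula \<open>p\<close> with its free variables \<open>0, \<dots>, k\<close> replaced by
  \<open>x\<^sub>0, \<dots>, x\<^sub>k\<close>; the remaining free variables of \<open>p\<close> are parameters, which stay free outside all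
  binders.
\<close>

definition inst :: "fm \<Rightarrow> var list \<Rightarrow> form" where
  "inst p xs = (\<lambda>n. ren (\<lambda>k. if k < length xs then (xs ! k) n else k - length xs + n) p)"

inductive bounded :: "fm \<Rightarrow> bool" where
  "bounded (FMem x y)"
| "bounded (FEq x y)"
| "bounded FBot"
| "bounded p \<Longrightarrow> bounded q \<Longrightarrow> bounded (FAnd p q)"
| "bounded p \<Longrightarrow> bounded q \<Longrightarrow> bounded (FOr p q)"
| "bounded p \<Longrightarrow> bounded q \<Longrightarrow> bounded (FImp p q)"
| "bounded p \<Longrightarrow> bounded (FAll (FImp (FMem 0 (Suc a)) p))"
| "bounded p \<Longrightarrow> bounded (FEx (FAnd (FMem 0 (Suc a)) p))"

definition is_empty :: "var \<Rightarrow> form" where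
  "is_empty x = (\<forall>\<^sub>s y. \<not>\<^sub>s y \<in>\<^sub>s x)"
definition is_succ :: "var \<Rightarrow> var \<Rightarrow> form" where
  "is_succ u v = (\<forall>\<^sub>s y. y \<in>\<^sub>s u \<longleftrightarrow>\<^sub>s (y \<in>\<^sub>s v \<or>\<^sub>s y =\<^sub>s v))"
definition is_omega :: "var \<Rightarrow> form" where
  "is_omega w = (\<forall>\<^sub>s u. u \<in>\<^sub>s w \<longleftrightarrow>\<^sub>s (is_empty u \<or>\<^sub>s s_bex w (\<lambda>v. is_succ u v)))"

definition ax_extensionality :: form where
  "ax_extensionality = (\<forall>\<^sub>s a. \<forall>\<^sub>s b. (\<forall>\<^sub>s y. y \<in>\<^sub>s a \<longleftrightarrow>\<^sub>s y \<in>\<^sub>s b) \<longrightarrow>\<^sub>s a =\<^sub>s b)"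
definition ax_pairing :: form where
  "ax_pairing = (\<forall>\<^sub>s a. \<forall>\<^sub>s b. \<exists>\<^sub>s c. \<forall>\<^sub>s y. y \<in>\<^sub>s c \<longleftrightarrow>\<^sub>s (y =\<^sub>s a \<or>\<^sub>s y =\<^sub>s b))"
definition ax_union :: form where
  "ax_union = (\<forall>\<^sub>s a. \<exists>\<^sub>s b. \<forall>\<^sub>s y. y \<in>\<^sub>s b \<longleftrightarrow>\<^sub>s s_bex a (\<lambda>x. y \<in>\<^sub>s x))"
definition ax_infinity :: form where
  "ax_infinity = (\<exists>\<^sub>s w. is_omega w)"
definition ax_powerset :: form where
  "ax_powerset = (\<forall>\<^sub>s a. \<exists>\<^sub>s b. \<forall>\<^sub>s x. x \<in>\<^sub>s b \<longleftrightarrow>\<^sub>s x \<subseteq>\<^sub>s a)"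
definition ax_set_induction :: "fm \<Rightarrow> form" where
  "ax_set_induction p =
     ((\<forall>\<^sub>s a. s_ball a (\<lambda>x. inst p [x]) \<longrightarrow>\<^sub>s inst p [a]) \<longrightarrow>\<^sub>s (\<forall>\<^sub>s a. inst p [a]))"
definition ax_separation :: "fm \<Rightarrow> form" where
  "ax_separation p = (\<forall>\<^sub>s a. \<exists>\<^sub>s b. \<forall>\<^sub>s x. x \<in>\<^sub>s b \<longleftrightarrow>\<^sub>s (x \<in>\<^sub>s a \<and>\<^sub>s inst p [x]))"
definition ax_strong_collection :: "fm \<Rightarrow> form" where
  "ax_strong_collection p =
     (\<forall>\<^sub>s a. s_ball a (\<lambda>x. \<exists>\<^sub>s y. inst p [x, y]) \<longrightarrow>\<^sub>s
        (\<exists>\<^sub>s b. s_ball a (\<lambda>x. s_bex b (\<lambda>y. inst p [x, y])) \<and>\<^sub>s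
              s_ball b (\<lambda>y. s_bex a (\<lambda>x. inst p [x, y]))))"
definition ax_subset_collection :: "fm \<Rightarrow> form" where
  "ax_subset_collection p =
     (\<forall>\<^sub>s a. \<forall>\<^sub>s b. \<exists>\<^sub>s c. \<forall>\<^sub>s u. s_ball a (\<lambda>x. s_bex b (\<lambda>y. inst p [x, y, u])) \<longrightarrow>\<^sub>s
        s_bex c (\<lambda>d. s_ball a (\<lambda>x. s_bex d (\<lambda>y. inst p [x, y, u])) \<and>\<^sub>s
                     s_ball d (\<lambda>y. s_bex a (\<lambda>x. inst p [x, y, u]))))"

definition CZF :: "fm set" where
  "CZF = {ax_extensionality 0, ax_pairing 0, ax_union 0, ax_infinity 0}
     \<union> {ax_set_induction p 0 | p. True}
     \<union> {ax_separation p 0 | p. bounded p}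
     \<union> {ax_strong_collection p 0 | p. True}
     \<union> {ax_subset_collection p 0 | p. True}"

definition IZF :: "fm set" where
  "IZF = CZF \<union> {ax_separation p 0 | p. True} \<union> {ax_powerset 0}"

definition GUP_CZF :: "fm set" where
  "GUP_CZF = {(\<forall>\<^sub>s I. (\<forall>\<^sub>s x. s_bex I (\<lambda>y. inst A [x, y])) \<longrightarrow>\<^sub>s
                     s_bex I (\<lambda>y. \<forall>\<^sub>s x. inst A [x, y])) 0 | A. True}"

definition fm_consistent :: "fm set \<Rightarrow> bool" where
  "fm_consistent T \<longleftrightarrow> \<not> nd T [] FBot"


subsection \<open>Formal spaces in set theory\<close>

text \<open>
  Subclasses of the base set are predicates on variables; \<open>elts U\<close> is the class of elements of the
  set \<open>U\<close>.  The cover relation relates elements to sets.  As usual for class terms in argument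
  position, \<open>a\<close> is covered by the class \<open>V\<close> if \<open>V\<close> is a set and \<open>a\<close> is covered by that set.  (For
  the spaces considered, every class occurring below is provably a set.)
\<close>

type_synonym cls = "var \<Rightarrow> form"
type_synonym cover = "var \<Rightarrow> var \<Rightarrow> form"

definition is_class :: "var \<Rightarrow> cls \<Rightarrow> form" where
  "is_class w V = (\<forall>\<^sub>s x. x \<in>\<^sub>s w \<longleftrightarrow>\<^sub>s V x)"
definition elts :: "var \<Rightarrow> cls" where
  "elts U = (\<lambda>x. x \<in>\<^sub>s U)"
definition none :: cls where
  "none = (\<lambda>x. s_bot)"
definition sing :: "var \<Rightarrow> cls" where
  "sing a = (\<lambda>x. x =\<^sub>s a)"
definition cunion :: "cls \<Rightarrow> cls \<Rightarrow> cls" where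
  "cunion U V = (\<lambda>x. U x \<or>\<^sub>s V x)"

definition cov :: "cover \<Rightarrow> var \<Rightarrow> cls \<Rightarrow> form" where
  "cov C a V = (\<exists>\<^sub>s w. is_class w V \<and>\<^sub>s C a w)"
definition covs :: "cover \<Rightarrow> cls \<Rightarrow> cls \<Rightarrow> form" where
  "covs C U V = (\<forall>\<^sub>s u. U u \<longrightarrow>\<^sub>s cov C u V)"
definition down :: "var \<Rightarrow> cover \<Rightarrow> cls \<Rightarrow> cls \<Rightarrow> cls" where
  "down S C U V = (\<lambda>d. d \<in>\<^sub>s S \<and>\<^sub>s (\<exists>\<^sub>s u. U u \<and>\<^sub>s cov C d (sing u)) \<and>\<^sub>s
                                (\<exists>\<^sub>s v. V v \<and>\<^sub>s cov C d (sing v)))"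
definition pseudocompl :: "var \<Rightarrow> cover \<Rightarrow> cls \<Rightarrow> cls" where
  "pseudocompl S C U = (\<lambda>a. a \<in>\<^sub>s S \<and>\<^sub>s covs C (down S C (sing a) U) none)"

definition all_subsets :: "var \<Rightarrow> (var \<Rightarrow> form) \<Rightarrow> form" where
  "all_subsets S P = (\<forall>\<^sub>s U. U \<subseteq>\<^sub>s S \<longrightarrow>\<^sub>s P U)"

definition formal_space :: "var \<Rightarrow> cover \<Rightarrow> form" where
  "formal_space S C =
     (s_ball S (\<lambda>a. all_subsets S (\<lambda>U.
        a \<in>\<^sub>s U \<longrightarrow>\<^sub>s cov C a (elts U))) \<and>\<^sub>s
      s_ball S (\<lambda>a. all_subsets S (\<lambda>U. all_subsets S (\<lambda>V.
        cov C a (elts U) \<and>\<^sub>s covs C (elts U) (elts V) \<longrightarrow>\<^sub>s cov C a (elts V)))) \<and>\<^sub>s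
      s_ball S (\<lambda>a. all_subsets S (\<lambda>U. all_subsets S (\<lambda>V.
        cov C a (elts U) \<and>\<^sub>s cov C a (elts V) \<longrightarrow>\<^sub>s cov C a (down S C (elts U) (elts V))))))"

text \<open>The additional requirement for CZF: the elements covered by a subset form a set.\<close>

definition set_presented_saturation :: "var \<Rightarrow> cover \<Rightarrow> form" where
  "set_presented_saturation S C =
     all_subsets S (\<lambda>U. \<exists>\<^sub>s z. is_class z (\<lambda>a. a \<in>\<^sub>s S \<and>\<^sub>s cov C a (elts U)))"

definition nontrivial :: "var \<Rightarrow> cover \<Rightarrow> form" where
  "nontrivial S C = (\<not>\<^sub>s covs C (elts S) none)"
definition boolean_space :: "var \<Rightarrow> cover \<Rightarrow> form" where
  "boolean_space S C =
     all_subsets S (\<lambda>U. covs C (elts S) (cunion (elts U) (pseudocompl S C (elts U))))"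

definition is_upair :: "var \<Rightarrow> var \<Rightarrow> var \<Rightarrow> form" where
  "is_upair z x y = (\<forall>\<^sub>s w. w \<in>\<^sub>s z \<longleftrightarrow>\<^sub>s (w =\<^sub>s x \<or>\<^sub>s w =\<^sub>s y))"
definition is_pair :: "var \<Rightarrow> var \<Rightarrow> var \<Rightarrow> form" where
  "is_pair z x y = (\<exists>\<^sub>s a. \<exists>\<^sub>s b. is_upair a x x \<and>\<^sub>s is_upair b x y \<and>\<^sub>s is_upair z a b)"
definition pair_mem :: "var \<Rightarrow> var \<Rightarrow> var \<Rightarrow> form" where
  "pair_mem x y f = (\<exists>\<^sub>s z. is_pair z x y \<and>\<^sub>s z \<in>\<^sub>s f)"

text \<open>
  \<open>u = {f 0, \<dots>, f (n - 1)}\<close> for a natural number \<open>n = {0, \<dots>, n - 1}\<close> and (the graph of) a function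
  \<open>f\<close> defined on \<open>n\<close>.
\<close>

definition finitely_listed :: "var \<Rightarrow> form" where
  "finitely_listed u =
     (\<exists>\<^sub>s w. is_omega w \<and>\<^sub>s s_bex w (\<lambda>n. \<exists>\<^sub>s f.
        s_ball n (\<lambda>i. \<exists>\<^sub>s x. pair_mem i x f \<and>\<^sub>s (\<forall>\<^sub>s y. pair_mem i y f \<longrightarrow>\<^sub>s y =\<^sub>s x)) \<and>\<^sub>s
        (\<forall>\<^sub>s x. x \<in>\<^sub>s u \<longleftrightarrow>\<^sub>s s_bex n (\<lambda>i. pair_mem i x f))))"

definition compact_space :: "var \<Rightarrow> cover \<Rightarrow> form" where
  "compact_space S C =
     all_subsets S (\<lambda>U. covs C (elts S) (elts U) \<longrightarrow>\<^sub>s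
        (\<exists>\<^sub>s u. finitely_listed u \<and>\<^sub>s u \<subseteq>\<^sub>s U \<and>\<^sub>s covs C (elts S) (elts u)))"

text \<open>
  In CZF the cover is a class: it is given by a formula with free variables \<open>0, 1\<close> for the
  arguments, \<open>2\<close> for the base set, and arbitrary further parameters.  In IZF it is a set of ordered
  pairs.
\<close>

definition compact_boolean_CZF :: "fm \<Rightarrow> form" where
  "compact_boolean_CZF p =
     (\<exists>\<^sub>s S. let C = (\<lambda>a U. inst p [a, U, S]) in
        formal_space S C \<and>\<^sub>s set_presented_saturation S C \<and>\<^sub>s
        nontrivial S C \<and>\<^sub>s boolean_space S C \<and>\<^sub>s compact_space S C)"

definition compact_boolean_IZF :: form where
  "compact_boolean_IZF =
     (\<exists>\<^sub>s S. \<exists>\<^sub>s R. let C = (\<lambda>a U. pair_mem a U R) in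
        formal_space S C \<and>\<^sub>s nontrivial S C \<and>\<^sub>s boolean_space S C \<and>\<^sub>s compact_space S C)"

text \<open>Restricted excluded middle, where \<open>\<top>\<close> is the empty set, so that \<open>{\<top>} = {x. x = \<emptyset>}\<close>.\<close>

definition REM :: form where
  "REM = (\<forall>\<^sub>s p. (\<forall>\<^sub>s x. x \<in>\<^sub>s p \<longrightarrow>\<^sub>s is_empty x) \<longrightarrow>\<^sub>s
            (\<forall>\<^sub>s x. (x \<in>\<^sub>s p \<or>\<^sub>s (is_empty x \<and>\<^sub>s \<not>\<^sub>s x \<in>\<^sub>s p)) \<longleftrightarrow>\<^sub>s is_empty x))"

definition EM_instance :: "fm \<Rightarrow> form" where
  "EM_instance p = (inst p [] \<or>\<^sub>s \<not>\<^sub>s inst p [])"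


section \<open>Higher-order Heyting arithmetic (HHA)\<close>

text \<open>
  Intuitionistic type theory in the style of Lambek and Scott: the internal language of toposes
  with a natural numbers object.  Formulas are the terms of type \<open>HOmega\<close>.
\<close>

datatype hty = HOne | HNat | HOmega | HPow hty | HProd hty hty

datatype htm =
    HVar nat
  | HStar
  | HPair htm htm
  | HZero
  | HSuc htm
  | HCompr hty htm
  | HMem htm htm
  | HEq htm htm
  | HBot
  | HAnd htm htm
  | HOr htm htm
  | HImp htm htm
  | HAll hty htm
  | HEx hty htm

primrec h_ren :: "(nat \<Rightarrow> nat) \<Rightarrow> htm \<Rightarrow> htm" where
  "h_ren r (HVar k) = HVar (r k)"
| "h_ren r HStar = HStar"
| "h_ren r (HPair s t) = HPair (h_ren r s) (h_ren r t)"
| "h_ren r HZero = HZero"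
| "h_ren r (HSuc t) = HSuc (h_ren r t)"
| "h_ren r (HCompr A p) = HCompr A (h_ren (up r) p)"
| "h_ren r (HMem s t) = HMem (h_ren r s) (h_ren r t)"
| "h_ren r (HEq s t) = HEq (h_ren r s) (h_ren r t)"
| "h_ren r HBot = HBot"
| "h_ren r (HAnd p q) = HAnd (h_ren r p) (h_ren r q)"
| "h_ren r (HOr p q) = HOr (h_ren r p) (h_ren r q)"
| "h_ren r (HImp p q) = HImp (h_ren r p) (h_ren r q)"
| "h_ren r (HAll A p) = HAll A (h_ren (up r) p)"
| "h_ren r (HEx A p) = HEx A (h_ren (up r) p)"

abbreviation h_lift :: "htm \<Rightarrow> htm" where
  "h_lift \<equiv> h_ren Suc"

definition h_up :: "(nat \<Rightarrow> htm) \<Rightarrow> nat \<Rightarrow> htm" where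
  "h_up s = case_nat (HVar 0) (\<lambda>k. h_lift (s k))"

primrec h_sub :: "(nat \<Rightarrow> htm) \<Rightarrow> htm \<Rightarrow> htm" where
  "h_sub f (HVar k) = f k"
| "h_sub f HStar = HStar"
| "h_sub f (HPair s t) = HPair (h_sub f s) (h_sub f t)"
| "h_sub f HZero = HZero"
| "h_sub f (HSuc t) = HSuc (h_sub f t)"
| "h_sub f (HCompr A p) = HCompr A (h_sub (h_up f) p)"
| "h_sub f (HMem s t) = HMem (h_sub f s) (h_sub f t)"
| "h_sub f (HEq s t) = HEq (h_sub f s) (h_sub f t)"
| "h_sub f HBot = HBot"
| "h_sub f (HAnd p q) = HAnd (h_sub f p) (h_sub f q)"
| "h_sub f (HOr p q) = HOr (h_sub f p) (h_sub f q)"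
| "h_sub f (HImp p q) = HImp (h_sub f p) (h_sub f q)"
| "h_sub f (HAll A p) = HAll A (h_sub (h_up f) p)"
| "h_sub f (HEx A p) = HEx A (h_sub (h_up f) p)"

abbreviation h_inst :: "htm \<Rightarrow> htm \<Rightarrow> htm" where
  "h_inst t p \<equiv> h_sub (case_nat t HVar) p"

text \<open>A context lists the types of the free variables \<open>0, 1, \<dots>\<close>\<close>

inductive h_has_type :: "hty list \<Rightarrow> htm \<Rightarrow> hty \<Rightarrow> bool" where
  "k < length G \<Longrightarrow> h_has_type G (HVar k) (G ! k)"
| "h_has_type G HStar HOne"
| "h_has_type G s A \<Longrightarrow> h_has_type G t B \<Longrightarrow> h_has_type G (HPair s t) (HProd A B)"
| "h_has_type G HZero HNat"
| "h_has_type G t HNat \<Longrightarrow> h_has_type G (HSuc t) HNat"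
| "h_has_type (A # G) p HOmega \<Longrightarrow> h_has_type G (HCompr A p) (HPow A)"
| "h_has_type G s A \<Longrightarrow> h_has_type G t (HPow A) \<Longrightarrow> h_has_type G (HMem s t) HOmega"
| "h_has_type G s A \<Longrightarrow> h_has_type G t A \<Longrightarrow> h_has_type G (HEq s t) HOmega"
| "h_has_type G HBot HOmega"
| "h_has_type G p HOmega \<Longrightarrow> h_has_type G q HOmega \<Longrightarrow> h_has_type G (HAnd p q) HOmega"
| "h_has_type G p HOmega \<Longrightarrow> h_has_type G q HOmega \<Longrightarrow> h_has_type G (HOr p q) HOmega"
| "h_has_type G p HOmega \<Longrightarrow> h_has_type G q HOmega \<Longrightarrow> h_has_type G (HImp p q) HOmega"
| "h_has_type (A # G) p HOmega \<Longrightarrow> h_has_type G (HAll A p) HOmega"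
| "h_has_type (A # G) p HOmega \<Longrightarrow> h_has_type G (HEx A p) HOmega"

type_synonym hexp = "nat \<Rightarrow> htm"

definition h_star :: hexp where
  "h_star = (\<lambda>n. HStar)"
definition h_pair :: "hexp \<Rightarrow> hexp \<Rightarrow> hexp" where
  "h_pair s t = (\<lambda>n. HPair (s n) (t n))"
definition h_zero :: hexp where
  "h_zero = (\<lambda>n. HZero)"
definition h_suc :: "hexp \<Rightarrow> hexp" where
  "h_suc t = (\<lambda>n. HSuc (t n))"
definition h_compr :: "hty \<Rightarrow> (hexp \<Rightarrow> hexp) \<Rightarrow> hexp" where
  "h_compr A P = (\<lambda>n. HCompr A (P (\<lambda>m. HVar (m - Suc n)) (Suc n)))"
definition h_mem :: "hexp \<Rightarrow> hexp \<Rightarrow> hexp" (infix "\<in>\<^sub>h" 50) where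
  "(s \<in>\<^sub>h t) = (\<lambda>n. HMem (s n) (t n))"
definition h_eq :: "hexp \<Rightarrow> hexp \<Rightarrow> hexp" (infix "=\<^sub>h" 50) where
  "(s =\<^sub>h t) = (\<lambda>n. HEq (s n) (t n))"
definition h_bot :: hexp where
  "h_bot = (\<lambda>n. HBot)"
definition h_and :: "hexp \<Rightarrow> hexp \<Rightarrow> hexp" (infixr "\<and>\<^sub>h" 35) where
  "(p \<and>\<^sub>h q) = (\<lambda>n. HAnd (p n) (q n))"
definition h_or :: "hexp \<Rightarrow> hexp \<Rightarrow> hexp" (infixr "\<or>\<^sub>h" 30) where
  "(p \<or>\<^sub>h q) = (\<lambda>n. HOr (p n) (q n))"
definition h_imp :: "hexp \<Rightarrow> hexp \<Rightarrow> hexp" (infixr "\<longrightarrow>\<^sub>h" 25) where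
  "(p \<longrightarrow>\<^sub>h q) = (\<lambda>n. HImp (p n) (q n))"
definition h_iff :: "hexp \<Rightarrow> hexp \<Rightarrow> hexp" (infixr "\<longleftrightarrow>\<^sub>h" 25) where
  "(p \<longleftrightarrow>\<^sub>h q) = ((p \<longrightarrow>\<^sub>h q) \<and>\<^sub>h (q \<longrightarrow>\<^sub>h p))"
definition h_not :: "hexp \<Rightarrow> hexp" ("\<not>\<^sub>h _" [40] 40) where
  "(\<not>\<^sub>h p) = (p \<longrightarrow>\<^sub>h h_bot)"
definition h_all :: "hty \<Rightarrow> (hexp \<Rightarrow> hexp) \<Rightarrow> hexp" where
  "h_all A P = (\<lambda>n. HAll A (P (\<lambda>m. HVar (m - Suc n)) (Suc n)))"
definition h_ex :: "hty \<Rightarrow> (hexp \<Rightarrow> hexp) \<Rightarrow> hexp" where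
  "h_ex A P = (\<lambda>n. HEx A (P (\<lambda>m. HVar (m - Suc n)) (Suc n)))"

definition HHA_axioms :: "htm set" where
  "HHA_axioms =
     {h_all (HPow A) (\<lambda>u. h_all (HPow A) (\<lambda>v.
        h_all A (\<lambda>x. x \<in>\<^sub>h u \<longleftrightarrow>\<^sub>h x \<in>\<^sub>h v) \<longrightarrow>\<^sub>h u =\<^sub>h v)) 0 | A. True}
   \<union> {h_all HOmega (\<lambda>p. h_all HOmega (\<lambda>q. (p \<longleftrightarrow>\<^sub>h q) \<longrightarrow>\<^sub>h p =\<^sub>h q)) 0}
   \<union> {h_all HOne (\<lambda>z. z =\<^sub>h h_star) 0}
   \<union> {h_all (HProd A B) (\<lambda>z. h_ex A (\<lambda>x. h_ex B (\<lambda>y. z =\<^sub>h h_pair x y))) 0 | A B. True}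
   \<union> {h_all A (\<lambda>x. h_all B (\<lambda>y. h_all A (\<lambda>x'. h_all B (\<lambda>y'.
        h_pair x y =\<^sub>h h_pair x' y' \<longrightarrow>\<^sub>h x =\<^sub>h x' \<and>\<^sub>h y =\<^sub>h y')))) 0 | A B. True}
   \<union> {h_all HNat (\<lambda>x. \<not>\<^sub>h h_suc x =\<^sub>h h_zero) 0}
   \<union> {h_all HNat (\<lambda>x. h_all HNat (\<lambda>y. h_suc x =\<^sub>h h_suc y \<longrightarrow>\<^sub>h x =\<^sub>h y)) 0}
   \<union> {h_all (HPow HNat) (\<lambda>u.
        h_zero \<in>\<^sub>h u \<and>\<^sub>h h_all HNat (\<lambda>x. x \<in>\<^sub>h u \<longrightarrow>\<^sub>h h_suc x \<in>\<^sub>h u) \<longrightarrow>\<^sub>h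
        h_all HNat (\<lambda>x. x \<in>\<^sub>h u)) 0}"

inductive hha :: "hty list \<Rightarrow> htm list \<Rightarrow> htm \<Rightarrow> bool" where
  H_Ax: "p \<in> HHA_axioms \<Longrightarrow> hha G H p"
| H_Hyp: "p \<in> set H \<Longrightarrow> hha G H p"
| H_BotE: "hha G H HBot \<Longrightarrow> h_has_type G p HOmega \<Longrightarrow> hha G H p"
| H_AndI: "hha G H p \<Longrightarrow> hha G H q \<Longrightarrow> hha G H (HAnd p q)"
| H_AndE1: "hha G H (HAnd p q) \<Longrightarrow> hha G H p"
| H_AndE2: "hha G H (HAnd p q) \<Longrightarrow> hha G H q"
| H_OrI1: "hha G H p \<Longrightarrow> h_has_type G q HOmega \<Longrightarrow> hha G H (HOr p q)"
| H_OrI2: "hha G H q \<Longrightarrow> h_has_type G p HOmega \<Longrightarrow> hha G H (HOr p q)"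
| H_OrE: "hha G H (HOr p q) \<Longrightarrow> hha G (p # H) r \<Longrightarrow> hha G (q # H) r \<Longrightarrow> hha G H r"
| H_ImpI: "h_has_type G p HOmega \<Longrightarrow> hha G (p # H) q \<Longrightarrow> hha G H (HImp p q)"
| H_ImpE: "hha G H (HImp p q) \<Longrightarrow> hha G H p \<Longrightarrow> hha G H q"
| H_AllI: "hha (A # G) (map h_lift H) p \<Longrightarrow> hha G H (HAll A p)"
| H_AllE: "hha G H (HAll A p) \<Longrightarrow> h_has_type G t A \<Longrightarrow> hha G H (h_inst t p)"
| H_ExI: "h_has_type (A # G) p HOmega \<Longrightarrow> h_has_type G t A \<Longrightarrow> hha G H (h_inst t p) \<Longrightarrow>
    hha G H (HEx A p)"
| H_ExE: "hha G H (HEx A p) \<Longrightarrow> hha (A # G) (p # map h_lift H) (h_lift q) \<Longrightarrow> hha G H q"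
| H_EqI: "h_has_type G t A \<Longrightarrow> hha G H (HEq t t)"
| H_EqE: "h_has_type (A # G) p HOmega \<Longrightarrow> h_has_type G s A \<Longrightarrow> h_has_type G t A \<Longrightarrow>
    hha G H (HEq s t) \<Longrightarrow> hha G H (h_inst s p) \<Longrightarrow> hha G H (h_inst t p)"
| H_ComprI: "h_has_type (A # G) p HOmega \<Longrightarrow> h_has_type G t A \<Longrightarrow> hha G H (h_inst t p) \<Longrightarrow>
    hha G H (HMem t (HCompr A p))"
| H_ComprE: "h_has_type (A # G) p HOmega \<Longrightarrow> h_has_type G t A \<Longrightarrow>
    hha G H (HMem t (HCompr A p)) \<Longrightarrow> hha G H (h_inst t p)"


subsection \<open>Formal spaces in HHA\<close>

text \<open>
  The base \<open>S\<close> is a set of elements of some type \<open>A\<close>, and the cover \<open>C\<close> has type \<open>P(A \<times> P A)\<close>.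
\<close>

definition h_ball :: "hty \<Rightarrow> hexp \<Rightarrow> (hexp \<Rightarrow> hexp) \<Rightarrow> hexp" where
  "h_ball A S P = h_all A (\<lambda>x. x \<in>\<^sub>h S \<longrightarrow>\<^sub>h P x)"
definition h_sub_eq :: "hty \<Rightarrow> hexp \<Rightarrow> hexp \<Rightarrow> hexp" where
  "h_sub_eq A U V = h_ball A U (\<lambda>x. x \<in>\<^sub>h V)"
definition h_all_subsets :: "hty \<Rightarrow> hexp \<Rightarrow> (hexp \<Rightarrow> hexp) \<Rightarrow> hexp" where
  "h_all_subsets A S P = h_all (HPow A) (\<lambda>U. h_sub_eq A U S \<longrightarrow>\<^sub>h P U)"

definition h_none :: "hty \<Rightarrow> hexp" where
  "h_none A = h_compr A (\<lambda>x. h_bot)"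
definition h_sing :: "hty \<Rightarrow> hexp \<Rightarrow> hexp" where
  "h_sing A a = h_compr A (\<lambda>x. x =\<^sub>h a)"
definition h_union :: "hty \<Rightarrow> hexp \<Rightarrow> hexp \<Rightarrow> hexp" where
  "h_union A U V = h_compr A (\<lambda>x. x \<in>\<^sub>h U \<or>\<^sub>h x \<in>\<^sub>h V)"

definition h_cov :: "hexp \<Rightarrow> hexp \<Rightarrow> hexp \<Rightarrow> hexp" where
  "h_cov C a U = (h_pair a U \<in>\<^sub>h C)"
definition h_covs :: "hty \<Rightarrow> hexp \<Rightarrow> hexp \<Rightarrow> hexp \<Rightarrow> hexp" where
  "h_covs A C U V = h_ball A U (\<lambda>u. h_cov C u V)"
definition h_down :: "hty \<Rightarrow> hexp \<Rightarrow> hexp \<Rightarrow> hexp \<Rightarrow> hexp \<Rightarrow> hexp" where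
  "h_down A S C U V = h_compr A (\<lambda>d. d \<in>\<^sub>h S \<and>\<^sub>h
     h_ex A (\<lambda>u. u \<in>\<^sub>h U \<and>\<^sub>h h_cov C d (h_sing A u)) \<and>\<^sub>h
     h_ex A (\<lambda>v. v \<in>\<^sub>h V \<and>\<^sub>h h_cov C d (h_sing A v)))"
definition h_pseudocompl :: "hty \<Rightarrow> hexp \<Rightarrow> hexp \<Rightarrow> hexp \<Rightarrow> hexp" where
  "h_pseudocompl A S C U = h_compr A (\<lambda>a. a \<in>\<^sub>h S \<and>\<^sub>h
     h_covs A C (h_down A S C (h_sing A a) U) (h_none A))"

definition h_formal_space :: "hty \<Rightarrow> hexp \<Rightarrow> hexp \<Rightarrow> hexp" where
  "h_formal_space A S C =
     (h_ball A S (\<lambda>a. h_all_subsets A S (\<lambda>U. a \<in>\<^sub>h U \<longrightarrow>\<^sub>h h_cov C a U)) \<and>\<^sub>h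
      h_ball A S (\<lambda>a. h_all_subsets A S (\<lambda>U. h_all_subsets A S (\<lambda>V.
        h_cov C a U \<and>\<^sub>h h_covs A C U V \<longrightarrow>\<^sub>h h_cov C a V))) \<and>\<^sub>h
      h_ball A S (\<lambda>a. h_all_subsets A S (\<lambda>U. h_all_subsets A S (\<lambda>V.
        h_cov C a U \<and>\<^sub>h h_cov C a V \<longrightarrow>\<^sub>h h_cov C a (h_down A S C U V)))))"
definition h_nontrivial :: "hty \<Rightarrow> hexp \<Rightarrow> hexp \<Rightarrow> hexp" where
  "h_nontrivial A S C = (\<not>\<^sub>h h_covs A C S (h_none A))"
definition h_boolean_space :: "hty \<Rightarrow> hexp \<Rightarrow> hexp \<Rightarrow> hexp" where
  "h_boolean_space A S C =
     h_all_subsets A S (\<lambda>U. h_covs A C S (h_union A U (h_pseudocompl A S C U)))"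

text \<open>\<open>i < n\<close>: every set of numbers containing \<open>i + 1\<close> and closed under successor contains \<open>n\<close>.\<close>

definition h_less :: "hexp \<Rightarrow> hexp \<Rightarrow> hexp" where
  "h_less i n = h_all (HPow HNat) (\<lambda>X.
     h_suc i \<in>\<^sub>h X \<and>\<^sub>h h_all HNat (\<lambda>m. m \<in>\<^sub>h X \<longrightarrow>\<^sub>h h_suc m \<in>\<^sub>h X) \<longrightarrow>\<^sub>h n \<in>\<^sub>h X)"

definition h_finitely_listed :: "hty \<Rightarrow> hexp \<Rightarrow> hexp" where
  "h_finitely_listed A u =
     h_ex HNat (\<lambda>n. h_ex (HPow (HProd HNat A)) (\<lambda>f.
       h_all HNat (\<lambda>i. h_less i n \<longrightarrow>\<^sub>h
         h_ex A (\<lambda>x. h_pair i x \<in>\<^sub>h f \<and>\<^sub>h h_all A (\<lambda>y. h_pair i y \<in>\<^sub>h f \<longrightarrow>\<^sub>h y =\<^sub>h x))) \<and>\<^sub>h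
       h_all A (\<lambda>x. x \<in>\<^sub>h u \<longleftrightarrow>\<^sub>h h_ex HNat (\<lambda>i. h_less i n \<and>\<^sub>h h_pair i x \<in>\<^sub>h f))))"

definition h_compact_space :: "hty \<Rightarrow> hexp \<Rightarrow> hexp \<Rightarrow> hexp" where
  "h_compact_space A S C =
     h_all_subsets A S (\<lambda>U. h_covs A C S U \<longrightarrow>\<^sub>h
       h_ex (HPow A) (\<lambda>u. h_finitely_listed A u \<and>\<^sub>h h_sub_eq A u U \<and>\<^sub>h h_covs A C S u))"

definition compact_boolean_HHA :: "hty \<Rightarrow> hexp" where
  "compact_boolean_HHA A =
     h_ex (HPow A) (\<lambda>S. h_ex (HPow (HProd A (HPow A))) (\<lambda>C.
       h_formal_space A S C \<and>\<^sub>h h_nontrivial A S C \<and>\<^sub>h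
       h_boolean_space A S C \<and>\<^sub>h h_compact_space A S C))"

definition EM_HHA :: hexp where
  "EM_HHA = h_all HOmega (\<lambda>p. p \<or>\<^sub>h \<not>\<^sub>h p)"


section \<open>Martin-Loef type theory (CTT)\<close>

subsection \<open>The logical framework\<close>

text \<open>
  Constructive type theory is presented in Martin-Loef's logical framework, as in
  Nordstroem, Petersson and Smith: \<open>SET\<close> is the type of sets (that is, of propositions), \<open>EL A\<close> the
  type of elements of the set \<open>A\<close>, and \<open>FUN A B\<close> the dependent function type \<open>(x \<in> A) B\<close>.
  \<open>Con\<close> gives the constants of CTT and \<open>Ext\<close> those available to extensions of CTT.  The last two
  constants are reserved for the principle GUP; CTT itself does not declare them.
\<close>

datatype con =
    cPi | cLam | cApply
  | cSigma | cPair | cSplit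
  | cPlus | cInl | cInr | cWhen
  | cId | cRefl | cIdpeel
  | cN0 | cCase0
  | cN1 | cStar | cCase1
  | cNat | cZero | cSucc | cNatrec
  | cList | cNil | cCons | cListrec
  | cW | cSup | cWrec
  | cU | cT | cuPi | cuSigma | cuPlus | cuId | cuN0 | cuN1 | cuNat | cuList | cuW
  | cGup | cGupProof

datatype 'c tm = Var nat | Con con | Ext 'c | App "'c tm" "'c tm" | Lam "'c tm"

datatype 'c ty = SET | EL "'c tm" | FUN "'c ty" "'c ty"

datatype 'c judgement =
    Ctx
  | IsTy "'c ty"
  | TyEq "'c ty" "'c ty"
  | HasTy "'c tm" "'c ty"
  | TmEq "'c tm" "'c tm" "'c ty"

primrec tm_ren :: "(nat \<Rightarrow> nat) \<Rightarrow> 'c tm \<Rightarrow> 'c tm" where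
  "tm_ren r (Var k) = Var (r k)"
| "tm_ren r (Con c) = Con c"
| "tm_ren r (Ext c) = Ext c"
| "tm_ren r (App s t) = App (tm_ren r s) (tm_ren r t)"
| "tm_ren r (Lam t) = Lam (tm_ren (up r) t)"

definition tm_up :: "(nat \<Rightarrow> 'c tm) \<Rightarrow> nat \<Rightarrow> 'c tm" where
  "tm_up f = case_nat (Var 0) (\<lambda>k. tm_ren Suc (f k))"

primrec tm_sub :: "(nat \<Rightarrow> 'c tm) \<Rightarrow> 'c tm \<Rightarrow> 'c tm" where
  "tm_sub f (Var k) = f k"
| "tm_sub f (Con c) = Con c"
| "tm_sub f (Ext c) = Ext c"
| "tm_sub f (App s t) = App (tm_sub f s) (tm_sub f t)"
| "tm_sub f (Lam t) = Lam (tm_sub (tm_up f) t)"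

primrec ty_sub :: "(nat \<Rightarrow> 'c tm) \<Rightarrow> 'c ty \<Rightarrow> 'c ty" where
  "ty_sub f SET = SET"
| "ty_sub f (EL a) = EL (tm_sub f a)"
| "ty_sub f (FUN A B) = FUN (ty_sub f A) (ty_sub (tm_up f) B)"

primrec j_sub :: "(nat \<Rightarrow> 'c tm) \<Rightarrow> 'c judgement \<Rightarrow> 'c judgement" where
  "j_sub f Ctx = Ctx"
| "j_sub f (IsTy A) = IsTy (ty_sub f A)"
| "j_sub f (TyEq A B) = TyEq (ty_sub f A) (ty_sub f B)"
| "j_sub f (HasTy a A) = HasTy (tm_sub f a) (ty_sub f A)"
| "j_sub f (TmEq a b A) = TmEq (tm_sub f a) (tm_sub f b) (ty_sub f A)"

abbreviation tm_inst :: "'c tm \<Rightarrow> 'c tm \<Rightarrow> 'c tm" where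
  "tm_inst a b \<equiv> tm_sub (case_nat a Var) b"
abbreviation ty_inst :: "'c tm \<Rightarrow> 'c ty \<Rightarrow> 'c ty" where
  "ty_inst a B \<equiv> ty_sub (case_nat a Var) B"

text \<open>
  In a context \<open>G\<close> the type \<open>G ! k\<close> of variable \<open>k\<close> refers to the variables \<open>k + 1, k + 2, \<dots>\<close>;
  \<open>ctx_ty G k\<close> is this type, weakened to the whole context.
\<close>

definition ctx_ty :: "'c ty list \<Rightarrow> nat \<Rightarrow> 'c ty" where
  "ctx_ty G k = ty_sub (\<lambda>i. Var (i + Suc k)) (G ! k)"

type_synonym 'c sequent = "'c ty list \<times> 'c judgement"
type_synonym 'c rule = "'c sequent list \<times> 'c sequent"

text \<open>
  \<open>lf R G J\<close>: the judgement \<open>J\<close> is derivable in context \<open>G\<close> by the rules of the logical framework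
  together with the rules \<open>R\<close>.  The substitution rules are simultaneous and so include weakening.
\<close>

inductive lf :: "'c rule set \<Rightarrow> 'c ty list \<Rightarrow> 'c judgement \<Rightarrow> bool" for R where
  LF_rule: "(Ps, (G, J)) \<in> R \<Longrightarrow> (\<And>D K. (D, K) \<in> set Ps \<Longrightarrow> lf R D K) \<Longrightarrow> lf R G J"
| LF_nil: "lf R [] Ctx"
| LF_cons: "lf R G (IsTy A) \<Longrightarrow> lf R (A # G) Ctx"
| LF_var: "lf R G Ctx \<Longrightarrow> k < length G \<Longrightarrow> lf R G (HasTy (Var k) (ctx_ty G k))"
| LF_subst: "lf R G J \<Longrightarrow> lf R D Ctx \<Longrightarrow>
    (\<And>k. k < length G \<Longrightarrow> lf R D (HasTy (f k) (ty_sub f (ctx_ty G k)))) \<Longrightarrow>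
    lf R D (j_sub f J)"
| LF_subst_ty_eq: "lf R G (IsTy A) \<Longrightarrow> lf R D Ctx \<Longrightarrow>
    (\<And>k. k < length G \<Longrightarrow> lf R D (TmEq (f k) (g k) (ty_sub f (ctx_ty G k)))) \<Longrightarrow>
    lf R D (TyEq (ty_sub f A) (ty_sub g A))"
| LF_subst_tm_eq: "lf R G (HasTy a A) \<Longrightarrow> lf R D Ctx \<Longrightarrow>
    (\<And>k. k < length G \<Longrightarrow> lf R D (TmEq (f k) (g k) (ty_sub f (ctx_ty G k)))) \<Longrightarrow>
    lf R D (TmEq (tm_sub f a) (tm_sub g a) (ty_sub f A))"
| LF_ty_refl: "lf R G (IsTy A) \<Longrightarrow> lf R G (TyEq A A)"
| LF_ty_sym: "lf R G (TyEq A B) \<Longrightarrow> lf R G (TyEq B A)"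
| LF_ty_trans: "lf R G (TyEq A B) \<Longrightarrow> lf R G (TyEq B C) \<Longrightarrow> lf R G (TyEq A C)"
| LF_tm_refl: "lf R G (HasTy a A) \<Longrightarrow> lf R G (TmEq a a A)"
| LF_tm_sym: "lf R G (TmEq a b A) \<Longrightarrow> lf R G (TmEq b a A)"
| LF_tm_trans: "lf R G (TmEq a b A) \<Longrightarrow> lf R G (TmEq b c A) \<Longrightarrow> lf R G (TmEq a c A)"
| LF_conv: "lf R G (HasTy a A) \<Longrightarrow> lf R G (TyEq A B) \<Longrightarrow> lf R G (HasTy a B)"
| LF_conv_eq: "lf R G (TmEq a b A) \<Longrightarrow> lf R G (TyEq A B) \<Longrightarrow> lf R G (TmEq a b B)"
| LF_set: "lf R G Ctx \<Longrightarrow> lf R G (IsTy SET)"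
| LF_el: "lf R G (HasTy A SET) \<Longrightarrow> lf R G (IsTy (EL A))"
| LF_el_eq: "lf R G (TmEq A B SET) \<Longrightarrow> lf R G (TyEq (EL A) (EL B))"
| LF_fun: "lf R G (IsTy A) \<Longrightarrow> lf R (A # G) (IsTy B) \<Longrightarrow> lf R G (IsTy (FUN A B))"
| LF_fun_eq: "lf R G (TyEq A A') \<Longrightarrow> lf R G (IsTy A) \<Longrightarrow> lf R (A # G) (TyEq B B') \<Longrightarrow>
    lf R G (TyEq (FUN A B) (FUN A' B'))"
| LF_lam: "lf R G (IsTy A) \<Longrightarrow> lf R (A # G) (HasTy b B) \<Longrightarrow> lf R G (HasTy (Lam b) (FUN A B))"
| LF_xi: "lf R G (IsTy A) \<Longrightarrow> lf R (A # G) (TmEq b b' B) \<Longrightarrow>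
    lf R G (TmEq (Lam b) (Lam b') (FUN A B))"
| LF_app: "lf R G (HasTy c (FUN A B)) \<Longrightarrow> lf R G (HasTy a A) \<Longrightarrow>
    lf R G (HasTy (App c a) (ty_inst a B))"
| LF_app_eq: "lf R G (TmEq c c' (FUN A B)) \<Longrightarrow> lf R G (TmEq a a' A) \<Longrightarrow>
    lf R G (TmEq (App c a) (App c' a') (ty_inst a B))"
| LF_beta: "lf R (A # G) (HasTy b B) \<Longrightarrow> lf R G (HasTy a A) \<Longrightarrow>
    lf R G (TmEq (App (Lam b) a) (tm_inst a b) (ty_inst a B))"
| LF_eta: "lf R G (HasTy c (FUN A B)) \<Longrightarrow>
    lf R G (TmEq (Lam (App (tm_ren Suc c) (Var 0))) c (FUN A B))"


subsection \<open>The sets of CTT\<close>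

type_synonym 'c tmx = "nat \<Rightarrow> 'c tm"
type_synonym 'c tyx = "nat \<Rightarrow> 'c ty"

definition t_app :: "'c tmx \<Rightarrow> 'c tmx \<Rightarrow> 'c tmx" (infixl "\<cdot>" 90) where
  "c \<cdot> a = (\<lambda>n. App (c n) (a n))"
definition t_lam :: "('c tmx \<Rightarrow> 'c tmx) \<Rightarrow> 'c tmx" where
  "t_lam F = (\<lambda>n. Lam (F (\<lambda>m. Var (m - Suc n)) (Suc n)))"
definition t_con :: "con \<Rightarrow> 'c tmx list \<Rightarrow> 'c tmx" (infix "$$" 95) where
  "c $$ as = foldl (\<cdot>) (\<lambda>n. Con c) as"

definition set_ty :: "'c tyx" where
  "set_ty = (\<lambda>n. SET)"
definition el :: "'c tmx \<Rightarrow> 'c tyx" where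
  "el a = (\<lambda>n. EL (a n))"
definition fun_ty :: "'c tyx \<Rightarrow> ('c tmx \<Rightarrow> 'c tyx) \<Rightarrow> 'c tyx" where
  "fun_ty A F = (\<lambda>n. FUN (A n) (F (\<lambda>m. Var (m - Suc n)) (Suc n)))"
definition arrow :: "'c tyx \<Rightarrow> 'c tyx \<Rightarrow> 'c tyx" (infixr "\<rightarrow>" 60) where
  "(A \<rightarrow> B) = fun_ty A (\<lambda>x. B)"

primrec con_ty :: "con \<Rightarrow> 'c tyx" where
  "con_ty cPi = fun_ty set_ty (\<lambda>A. (el A \<rightarrow> set_ty) \<rightarrow> set_ty)"
| "con_ty cLam = fun_ty set_ty (\<lambda>A. fun_ty (el A \<rightarrow> set_ty) (\<lambda>B.
     fun_ty (el A) (\<lambda>x. el (B \<cdot> x)) \<rightarrow> el (cPi $$ [A, B])))"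
| "con_ty cApply = fun_ty set_ty (\<lambda>A. fun_ty (el A \<rightarrow> set_ty) (\<lambda>B.
     el (cPi $$ [A, B]) \<rightarrow> fun_ty (el A) (\<lambda>x. el (B \<cdot> x))))"
| "con_ty cSigma = fun_ty set_ty (\<lambda>A. (el A \<rightarrow> set_ty) \<rightarrow> set_ty)"
| "con_ty cPair = fun_ty set_ty (\<lambda>A. fun_ty (el A \<rightarrow> set_ty) (\<lambda>B.
     fun_ty (el A) (\<lambda>x. el (B \<cdot> x) \<rightarrow> el (cSigma $$ [A, B]))))"
| "con_ty cSplit = fun_ty set_ty (\<lambda>A. fun_ty (el A \<rightarrow> set_ty) (\<lambda>B.
     fun_ty (el (cSigma $$ [A, B]) \<rightarrow> set_ty) (\<lambda>C.
     fun_ty (el A) (\<lambda>x. fun_ty (el (B \<cdot> x)) (\<lambda>y. el (C \<cdot> (cPair $$ [A, B, x, y])))) \<rightarrow>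
     fun_ty (el (cSigma $$ [A, B])) (\<lambda>z. el (C \<cdot> z)))))"
| "con_ty cPlus = set_ty \<rightarrow> set_ty \<rightarrow> set_ty"
| "con_ty cInl = fun_ty set_ty (\<lambda>A. fun_ty set_ty (\<lambda>B. el A \<rightarrow> el (cPlus $$ [A, B])))"
| "con_ty cInr = fun_ty set_ty (\<lambda>A. fun_ty set_ty (\<lambda>B. el B \<rightarrow> el (cPlus $$ [A, B])))"
| "con_ty cWhen = fun_ty set_ty (\<lambda>A. fun_ty set_ty (\<lambda>B.
     fun_ty (el (cPlus $$ [A, B]) \<rightarrow> set_ty) (\<lambda>C.
     fun_ty (el A) (\<lambda>x. el (C \<cdot> (cInl $$ [A, B, x]))) \<rightarrow>
     fun_ty (el B) (\<lambda>y. el (C \<cdot> (cInr $$ [A, B, y]))) \<rightarrow>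
     fun_ty (el (cPlus $$ [A, B])) (\<lambda>z. el (C \<cdot> z)))))"
| "con_ty cId = fun_ty set_ty (\<lambda>A. el A \<rightarrow> el A \<rightarrow> set_ty)"
| "con_ty cRefl = fun_ty set_ty (\<lambda>A. fun_ty (el A) (\<lambda>x. el (cId $$ [A, x, x])))"
| "con_ty cIdpeel = fun_ty set_ty (\<lambda>A.
     fun_ty (fun_ty (el A) (\<lambda>x. fun_ty (el A) (\<lambda>y. el (cId $$ [A, x, y]) \<rightarrow> set_ty))) (\<lambda>C.
     fun_ty (el A) (\<lambda>x. el (C \<cdot> x \<cdot> x \<cdot> (cRefl $$ [A, x]))) \<rightarrow>
     fun_ty (el A) (\<lambda>x. fun_ty (el A) (\<lambda>y.
       fun_ty (el (cId $$ [A, x, y])) (\<lambda>e. el (C \<cdot> x \<cdot> y \<cdot> e))))))"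
| "con_ty cN0 = set_ty"
| "con_ty cCase0 = fun_ty (el (cN0 $$ []) \<rightarrow> set_ty) (\<lambda>C.
     fun_ty (el (cN0 $$ [])) (\<lambda>z. el (C \<cdot> z)))"
| "con_ty cN1 = set_ty"
| "con_ty cStar = el (cN1 $$ [])"
| "con_ty cCase1 = fun_ty (el (cN1 $$ []) \<rightarrow> set_ty) (\<lambda>C.
     el (C \<cdot> (cStar $$ [])) \<rightarrow> fun_ty (el (cN1 $$ [])) (\<lambda>z. el (C \<cdot> z)))"
| "con_ty cNat = set_ty"
| "con_ty cZero = el (cNat $$ [])"
| "con_ty cSucc = el (cNat $$ []) \<rightarrow> el (cNat $$ [])"
| "con_ty cNatrec = fun_ty (el (cNat $$ []) \<rightarrow> set_ty) (\<lambda>C.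
     el (C \<cdot> (cZero $$ [])) \<rightarrow>
     fun_ty (el (cNat $$ [])) (\<lambda>x. el (C \<cdot> x) \<rightarrow> el (C \<cdot> (cSucc $$ [x]))) \<rightarrow>
     fun_ty (el (cNat $$ [])) (\<lambda>n. el (C \<cdot> n)))"
| "con_ty cList = set_ty \<rightarrow> set_ty"
| "con_ty cNil = fun_ty set_ty (\<lambda>A. el (cList $$ [A]))"
| "con_ty cCons = fun_ty set_ty (\<lambda>A. el A \<rightarrow> el (cList $$ [A]) \<rightarrow> el (cList $$ [A]))"
| "con_ty cListrec = fun_ty set_ty (\<lambda>A. fun_ty (el (cList $$ [A]) \<rightarrow> set_ty) (\<lambda>C.
     el (C \<cdot> (cNil $$ [A])) \<rightarrow>
     fun_ty (el A) (\<lambda>x. fun_ty (el (cList $$ [A])) (\<lambda>y.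
       el (C \<cdot> y) \<rightarrow> el (C \<cdot> (cCons $$ [A, x, y])))) \<rightarrow>
     fun_ty (el (cList $$ [A])) (\<lambda>l. el (C \<cdot> l))))"
| "con_ty cW = fun_ty set_ty (\<lambda>A. (el A \<rightarrow> set_ty) \<rightarrow> set_ty)"
| "con_ty cSup = fun_ty set_ty (\<lambda>A. fun_ty (el A \<rightarrow> set_ty) (\<lambda>B.
     fun_ty (el A) (\<lambda>x. (el (B \<cdot> x) \<rightarrow> el (cW $$ [A, B])) \<rightarrow> el (cW $$ [A, B]))))"
| "con_ty cWrec = fun_ty set_ty (\<lambda>A. fun_ty (el A \<rightarrow> set_ty) (\<lambda>B.
     fun_ty (el (cW $$ [A, B]) \<rightarrow> set_ty) (\<lambda>C.
     fun_ty (el A) (\<lambda>x. fun_ty (el (B \<cdot> x) \<rightarrow> el (cW $$ [A, B])) (\<lambda>y.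
       fun_ty (el (B \<cdot> x)) (\<lambda>u. el (C \<cdot> (y \<cdot> u))) \<rightarrow> el (C \<cdot> (cSup $$ [A, B, x, y])))) \<rightarrow>
     fun_ty (el (cW $$ [A, B])) (\<lambda>w. el (C \<cdot> w)))))"
| "con_ty cU = set_ty"
| "con_ty cT = el (cU $$ []) \<rightarrow> set_ty"
| "con_ty cuPi = fun_ty (el (cU $$ [])) (\<lambda>a. (el (cT $$ [a]) \<rightarrow> el (cU $$ [])) \<rightarrow> el (cU $$ []))"
| "con_ty cuSigma = fun_ty (el (cU $$ [])) (\<lambda>a. (el (cT $$ [a]) \<rightarrow> el (cU $$ [])) \<rightarrow> el (cU $$ []))"
| "con_ty cuPlus = el (cU $$ []) \<rightarrow> el (cU $$ []) \<rightarrow> el (cU $$ [])"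
| "con_ty cuId = fun_ty (el (cU $$ [])) (\<lambda>a. el (cT $$ [a]) \<rightarrow> el (cT $$ [a]) \<rightarrow> el (cU $$ []))"
| "con_ty cuN0 = el (cU $$ [])"
| "con_ty cuN1 = el (cU $$ [])"
| "con_ty cuNat = el (cU $$ [])"
| "con_ty cuList = el (cU $$ []) \<rightarrow> el (cU $$ [])"
| "con_ty cuW = fun_ty (el (cU $$ [])) (\<lambda>a. (el (cT $$ [a]) \<rightarrow> el (cU $$ [])) \<rightarrow> el (cU $$ []))"
| "con_ty cGup = fun_ty set_ty (\<lambda>I. fun_ty (set_ty \<rightarrow> el I \<rightarrow> set_ty) (\<lambda>R.
     fun_ty (set_ty \<rightarrow> el I) (\<lambda>F.
     fun_ty set_ty (\<lambda>P. el (R \<cdot> P \<cdot> (F \<cdot> P))) \<rightarrow> el I)))"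
| "con_ty cGupProof = fun_ty set_ty (\<lambda>I. fun_ty (set_ty \<rightarrow> el I \<rightarrow> set_ty) (\<lambda>R.
     fun_ty (set_ty \<rightarrow> el I) (\<lambda>F.
     fun_ty (fun_ty set_ty (\<lambda>P. el (R \<cdot> P \<cdot> (F \<cdot> P)))) (\<lambda>r.
     fun_ty set_ty (\<lambda>P. el (R \<cdot> P \<cdot> (cGup $$ [I, R, F, r])))))))"

text \<open>
  \<open>given A (\<lambda>x. \<dots>)\<close> extends the context of a sequent by a variable \<open>x\<close> of type \<open>A\<close>; the depth of an
  expression is then the length of the context.
\<close>

definition given :: "'c tyx \<Rightarrow> ('c tmx \<Rightarrow> 'c ty list \<Rightarrow> 'c sequent) \<Rightarrow> 'c ty list \<Rightarrow> 'c sequent" where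
  "given A J = (\<lambda>G. J (\<lambda>m. Var (m - Suc (length G))) (A (length G) # G))"
definition equation :: "'c tmx \<Rightarrow> 'c tmx \<Rightarrow> 'c tyx \<Rightarrow> 'c ty list \<Rightarrow> 'c sequent" where
  "equation a b A = (\<lambda>G. (G, TmEq (a (length G)) (b (length G)) (A (length G))))"

definition computation_rules :: "('c ty list \<Rightarrow> 'c sequent) set" where
  "computation_rules = {
     given set_ty (\<lambda>A. given (el A \<rightarrow> set_ty) (\<lambda>B.
     given (fun_ty (el A) (\<lambda>x. el (B \<cdot> x))) (\<lambda>b. given (el A) (\<lambda>a.
       equation (cApply $$ [A, B, cLam $$ [A, B, b], a]) (b \<cdot> a) (el (B \<cdot> a)))))),
     given set_ty (\<lambda>A. given (el A \<rightarrow> set_ty) (\<lambda>B.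
     given (el (cSigma $$ [A, B]) \<rightarrow> set_ty) (\<lambda>C.
     given (fun_ty (el A) (\<lambda>x. fun_ty (el (B \<cdot> x)) (\<lambda>y. el (C \<cdot> (cPair $$ [A, B, x, y]))))) (\<lambda>d.
     given (el A) (\<lambda>a. given (el (B \<cdot> a)) (\<lambda>b.
       equation (cSplit $$ [A, B, C, d, cPair $$ [A, B, a, b]]) (d \<cdot> a \<cdot> b)
         (el (C \<cdot> (cPair $$ [A, B, a, b]))))))))),
     given set_ty (\<lambda>A. given set_ty (\<lambda>B. given (el (cPlus $$ [A, B]) \<rightarrow> set_ty) (\<lambda>C.
     given (fun_ty (el A) (\<lambda>x. el (C \<cdot> (cInl $$ [A, B, x])))) (\<lambda>d.
     given (fun_ty (el B) (\<lambda>y. el (C \<cdot> (cInr $$ [A, B, y])))) (\<lambda>e. given (el A) (\<lambda>a.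
       equation (cWhen $$ [A, B, C, d, e, cInl $$ [A, B, a]]) (d \<cdot> a)
         (el (C \<cdot> (cInl $$ [A, B, a]))))))))),
     given set_ty (\<lambda>A. given set_ty (\<lambda>B. given (el (cPlus $$ [A, B]) \<rightarrow> set_ty) (\<lambda>C.
     given (fun_ty (el A) (\<lambda>x. el (C \<cdot> (cInl $$ [A, B, x])))) (\<lambda>d.
     given (fun_ty (el B) (\<lambda>y. el (C \<cdot> (cInr $$ [A, B, y])))) (\<lambda>e. given (el B) (\<lambda>b.
       equation (cWhen $$ [A, B, C, d, e, cInr $$ [A, B, b]]) (e \<cdot> b)
         (el (C \<cdot> (cInr $$ [A, B, b]))))))))),
     given set_ty (\<lambda>A.
     given (fun_ty (el A) (\<lambda>x. fun_ty (el A) (\<lambda>y. el (cId $$ [A, x, y]) \<rightarrow> set_ty))) (\<lambda>C.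
     given (fun_ty (el A) (\<lambda>x. el (C \<cdot> x \<cdot> x \<cdot> (cRefl $$ [A, x])))) (\<lambda>d. given (el A) (\<lambda>a.
       equation (cIdpeel $$ [A, C, d, a, a, cRefl $$ [A, a]]) (d \<cdot> a)
         (el (C \<cdot> a \<cdot> a \<cdot> (cRefl $$ [A, a]))))))),
     given (el (cN1 $$ []) \<rightarrow> set_ty) (\<lambda>C. given (el (C \<cdot> (cStar $$ []))) (\<lambda>d.
       equation (cCase1 $$ [C, d, cStar $$ []]) d (el (C \<cdot> (cStar $$ []))))),
     given (el (cNat $$ []) \<rightarrow> set_ty) (\<lambda>C. given (el (C \<cdot> (cZero $$ []))) (\<lambda>d.
     given (fun_ty (el (cNat $$ [])) (\<lambda>x. el (C \<cdot> x) \<rightarrow> el (C \<cdot> (cSucc $$ [x])))) (\<lambda>e.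
       equation (cNatrec $$ [C, d, e, cZero $$ []]) d (el (C \<cdot> (cZero $$ [])))))),
     given (el (cNat $$ []) \<rightarrow> set_ty) (\<lambda>C. given (el (C \<cdot> (cZero $$ []))) (\<lambda>d.
     given (fun_ty (el (cNat $$ [])) (\<lambda>x. el (C \<cdot> x) \<rightarrow> el (C \<cdot> (cSucc $$ [x])))) (\<lambda>e.
     given (el (cNat $$ [])) (\<lambda>n.
       equation (cNatrec $$ [C, d, e, cSucc $$ [n]]) (e \<cdot> n \<cdot> (cNatrec $$ [C, d, e, n]))
         (el (C \<cdot> (cSucc $$ [n]))))))),
     given set_ty (\<lambda>A. given (el (cList $$ [A]) \<rightarrow> set_ty) (\<lambda>C.
     given (el (C \<cdot> (cNil $$ [A]))) (\<lambda>d.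
     given (fun_ty (el A) (\<lambda>x. fun_ty (el (cList $$ [A])) (\<lambda>y.
       el (C \<cdot> y) \<rightarrow> el (C \<cdot> (cCons $$ [A, x, y]))))) (\<lambda>e.
       equation (cListrec $$ [A, C, d, e, cNil $$ [A]]) d (el (C \<cdot> (cNil $$ [A]))))))),
     given set_ty (\<lambda>A. given (el (cList $$ [A]) \<rightarrow> set_ty) (\<lambda>C.
     given (el (C \<cdot> (cNil $$ [A]))) (\<lambda>d.
     given (fun_ty (el A) (\<lambda>x. fun_ty (el (cList $$ [A])) (\<lambda>y.
       el (C \<cdot> y) \<rightarrow> el (C \<cdot> (cCons $$ [A, x, y]))))) (\<lambda>e.
     given (el A) (\<lambda>a. given (el (cList $$ [A])) (\<lambda>l.
       equation (cListrec $$ [A, C, d, e, cCons $$ [A, a, l]])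
         (e \<cdot> a \<cdot> l \<cdot> (cListrec $$ [A, C, d, e, l])) (el (C \<cdot> (cCons $$ [A, a, l]))))))))),
     given set_ty (\<lambda>A. given (el A \<rightarrow> set_ty) (\<lambda>B. given (el (cW $$ [A, B]) \<rightarrow> set_ty) (\<lambda>C.
     given (fun_ty (el A) (\<lambda>x. fun_ty (el (B \<cdot> x) \<rightarrow> el (cW $$ [A, B])) (\<lambda>y.
       fun_ty (el (B \<cdot> x)) (\<lambda>u. el (C \<cdot> (y \<cdot> u))) \<rightarrow> el (C \<cdot> (cSup $$ [A, B, x, y]))))) (\<lambda>d.
     given (el A) (\<lambda>a. given (el (B \<cdot> a) \<rightarrow> el (cW $$ [A, B])) (\<lambda>b.
       equation (cWrec $$ [A, B, C, d, cSup $$ [A, B, a, b]])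
         (d \<cdot> a \<cdot> b \<cdot> t_lam (\<lambda>u. cWrec $$ [A, B, C, d, b \<cdot> u]))
         (el (C \<cdot> (cSup $$ [A, B, a, b]))))))))),
     given (el (cU $$ [])) (\<lambda>a. given (el (cT $$ [a]) \<rightarrow> el (cU $$ [])) (\<lambda>b.
       equation (cT $$ [cuPi $$ [a, b]]) (cPi $$ [cT $$ [a], t_lam (\<lambda>x. cT $$ [b \<cdot> x])]) set_ty)),
     given (el (cU $$ [])) (\<lambda>a. given (el (cT $$ [a]) \<rightarrow> el (cU $$ [])) (\<lambda>b.
       equation (cT $$ [cuSigma $$ [a, b]]) (cSigma $$ [cT $$ [a], t_lam (\<lambda>x. cT $$ [b \<cdot> x])]) set_ty)),
     given (el (cU $$ [])) (\<lambda>a. given (el (cU $$ [])) (\<lambda>b.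
       equation (cT $$ [cuPlus $$ [a, b]]) (cPlus $$ [cT $$ [a], cT $$ [b]]) set_ty)),
     given (el (cU $$ [])) (\<lambda>a. given (el (cT $$ [a])) (\<lambda>x. given (el (cT $$ [a])) (\<lambda>y.
       equation (cT $$ [cuId $$ [a, x, y]]) (cId $$ [cT $$ [a], x, y]) set_ty))),
     equation (cT $$ [cuN0 $$ []]) (cN0 $$ []) set_ty,
     equation (cT $$ [cuN1 $$ []]) (cN1 $$ []) set_ty,
     equation (cT $$ [cuNat $$ []]) (cNat $$ []) set_ty,
     given (el (cU $$ [])) (\<lambda>a. equation (cT $$ [cuList $$ [a]]) (cList $$ [cT $$ [a]]) set_ty),
     given (el (cU $$ [])) (\<lambda>a. given (el (cT $$ [a]) \<rightarrow> el (cU $$ [])) (\<lambda>b.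
       equation (cT $$ [cuW $$ [a, b]]) (cW $$ [cT $$ [a], t_lam (\<lambda>x. cT $$ [b \<cdot> x])]) set_ty))}"

definition con_decl :: "con \<Rightarrow> 'c rule" where
  "con_decl c = ([], ([], HasTy (Con c) (con_ty c 0)))"

definition CTT :: "'c rule set" where
  "CTT = {con_decl c | c. c \<noteq> cGup \<and> c \<noteq> cGupProof}
     \<union> {([], s []) | s. s \<in> computation_rules}"

definition GUP_CTT :: "'c rule set" where
  "GUP_CTT = {con_decl cGup, con_decl cGupProof}"

definition inhabited :: "'c rule set \<Rightarrow> 'c tyx \<Rightarrow> bool" where
  "inhabited R A \<longleftrightarrow> (\<exists>t. lf R [] (HasTy t (A 0)))"

definition ctt_consistent :: "'c rule set \<Rightarrow> bool" where
  "ctt_consistent R \<longleftrightarrow> \<not> inhabited R (el (cN0 $$ []))"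


subsection \<open>Formal spaces in CTT\<close>

definition p_all :: "'c tmx \<Rightarrow> ('c tmx \<Rightarrow> 'c tmx) \<Rightarrow> 'c tmx" where
  "p_all A F = cPi $$ [A, t_lam F]"
definition p_ex :: "'c tmx \<Rightarrow> ('c tmx \<Rightarrow> 'c tmx) \<Rightarrow> 'c tmx" where
  "p_ex A F = cSigma $$ [A, t_lam F]"
definition p_imp :: "'c tmx \<Rightarrow> 'c tmx \<Rightarrow> 'c tmx" where
  "p_imp A B = p_all A (\<lambda>x. B)"
definition p_and :: "'c tmx \<Rightarrow> 'c tmx \<Rightarrow> 'c tmx" where
  "p_and A B = p_ex A (\<lambda>x. B)"
definition p_or :: "'c tmx \<Rightarrow> 'c tmx \<Rightarrow> 'c tmx" where
  "p_or A B = cPlus $$ [A, B]"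
definition p_bot :: "'c tmx" where
  "p_bot = cN0 $$ []"
definition p_not :: "'c tmx \<Rightarrow> 'c tmx" where
  "p_not A = p_imp A p_bot"

text \<open>
  Subsets of a set \<open>S\<close> are propositional functions \<open>U : subset_ty S\<close>, with \<open>a \<in> U\<close> meaning \<open>U \<cdot> a\<close>.
\<close>

definition subset_ty :: "'c tmx \<Rightarrow> 'c tyx" where
  "subset_ty S = (el S \<rightarrow> set_ty)"
definition t_none :: "'c tmx" where
  "t_none = t_lam (\<lambda>x. p_bot)"
definition t_sing :: "'c tmx \<Rightarrow> 'c tmx \<Rightarrow> 'c tmx" where
  "t_sing S a = t_lam (\<lambda>x. cId $$ [S, x, a])"
definition t_union :: "'c tmx \<Rightarrow> 'c tmx \<Rightarrow> 'c tmx" where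
  "t_union U V = t_lam (\<lambda>x. p_or (U \<cdot> x) (V \<cdot> x))"
definition t_subset :: "'c tmx \<Rightarrow> 'c tmx \<Rightarrow> 'c tmx \<Rightarrow> 'c tmx" where
  "t_subset S U V = p_all S (\<lambda>x. p_imp (U \<cdot> x) (V \<cdot> x))"

definition t_covs :: "'c tmx \<Rightarrow> 'c tmx \<Rightarrow> 'c tmx \<Rightarrow> 'c tmx \<Rightarrow> 'c tmx" where
  "t_covs S C U V = p_all S (\<lambda>u. p_imp (U \<cdot> u) (C \<cdot> u \<cdot> V))"
definition t_covers_space :: "'c tmx \<Rightarrow> 'c tmx \<Rightarrow> 'c tmx \<Rightarrow> 'c tmx" where
  "t_covers_space S C V = p_all S (\<lambda>a. C \<cdot> a \<cdot> V)"
definition t_down :: "'c tmx \<Rightarrow> 'c tmx \<Rightarrow> 'c tmx \<Rightarrow> 'c tmx \<Rightarrow> 'c tmx" where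
  "t_down S C U V = t_lam (\<lambda>d. p_and
     (p_ex S (\<lambda>u. p_and (U \<cdot> u) (C \<cdot> d \<cdot> t_sing S u)))
     (p_ex S (\<lambda>v. p_and (V \<cdot> v) (C \<cdot> d \<cdot> t_sing S v))))"
definition t_pseudocompl :: "'c tmx \<Rightarrow> 'c tmx \<Rightarrow> 'c tmx \<Rightarrow> 'c tmx" where
  "t_pseudocompl S C U = t_lam (\<lambda>a. t_covs S C (t_down S C (t_sing S a) U) t_none)"

definition cover_ty :: "'c tmx \<Rightarrow> 'c tyx" where
  "cover_ty S = (el S \<rightarrow> subset_ty S \<rightarrow> set_ty)"
definition t_reflexivity :: "'c tmx \<Rightarrow> 'c tmx \<Rightarrow> 'c tyx" where
  "t_reflexivity S C = fun_ty (el S) (\<lambda>a. fun_ty (subset_ty S) (\<lambda>U.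
     el (p_imp (U \<cdot> a) (C \<cdot> a \<cdot> U))))"
definition t_transitivity :: "'c tmx \<Rightarrow> 'c tmx \<Rightarrow> 'c tyx" where
  "t_transitivity S C = fun_ty (el S) (\<lambda>a. fun_ty (subset_ty S) (\<lambda>U. fun_ty (subset_ty S) (\<lambda>V.
     el (p_imp (p_and (C \<cdot> a \<cdot> U) (t_covs S C U V)) (C \<cdot> a \<cdot> V)))))"
definition t_down_right :: "'c tmx \<Rightarrow> 'c tmx \<Rightarrow> 'c tyx" where
  "t_down_right S C = fun_ty (el S) (\<lambda>a. fun_ty (subset_ty S) (\<lambda>U. fun_ty (subset_ty S) (\<lambda>V.
     el (p_imp (p_and (C \<cdot> a \<cdot> U) (C \<cdot> a \<cdot> V)) (C \<cdot> a \<cdot> t_down S C U V)))))"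

definition t_nontrivial :: "'c tmx \<Rightarrow> 'c tmx \<Rightarrow> 'c tyx" where
  "t_nontrivial S C = el (p_not (t_covers_space S C t_none))"
definition t_boolean_space :: "'c tmx \<Rightarrow> 'c tmx \<Rightarrow> 'c tyx" where
  "t_boolean_space S C = fun_ty (subset_ty S) (\<lambda>U.
     el (t_covers_space S C (t_union U (t_pseudocompl S C U))))"

text \<open>
  \<open>Fin n\<close> is the standard set with \<open>n\<close> elements, \<open>N\<^sub>0 + N\<^sub>1 + \<dots> + N\<^sub>1\<close>, defined by recursion into the
  universe.  A finitely listed subset of \<open>S\<close> is given by \<open>n\<close> and \<open>f : Fin n \<Rightarrow> S\<close>.
\<close>

definition Fin :: "'c tmx \<Rightarrow> 'c tmx" where
  "Fin n = cT $$ [cNatrec $$ [t_lam (\<lambda>x. cU $$ []), cuN0 $$ [],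
     t_lam (\<lambda>x. t_lam (\<lambda>c. cuPlus $$ [c, cuN1 $$ []])), n]]"
definition t_listed :: "'c tmx \<Rightarrow> 'c tmx \<Rightarrow> 'c tmx \<Rightarrow> 'c tmx" where
  "t_listed S n f = t_lam (\<lambda>x. p_ex (Fin n) (\<lambda>i.
     cId $$ [S, x, cApply $$ [Fin n, t_lam (\<lambda>j. S), f, i]]))"
definition t_compact_space :: "'c tmx \<Rightarrow> 'c tmx \<Rightarrow> 'c tyx" where
  "t_compact_space S C = fun_ty (subset_ty S) (\<lambda>U.
     el (p_imp (t_covers_space S C U)
       (p_ex (cNat $$ []) (\<lambda>n. p_ex (p_imp (Fin n) S) (\<lambda>f.
         p_and (t_subset S (t_listed S n f) U) (t_covers_space S C (t_listed S n f)))))))"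

definition EM_CTT :: "'c tyx" where
  "EM_CTT = fun_ty set_ty (\<lambda>P. el (p_or P (p_not P)))"

text \<open>
  The type of proofs that excluded middle holds if there is a non-trivial compact Boolean formal
  space.  It is a hypothetical judgement over all spaces, since propositions about all subsets form
  types rather than sets.
\<close>

definition compact_boolean_imp_EM_CTT :: "'c tyx" where
  "compact_boolean_imp_EM_CTT = fun_ty set_ty (\<lambda>S. fun_ty (cover_ty S) (\<lambda>C.
     t_reflexivity S C \<rightarrow> t_transitivity S C \<rightarrow> t_down_right S C \<rightarrow>
     t_nontrivial S C \<rightarrow> t_boolean_space S C \<rightarrow> t_compact_space S C \<rightarrow> EM_CTT))"

end

theory Submission
  imports Defs "HOL-Library.Countable"
begin

text \<open>
  Let \<open>S\<close> be compact, Boolean and non-trivial, let \<open>P\<close> be a proposition, and put \<open>U = {x \<in> S. P}\<close>. Since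
  \<open>S\<close> is Boolean, \<open>U \<union> U\<^sup>*\<close> covers \<open>S\<close>, and by compactness so does some finite list \<open>x\<^sub>1, \<dots>, x\<^sub>n\<close> of
  its elements. Each \<open>x\<^sub>i\<close> satisfies \<open>P\<close> or \<open>x\<^sub>i \<in> U\<^sup>*\<close>, so induction on \<open>n\<close> gives \<open>P\<close>, or \<open>x\<^sub>i \<in> U\<^sup>*\<close> for
  all \<open>i\<close>. In the second case \<open>P\<close> would put every \<open>x\<^sub>i\<close> into \<open>U \<inter> U\<^sup>*\<close>, hence \<open>x\<^sub>i\<close> would be covered by
  the empty set, and so would \<open>S\<close>, contradicting non-triviality; thus \<open>\<not> P\<close>. The argument is carried
  out inside each of the formal systems.
\<close>

section \<open>Set theory\<close>

text \<open>Which \<open>P\<close> can be treated depends on which \<open>P\<close> define a subset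
  \<open>U\<close> of the base: bounded separation in CZF yields only restricted excluded middle,
  while full separation in IZF, comprehension in HHA and constant propositional functions in CTT
  admit every proposition. Finiteness of the subcover is what allows the separate decisions to be
  merged constructively, one index after another. In set theory there is an additional obstacle:
  \<open>U \<union> U\<^sup>*\<close> is a class, whereas compactness speaks of sets. The required
  set is extracted from what it means to be covered by a class.

  As the systems are deep embeddings, each inference is a derivation, and the main technical
  difficulty is binding. Every calculus therefore gets a layer in which formulas or terms are
  functions of the depth, and a compositional relation shows that such a family commutes with
  substitution. In the two logical calculi eigenvariables become ordinary free variables; in the
  logical framework contexts stay explicit and proof terms are hidden. Above these layers the
  derivations follow informal reasoning.\<close>

lemma up_simps [simp]: "up r 0 = 0" "up r (Suc k) = Suc (r k)"
  by (simp_all add: up_def)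

lemma up_comp: "up r \<circ> up s = up (r \<circ> s)"
  by (auto simp: fun_eq_iff up_def split: nat.split)

lemma up_id [simp]: "up id = id" "up (\<lambda>x. x) = (\<lambda>x. x)"
  by (auto simp: fun_eq_iff up_def split: nat.split)

lemma ren_ren: "ren r (ren s p) = ren (r \<circ> s) p"
  by (induction p arbitrary: r s) (simp_all add: up_comp)

lemma ren_id [simp]: "ren id p = p" "ren (\<lambda>x. x) p = p"
  by (induction p) (simp_all add: id_def[symmetric])

text \<open>Closed form of a renaming pushed under \<open>k\<close> binders. The relations defined
  later are verified at arbitrary depth by computing with it.\<close>

lemma up_pow: "(up ^^ k) r i = (if i < k then i else r (i - k) + k)"
proof (induction k arbitrary: i)
  case (Suc k)
  then show ?case by (cases i) simp_all
qed simp

text \<open>The rule \<open>nd.Ax\<close> admits every renaming of an axiom, so arbitrary renamings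
  act on derivations, not only injective ones. This is what moves a freely chosen eigenvariable into
  its de Bruijn position.\<close>

lemma nd_ren: "nd T H p \<Longrightarrow> nd T (map (ren r) H) (ren r p)"
proof (induction arbitrary: r rule: nd.induct)
  case (Ax p H s)
  then show ?case by (simp add: ren_ren nd.Ax)
next
  case (AllI H p)
  have "map (ren (up r)) (map (ren Suc) H) = map (ren Suc) (map (ren r) H)"
    by (simp add: ren_ren comp_def)
  with AllI.IH[of "up r"] show ?case by (simp only: ren.simps nd.AllI)
next
  case (AllE H p y)
  have "ren r (fm_inst y p) = fm_inst (r y) (ren (up r) p)"
    by (simp add: ren_ren) (rule arg_cong[of _ _ "\<lambda>f. ren f p"], auto simp: fun_eq_iff split: nat.split)
  with AllE.IH[of r] show ?case by (auto intro: nd.AllE)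
next
  case (ExI H y p)
  have "ren r (fm_inst y p) = fm_inst (r y) (ren (up r) p)"
    by (simp add: ren_ren) (rule arg_cong[of _ _ "\<lambda>f. ren f p"], auto simp: fun_eq_iff split: nat.split)
  with ExI.IH[of r] show ?case by (auto intro: nd.ExI)
next
  case (ExE H p q)
  have "map (ren (up r)) (map (ren Suc) H) = map (ren Suc) (map (ren r) H)"
    "ren (up r) (ren Suc q) = ren Suc (ren r q)"
    by (simp_all add: ren_ren comp_def)
  with ExE.IH(2)[of "up r"] have "nd T (ren (up r) p # map (ren Suc) (map (ren r) H)) (ren Suc (ren r q))"
    by (simp only: list.map)
  then show ?case by (rule nd.ExE[OF ExE.IH(1)[of r, simplified]])
next
  case (EqE H x y p)
  have "ren r (fm_inst z p) = fm_inst (r z) (ren (up r) p)" for z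
    by (simp add: ren_ren) (rule arg_cong[of _ _ "\<lambda>f. ren f p"], auto simp: fun_eq_iff split: nat.split)
  with EqE.IH[of r] show ?case by (auto intro: nd.EqE)
qed (auto intro: nd.intros)

lemma nd_weak: "nd T H p \<Longrightarrow> set H \<subseteq> set H' \<Longrightarrow> nd T H' p"
proof (induction arbitrary: H' rule: nd.induct)
  case (OrE H p q r)
  show ?case
    by (rule nd.OrE[OF OrE.IH(1) OrE.IH(2) OrE.IH(3)]) (use OrE.prems in auto)
next
  case (ImpI p H q)
  show ?case by (rule nd.ImpI, rule ImpI.IH) (use ImpI.prems in auto)
next
  case (AllI H p)
  show ?case by (rule nd.AllI, rule AllI.IH) (use AllI.prems in auto)
next
  case (ExE H p q)
  show ?case by (rule nd.ExE[OF ExE.IH(1) ExE.IH(2)]) (use ExE.prems in auto)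
next
  case (EqE H x y p)
  show ?case by (rule nd.EqE[OF EqE.IH(1) EqE.IH(2)]) (use EqE.prems in auto)
qed (auto intro: nd.intros)

text \<open>Finiteness of the set of free variables, phrased as locality of renaming, so that no
  function collecting free variables is required. Every index from the bound on is fresh.\<close>

lemma ren_bound: "\<exists>b. \<forall>r s. (\<forall>k<b. r k = s k) \<longrightarrow> ren r p = ren s p"
proof (induction p)
  case (FMem x y)
  show ?case by (rule exI[of _ "Suc (x + y)"]) auto
next
  case (FEq x y)
  show ?case by (rule exI[of _ "Suc (x + y)"]) auto
next
  case (FAnd p q)
  then obtain a b where "\<forall>r s. (\<forall>k<a. r k = s k) \<longrightarrow> ren r p = ren s p"
    "\<forall>r s. (\<forall>k<b. r k = s k) \<longrightarrow> ren r q = ren s q" by blast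
  then show ?case by (intro exI[of _ "a + b"]) (simp add: trans_less_add1 trans_less_add2)
next
  case (FOr p q)
  then obtain a b where "\<forall>r s. (\<forall>k<a. r k = s k) \<longrightarrow> ren r p = ren s p"
    "\<forall>r s. (\<forall>k<b. r k = s k) \<longrightarrow> ren r q = ren s q" by blast
  then show ?case by (intro exI[of _ "a + b"]) (simp add: trans_less_add1 trans_less_add2)
next
  case (FImp p q)
  then obtain a b where "\<forall>r s. (\<forall>k<a. r k = s k) \<longrightarrow> ren r p = ren s p"
    "\<forall>r s. (\<forall>k<b. r k = s k) \<longrightarrow> ren r q = ren s q" by blast
  then show ?case by (intro exI[of _ "a + b"]) (simp add: trans_less_add1 trans_less_add2)
next
  case (FAll p)
  then obtain b where b: "\<And>r s. \<forall>k<b. r k = s k \<Longrightarrow> ren r p = ren s p" by blast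
  have "ren (up r) p = ren (up s) p" if "\<forall>k<b. r k = s k" for r s
    by (rule b) (use that in \<open>auto simp: up_def split: nat.split\<close>)
  then show ?case by (intro exI[of _ b]) simp
next
  case (FEx p)
  then obtain b where b: "\<And>r s. \<forall>k<b. r k = s k \<Longrightarrow> ren r p = ren s p" by blast
  have "ren (up r) p = ren (up s) p" if "\<forall>k<b. r k = s k" for r s
    by (rule b) (use that in \<open>auto simp: up_def split: nat.split\<close>)
  then show ?case by (intro exI[of _ b]) simp
qed auto

lemma ren_bound_list: "\<exists>b. \<forall>p\<in>set H. \<forall>r s. (\<forall>k<b. r k = s k) \<longrightarrow> ren r p = ren s p"
proof (induction H)
  case (Cons p H)
  obtain a where "\<forall>r s. (\<forall>k<a. r k = s k) \<longrightarrow> ren r p = ren s p" using ren_bound by blast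
  moreover obtain b where "\<forall>p\<in>set H. \<forall>r s. (\<forall>k<b. r k = s k) \<longrightarrow> ren r p = ren s p" using Cons by blast
  ultimately show ?case by (intro exI[of _ "a + b"]) (simp add: trans_less_add1 trans_less_add2)
qed simp

text \<open>
  Renaming a variable \<open>y\<close> that does not occur to \<open>0\<close> and shifting all others undoes \<open>fm_inst y\<close>, so
  the eigenvariable rules follow from their versions for all instances.
\<close>

lemma nd_fresh_var:
  "\<exists>y. let r = (\<lambda>k. if k = y then 0 else Suc k) in map (ren r) H = map (ren Suc) H \<and>
     ren r q = ren Suc q \<and> ren r (fm_inst y p) = p"
proof -
  obtain b where b: "\<And>p' r s. p' \<in> set (p # q # H) \<Longrightarrow> \<forall>k<b. r k = s k \<Longrightarrow> ren r p' = ren s p'"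
    using ren_bound_list[of "p # q # H"] by blast
  let ?r = "\<lambda>k. if k = b then 0 else Suc k"
  have "ren ?r (fm_inst b p) = ren id p"
    unfolding ren_ren by (rule b) (auto split: nat.split)
  moreover have "map (ren ?r) H = map (ren Suc) H" by (rule map_cong[OF refl], rule b) auto
  moreover have "ren ?r q = ren Suc q" by (rule b) auto
  ultimately show ?thesis by (auto simp: Let_def)
qed

lemma nd_AllI:
  assumes "\<And>y. nd T H (fm_inst y p)"
  shows "nd T H (FAll p)"
proof -
  obtain y where y: "map (ren (\<lambda>k. if k = y then 0 else Suc k)) H = map (ren Suc) H"
      "ren (\<lambda>k. if k = y then 0 else Suc k) (fm_inst y p) = p"
    using nd_fresh_var[of H FBot p] by (auto simp: Let_def)
  show ?thesis
    using nd_ren[OF assms[of y], of "\<lambda>k. if k = y then 0 else Suc k"] y by (auto intro: nd.AllI)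
qed

lemma nd_ExE:
  assumes "nd T H (FEx p)" "\<And>y. nd T (fm_inst y p # H) q"
  shows "nd T H q"
proof -
  obtain y where y: "map (ren (\<lambda>k. if k = y then 0 else Suc k)) H = map (ren Suc) H"
      "ren (\<lambda>k. if k = y then 0 else Suc k) q = ren Suc q"
      "ren (\<lambda>k. if k = y then 0 else Suc k) (fm_inst y p) = p"
    using nd_fresh_var[of H q p] by (auto simp: Let_def)
  show ?thesis
    using nd_ren[OF assms(2)[of y], of "\<lambda>k. if k = y then 0 else Suc k"] y by (auto intro: nd.ExE[OF assms(1)])
qed

text \<open>
  A formula with parameters is a function of the binding depth. \<open>sv y\<close> is the global variable \<open>y\<close> seen
  from any depth, \<open>sb i\<close> the variable bound at depth \<open>i\<close>. The relation \<open>f_rel y k p q\<close> says that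
  replacing the outermost bound variable of \<open>p\<close> by \<open>y\<close> gives \<open>q\<close> below \<open>k\<close> further binders; it is
  compositional, so the simplifier proves that a concrete family commutes with instantiation, and
  the quantifier rules can be stated without de Bruijn indices.
\<close>

abbreviation sv :: "nat \<Rightarrow> var" where "sv y \<equiv> (\<lambda>m. y + m)"
abbreviation sb :: "nat \<Rightarrow> var" where "sb i \<equiv> (\<lambda>m. m - Suc i)"

definition v_rel :: "nat \<Rightarrow> nat \<Rightarrow> var \<Rightarrow> var \<Rightarrow> bool" where
  "v_rel y k a b \<longleftrightarrow> (up ^^ k) (case_nat y id) (a (Suc k)) = b k"
definition f_rel :: "nat \<Rightarrow> nat \<Rightarrow> form \<Rightarrow> form \<Rightarrow> bool" where
  "f_rel y k p q \<longleftrightarrow> ren ((up ^^ k) (case_nat y id)) (p (Suc k)) = q k"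
definition s_stable :: "(var \<Rightarrow> form) \<Rightarrow> bool" where
  "s_stable P \<longleftrightarrow> (\<forall>y. f_rel y 0 (P (sb 0)) (P (sv y)))"

text \<open>The argument is related at all depths \<open>j \<ge> k\<close>, because \<open>P\<close>
  may place it under further binders of its own. This stronger form of \<open>s_stable\<close> is
  what lets \<open>P\<close> occur inside larger families.\<close>

definition s_fam :: "(var \<Rightarrow> form) \<Rightarrow> bool" where
  "s_fam P \<longleftrightarrow> (\<forall>y k a a'. (\<forall>j\<ge>k. v_rel y j a a') \<longrightarrow> f_rel y k (P a) (P a'))"
definition s_fam2 :: "(var \<Rightarrow> var \<Rightarrow> form) \<Rightarrow> bool" where
  "s_fam2 P \<longleftrightarrow> (\<forall>y k a a' b b'. (\<forall>j\<ge>k. v_rel y j a a') \<longrightarrow> (\<forall>j\<ge>k. v_rel y j b b') \<longrightarrow>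
     f_rel y k (P a b) (P a' b'))"

named_theorems srel

lemma v_rel_0 [srel]: "v_rel y k (sb 0) (sv y)"
  by (simp add: v_rel_def up_pow)

lemma v_rel_free [srel]: "v_rel y k (sv z) (sv z)"
  by (simp add: v_rel_def up_pow)

text \<open>Instantiating the outermost binder removes level 0, so every inner level drops by one.
  The equation is a premise, which lets the simplifier apply the rule to levels of any syntactic
  shape.\<close>

lemma v_rel_bound [srel]: "i = Suc j \<Longrightarrow> j < k \<Longrightarrow> v_rel y k (sb i) (sb j)"
  by (simp add: v_rel_def up_pow)

lemma f_rel_mem [srel]: "v_rel y k a a' \<Longrightarrow> v_rel y k b b' \<Longrightarrow> f_rel y k (a \<in>\<^sub>s b) (a' \<in>\<^sub>s b')"
  and f_rel_eq [srel]: "v_rel y k a a' \<Longrightarrow> v_rel y k b b' \<Longrightarrow> f_rel y k (a =\<^sub>s b) (a' =\<^sub>s b')"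
  and f_rel_bot [srel]: "f_rel y k s_bot s_bot"
  and f_rel_and [srel]: "f_rel y k p p' \<Longrightarrow> f_rel y k q q' \<Longrightarrow> f_rel y k (p \<and>\<^sub>s q) (p' \<and>\<^sub>s q')"
  and f_rel_or [srel]: "f_rel y k p p' \<Longrightarrow> f_rel y k q q' \<Longrightarrow> f_rel y k (p \<or>\<^sub>s q) (p' \<or>\<^sub>s q')"
  and f_rel_imp [srel]: "f_rel y k p p' \<Longrightarrow> f_rel y k q q' \<Longrightarrow> f_rel y k (p \<longrightarrow>\<^sub>s q) (p' \<longrightarrow>\<^sub>s q')"
  and f_rel_all [srel]: "f_rel y (Suc k) (P (sb (Suc k))) (P' (sb k)) \<Longrightarrow> f_rel y k (s_all P) (s_all P')"
  and f_rel_ex [srel]: "f_rel y (Suc k) (P (sb (Suc k))) (P' (sb k)) \<Longrightarrow> f_rel y k (s_ex P) (s_ex P')"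
  by (simp_all add: f_rel_def v_rel_def s_mem_def s_eq_def s_bot_def s_and_def s_or_def s_imp_def s_all_def s_ex_def)

text \<open>In \<open>inst\<close> the parameters of \<open>p\<close> are shifted by the depth.
  Losing one binder lowers this shift by one, which is the effect of the instantiating renaming on
  indices above \<open>k\<close>.\<close>

lemma f_rel_inst [srel]:
  assumes "list_all2 (v_rel y k) xs xs'"
  shows "f_rel y k (inst p xs) (inst p xs')"
  unfolding f_rel_def inst_def ren_ren
proof (rule arg_cong[of _ _ "\<lambda>f. ren f p"], rule ext)
  fix i
  show "((up ^^ k) (case_nat y id) \<circ> (\<lambda>i. if i < length xs then (xs ! i) (Suc k) else i - length xs + Suc k)) i =
    (if i < length xs' then (xs' ! i) k else i - length xs' + k)"
  proof (cases "i < length xs")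
    case True
    then show ?thesis using assms by (simp add: list_all2_conv_all_nth v_rel_def)
  next
    case False
    have "i - length xs + Suc k - k = Suc (i - length xs)" by simp
    with False show ?thesis using list_all2_lengthD[OF assms] by (simp add: up_pow)
  qed
qed

text \<open>Unfolding the derived notions reduces compatibility of a concrete formula to atoms and
  quantifiers, so the side conditions of the rules below are discharged by simplification.\<close>

lemmas [srel] = s_iff_def s_not_def s_ball_def s_bex_def s_sub_def is_empty_def is_succ_def is_omega_def
  is_class_def elts_def none_def sing_def cunion_def cov_def covs_def down_def pseudocompl_def
  all_subsets_def formal_space_def set_presented_saturation_def nontrivial_def boolean_space_def
  is_upair_def is_pair_def pair_mem_def finitely_listed_def compact_space_def s_stable_def s_fam_def s_fam2_def

lemma s_stable_inst: "s_stable P \<Longrightarrow> fm_inst y (P (sb 0) (Suc 0)) = P (sv y) 0"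
  by (auto simp: s_stable_def f_rel_def)

text \<open>Axiom schemes take a formula, whereas the derived rules take a family. The formula
  \<open>P (sb 0) (Suc 0)\<close> has its variable 0 in the place of the argument, and substituting
  for it recovers the family.\<close>

lemma inst_stable: "s_stable P \<Longrightarrow> inst (P (sb 0) (Suc 0)) [sv y] 0 = P (sv y) 0"
proof -
  have "(\<lambda>k. if k < length [sv y] then ([sv y] ! k) 0 else k - length [sv y] + 0) = case_nat y id"
    by (auto simp: fun_eq_iff split: nat.split)
  then show "s_stable P \<Longrightarrow> inst (P (sb 0) (Suc 0)) [sv y] 0 = P (sv y) 0"
    by (simp only: inst_def s_stable_inst)
qed

text \<open>\<open>ren Suc p\<close> cannot mention variable 0, so the argument \<open>x\<close>
  disappears. Thus a scheme can be applied to a formula that ignores the first variable of the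
  scheme.\<close>

lemma inst_weak: "inst (ren Suc p) (x # xs) = inst p xs"
  unfolding inst_def ren_ren by (rule ext, rule arg_cong[of _ _ "\<lambda>f. ren f p"]) (auto simp: fun_eq_iff)

lemma inst_Nil_0 [simp]: "inst p [] 0 = p"
  by (simp add: inst_def id_def[symmetric])

section \<open>Derived rules of intuitionistic logic for formulas with parameters\<close>

definition s_entails :: "fm set \<Rightarrow> fm list \<Rightarrow> form \<Rightarrow> bool" where
  "s_entails T H p \<longleftrightarrow> nd T H (p 0)"

lemma s_hyp: "p 0 \<in> set H \<Longrightarrow> s_entails T H p"
  by (simp add: s_entails_def nd.Hyp)

lemma s_hd: "s_entails T (p 0 # H) p"
  by (simp add: s_hyp)

lemma s_wk: "s_entails T H p \<Longrightarrow> s_entails T (q # H) p"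
  unfolding s_entails_def by (erule nd_weak) auto

lemma s_botE: "s_entails T H s_bot \<Longrightarrow> s_entails T H p"
  by (simp add: s_entails_def s_bot_def nd.BotE)

lemma s_andI: "s_entails T H p \<Longrightarrow> s_entails T H q \<Longrightarrow> s_entails T H (p \<and>\<^sub>s q)"
  and s_andE1: "s_entails T H (p \<and>\<^sub>s q) \<Longrightarrow> s_entails T H p"
  and s_andE2: "s_entails T H (p \<and>\<^sub>s q) \<Longrightarrow> s_entails T H q"
  unfolding s_entails_def s_and_def by (auto intro: nd.AndI nd.AndE1 nd.AndE2)

lemma s_orI1: "s_entails T H p \<Longrightarrow> s_entails T H (p \<or>\<^sub>s q)"
  and s_orI2: "s_entails T H q \<Longrightarrow> s_entails T H (p \<or>\<^sub>s q)"
  and s_orE: "s_entails T H (p \<or>\<^sub>s q) \<Longrightarrow> s_entails T (p 0 # H) r \<Longrightarrow> s_entails T (q 0 # H) r \<Longrightarrow> s_entails T H r"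
  unfolding s_entails_def s_or_def by (auto intro: nd.OrI1 nd.OrI2 nd.OrE)

lemma s_impI: "s_entails T (p 0 # H) q \<Longrightarrow> s_entails T H (p \<longrightarrow>\<^sub>s q)"
  and s_impE: "s_entails T H (p \<longrightarrow>\<^sub>s q) \<Longrightarrow> s_entails T H p \<Longrightarrow> s_entails T H q"
  unfolding s_entails_def s_imp_def by (auto intro: nd.ImpI nd.ImpE)

lemma s_iffE1: "s_entails T H (p \<longleftrightarrow>\<^sub>s q) \<Longrightarrow> s_entails T H p \<Longrightarrow> s_entails T H q"
  and s_iffE2: "s_entails T H (p \<longleftrightarrow>\<^sub>s q) \<Longrightarrow> s_entails T H q \<Longrightarrow> s_entails T H p"
  and s_iffI: "s_entails T (p 0 # H) q \<Longrightarrow> s_entails T (q 0 # H) p \<Longrightarrow> s_entails T H (p \<longleftrightarrow>\<^sub>s q)"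
  unfolding s_iff_def by (auto intro: s_andE1 s_andE2 s_impE s_andI s_impI)

lemma s_notI: "s_entails T (p 0 # H) s_bot \<Longrightarrow> s_entails T H (\<not>\<^sub>s p)"
  and s_notE: "s_entails T H (\<not>\<^sub>s p) \<Longrightarrow> s_entails T H p \<Longrightarrow> s_entails T H q"
  unfolding s_not_def by (auto intro: s_impI s_impE s_botE)

lemma s_allI: "s_stable P \<Longrightarrow> (\<And>y. s_entails T H (P (sv y))) \<Longrightarrow> s_entails T H (s_all P)"
  unfolding s_entails_def s_all_def using s_stable_inst[of P] by (auto intro: nd_AllI)

lemma s_allE: "s_entails T H (s_all P) \<Longrightarrow> s_stable P \<Longrightarrow> s_entails T H (P (sv y))"
  unfolding s_entails_def s_all_def using s_stable_inst[of P y] nd.AllE[of T H "P (sb 0) (Suc 0)" y] by simp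

lemma s_exI: "s_entails T H (P (sv y)) \<Longrightarrow> s_stable P \<Longrightarrow> s_entails T H (s_ex P)"
  unfolding s_entails_def s_ex_def using s_stable_inst[of P y] nd.ExI[of T H y "P (sb 0) (Suc 0)"] by simp

lemma s_exE: "s_entails T H (s_ex P) \<Longrightarrow> s_stable P \<Longrightarrow> (\<And>y. s_entails T (P (sv y) 0 # H) q) \<Longrightarrow> s_entails T H q"
  unfolding s_entails_def s_ex_def using s_stable_inst[of P] by (auto intro: nd_ExE)

lemma s_eqE: "s_entails T H (sv x =\<^sub>s sv y) \<Longrightarrow> s_entails T H (P (sv x)) \<Longrightarrow> s_stable P \<Longrightarrow> s_entails T H (P (sv y))"
  unfolding s_entails_def s_eq_def using s_stable_inst[of P] nd.EqE[of T H x y "P (sb 0) (Suc 0)"] by auto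

lemma s_eqI: "s_entails T H (sv x =\<^sub>s sv x)"
  by (simp add: s_entails_def s_eq_def nd.EqI)

lemma s_eq_sym: "s_entails T H (sv x =\<^sub>s sv y) \<Longrightarrow> s_entails T H (sv y =\<^sub>s sv x)"
  by (rule s_eqE[of T H x y "\<lambda>z. z =\<^sub>s sv x"]) (simp_all add: s_eqI srel)

lemma s_ax: "p 0 \<in> T \<Longrightarrow> s_entails T H p"
  using nd.Ax[of "p 0" T H id] by (simp add: s_entails_def)

lemma s_stable_ball: "s_stable P \<Longrightarrow> s_stable (\<lambda>x. x \<in>\<^sub>s sv a \<longrightarrow>\<^sub>s P x)"
  and s_stable_bex: "s_stable P \<Longrightarrow> s_stable (\<lambda>x. x \<in>\<^sub>s sv a \<and>\<^sub>s P x)"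
  by (simp_all add: srel)

lemma s_ballI: "s_stable P \<Longrightarrow> (\<And>x. s_entails T ((sv x \<in>\<^sub>s sv a) 0 # H) (P (sv x))) \<Longrightarrow> s_entails T H (s_ball (sv a) P)"
  unfolding s_ball_def by (intro s_allI s_impI s_stable_ball) auto

lemma s_ballE: "s_entails T H (s_ball (sv a) P) \<Longrightarrow> s_stable P \<Longrightarrow> s_entails T H (sv x \<in>\<^sub>s sv a) \<Longrightarrow> s_entails T H (P (sv x))"
  unfolding s_ball_def by (drule s_allE[OF _ s_stable_ball]) (auto intro: s_impE)

lemma s_bexI: "s_entails T H (sv x \<in>\<^sub>s sv a) \<Longrightarrow> s_entails T H (P (sv x)) \<Longrightarrow> s_stable P \<Longrightarrow> s_entails T H (s_bex (sv a) P)"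
  unfolding s_bex_def by (rule s_exI[OF _ s_stable_bex]) (auto intro: s_andI)

lemma s_bexE: "s_entails T H (s_bex (sv a) P) \<Longrightarrow> s_stable P \<Longrightarrow>
    (\<And>x. s_entails T (P (sv x) 0 # (sv x \<in>\<^sub>s sv a) 0 # H) q) \<Longrightarrow> s_entails T H q"
  unfolding s_bex_def
proof (erule s_exE[OF _ s_stable_bex])
  fix x assume *: "\<And>x. s_entails T (P (sv x) 0 # (sv x \<in>\<^sub>s sv a) 0 # H) q"
  let ?H = "(sv x \<in>\<^sub>s sv a \<and>\<^sub>s P (sv x)) 0 # H"
  have "s_entails T ?H (sv x \<in>\<^sub>s sv a \<longrightarrow>\<^sub>s P (sv x) \<longrightarrow>\<^sub>s q)" by (rule s_wk) (intro s_impI *)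
  then show "s_entails T ?H q" by (rule s_impE[OF s_impE s_andE2[OF s_hd]]) (rule s_andE1[OF s_hd])
qed

lemma s_subI: "(\<And>x. s_entails T ((sv x \<in>\<^sub>s sv a) 0 # H) (sv x \<in>\<^sub>s sv b)) \<Longrightarrow> s_entails T H (sv a \<subseteq>\<^sub>s sv b)"
  unfolding s_sub_def by (rule s_ballI) (simp_all add: srel)

lemma s_subE: "s_entails T H (sv a \<subseteq>\<^sub>s sv b) \<Longrightarrow> s_entails T H (sv x \<in>\<^sub>s sv a) \<Longrightarrow> s_entails T H (sv x \<in>\<^sub>s sv b)"
  unfolding s_sub_def by (drule s_ballE) (simp_all add: srel)

section \<open>Consequences of CZF: separation, induction on omega and finite choice\<close>

locale constructive_set_theory =
  fixes T :: "fm set"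
  assumes CZF_sub: "CZF \<subseteq> T"
begin

abbreviation entails :: "fm list \<Rightarrow> form \<Rightarrow> bool" (infix "\<turnstile>" 20) where "H \<turnstile> p \<equiv> s_entails T H p"

lemma s_cong0: "H \<turnstile> p \<Longrightarrow> p 0 = q 0 \<Longrightarrow> H \<turnstile> q"
  by (simp add: s_entails_def)

lemma ex_pair: "H \<turnstile> (\<exists>\<^sub>s c. \<forall>\<^sub>s y. y \<in>\<^sub>s c \<longleftrightarrow>\<^sub>s (y =\<^sub>s sv a \<or>\<^sub>s y =\<^sub>s sv b))"
proof -
  have "H \<turnstile> ax_pairing" by (rule s_ax) (use CZF_sub in \<open>auto simp: CZF_def\<close>)
  then have "H \<turnstile> (\<forall>\<^sub>s b. \<exists>\<^sub>s c. \<forall>\<^sub>s y. y \<in>\<^sub>s c \<longleftrightarrow>\<^sub>s (y =\<^sub>s sv a \<or>\<^sub>s y =\<^sub>s b))"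
    unfolding ax_pairing_def by (rule s_allE) (simp add: srel)
  then show ?thesis by (rule s_allE) (simp add: srel)
qed

lemma ex_union: "H \<turnstile> (\<exists>\<^sub>s b. \<forall>\<^sub>s y. y \<in>\<^sub>s b \<longleftrightarrow>\<^sub>s s_bex (sv a) (\<lambda>x. y \<in>\<^sub>s x))"
proof -
  have "H \<turnstile> ax_union" by (rule s_ax) (use CZF_sub in \<open>auto simp: CZF_def\<close>)
  then show ?thesis
    unfolding ax_union_def by (rule s_allE) (simp add: srel)
qed

lemma extensionality:
  assumes "H \<turnstile> (\<forall>\<^sub>s y. y \<in>\<^sub>s sv a \<longleftrightarrow>\<^sub>s y \<in>\<^sub>s sv b)"
  shows "H \<turnstile> (sv a =\<^sub>s sv b)"
proof -
  have "H \<turnstile> ax_extensionality" by (rule s_ax) (use CZF_sub in \<open>auto simp: CZF_def\<close>)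
  then have "H \<turnstile> (\<forall>\<^sub>s b. (\<forall>\<^sub>s y. y \<in>\<^sub>s sv a \<longleftrightarrow>\<^sub>s y \<in>\<^sub>s b) \<longrightarrow>\<^sub>s sv a =\<^sub>s b)"
    unfolding ax_extensionality_def by (rule s_allE) (simp add: srel)
  then have "H \<turnstile> ((\<forall>\<^sub>s y. y \<in>\<^sub>s sv a \<longleftrightarrow>\<^sub>s y \<in>\<^sub>s sv b) \<longrightarrow>\<^sub>s sv a =\<^sub>s sv b)"
    by (rule s_allE) (simp add: srel)
  then show ?thesis using assms by (rule s_impE)
qed

text \<open>The formula \<open>q\<close> does not speak of the element, so a truth value is turned
  into a subset of \<open>a\<close>. Membership of the instance in \<open>T\<close> is left as a
  hypothesis because CZF provides it for bounded formulas only.\<close>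

lemma separation:
  assumes "ax_separation (ren Suc q) 0 \<in> T"
  shows "H \<turnstile> (\<exists>\<^sub>s b. \<forall>\<^sub>s x. x \<in>\<^sub>s b \<longleftrightarrow>\<^sub>s (x \<in>\<^sub>s sv a \<and>\<^sub>s inst q []))"
proof -
  have "H \<turnstile> ax_separation (ren Suc q)" by (rule s_ax) (rule assms)
  then show ?thesis
    unfolding ax_separation_def inst_weak by (rule s_allE) (simp add: srel)
qed

lemma set_induction:
  assumes Q: "s_stable Q" and step: "\<And>a. s_ball (sv a) Q 0 # H \<turnstile> Q (sv a)"
  shows "H \<turnstile> Q (sv a)"
proof -
  define q where "q = Q (sb 0) (Suc 0)"
  have i: "inst q [sv x] 0 = Q (sv x) 0" for x unfolding q_def by (rule inst_stable[OF Q])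
  have "H \<turnstile> ax_set_induction q" by (rule s_ax) (use CZF_sub in \<open>auto simp: CZF_def\<close>)
  moreover have "H \<turnstile> (\<forall>\<^sub>s a. s_ball a (\<lambda>x. inst q [x]) \<longrightarrow>\<^sub>s inst q [a])"
  proof (intro s_allI s_impI)
    fix a
    let ?H = "s_ball (sv a) (\<lambda>x. inst q [x]) 0 # H"
    have "?H \<turnstile> s_ball (sv a) Q"
    proof (rule s_ballI[OF Q])
      fix x
      have "(sv x \<in>\<^sub>s sv a) 0 # ?H \<turnstile> inst q [sv x]"
        by (rule s_ballE[OF s_wk[OF s_hd] _ s_hd]) (simp add: srel)
      then show "(sv x \<in>\<^sub>s sv a) 0 # ?H \<turnstile> Q (sv x)" by (rule s_cong0) (rule i)
    qed
    moreover have "H \<turnstile> (s_ball (sv a) Q \<longrightarrow>\<^sub>s Q (sv a))" by (rule s_impI) (rule step)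
    ultimately have "?H \<turnstile> Q (sv a)" by (blast intro: s_impE s_wk)
    then show "?H \<turnstile> inst q [sv a]" by (rule s_cong0) (rule i[symmetric])
  qed (simp add: srel)
  ultimately have "H \<turnstile> (\<forall>\<^sub>s a. inst q [a])" unfolding ax_set_induction_def by (rule s_impE)
  then have "H \<turnstile> inst q [sv a]" by (rule s_allE) (simp add: srel)
  then show ?thesis by (rule s_cong0) (rule i)
qed

text \<open>\<open>is_omega\<close> describes the elements of \<open>w\<close> without stating
  minimality. Induction comes from set induction on \<open>n \<in> w \<longrightarrow> Q n\<close>:
  a nonempty \<open>u\<close> in \<open>w\<close> is the successor of some \<open>v\<close> in
  \<open>w\<close>, and \<open>v\<close> is a member of its successor.\<close>

lemma omega_induction:
  assumes Q: "s_stable Q" and w: "H \<turnstile> is_omega (sv w)" and n: "H \<turnstile> (sv n \<in>\<^sub>s sv w)"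
    and zero: "\<And>u. is_empty (sv u) 0 # H \<turnstile> Q (sv u)"
    and succ: "\<And>u v. is_succ (sv u) (sv v) 0 # Q (sv v) 0 # H \<turnstile> Q (sv u)"
  shows "H \<turnstile> Q (sv n)"
proof -
  have gd: "s_stable (\<lambda>n. n \<in>\<^sub>s sv w \<longrightarrow>\<^sub>s Q n)" using Q by (simp add: srel)
  have "H \<turnstile> (sv n \<in>\<^sub>s sv w \<longrightarrow>\<^sub>s Q (sv n))"
  proof (rule set_induction[OF gd], rule s_impI)
    fix u
    let ?H = "(sv u \<in>\<^sub>s sv w) 0 # s_ball (sv u) (\<lambda>n. n \<in>\<^sub>s sv w \<longrightarrow>\<^sub>s Q n) 0 # H"
    have "?H \<turnstile> (sv u \<in>\<^sub>s sv w \<longleftrightarrow>\<^sub>s (is_empty (sv u) \<or>\<^sub>s s_bex (sv w) (\<lambda>v. is_succ (sv u) v)))"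
      using s_wk[OF s_wk[OF w]] unfolding is_omega_def by (rule s_allE) (simp add: srel)
    then have "?H \<turnstile> (is_empty (sv u) \<or>\<^sub>s s_bex (sv w) (\<lambda>v. is_succ (sv u) v))"
      by (rule s_iffE1[OF _ s_hd])
    then show "?H \<turnstile> Q (sv u)"
    proof (rule s_orE)
      show "is_empty (sv u) 0 # ?H \<turnstile> Q (sv u)"
      proof (rule s_impE[OF _ s_hd])
        have "H \<turnstile> (is_empty (sv u) \<longrightarrow>\<^sub>s Q (sv u))" by (rule s_impI) (rule zero)
        then show "is_empty (sv u) 0 # ?H \<turnstile> (is_empty (sv u) \<longrightarrow>\<^sub>s Q (sv u))" by (intro s_wk)
      qed
      show "s_bex (sv w) (\<lambda>v. is_succ (sv u) v) 0 # ?H \<turnstile> Q (sv u)"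
      proof (rule s_bexE[OF s_hd])
        fix v
        let ?K = "is_succ (sv u) (sv v) 0 # (sv v \<in>\<^sub>s sv w) 0 # s_bex (sv w) (\<lambda>v. is_succ (sv u) v) 0 # ?H"
        have "?K \<turnstile> (sv v \<in>\<^sub>s sv u \<longleftrightarrow>\<^sub>s (sv v \<in>\<^sub>s sv v \<or>\<^sub>s sv v =\<^sub>s sv v))"
          using s_hd[of T "is_succ (sv u) (sv v)"] unfolding is_succ_def by (rule s_allE) (simp add: srel)
        then have "?K \<turnstile> (sv v \<in>\<^sub>s sv u)" by (rule s_iffE2[OF _ s_orI2[OF s_eqI]])
        with s_hyp[of "s_ball (sv u) (\<lambda>n. n \<in>\<^sub>s sv w \<longrightarrow>\<^sub>s Q n)" ?K T]
        have "?K \<turnstile> (sv v \<in>\<^sub>s sv w \<longrightarrow>\<^sub>s Q (sv v))"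
          by (intro s_ballE[where P = "\<lambda>n. n \<in>\<^sub>s sv w \<longrightarrow>\<^sub>s Q n", OF _ gd]) simp_all
        then have "?K \<turnstile> Q (sv v)" by (rule s_impE) (simp add: s_hyp)
        moreover have "H \<turnstile> (Q (sv v) \<longrightarrow>\<^sub>s is_succ (sv u) (sv v) \<longrightarrow>\<^sub>s Q (sv u))"
          by (rule s_impI, rule s_impI) (rule succ)
        then have "?K \<turnstile> (Q (sv v) \<longrightarrow>\<^sub>s is_succ (sv u) (sv v) \<longrightarrow>\<^sub>s Q (sv u))"
          by (intro s_wk)
        ultimately show "?K \<turnstile> Q (sv u)" by (blast intro: s_impE s_hd)
      qed (simp add: srel)
    qed
  qed
  then show ?thesis using n by (rule s_impE)
qed

text \<open>The disjunctions are merged one index at a time: the members of the successor of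
  \<open>v\<close> are those of \<open>v\<close> and \<open>v\<close> itself, and the new index
  costs one further case distinction.\<close>

lemma omega_choice:
  assumes B1: "s_fam B" and w: "H \<turnstile> is_omega (sv w)" and n: "H \<turnstile> (sv n \<in>\<^sub>s sv w)"
    and p: "H \<turnstile> s_ball (sv n) (\<lambda>i. inst q [] \<or>\<^sub>s B i)"
  shows "H \<turnstile> (inst q [] \<or>\<^sub>s s_ball (sv n) B)"
proof -
  let ?P = "\<lambda>n. s_ball n (\<lambda>i. inst q [] \<or>\<^sub>s B i)" and ?R = "\<lambda>n. inst q [] \<or>\<^sub>s s_ball n B"
  have B: "s_stable B" using B1 by (simp add: srel)
  have B': "s_stable (\<lambda>i. inst q [] \<or>\<^sub>s B i)" using B by (simp add: srel)
  have "H \<turnstile> (?P (sv n) \<longrightarrow>\<^sub>s ?R (sv n))"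
  proof (rule omega_induction[OF _ w n])
    show "s_stable (\<lambda>n. ?P n \<longrightarrow>\<^sub>s ?R n)" using B1 by (simp add: srel)
    fix u v
    show "is_empty (sv u) 0 # H \<turnstile> (?P (sv u) \<longrightarrow>\<^sub>s ?R (sv u))"
    proof (intro s_impI s_orI2 s_ballI[OF B])
      fix x
      let ?H = "(sv x \<in>\<^sub>s sv u) 0 # ?P (sv u) 0 # is_empty (sv u) 0 # H"
      have "?H \<turnstile> is_empty (sv u)" by (rule s_hyp) simp
      then have "?H \<turnstile> (\<not>\<^sub>s sv x \<in>\<^sub>s sv u)" unfolding is_empty_def by (rule s_allE) (simp add: srel)
      then show "?H \<turnstile> B (sv x)" by (rule s_notE[OF _ s_hd])
    qed
    show "is_succ (sv u) (sv v) 0 # (?P (sv v) \<longrightarrow>\<^sub>s ?R (sv v)) 0 # H \<turnstile> (?P (sv u) \<longrightarrow>\<^sub>s ?R (sv u))"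
    proof (rule s_impI)
      let ?H = "?P (sv u) 0 # is_succ (sv u) (sv v) 0 # (?P (sv v) \<longrightarrow>\<^sub>s ?R (sv v)) 0 # H"
      have su: "K \<turnstile> (sv x \<in>\<^sub>s sv u \<longleftrightarrow>\<^sub>s (sv x \<in>\<^sub>s sv v \<or>\<^sub>s sv x =\<^sub>s sv v))" if "set ?H \<subseteq> set K" for K x
      proof -
        have "K \<turnstile> is_succ (sv u) (sv v)" by (rule s_hyp) (use that in auto)
        then show ?thesis unfolding is_succ_def by (rule s_allE) (simp add: srel)
      qed
      have Pu: "K \<turnstile> (inst q [] \<or>\<^sub>s B (sv x))" if "set ?H \<subseteq> set K" "K \<turnstile> (sv x \<in>\<^sub>s sv u)" for K x
        by (rule s_ballE[OF s_hyp B' that(2)]) (use that(1) in auto)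
      have "?H \<turnstile> ?P (sv v)"
      proof (rule s_ballI[OF B'])
        fix x
        let ?K = "(sv x \<in>\<^sub>s sv v) 0 # ?H"
        show "?K \<turnstile> (inst q [] \<or>\<^sub>s B (sv x))"
          by (rule Pu[OF _ s_iffE2[OF su s_orI1[OF s_hd]]]) auto
      qed
      moreover have "?H \<turnstile> (?P (sv v) \<longrightarrow>\<^sub>s ?R (sv v))" by (rule s_hyp) simp
      ultimately have "?H \<turnstile> ?R (sv v)" by (blast intro: s_impE)
      then show "?H \<turnstile> ?R (sv u)"
      proof (rule s_orE)
        show "inst q [] 0 # ?H \<turnstile> ?R (sv u)" by (rule s_orI1[OF s_hd])
        let ?K = "s_ball (sv v) B 0 # ?H"
        have "?K \<turnstile> (inst q [] \<or>\<^sub>s B (sv v))"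
          by (rule Pu[OF _ s_iffE2[OF su s_orI2[OF s_eqI]]]) auto
        then show "?K \<turnstile> ?R (sv u)"
        proof (rule s_orE)
          show "inst q [] 0 # ?K \<turnstile> ?R (sv u)" by (rule s_orI1[OF s_hd])
          show "B (sv v) 0 # ?K \<turnstile> ?R (sv u)"
          proof (intro s_orI2 s_ballI[OF B])
            fix x
            let ?L = "(sv x \<in>\<^sub>s sv u) 0 # B (sv v) 0 # ?K"
            have "?L \<turnstile> (sv x \<in>\<^sub>s sv v \<or>\<^sub>s sv x =\<^sub>s sv v)"
              by (rule s_iffE1[OF su s_hd]) auto
            then show "?L \<turnstile> B (sv x)"
            proof (rule s_orE)
              show "(sv x \<in>\<^sub>s sv v) 0 # ?L \<turnstile> B (sv x)"
                by (rule s_ballE[OF s_hyp B s_hd]) simp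
              show "(sv x =\<^sub>s sv v) 0 # ?L \<turnstile> B (sv x)"
                by (rule s_eqE[OF s_eq_sym[OF s_hd] s_hyp B]) simp
            qed
          qed
        qed
      qed
    qed
  qed
  then show ?thesis using p by (rule s_impE)
qed

end

lemma s_mono: "s_entails T H p \<Longrightarrow> set H \<subseteq> set K \<Longrightarrow> s_entails T K p"
  unfolding s_entails_def by (rule nd_weak)

lemma s_fam_stable: "s_fam P \<Longrightarrow> s_stable P"
  by (simp add: srel)

context constructive_set_theory
begin

text \<open>
  A class may be covering without being known to be a set: \<open>cov C x V\<close> only provides, for each \<open>x\<close>,
  a set with the elements of \<open>V\<close>. Strong collection over the base and union make this set
  independent of \<open>x\<close>; if the base is empty, the result may be smaller than \<open>V\<close>.
\<close>

lemma uniform_class: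
  assumes V: "s_fam V" and ex: "H \<turnstile> s_ball (sv s) (\<lambda>x. \<exists>\<^sub>s w. is_class w V)"
  shows "H \<turnstile> (\<exists>\<^sub>s w. (\<forall>\<^sub>s x. x \<in>\<^sub>s w \<longrightarrow>\<^sub>s V x) \<and>\<^sub>s s_ball (sv s) (\<lambda>x. is_class w V))"
proof -
  define Q where "Q = (\<lambda>w. is_class w V)"
  have Q1: "s_fam Q" and Q: "s_stable Q" using V by (simp_all add: Q_def srel)
  \<comment> \<open>Strong collection is a scheme in two variables. The relation used here depends
    on the second one only, hence \<open>ren Suc q\<close> below.\<close>
  define q where "q = Q (sb 0) (Suc 0)"
  have i: "inst q [sv x] 0 = Q (sv x) 0" for x unfolding q_def by (rule inst_stable[OF Q])
  let ?V = "\<lambda>y. inst q [y]"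
  have "H \<turnstile> ax_strong_collection (ren Suc q)" by (rule s_ax) (use CZF_sub in \<open>auto simp: CZF_def\<close>)
  then have "H \<turnstile> (s_ball (sv s) (\<lambda>x. s_ex ?V) \<longrightarrow>\<^sub>s
     (\<exists>\<^sub>s b. s_ball (sv s) (\<lambda>x. s_bex b ?V) \<and>\<^sub>s s_ball b (\<lambda>y. s_bex (sv s) (\<lambda>x. ?V y))))"
    unfolding ax_strong_collection_def inst_weak by (rule s_allE) (simp add: srel)
  moreover have "H \<turnstile> s_ball (sv s) (\<lambda>x. s_ex ?V)"
  proof (rule s_ballI)
    fix x let ?H = "(sv x \<in>\<^sub>s sv s) 0 # H"
    have "?H \<turnstile> s_ex Q"
      unfolding Q_def by (rule s_ballE[OF s_wk[OF ex] _ s_hd]) (use V in \<open>simp add: srel\<close>)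
    then show "?H \<turnstile> s_ex ?V"
    proof (rule s_exE[OF _ Q])
      fix w
      show "Q (sv w) 0 # ?H \<turnstile> s_ex ?V"
        by (rule s_exI[OF s_cong0[OF s_hd]]) (rule i[symmetric], simp add: srel)
    qed
  qed (simp add: srel)
  ultimately have "H \<turnstile> (\<exists>\<^sub>s b. s_ball (sv s) (\<lambda>x. s_bex b ?V) \<and>\<^sub>s s_ball b (\<lambda>y. s_bex (sv s) (\<lambda>x. ?V y)))"
    by (rule s_impE)
  then show ?thesis
  proof (rule s_exE)
    fix b
    let ?H = "(s_ball (sv s) (\<lambda>x. s_bex (sv b) ?V) \<and>\<^sub>s s_ball (sv b) (\<lambda>y. s_bex (sv s) (\<lambda>x. ?V y))) 0 # H"
    have b1: "?H \<turnstile> s_ball (sv s) (\<lambda>x. s_bex (sv b) ?V)" and b2: "?H \<turnstile> s_ball (sv b) (\<lambda>y. s_bex (sv s) (\<lambda>x. ?V y))"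
      by (rule s_andE1[OF s_hd], rule s_andE2[OF s_hd])
    show "?H \<turnstile> (\<exists>\<^sub>s w. (\<forall>\<^sub>s x. x \<in>\<^sub>s w \<longrightarrow>\<^sub>s V x) \<and>\<^sub>s s_ball (sv s) (\<lambda>x. is_class w V))"
    proof (rule s_exE[OF ex_union[of _ b]])
      fix w
      let ?K = "(\<forall>\<^sub>s y. y \<in>\<^sub>s sv w \<longleftrightarrow>\<^sub>s s_bex (sv b) (\<lambda>x. y \<in>\<^sub>s x)) 0 # ?H"
      have w: "K \<turnstile> (sv x \<in>\<^sub>s sv w \<longleftrightarrow>\<^sub>s s_bex (sv b) (\<lambda>z. sv x \<in>\<^sub>s z))" if "set ?K \<subseteq> set K" for x K
        by (rule s_mono[OF s_allE[OF s_hd] that]) (simp add: srel)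
      \<comment> \<open>Each member of \<open>b\<close> was collected for some element of
        \<open>s\<close> and therefore has exactly the elements of \<open>V\<close>. So the union
        stays inside \<open>V\<close> whether or not \<open>s\<close> is inhabited.\<close>
      have V1: "K \<turnstile> V (sv x)" if K: "set ?K \<subseteq> set K" and x: "K \<turnstile> (sv x \<in>\<^sub>s sv w)" for x K
        using s_iffE1[OF w[OF K] x]
      proof (rule s_bexE)
        fix z
        let ?L = "(sv x \<in>\<^sub>s sv z) 0 # (sv z \<in>\<^sub>s sv b) 0 # K"
        have "?L \<turnstile> s_bex (sv s) (\<lambda>x. ?V (sv z))"
          by (rule s_ballE[OF s_mono[OF b2]]) (use K in \<open>auto simp: srel intro: s_hyp\<close>)
        then show "?L \<turnstile> V (sv x)"
        proof (rule s_bexE)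
          fix a
          let ?M = "?V (sv z) 0 # (sv a \<in>\<^sub>s sv s) 0 # ?L"
          have "?M \<turnstile> Q (sv z)" by (rule s_cong0[OF s_hd]) (rule i)
          then have "?M \<turnstile> (sv x \<in>\<^sub>s sv z \<longleftrightarrow>\<^sub>s V (sv x))"
            unfolding Q_def is_class_def by (rule s_allE) (use V in \<open>simp add: srel\<close>)
          then show "?M \<turnstile> V (sv x)" by (rule s_iffE1) (simp add: s_hyp)
        qed (simp add: srel)
      qed (simp add: srel)
      have "?K \<turnstile> (\<forall>\<^sub>s x. x \<in>\<^sub>s sv w \<longrightarrow>\<^sub>s V x)"
        by (intro s_allI s_impI V1 s_hd) (use V in \<open>auto simp: srel\<close>)
      \<comment> \<open>An element of \<open>s\<close> provides a member of \<open>b\<close>, which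
        already contains all of \<open>V\<close>; hence so does the union.\<close>
      moreover have "?K \<turnstile> s_ball (sv s) (\<lambda>x. is_class (sv w) V)"
      proof (rule s_ballI)
        fix a let ?L = "(sv a \<in>\<^sub>s sv s) 0 # ?K"
        have "?L \<turnstile> s_bex (sv b) ?V"
          by (rule s_ballE[OF s_mono[OF b1] _ s_hd]) (auto simp: srel)
        then show "?L \<turnstile> is_class (sv w) V"
        proof (rule s_bexE)
          fix z let ?M = "?V (sv z) 0 # (sv z \<in>\<^sub>s sv b) 0 # ?L"
          have "?M \<turnstile> Q (sv z)" by (rule s_cong0[OF s_hd]) (rule i)
          then have z: "?M \<turnstile> (sv x \<in>\<^sub>s sv z \<longleftrightarrow>\<^sub>s V (sv x))" for x
            unfolding Q_def is_class_def by (rule s_allE) (use V in \<open>simp add: srel\<close>)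
          show "?M \<turnstile> is_class (sv w) V"
            unfolding is_class_def
          proof (intro s_allI s_iffI)
            fix x
            show "(sv x \<in>\<^sub>s sv w) 0 # ?M \<turnstile> V (sv x)" by (rule V1[OF _ s_hd]) auto
            have "V (sv x) 0 # ?M \<turnstile> (sv x \<in>\<^sub>s sv z)" by (rule s_iffE2[OF s_wk[OF z] s_hd])
            then show "V (sv x) 0 # ?M \<turnstile> (sv x \<in>\<^sub>s sv w)"
              by (intro s_iffE2[OF w] s_bexI[where P = "\<lambda>z. sv x \<in>\<^sub>s z"]) (auto simp: srel intro: s_hyp)
          qed (use V in \<open>simp add: srel\<close>)
        qed (simp add: srel)
      qed (use V in \<open>simp add: srel\<close>)
      ultimately show "?K \<turnstile> (\<exists>\<^sub>s w. (\<forall>\<^sub>s x. x \<in>\<^sub>s w \<longrightarrow>\<^sub>s V x) \<and>\<^sub>s s_ball (sv s) (\<lambda>x. is_class w V))"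
        by (intro s_exI[OF s_andI]) (use V in \<open>simp_all add: srel\<close>)
    qed (simp add: srel)
  qed (simp add: srel)
qed

end

section \<open>Formal spaces in set theory\<close>

locale set_space = constructive_set_theory +
  fixes C :: cover
  assumes fam2_C: "s_fam2 C"
begin

text \<open>Registers the cover like an atomic relation symbol, so that formulas built from it are
  checked by the same simplification as concrete ones.\<close>

lemma srel_C [srel]: "\<forall>j\<ge>k. v_rel y j a a' \<Longrightarrow> \<forall>j\<ge>k. v_rel y j b b' \<Longrightarrow> f_rel y k (C a b) (C a' b')"
  using fam2_C by (simp add: s_fam2_def)

lemma cunionE: "H \<turnstile> cunion U V x \<Longrightarrow> U x 0 # H \<turnstile> p \<Longrightarrow> V x 0 # H \<turnstile> p \<Longrightarrow> H \<turnstile> p"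
  unfolding cunion_def by (rule s_orE)

lemma is_classI: "s_fam V \<Longrightarrow> (\<And>x. H \<turnstile> (sv x \<in>\<^sub>s sv w \<longleftrightarrow>\<^sub>s V (sv x))) \<Longrightarrow> H \<turnstile> is_class (sv w) V"
  unfolding is_class_def by (rule s_allI) (simp_all add: srel)

lemma is_classE: "H \<turnstile> is_class (sv w) V \<Longrightarrow> s_fam V \<Longrightarrow> H \<turnstile> (sv x \<in>\<^sub>s sv w \<longleftrightarrow>\<^sub>s V (sv x))"
  unfolding is_class_def by (erule s_allE) (simp add: srel)

lemma pseudocomplE:
  assumes "H \<turnstile> pseudocompl S C U x"
  shows "H \<turnstile> (x \<in>\<^sub>s S)" "H \<turnstile> covs C (down S C (sing x) U) none"
  using assms unfolding pseudocompl_def by (rule s_andE1, rule s_andE2)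

text \<open>Covering by a class is witnessed by a set with the elements of that class, and the same
  set serves any class with the same elements.\<close>

lemma cov_cong:
  assumes V: "s_fam V" "s_fam V'" and c: "H \<turnstile> cov C (sv a) V" and e: "\<And>x. H \<turnstile> (V (sv x) \<longleftrightarrow>\<^sub>s V' (sv x))"
  shows "H \<turnstile> cov C (sv a) V'"
  unfolding cov_def
proof (rule s_exE[OF c[unfolded cov_def]])
  fix w
  let ?H = "(is_class (sv w) V \<and>\<^sub>s C (sv a) (sv w)) 0 # H"
  have w: "?H \<turnstile> (sv x \<in>\<^sub>s sv w \<longleftrightarrow>\<^sub>s V (sv x))" for x
    by (rule is_classE[OF s_andE1[OF s_hd] V(1)])
  have "?H \<turnstile> is_class (sv w) V'"
  proof (rule is_classI[OF V(2)], rule s_iffI)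
    fix x
    show "(sv x \<in>\<^sub>s sv w) 0 # ?H \<turnstile> V' (sv x)"
      by (rule s_iffE1[OF s_mono[OF e] s_iffE1[OF s_wk[OF w] s_hd]]) auto
    show "V' (sv x) 0 # ?H \<turnstile> (sv x \<in>\<^sub>s sv w)"
      by (rule s_iffE2[OF s_wk[OF w] s_iffE2[OF s_mono[OF e] s_hd]]) auto
  qed
  then show "?H \<turnstile> (\<exists>\<^sub>s w. is_class w V' \<and>\<^sub>s C (sv a) w)"
    by (rule s_exI[OF s_andI[OF _ s_andE2[OF s_hd]]]) (use V in \<open>simp add: srel\<close>)
qed (use V in \<open>simp add: srel\<close>)

lemma covsE: "H \<turnstile> covs C U V \<Longrightarrow> s_fam U \<Longrightarrow> s_fam V \<Longrightarrow> H \<turnstile> U (sv a) \<Longrightarrow> H \<turnstile> cov C (sv a) V"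
  unfolding covs_def by (drule s_allE) (auto simp: srel intro: s_impE)

lemma covsI: "(\<And>a. U (sv a) 0 # H \<turnstile> cov C (sv a) V) \<Longrightarrow> s_fam U \<Longrightarrow> s_fam V \<Longrightarrow> H \<turnstile> covs C U V"
  unfolding covs_def by (intro s_allI s_impI) (auto simp: srel)

lemma all_subsetsE: "H \<turnstile> all_subsets (sv s) P \<Longrightarrow> s_fam P \<Longrightarrow> H \<turnstile> (sv u \<subseteq>\<^sub>s sv s) \<Longrightarrow> H \<turnstile> P (sv u)"
  unfolding all_subsets_def by (drule s_allE) (auto simp: srel intro: s_impE)

lemma reflexivity:
  assumes "H \<turnstile> formal_space (sv s) C" "H \<turnstile> (sv a \<in>\<^sub>s sv s)" "H \<turnstile> (sv u \<subseteq>\<^sub>s sv s)" "H \<turnstile> (sv a \<in>\<^sub>s sv u)"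
  shows "H \<turnstile> cov C (sv a) (elts (sv u))"
proof -
  have "H \<turnstile> all_subsets (sv s) (\<lambda>U. sv a \<in>\<^sub>s U \<longrightarrow>\<^sub>s cov C (sv a) (elts U))"
    using s_andE1[OF assms(1)[unfolded formal_space_def]] by (rule s_ballE[OF _ _ assms(2)]) (simp add: srel)
  then have "H \<turnstile> (sv a \<in>\<^sub>s sv u \<longrightarrow>\<^sub>s cov C (sv a) (elts (sv u)))"
    by (rule all_subsetsE[OF _ _ assms(3)]) (simp add: srel)
  then show ?thesis using assms(4) by (rule s_impE)
qed

lemma transitivity:
  assumes "H \<turnstile> formal_space (sv s) C" "H \<turnstile> (sv a \<in>\<^sub>s sv s)" "H \<turnstile> (sv u \<subseteq>\<^sub>s sv s)" "H \<turnstile> (sv v \<subseteq>\<^sub>s sv s)"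
    "H \<turnstile> cov C (sv a) (elts (sv u))" "H \<turnstile> covs C (elts (sv u)) (elts (sv v))"
  shows "H \<turnstile> cov C (sv a) (elts (sv v))"
proof -
  have "H \<turnstile> all_subsets (sv s) (\<lambda>U. all_subsets (sv s) (\<lambda>V.
      cov C (sv a) (elts U) \<and>\<^sub>s covs C (elts U) (elts V) \<longrightarrow>\<^sub>s cov C (sv a) (elts V)))"
    using s_andE1[OF s_andE2[OF assms(1)[unfolded formal_space_def]]]
    by (rule s_ballE[OF _ _ assms(2)]) (simp add: srel)
  then have "H \<turnstile> all_subsets (sv s) (\<lambda>V.
      cov C (sv a) (elts (sv u)) \<and>\<^sub>s covs C (elts (sv u)) (elts V) \<longrightarrow>\<^sub>s cov C (sv a) (elts V))"
    by (rule all_subsetsE[OF _ _ assms(3)]) (simp add: srel)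
  then have "H \<turnstile> (cov C (sv a) (elts (sv u)) \<and>\<^sub>s covs C (elts (sv u)) (elts (sv v)) \<longrightarrow>\<^sub>s cov C (sv a) (elts (sv v)))"
    by (rule all_subsetsE[OF _ _ assms(4)]) (simp add: srel)
  then show ?thesis using s_andI[OF assms(5,6)] by (rule s_impE)
qed

text \<open>Pairing \<open>a\<close> with itself makes the class \<open>sing a\<close> a set, to
  which reflexivity applies.\<close>

lemma cov_sing:
  assumes "H \<turnstile> formal_space (sv s) C" "H \<turnstile> (sv a \<in>\<^sub>s sv s)"
  shows "H \<turnstile> cov C (sv a) (sing (sv a))"
proof (rule s_exE[OF ex_pair[of _ a a]])
  fix c
  let ?H = "(\<forall>\<^sub>s y. y \<in>\<^sub>s sv c \<longleftrightarrow>\<^sub>s (y =\<^sub>s sv a \<or>\<^sub>s y =\<^sub>s sv a)) 0 # H"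
  have c: "?H \<turnstile> (sv y \<in>\<^sub>s sv c \<longleftrightarrow>\<^sub>s (sv y =\<^sub>s sv a \<or>\<^sub>s sv y =\<^sub>s sv a))" for y
    by (rule s_allE[OF s_hd]) (simp add: srel)
  have e: "?H \<turnstile> (sv y \<in>\<^sub>s sv c \<longleftrightarrow>\<^sub>s sv y =\<^sub>s sv a)" for y
  proof (rule s_iffI)
    show "(sv y \<in>\<^sub>s sv c) 0 # ?H \<turnstile> (sv y =\<^sub>s sv a)"
      by (rule s_orE[OF s_iffE1[OF s_wk[OF c] s_hd]]) (rule s_hd)+
    show "(sv y =\<^sub>s sv a) 0 # ?H \<turnstile> (sv y \<in>\<^sub>s sv c)"
      by (rule s_iffE2[OF s_wk[OF c] s_orI1[OF s_hd]])
  qed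
  have "?H \<turnstile> (sv c \<subseteq>\<^sub>s sv s)"
  proof (rule s_subI)
    fix x let ?K = "(sv x \<in>\<^sub>s sv c) 0 # ?H"
    have "?K \<turnstile> (sv a =\<^sub>s sv x)" by (rule s_eq_sym[OF s_iffE1[OF s_wk[OF e] s_hd]])
    then show "?K \<turnstile> (sv x \<in>\<^sub>s sv s)"
      by (rule s_eqE[where P = "\<lambda>z. z \<in>\<^sub>s sv s"]) (simp_all add: s_wk assms(2), simp add: srel)
  qed
  then have "?H \<turnstile> cov C (sv a) (elts (sv c))"
    by (rule reflexivity[OF s_wk[OF assms(1)] s_wk[OF assms(2)] _ s_iffE2[OF e s_eqI]])
  then show "?H \<turnstile> cov C (sv a) (sing (sv a))"
    by (rule cov_cong[rotated 2]) (simp_all add: elts_def sing_def e, simp_all add: srel)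
qed (simp add: srel)

text \<open>The point \<open>a\<close> lies in \<open>{a} \<down> U\<close> with itself as witness
  on both sides, by \<open>cov_sing\<close>; the definition of the pseudocomplement then covers it
  by the empty class.\<close>

lemma pseudocompl_cov:
  assumes "H \<turnstile> formal_space (sv s) C" "H \<turnstile> pseudocompl (sv s) C (elts (sv u)) (sv a)" "H \<turnstile> (sv a \<in>\<^sub>s sv u)"
  shows "H \<turnstile> cov C (sv a) none"
proof -
  have a: "H \<turnstile> (sv a \<in>\<^sub>s sv s)" and c: "H \<turnstile> covs C (down (sv s) C (sing (sv a)) (elts (sv u))) none"
    using s_andE1 s_andE2 assms(2)[unfolded pseudocompl_def] by blast+
  note s = cov_sing[OF assms(1) a]
  have "H \<turnstile> down (sv s) C (sing (sv a)) (elts (sv u)) (sv a)"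
    unfolding down_def
    by (intro s_andI a s_exI[where y = a] s)
      (simp_all add: sing_def elts_def s_eqI assms(3), simp_all add: srel)
  then show ?thesis
    by (rule covsE[OF c, rotated 2]) (simp_all add: srel)
qed

lemma finitely_listed_choice:
  assumes D: "s_fam D" and l: "H \<turnstile> finitely_listed (sv l)"
    and dec: "\<And>x. (sv x \<in>\<^sub>s sv l) 0 # H \<turnstile> (inst q [] \<or>\<^sub>s D (sv x))"
  shows "H \<turnstile> (inst q [] \<or>\<^sub>s s_ball (sv l) D)" (is "_ \<turnstile> ?G")
  using l unfolding finitely_listed_def
proof (rule s_exE)
  let ?fun = "\<lambda>n f. s_ball n (\<lambda>i. \<exists>\<^sub>s x. pair_mem i x f \<and>\<^sub>s (\<forall>\<^sub>s y. pair_mem i y f \<longrightarrow>\<^sub>s y =\<^sub>s x))"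
  let ?ran = "\<lambda>n f. \<forall>\<^sub>s x. x \<in>\<^sub>s sv l \<longleftrightarrow>\<^sub>s s_bex n (\<lambda>i. pair_mem i x f)"
  have D0: "s_stable D" using D by (rule s_fam_stable)
  fix w
  let ?H1 = "(is_omega (sv w) \<and>\<^sub>s s_bex (sv w) (\<lambda>n. \<exists>\<^sub>s f. ?fun n f \<and>\<^sub>s ?ran n f)) 0 # H"
  have w: "?H1 \<turnstile> is_omega (sv w)" by (rule s_andE1[OF s_hd])
  have "?H1 \<turnstile> s_bex (sv w) (\<lambda>n. \<exists>\<^sub>s f. ?fun n f \<and>\<^sub>s ?ran n f)" by (rule s_andE2[OF s_hd])
  then show "?H1 \<turnstile> ?G"
  proof (rule s_bexE)
    fix n
    let ?H2 = "(\<exists>\<^sub>s f. ?fun (sv n) f \<and>\<^sub>s ?ran (sv n) f) 0 # (sv n \<in>\<^sub>s sv w) 0 # ?H1"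
    have n: "?H2 \<turnstile> (sv n \<in>\<^sub>s sv w)" by (rule s_hyp) simp
    have "?H2 \<turnstile> (\<exists>\<^sub>s f. ?fun (sv n) f \<and>\<^sub>s ?ran (sv n) f)" by (rule s_hd)
    then show "?H2 \<turnstile> ?G"
    proof (rule s_exE)
      fix f
      let ?H3 = "(?fun (sv n) (sv f) \<and>\<^sub>s ?ran (sv n) (sv f)) 0 # ?H2"
      have fn: "?H3 \<turnstile> ?fun (sv n) (sv f)" by (rule s_andE1[OF s_hd])
      have ran: "?H3 \<turnstile> (sv x \<in>\<^sub>s sv l \<longleftrightarrow>\<^sub>s s_bex (sv n) (\<lambda>i. pair_mem i (sv x) (sv f)))" for x
        by (rule s_allE[OF s_andE2[OF s_hd]]) (simp add: srel)
      \<comment> \<open>The language has no application terms, so the entry at \<open>i\<close> is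
        reached by quantifying over all values paired with \<open>i\<close> in \<open>f\<close>.
        Uniqueness of the value yields this from one decided value, and the universal form gives
        \<open>D\<close> for every listed element at the end.\<close>
      define B where "B = (\<lambda>i. \<forall>\<^sub>s x. pair_mem i x (sv f) \<longrightarrow>\<^sub>s D x)"
      have B: "s_fam B" using D by (simp add: srel B_def)
      have "?H3 \<turnstile> s_ball (sv n) (\<lambda>i. inst q [] \<or>\<^sub>s B i)"
      proof (rule s_ballI)
        fix i
        let ?K = "(sv i \<in>\<^sub>s sv n) 0 # ?H3"
        have "?K \<turnstile> (\<exists>\<^sub>s x. pair_mem (sv i) x (sv f) \<and>\<^sub>s (\<forall>\<^sub>s y. pair_mem (sv i) y (sv f) \<longrightarrow>\<^sub>s y =\<^sub>s x))"
          by (rule s_ballE[OF s_wk[OF fn] _ s_hd]) (simp add: srel)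
        then show "?K \<turnstile> (inst q [] \<or>\<^sub>s B (sv i))"
        proof (rule s_exE)
          fix x
          let ?L = "(pair_mem (sv i) (sv x) (sv f) \<and>\<^sub>s (\<forall>\<^sub>s y. pair_mem (sv i) y (sv f) \<longrightarrow>\<^sub>s y =\<^sub>s sv x)) 0 # ?K"
          have ix: "?L \<turnstile> pair_mem (sv i) (sv x) (sv f)" by (rule s_andE1[OF s_hd])
          have uniq: "?L \<turnstile> (pair_mem (sv i) (sv y) (sv f) \<longrightarrow>\<^sub>s sv y =\<^sub>s sv x)" for y
            by (rule s_allE[OF s_andE2[OF s_hd]]) (simp add: srel)
          have "?L \<turnstile> s_bex (sv n) (\<lambda>i. pair_mem i (sv x) (sv f))"
            by (rule s_bexI[where x = i]) (rule s_hyp, simp, rule ix, simp add: srel)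
          note s_iffE2[OF s_mono[OF ran] this]
          then have xl: "?L \<turnstile> (sv x \<in>\<^sub>s sv l)" by auto
          \<comment> \<open>A premise that carries its own hypothesis over \<open>H\<close> is moved
            into the longer hypothesis list as an implication.\<close>
          have "H \<turnstile> (sv x \<in>\<^sub>s sv l \<longrightarrow>\<^sub>s inst q [] \<or>\<^sub>s D (sv x))" by (rule s_impI) (rule dec)
          then have "?L \<turnstile> (sv x \<in>\<^sub>s sv l \<longrightarrow>\<^sub>s inst q [] \<or>\<^sub>s D (sv x))" by (rule s_mono) auto
          then have "?L \<turnstile> (inst q [] \<or>\<^sub>s D (sv x))" using xl by (rule s_impE)
          then show "?L \<turnstile> (inst q [] \<or>\<^sub>s B (sv i))"
          proof (rule s_orE)
            show "inst q [] 0 # ?L \<turnstile> (inst q [] \<or>\<^sub>s B (sv i))" by (rule s_orI1[OF s_hd])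
            have "D (sv x) 0 # ?L \<turnstile> B (sv i)"
              unfolding B_def
            proof (intro s_allI s_impI)
              fix y
              let ?M = "pair_mem (sv i) (sv y) (sv f) 0 # D (sv x) 0 # ?L"
              have "?M \<turnstile> (sv x =\<^sub>s sv y)"
                by (rule s_eq_sym[OF s_impE[OF s_mono[OF uniq] s_hd]]) auto
              then show "?M \<turnstile> D (sv y)" by (rule s_eqE[OF _ s_hyp D0]) simp
            qed (use D in \<open>simp add: srel\<close>)
            then show "D (sv x) 0 # ?L \<turnstile> (inst q [] \<or>\<^sub>s B (sv i))" by (rule s_orI2)
          qed
        qed (simp add: srel)
      qed (use B in \<open>simp add: srel\<close>)
      note omega_choice[OF B s_mono[OF w] s_wk[OF n] this]
      then have "?H3 \<turnstile> (inst q [] \<or>\<^sub>s s_ball (sv n) B)" by auto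
      then show "?H3 \<turnstile> ?G"
      proof (rule s_orE)
        show "inst q [] 0 # ?H3 \<turnstile> ?G" by (rule s_orI1[OF s_hd])
        let ?K = "s_ball (sv n) B 0 # ?H3"
        show "?K \<turnstile> ?G"
        proof (intro s_orI2 s_ballI[OF D0])
          fix x
          let ?L = "(sv x \<in>\<^sub>s sv l) 0 # ?K"
          have "?L \<turnstile> s_bex (sv n) (\<lambda>i. pair_mem i (sv x) (sv f))"
            by (rule s_iffE1[OF s_mono[OF ran] s_hd]) auto
          then show "?L \<turnstile> D (sv x)"
          proof (rule s_bexE)
            fix i
            let ?M = "pair_mem (sv i) (sv x) (sv f) 0 # (sv i \<in>\<^sub>s sv n) 0 # ?L"
            have "?M \<turnstile> B (sv i)"
              by (rule s_ballE[where P = B and a = n]) (use B in \<open>auto simp: s_fam_stable intro: s_hyp\<close>)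
            then have "?M \<turnstile> (pair_mem (sv i) (sv x) (sv f) \<longrightarrow>\<^sub>s D (sv x))"
              unfolding B_def by (rule s_allE) (use D in \<open>simp add: srel\<close>)
            then show "?M \<turnstile> D (sv x)" using s_hd by (rule s_impE)
          qed (simp add: srel)
        qed
      qed
    qed (simp add: srel)
  qed (simp add: srel)
qed (simp add: srel)

text \<open>Separation enters for two formulas only: for \<open>q\<close>, to form \<open>U\<close>,
  and for falsum, to have the empty class as a set that transitivity can mention.\<close>

lemma compact_boolean_decides:
  assumes FS: "H \<turnstile> formal_space (sv s) C" and NT: "H \<turnstile> nontrivial (sv s) C"
    and BO: "H \<turnstile> boolean_space (sv s) C" and CO: "H \<turnstile> compact_space (sv s) C"
    and sep: "ax_separation (ren Suc q) 0 \<in> T" "ax_separation (ren Suc FBot) 0 \<in> T"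
  shows "H \<turnstile> (inst q [] \<or>\<^sub>s \<not>\<^sub>s inst q [])" (is "_ \<turnstile> ?G")
proof (rule s_exE[OF separation[OF sep(1), of _ s]])
  fix u
  let ?U = "elts (sv u)" and ?S = "elts (sv s)"
  let ?N = "pseudocompl (sv s) C ?U"
  let ?V = "cunion ?U ?N"
  have V: "s_fam ?V" and N: "s_fam ?N" and U: "s_fam ?U" and S: "s_fam ?S" by (simp_all add: srel)
  let ?H0 = "(\<forall>\<^sub>s x. x \<in>\<^sub>s sv u \<longleftrightarrow>\<^sub>s (x \<in>\<^sub>s sv s \<and>\<^sub>s inst q [])) 0 # H"
  have u0: "?H0 \<turnstile> (sv x \<in>\<^sub>s sv u \<longleftrightarrow>\<^sub>s (sv x \<in>\<^sub>s sv s \<and>\<^sub>s inst q []))" for x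
    by (rule s_allE[OF s_hd]) (simp add: srel)
  have us: "?H0 \<turnstile> (sv u \<subseteq>\<^sub>s sv s)"
    by (rule s_subI) (rule s_andE1[OF s_iffE1[OF s_wk[OF u0] s_hd]])
  have bo: "?H0 \<turnstile> covs C ?S ?V"
    using s_wk[OF BO] unfolding boolean_space_def by (rule all_subsetsE[OF _ _ us]) (simp add: srel)
  \<comment> \<open>To be covered by a class includes that the class is a set, so Booleanness
    supplies such a set at every point of the base. The set may depend on the point, which
    \<open>uniform_class\<close> repairs.\<close>
  have "?H0 \<turnstile> s_ball (sv s) (\<lambda>x. \<exists>\<^sub>s w. is_class w ?V)"
  proof (rule s_ballI)
    fix x let ?K = "(sv x \<in>\<^sub>s sv s) 0 # ?H0"
    have "?K \<turnstile> cov C (sv x) ?V" by (rule covsE[OF s_wk[OF bo] S V]) (simp add: elts_def s_hd)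
    then show "?K \<turnstile> (\<exists>\<^sub>s w. is_class w ?V)"
      unfolding cov_def
    proof (rule s_exE)
      fix w
      show "(is_class (sv w) ?V \<and>\<^sub>s C (sv x) (sv w)) 0 # ?K \<turnstile> (\<exists>\<^sub>s w. is_class w ?V)"
        by (rule s_exI[OF s_andE1[OF s_hd]]) (simp add: srel)
    qed (simp add: srel)
  qed (simp add: srel)
  from uniform_class[OF V this]
  show "?H0 \<turnstile> ?G"
  proof (rule s_exE)
    fix w
    let ?H1 = "((\<forall>\<^sub>s x. x \<in>\<^sub>s sv w \<longrightarrow>\<^sub>s ?V x) \<and>\<^sub>s s_ball (sv s) (\<lambda>x. is_class (sv w) ?V)) 0 # ?H0"
    have wV: "?H1 \<turnstile> (sv x \<in>\<^sub>s sv w \<longrightarrow>\<^sub>s ?V (sv x))" for x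
      by (rule s_allE[OF s_andE1[OF s_hd]]) (simp add: srel)
    have wc: "?H1 \<turnstile> s_ball (sv s) (\<lambda>x. is_class (sv w) ?V)" by (rule s_andE2[OF s_hd])
    have ws: "?H1 \<turnstile> (sv w \<subseteq>\<^sub>s sv s)"
    proof (rule s_subI)
      fix x let ?K = "(sv x \<in>\<^sub>s sv w) 0 # ?H1"
      have "?K \<turnstile> ?V (sv x)" by (rule s_impE[OF s_wk[OF wV] s_hd])
      then show "?K \<turnstile> (sv x \<in>\<^sub>s sv s)"
      proof (rule cunionE)
        show "?U (sv x) 0 # ?K \<turnstile> (sv x \<in>\<^sub>s sv s)"
          by (rule s_subE[OF s_mono[OF us]]) (auto intro: s_hyp simp: elts_def)
        show "?N (sv x) 0 # ?K \<turnstile> (sv x \<in>\<^sub>s sv s)"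
          by (rule pseudocomplE(1)[OF s_hd])
      qed
    qed
    have "?H1 \<turnstile> covs C ?S (elts (sv w))"
    proof (rule covsI[OF _ S])
      fix a
      let ?K = "?S (sv a) 0 # ?H1"
      have a: "?K \<turnstile> (sv a \<in>\<^sub>s sv s)" using s_hd[of T "?S (sv a)" ?H1] by (simp add: elts_def)
      have "?K \<turnstile> is_class (sv w) ?V" by (rule s_ballE[OF s_wk[OF wc] _ a]) (simp add: srel)
      note w = is_classE[OF this V]
      have "?K \<turnstile> cov C (sv a) ?V" by (rule covsE[OF s_mono[OF bo] S V s_hd]) auto
      moreover have W: "s_fam (elts (sv w))" by (simp add: srel)
      moreover have "?K \<turnstile> (?V (sv x) \<longleftrightarrow>\<^sub>s elts (sv w) (sv x))" for x
        unfolding elts_def[of "sv w"]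
        by (intro s_iffI s_iffE2[OF s_wk[OF w] s_hd] s_iffE1[OF s_wk[OF w] s_hd])
      ultimately show "?K \<turnstile> cov C (sv a) (elts (sv w))"
        by (blast intro: cov_cong[OF V])
    qed (simp add: srel)
    moreover have "?H1 \<turnstile> (covs C ?S (elts (sv w)) \<longrightarrow>\<^sub>s
        (\<exists>\<^sub>s l. finitely_listed l \<and>\<^sub>s l \<subseteq>\<^sub>s sv w \<and>\<^sub>s covs C ?S (elts l)))"
      using s_wk[OF s_wk[OF CO]] unfolding compact_space_def by (rule all_subsetsE[OF _ _ ws]) (simp add: srel)
    ultimately have "?H1 \<turnstile> (\<exists>\<^sub>s l. finitely_listed l \<and>\<^sub>s l \<subseteq>\<^sub>s sv w \<and>\<^sub>s covs C ?S (elts l))"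
      by (blast intro: s_impE)
    then show "?H1 \<turnstile> ?G"
    proof (rule s_exE)
      fix l
      let ?H2 = "(finitely_listed (sv l) \<and>\<^sub>s sv l \<subseteq>\<^sub>s sv w \<and>\<^sub>s covs C ?S (elts (sv l))) 0 # ?H1"
      have lw: "?H2 \<turnstile> (sv l \<subseteq>\<^sub>s sv w)" and lc: "?H2 \<turnstile> covs C ?S (elts (sv l))"
        by (rule s_andE1[OF s_andE2[OF s_hd]], rule s_andE2[OF s_andE2[OF s_hd]])
      have dec: "(sv x \<in>\<^sub>s sv l) 0 # ?H2 \<turnstile> (inst q [] \<or>\<^sub>s ?N (sv x))" for x
      proof -
        let ?K = "(sv x \<in>\<^sub>s sv l) 0 # ?H2"
        have "?K \<turnstile> (sv x \<in>\<^sub>s sv w)" by (rule s_subE[OF s_wk[OF lw] s_hd])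
        note s_impE[OF s_mono[OF wV] this]
        then have "?K \<turnstile> ?V (sv x)" by auto
        then show ?thesis
        proof (rule cunionE)
          have "?U (sv x) 0 # ?K \<turnstile> (sv x \<in>\<^sub>s sv u)"
            using s_hd[of T "?U (sv x)" ?K] by (simp add: elts_def)
          then show "?U (sv x) 0 # ?K \<turnstile> (inst q [] \<or>\<^sub>s ?N (sv x))"
            by (intro s_orI1 s_andE2[OF s_iffE1[OF s_mono[OF u0]]]) auto
          show "?N (sv x) 0 # ?K \<turnstile> (inst q [] \<or>\<^sub>s ?N (sv x))" by (rule s_orI2[OF s_hd])
        qed
      qed
      have "?H2 \<turnstile> (inst q [] \<or>\<^sub>s s_ball (sv l) ?N)"
        by (rule finitely_listed_choice[OF N s_andE1[OF s_hd] dec])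
      then show "?H2 \<turnstile> ?G"
      proof (rule s_orE)
        show "inst q [] 0 # ?H2 \<turnstile> ?G" by (rule s_orI1[OF s_hd])
        let ?H3 = "s_ball (sv l) ?N 0 # ?H2"
        have "inst q [] 0 # ?H3 \<turnstile> s_bot"
        proof (rule s_exE[OF separation[OF sep(2), of _ s]])
          fix e
          let ?K = "(\<forall>\<^sub>s x. x \<in>\<^sub>s sv e \<longleftrightarrow>\<^sub>s (x \<in>\<^sub>s sv s \<and>\<^sub>s inst FBot [])) 0 # inst q [] 0 # ?H3"
          have fbot: "inst FBot [] = s_bot" by (rule ext) (simp add: inst_def s_bot_def)
          have e: "?K \<turnstile> (sv x \<in>\<^sub>s sv e \<longleftrightarrow>\<^sub>s (sv x \<in>\<^sub>s sv s \<and>\<^sub>s s_bot))" for x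
            unfolding fbot[symmetric] by (rule s_allE[OF s_hd]) (simp add: srel)
          have empty: "K \<turnstile> (elts (sv e) (sv x) \<longleftrightarrow>\<^sub>s none (sv x))" if "set ?K \<subseteq> set K" for K x
            unfolding elts_def none_def
          proof (rule s_iffI)
            show "(sv x \<in>\<^sub>s sv e) 0 # K \<turnstile> s_bot"
              by (rule s_andE2[OF s_iffE1[OF s_mono[OF e] s_hd]]) (use that in auto)
            show "s_bot 0 # K \<turnstile> (sv x \<in>\<^sub>s sv e)" by (rule s_botE[OF s_hd])
          qed
          have es: "?K \<turnstile> (sv e \<subseteq>\<^sub>s sv s)"
            by (rule s_subI) (rule s_andE1[OF s_iffE1[OF s_wk[OF e] s_hd]])
          have ls: "?K \<turnstile> (sv l \<subseteq>\<^sub>s sv s)"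
          proof (rule s_subI)
            fix x
            show "(sv x \<in>\<^sub>s sv l) 0 # ?K \<turnstile> (sv x \<in>\<^sub>s sv s)"
              by (rule s_subE[OF s_mono[OF ws] s_subE[OF s_mono[OF lw] s_hd]]) auto
          qed
          have N0: "s_fam none" and E: "s_fam (elts (sv e))" and L: "s_fam (elts (sv l))" by (simp_all add: srel)
          \<comment> \<open>Transitivity is stated for sets, so the class \<open>none\<close> is
            replaced by the empty set \<open>e\<close> here and restored by \<open>cov_cong\<close>
            at the end.\<close>
          have le: "?K \<turnstile> covs C (elts (sv l)) (elts (sv e))"
          proof (rule covsI[OF _ L E])
            fix x
            let ?L = "elts (sv l) (sv x) 0 # ?K"
            have xl: "?L \<turnstile> (sv x \<in>\<^sub>s sv l)" using s_hd[of T "elts (sv l) (sv x)" ?K] by (simp add: elts_def)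
            have xN: "?L \<turnstile> ?N (sv x)" by (rule s_ballE[OF s_hyp _ xl]) (simp_all add: s_fam_stable[OF N])
            have q: "?L \<turnstile> inst q []" by (rule s_hyp) simp
            have "?L \<turnstile> (sv x \<in>\<^sub>s sv s)" by (rule pseudocomplE(1)[OF xN])
            note s_iffE2[OF s_mono[OF u0] s_andI[OF this q]]
            then have "?L \<turnstile> (sv x \<in>\<^sub>s sv u)" by auto
            note pseudocompl_cov[OF s_mono[OF FS] xN this]
            then have "?L \<turnstile> cov C (sv x) none" by auto
            then show "?L \<turnstile> cov C (sv x) (elts (sv e))"
              by (rule cov_cong[OF N0 E]) (rule s_iffI[OF s_iffE2[OF empty s_hd] s_iffE1[OF empty s_hd]]; auto)
          qed
          have "?K \<turnstile> covs C ?S none"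
          proof (rule covsI[OF _ S N0])
            fix a
            let ?L = "?S (sv a) 0 # ?K"
            have a: "?L \<turnstile> (sv a \<in>\<^sub>s sv s)" using s_hd[of T "?S (sv a)" ?K] by (simp add: elts_def)
            have "?L \<turnstile> cov C (sv a) (elts (sv l))"
              by (rule covsE[OF s_mono[OF lc] S L s_hd]) auto
            note transitivity[OF s_mono[OF FS] a s_wk[OF ls] s_wk[OF es] this s_wk[OF le]]
            then have "?L \<turnstile> cov C (sv a) (elts (sv e))" by auto
            then show "?L \<turnstile> cov C (sv a) none"
              by (rule cov_cong[OF E N0]) (rule empty, auto)
          qed
          moreover have "?K \<turnstile> nontrivial (sv s) C" by (rule s_mono[OF NT]) auto
          ultimately show "?K \<turnstile> s_bot" unfolding nontrivial_def by (blast intro: s_notE)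
        qed (simp add: srel)
        then show "?H3 \<turnstile> ?G" by (intro s_orI2 s_notI)
      qed
    qed (simp add: srel)
  qed (simp add: srel)
qed (simp add: srel)

end

lemma set_spaceI: "CZF \<subseteq> T \<Longrightarrow> s_fam2 C \<Longrightarrow> set_space T C"
  by (simp add: set_space_def set_space_axioms_def constructive_set_theory_def)

section \<open>Excluded middle in CZF and IZF\<close>

context constructive_set_theory
begin

lemma is_emptyE: "H \<turnstile> is_empty (sv x) \<Longrightarrow> H \<turnstile> (sv z \<in>\<^sub>s sv x) \<Longrightarrow> H \<turnstile> p"
  unfolding is_empty_def by (drule s_allE[of T H _ z]) (simp add: srel, erule s_notE)

text \<open>A subset \<open>e\<close> of the singleton is determined by whether it has an element,
  so for each \<open>e\<close> a single bounded formula has to be decided.\<close>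

lemma REM_if_decidable:
  assumes A: "\<And>q. bounded (ren Suc q) \<Longrightarrow> H0 \<turnstile> (inst q [] \<or>\<^sub>s \<not>\<^sub>s inst q [])"
  shows "H0 \<turnstile> REM"
  unfolding REM_def
proof (rule s_allI, simp add: srel, rule s_impI, rule s_allI, simp add: srel)
  fix e x
  let ?H = "(\<forall>\<^sub>s x. x \<in>\<^sub>s sv e \<longrightarrow>\<^sub>s is_empty x) 0 # H0"
  \<comment> \<open>Inhabitedness of \<open>e\<close> is written with the trivial matrix
    \<open>y = y\<close> in order to have the syntactic shape that \<open>bounded\<close> prescribes
    for an existential quantifier.\<close>
  let ?Q = "s_bex (sv e) (\<lambda>y. y =\<^sub>s y)"
  have e: "?H \<turnstile> (sv y \<in>\<^sub>s sv e \<longrightarrow>\<^sub>s is_empty (sv y))" for y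
    by (rule s_allE[OF s_hd]) (simp add: srel)
  have "bounded (ren Suc (?Q 0))"
    by (simp add: s_bex_def s_ex_def s_and_def s_mem_def s_eq_def bounded.intros)
  from s_wk[OF A[OF this]] have "?H \<turnstile> (?Q \<or>\<^sub>s \<not>\<^sub>s ?Q)"
    by (rule s_cong0) (simp add: s_or_def s_not_def s_imp_def)
  then show "?H \<turnstile> ((sv x \<in>\<^sub>s sv e \<or>\<^sub>s (is_empty (sv x) \<and>\<^sub>s \<not>\<^sub>s sv x \<in>\<^sub>s sv e)) \<longleftrightarrow>\<^sub>s is_empty (sv x))"
  proof (intro s_iffI)
    let ?K = "(sv x \<in>\<^sub>s sv e \<or>\<^sub>s (is_empty (sv x) \<and>\<^sub>s \<not>\<^sub>s sv x \<in>\<^sub>s sv e)) 0 # ?H"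
    show "?K \<turnstile> is_empty (sv x)"
      by (rule s_orE[OF s_hd]) (rule s_impE[OF s_mono[OF e] s_hd], force, rule s_andE1[OF s_hd])
  next
    assume dec: "?H \<turnstile> (?Q \<or>\<^sub>s \<not>\<^sub>s ?Q)"
    let ?K = "is_empty (sv x) 0 # ?H"
    show "?K \<turnstile> (sv x \<in>\<^sub>s sv e \<or>\<^sub>s (is_empty (sv x) \<and>\<^sub>s \<not>\<^sub>s sv x \<in>\<^sub>s sv e))"
    proof (rule s_orE[OF s_wk[OF dec]])
      show "?Q 0 # ?K \<turnstile> (sv x \<in>\<^sub>s sv e \<or>\<^sub>s (is_empty (sv x) \<and>\<^sub>s \<not>\<^sub>s sv x \<in>\<^sub>s sv e))"
      proof (rule s_bexE[OF s_hd])
        fix y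
        let ?L = "(sv y =\<^sub>s sv y) 0 # (sv y \<in>\<^sub>s sv e) 0 # ?Q 0 # ?K"
        have ye: "?L \<turnstile> (sv y \<in>\<^sub>s sv e)" by (rule s_wk[OF s_hd])
        have nx: "K \<turnstile> (sv z \<in>\<^sub>s sv x) \<Longrightarrow> K \<turnstile> p" and ny: "K \<turnstile> (sv z \<in>\<^sub>s sv y) \<Longrightarrow> K \<turnstile> p"
          if "set ?L \<subseteq> set K" for K z p
        proof -
          have x: "K \<turnstile> is_empty (sv x)" by (rule s_hyp) (use that in auto)
          have y: "K \<turnstile> is_empty (sv y)"
            by (rule s_mono[OF s_impE[OF s_mono[OF e] ye] that]) auto
          show "K \<turnstile> (sv z \<in>\<^sub>s sv x) \<Longrightarrow> K \<turnstile> p" "K \<turnstile> (sv z \<in>\<^sub>s sv y) \<Longrightarrow> K \<turnstile> p"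
            by (erule is_emptyE[OF x], erule is_emptyE[OF y])
        qed
        \<comment> \<open>Any two sets without elements are equal by extensionality: each direction
          of the equivalence starts from a member of one of them.\<close>
        have "?L \<turnstile> (sv y =\<^sub>s sv x)"
          by (intro extensionality s_allI s_iffI nx[OF _ s_hd] ny[OF _ s_hd]) (auto simp: srel)
        then have "?L \<turnstile> (sv x \<in>\<^sub>s sv e)"
          by (rule s_eqE[where P = "\<lambda>z. z \<in>\<^sub>s sv e", OF _ ye]) (simp add: srel)
        then show "?L \<turnstile> (sv x \<in>\<^sub>s sv e \<or>\<^sub>s (is_empty (sv x) \<and>\<^sub>s \<not>\<^sub>s sv x \<in>\<^sub>s sv e))" by (rule s_orI1)
      qed (simp add: srel)
      show "(\<not>\<^sub>s ?Q) 0 # ?K \<turnstile> (sv x \<in>\<^sub>s sv e \<or>\<^sub>s (is_empty (sv x) \<and>\<^sub>s \<not>\<^sub>s sv x \<in>\<^sub>s sv e))"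
      proof (intro s_orI2 s_andI s_notI)
        show "(\<not>\<^sub>s ?Q) 0 # ?K \<turnstile> is_empty (sv x)" by (rule s_wk[OF s_hd])
        let ?L = "(sv x \<in>\<^sub>s sv e) 0 # (\<not>\<^sub>s ?Q) 0 # ?K"
        have "?L \<turnstile> ?Q" by (rule s_bexI, rule s_hd, rule s_eqI) (simp add: srel)
        then show "?L \<turnstile> s_bot" by (rule s_notE[OF s_wk[OF s_hd]])
      qed
    qed
  qed
qed

end

lemma CZF_compact_boolean: "nd (CZF \<union> X) [] ((compact_boolean_CZF p \<longrightarrow>\<^sub>s REM) 0)"
proof -
  let ?T = "CZF \<union> X"
  interpret constructive_set_theory ?T by unfold_locales blast
  let ?A = "\<lambda>S. let C = (\<lambda>a U. inst p [a, U, S]) in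
        formal_space S C \<and>\<^sub>s set_presented_saturation S C \<and>\<^sub>s
        nontrivial S C \<and>\<^sub>s boolean_space S C \<and>\<^sub>s compact_space S C"
  have "s_entails ?T H REM" if "s_entails ?T H (\<exists>\<^sub>s S. ?A S)" for H
    using that
  proof (rule s_exE)
    fix s
    \<comment> \<open>The formula for the cover mentions the base, so the cover is available only
      after the base \<open>s\<close> has been opened. This is why the locale is interpreted inside
      the existential elimination.\<close>
    define C where "C = (\<lambda>a U. inst p [a, U, sv s])"
    let ?K = "?A (sv s) 0 # H"
    interpret set_space ?T C
      by (rule set_spaceI) (auto simp: C_def srel)
    have A: "s_entails ?T ?K (formal_space (sv s) C \<and>\<^sub>s set_presented_saturation (sv s) C \<and>\<^sub>s
        nontrivial (sv s) C \<and>\<^sub>s boolean_space (sv s) C \<and>\<^sub>s compact_space (sv s) C)"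
      unfolding C_def by (rule s_hyp) (simp add: Let_def)
    note B = s_andE2[OF s_andE2[OF A]]
    show "s_entails ?T ?K REM"
    proof (rule REM_if_decidable)
      fix q assume "bounded (ren Suc q)"
      moreover have "bounded (ren Suc FBot)" by (simp add: bounded.intros)
      ultimately have "ax_separation (ren Suc q) 0 \<in> ?T" "ax_separation (ren Suc FBot) 0 \<in> ?T"
        unfolding CZF_def by blast+
      then show "s_entails ?T ?K (inst q [] \<or>\<^sub>s \<not>\<^sub>s inst q [])"
        by (rule compact_boolean_decides[OF s_andE1[OF A] s_andE1[OF B] s_andE1[OF s_andE2[OF B]] s_andE2[OF s_andE2[OF B]]])
    qed
  qed (simp add: srel Let_def)
  then have "s_entails ?T [] (compact_boolean_CZF p \<longrightarrow>\<^sub>s REM)"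
    unfolding compact_boolean_CZF_def by - (rule s_impI, drule meta_spec, erule meta_mp, rule s_hd)
  then show ?thesis by (simp add: s_entails_def)
qed

text \<open>Full separation provides \<open>U\<close> for every formula, so \<open>q\<close> is
  decided directly, without a passage through subsets of a singleton.\<close>

lemma IZF_compact_boolean: "nd IZF [] ((compact_boolean_IZF \<longrightarrow>\<^sub>s EM_instance q) 0)"
proof -
  interpret constructive_set_theory IZF by unfold_locales (auto simp: IZF_def)
  have "s_entails IZF [] (compact_boolean_IZF \<longrightarrow>\<^sub>s EM_instance q)"
  proof (rule s_impI)
    have G: "EM_instance q = (inst q [] \<or>\<^sub>s \<not>\<^sub>s inst q [])" by (simp add: EM_instance_def)
    define H where "H = [compact_boolean_IZF 0]"
    let ?A = "\<lambda>S R. let C = \<lambda>a U. pair_mem a U R in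
        formal_space S C \<and>\<^sub>s nontrivial S C \<and>\<^sub>s boolean_space S C \<and>\<^sub>s compact_space S C"
    have "s_entails IZF H (\<exists>\<^sub>s S. \<exists>\<^sub>s R. ?A S R)"
      unfolding compact_boolean_IZF_def[symmetric] H_def by (rule s_hd)
    then have "s_entails IZF H (EM_instance q)"
    proof (rule s_exE)
      fix s
      show "s_entails IZF ((\<exists>\<^sub>s R. ?A (sv s) R) 0 # H) (EM_instance q)"
      proof (rule s_exE[OF s_hd])
        fix r
        define C where "C = (\<lambda>a U. pair_mem a U (sv r))"
        let ?K = "?A (sv s) (sv r) 0 # (\<exists>\<^sub>s R. ?A (sv s) R) 0 # H"
        interpret set_space IZF C
          by (rule set_spaceI) (auto simp: C_def IZF_def srel)
        have A: "s_entails IZF ?K (formal_space (sv s) C \<and>\<^sub>s nontrivial (sv s) C \<and>\<^sub>s boolean_space (sv s) C \<and>\<^sub>s compact_space (sv s) C)"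
          unfolding C_def by (rule s_hyp) (simp add: Let_def)
        have "ax_separation (ren Suc q) 0 \<in> IZF" "ax_separation (ren Suc FBot) 0 \<in> IZF"
          unfolding IZF_def by blast+
        then show "s_entails IZF ?K (EM_instance q)"
          unfolding G
          by (rule compact_boolean_decides[OF s_andE1[OF A] s_andE1[OF s_andE2[OF A]] s_andE1[OF s_andE2[OF s_andE2[OF A]]]
                s_andE2[OF s_andE2[OF s_andE2[OF A]]]])
      qed (simp add: srel Let_def)
    qed (simp add: srel Let_def)
    then show "s_entails IZF [compact_boolean_IZF 0] (EM_instance q)" by (simp add: H_def)
  qed
  then show ?thesis by (simp add: s_entails_def)
qed

section \<open>Higher-order arithmetic\<close>

instance hty :: countable by countable_datatype

lemma h_up_simps [simp]: "h_up f 0 = HVar 0" "h_up f (Suc k) = h_lift (f k)"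
  by (simp_all add: h_up_def)

lemma h_up_HVar: "h_up (\<lambda>i. HVar (r i)) = (\<lambda>i. HVar (up r i))"
  by (auto simp: fun_eq_iff h_up_def up_def split: nat.split)

lemma h_ren_eq_sub: "h_ren r t = h_sub (\<lambda>i. HVar (r i)) t"
  by (induction t arbitrary: r) (simp_all add: h_up_HVar)

lemma h_ren_ren: "h_ren r (h_ren s t) = h_ren (r \<circ> s) t"
  by (induction t arbitrary: r s) (simp_all add: up_comp)

lemma h_up_comp_up: "h_up f \<circ> up r = h_up (f \<circ> r)"
  by (auto simp: fun_eq_iff h_up_def up_def split: nat.split)

lemma h_sub_ren: "h_sub f (h_ren r t) = h_sub (f \<circ> r) t"
  by (induction t arbitrary: f r) (simp_all add: h_up_comp_up)

lemma h_ren_up_h_up: "(\<lambda>i. h_ren (up r) (h_up f i)) = h_up (\<lambda>i. h_ren r (f i))"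
  by (auto simp: fun_eq_iff h_up_def h_ren_ren comp_def split: nat.split)

lemma h_ren_sub: "h_ren r (h_sub f t) = h_sub (\<lambda>i. h_ren r (f i)) t"
  by (induction t arbitrary: f r) (simp_all add: h_ren_up_h_up)

lemma h_ren_id [simp]: "h_ren id t = t" "h_ren (\<lambda>x. x) t = t"
  by (induction t) (simp_all add: id_def[symmetric])

lemma h_up_pow: "(h_up ^^ k) f i = (if i < k then HVar i else h_ren (\<lambda>j. j + k) (f (i - k)))"
proof (induction k arbitrary: i)
  case (Suc k)
  then show ?case by (cases i) (simp_all add: h_ren_ren comp_def)
qed simp

lemma h_ren_inst: "h_ren r (h_inst t p) = h_inst (h_ren r t) (h_ren (up r) p)"
  unfolding h_ren_sub h_sub_ren
  by (rule arg_cong[of _ _ "\<lambda>f. h_sub f p"]) (auto simp: fun_eq_iff up_def split: nat.split)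

lemma h_inst_HVar: "h_inst (HVar y) p = h_ren (case_nat y id) p"
  unfolding h_ren_eq_sub
  by (rule arg_cong[of _ _ "\<lambda>f. h_sub f p"]) (auto simp: fun_eq_iff split: nat.split)

definition ren_into :: "(nat \<Rightarrow> nat) \<Rightarrow> hty list \<Rightarrow> hty list \<Rightarrow> bool" where
  "ren_into r G D \<longleftrightarrow> (\<forall>k<length G. r k < length D \<and> D ! r k = G ! k)"

lemma ren_into_up: "ren_into r G D \<Longrightarrow> ren_into (up r) (A # G) (A # D)"
  by (auto simp: ren_into_def up_def nth_Cons split: nat.split)

lemma h_has_type_ren: "h_has_type G t A \<Longrightarrow> ren_into r G D \<Longrightarrow> h_has_type D (h_ren r t) A"
proof (induction arbitrary: r D rule: h_has_type.induct)
  case (1 k G)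
  then show ?case using h_has_type.intros(1)[of "r k" D] by (auto simp: ren_into_def)
next
  case (7 G s A t)
  show ?case using h_has_type.intros(7)[OF 7(3,4)[OF 7(5)]] by simp
next
  case (8 G s A t)
  show ?case using h_has_type.intros(8)[OF 8(3,4)[OF 8(5)]] by simp
qed (auto intro: h_has_type.intros ren_into_up)

text \<open>In contrast to \<open>nd.Ax\<close>, the rule \<open>H_Ax\<close> offers no renaming.
  Closedness of the axioms takes its place in \<open>hha_ren\<close>.\<close>

lemma HHA_axioms_closed: "p \<in> HHA_axioms \<Longrightarrow> h_ren r p = p"
  unfolding HHA_axioms_def
  by (auto simp: h_all_def h_ex_def h_iff_def h_and_def h_imp_def h_mem_def h_eq_def h_star_def h_pair_def
      h_not_def h_bot_def h_zero_def h_suc_def eval_nat_numeral)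

lemma hha_ren: "hha G H p \<Longrightarrow> ren_into r G D \<Longrightarrow> hha D (map (h_ren r) H) (h_ren r p)"
proof (induction arbitrary: r D rule: hha.induct)
  case (H_Ax p G H)
  then show ?case by (simp add: HHA_axioms_closed hha.H_Ax)
next
  case (H_AllI A G H p)
  have "map (h_ren (up r)) (map h_lift H) = map h_lift (map (h_ren r) H)"
    by (simp add: h_ren_ren comp_def)
  with H_AllI.IH[OF ren_into_up[OF H_AllI.prems]] show ?case by (simp only: h_ren.simps hha.H_AllI)
next
  case (H_AllE G H A p t)
  then show ?case unfolding h_ren_inst by (auto intro: hha.H_AllE h_has_type_ren)
next
  case (H_ExI A G p t H)
  note p = h_has_type_ren[OF H_ExI.hyps(1) ren_into_up[OF H_ExI.prems]]
    and t = h_has_type_ren[OF H_ExI.hyps(2) H_ExI.prems]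
  show ?case using hha.H_ExI[OF p t] H_ExI.IH[OF H_ExI.prems] by (simp add: h_ren_inst)
next
  case (H_ExE G H A p q)
  have "map (h_ren (up r)) (map h_lift H) = map h_lift (map (h_ren r) H)"
    "h_ren (up r) (h_lift q) = h_lift (h_ren r q)"
    by (simp_all add: h_ren_ren comp_def)
  with H_ExE.IH(2)[OF ren_into_up[OF H_ExE.prems]]
  have "hha (A # D) (h_ren (up r) p # map h_lift (map (h_ren r) H)) (h_lift (h_ren r q))"
    by (simp only: list.map)
  then show ?case by (rule hha.H_ExE[OF H_ExE.IH(1)[OF H_ExE.prems, simplified]])
next
  case (H_EqE A G p s t H)
  note p = h_has_type_ren[OF H_EqE.hyps(1) ren_into_up[OF H_EqE.prems]]
    and s = h_has_type_ren[OF H_EqE.hyps(2) H_EqE.prems]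
    and t = h_has_type_ren[OF H_EqE.hyps(3) H_EqE.prems]
  show ?case
    using hha.H_EqE[OF p s t] H_EqE.IH[OF H_EqE.prems] by (simp add: h_ren_inst)
next
  case (H_ComprI A G p t H)
  note p = h_has_type_ren[OF H_ComprI.hyps(1) ren_into_up[OF H_ComprI.prems]]
    and t = h_has_type_ren[OF H_ComprI.hyps(2) H_ComprI.prems]
  show ?case using hha.H_ComprI[OF p t] H_ComprI.IH[OF H_ComprI.prems] by (simp add: h_ren_inst)
next
  case (H_ComprE A G p t H)
  note p = h_has_type_ren[OF H_ComprE.hyps(1) ren_into_up[OF H_ComprE.prems]]
    and t = h_has_type_ren[OF H_ComprE.hyps(2) H_ComprE.prems]
  show ?case using hha.H_ComprE[OF p t] H_ComprE.IH[OF H_ComprE.prems] by (simp add: h_ren_inst)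
next
  case (H_OrE G H p q r)
  show ?case
    using hha.H_OrE[OF H_OrE.IH(1)[OF H_OrE.prems, simplified]] H_OrE.IH(2,3)[OF H_OrE.prems] by simp
next
  case (H_ImpE G H p q)
  show ?case
    using hha.H_ImpE[OF H_ImpE.IH(1)[OF H_ImpE.prems, simplified]] H_ImpE.IH(2)[OF H_ImpE.prems] by simp
qed (auto intro: hha.intros h_has_type_ren)

lemma hha_weak: "hha G H p \<Longrightarrow> set H \<subseteq> set H' \<Longrightarrow> hha G H' p"
proof (induction arbitrary: H' rule: hha.induct)
  case (H_OrE G H p q r)
  show ?case
    by (rule hha.H_OrE[OF H_OrE.IH(1) H_OrE.IH(2) H_OrE.IH(3)]) (use H_OrE.prems in auto)
next
  case (H_ImpI G p H q)
  show ?case by (rule hha.H_ImpI[OF H_ImpI.hyps(1)], rule H_ImpI.IH) (use H_ImpI.prems in auto)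
next
  case (H_AllI A G H p)
  show ?case by (rule hha.H_AllI, rule H_AllI.IH) (use H_AllI.prems in auto)
next
  case (H_ExE G H A p q)
  show ?case by (rule hha.H_ExE[OF H_ExE.IH(1) H_ExE.IH(2)]) (use H_ExE.prems in auto)
next
  case (H_EqE A G p s t H)
  show ?case by (rule hha.H_EqE[OF H_EqE.hyps(1-3) H_EqE.IH]) (use H_EqE.prems in auto)
qed (auto intro: hha.intros)

lemma h_ren_bound: "\<exists>b. \<forall>r s. (\<forall>k<b. r k = s k) \<longrightarrow> h_ren r p = h_ren s p"
proof -
  \<comment> \<open>Bounds are combined for arbitrary predicates of two renamings, so one induction
    treats all constructors with two subterms alike.\<close>
  have two: "\<exists>c. \<forall>r s :: nat \<Rightarrow> nat. (\<forall>k<c. r k = s k) \<longrightarrow> P r s \<and> Q r s"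
    if "\<exists>b. \<forall>r s. (\<forall>k<b. r k = s k) \<longrightarrow> P r s" "\<exists>b. \<forall>r s. (\<forall>k<b. r k = s k) \<longrightarrow> Q r s" for P Q
  proof -
    from that obtain a b where "\<forall>r s. (\<forall>k<a. r k = s k) \<longrightarrow> P r s" "\<forall>r s. (\<forall>k<b. r k = s k) \<longrightarrow> Q r s"
      by blast
    then show ?thesis by (intro exI[of _ "a + b"]) (simp add: trans_less_add1 trans_less_add2)
  qed
  have under: "\<exists>c. \<forall>r s. (\<forall>k<c. r k = s k) \<longrightarrow> h_ren (up r) p = h_ren (up s) p"
    if "\<exists>b. \<forall>r s. (\<forall>k<b. r k = s k) \<longrightarrow> h_ren r p = h_ren s p" for p
  proof -
    from that obtain b where b: "\<And>r s. \<forall>k<b. r k = s k \<Longrightarrow> h_ren r p = h_ren s p" by blast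
    have "h_ren (up r) p = h_ren (up s) p" if "\<forall>k<b. r k = s k" for r s
      by (rule b) (use that in \<open>auto simp: up_def split: nat.split\<close>)
    then show ?thesis by blast
  qed
  show ?thesis by (induction p) (auto intro!: two under simp: less_Suc_eq_le)
qed

lemma h_ren_bound_list: "\<exists>b. \<forall>p\<in>set H. \<forall>r s. (\<forall>k<b. r k = s k) \<longrightarrow> h_ren r p = h_ren s p"
proof (induction H)
  case (Cons p H)
  obtain a where "\<forall>r s. (\<forall>k<a. r k = s k) \<longrightarrow> h_ren r p = h_ren s p" using h_ren_bound by blast
  moreover obtain b where "\<forall>p\<in>set H. \<forall>r s. (\<forall>k<b. r k = s k) \<longrightarrow> h_ren r p = h_ren s p" using Cons by blast
  ultimately show ?case by (intro exI[of _ "a + b"]) (simp add: trans_less_add1 trans_less_add2)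
qed simp

text \<open>
  A fixed infinite context in which every type occurs infinitely often; judgements relative to some
  finite initial part of it need no explicit context.
\<close>

definition tau :: "nat \<Rightarrow> hty" where "tau k = from_nat (fst (prod_decode k))"
definition tctx :: "nat \<Rightarrow> hty list" where "tctx n = map tau [0..<n]"

text \<open>The second component of the encoded pair does not influence the type, so it can push the
  index beyond any bound.\<close>

lemma tau_unbounded: "\<exists>y\<ge>b. tau y = A"
  by (rule exI[of _ "prod_encode (to_nat A, b)"]) (simp add: tau_def le_prod_encode_2)

lemma ren_into_le: "n \<le> m \<Longrightarrow> ren_into (\<lambda>k. k) (tctx n) (tctx m)"
  by (simp add: ren_into_def tctx_def)

text \<open>The variable is chosen beyond all free variables and of the type of the binder. Sending
  it to 0 and shifting the others then respects types for every length of the context, since its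
  type in the fixed context is \<open>A\<close>.\<close>

lemma h_fresh_var:
  "\<exists>y. tau y = A \<and> (let r = (\<lambda>k. if k = y then 0 else Suc k) in map (h_ren r) H = map h_lift H \<and>
     h_ren r q = h_lift q \<and> h_ren r (h_inst (HVar y) p) = p) \<and>
     (\<forall>n. ren_into (\<lambda>k. if k = y then 0 else Suc k) (tctx n) (A # tctx n))"
proof -
  obtain b where b: "\<And>p' r s. p' \<in> set (p # q # H) \<Longrightarrow> \<forall>k<b. r k = s k \<Longrightarrow> h_ren r p' = h_ren s p'"
    using h_ren_bound_list[of "p # q # H"] by blast
  obtain y where y: "y \<ge> b" "tau y = A" using tau_unbounded by blast
  let ?r = "\<lambda>k. if k = y then 0 else Suc k"
  have "h_ren ?r (h_inst (HVar y) p) = h_ren id p"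
    unfolding h_inst_HVar h_ren_ren by (rule b) (use y in \<open>auto split: nat.split\<close>)
  moreover have "map (h_ren ?r) H = map h_lift H" by (rule map_cong[OF refl], rule b) (use y in auto)
  moreover have "h_ren ?r q = h_lift q" by (rule b) (use y in auto)
  moreover have "ren_into ?r (tctx n) (A # tctx n)" for n
    using y by (auto simp: ren_into_def tctx_def)
  ultimately show ?thesis using y by (auto simp: Let_def)
qed

text \<open>Because of monotonicity in the length, see \<open>hha_le\<close>, finitely many
  judgements can always be brought to a common context. Side conditions about contexts thereby
  vanish from the derived rules.\<close>

definition hh :: "htm list \<Rightarrow> htm \<Rightarrow> bool" where "hh H p \<longleftrightarrow> (\<exists>n. hha (tctx n) H p)"
definition ht :: "htm \<Rightarrow> hty \<Rightarrow> bool" where "ht t A \<longleftrightarrow> (\<exists>n. h_has_type (tctx n) t A)"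

lemma hha_le: "hha (tctx n) H p \<Longrightarrow> n \<le> m \<Longrightarrow> hha (tctx m) H p"
  using hha_ren[OF _ ren_into_le, of n H p m] by (simp add: map_idI)

lemma ht_le: "h_has_type (tctx n) t A \<Longrightarrow> n \<le> m \<Longrightarrow> h_has_type (tctx m) t A"
  using h_has_type_ren[OF _ ren_into_le, of n t A m] by simp

lemma hhD: "hh H p \<Longrightarrow> \<exists>n. \<forall>m\<ge>n. hha (tctx m) H p"
  and htD: "ht t A \<Longrightarrow> \<exists>n. \<forall>m\<ge>n. h_has_type (tctx m) t A"
  unfolding hh_def ht_def using hha_le ht_le by blast+

lemma ht_binder:
  assumes "\<And>y. tau y = A \<Longrightarrow> ht (h_inst (HVar y) p) B"
  shows "\<exists>n. \<forall>m\<ge>n. h_has_type (A # tctx m) p B"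
proof -
  obtain y where y: "tau y = A" "h_ren (\<lambda>k. if k = y then 0 else Suc k) (h_inst (HVar y) p) = p"
     "\<And>n. ren_into (\<lambda>k. if k = y then 0 else Suc k) (tctx n) (A # tctx n)"
    using h_fresh_var[of A "[]" HBot p] by (auto simp: Let_def)
  obtain n where n: "\<forall>m\<ge>n. h_has_type (tctx m) (h_inst (HVar y) p) B" using htD[OF assms[OF y(1)]] by blast
  then show ?thesis using h_has_type_ren[OF _ y(3), of _ "h_inst (HVar y) p" B] y(2) by auto
qed

lemma hh_AllI:
  assumes "\<And>y. tau y = A \<Longrightarrow> hh H (h_inst (HVar y) p)"
  shows "hh H (HAll A p)"
proof -
  obtain y where y: "tau y = A" "h_ren (\<lambda>k. if k = y then 0 else Suc k) (h_inst (HVar y) p) = p"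
     "map (h_ren (\<lambda>k. if k = y then 0 else Suc k)) H = map h_lift H"
     "\<And>n. ren_into (\<lambda>k. if k = y then 0 else Suc k) (tctx n) (A # tctx n)"
    using h_fresh_var[of A H HBot p] by (auto simp: Let_def)
  obtain n where "hha (tctx n) H (h_inst (HVar y) p)" using assms[OF y(1)] by (auto simp: hh_def)
  from hha_ren[OF this y(4)] show ?thesis unfolding hh_def y(2,3) by (blast intro: hha.H_AllI)
qed

lemma hh_ExE:
  assumes "hh H (HEx A p)" "\<And>y. tau y = A \<Longrightarrow> hh (h_inst (HVar y) p # H) q"
  shows "hh H q"
proof -
  obtain y where y: "tau y = A" "h_ren (\<lambda>k. if k = y then 0 else Suc k) (h_inst (HVar y) p) = p"
     "map (h_ren (\<lambda>k. if k = y then 0 else Suc k)) H = map h_lift H"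
     "h_ren (\<lambda>k. if k = y then 0 else Suc k) q = h_lift q"
     "\<And>n. ren_into (\<lambda>k. if k = y then 0 else Suc k) (tctx n) (A # tctx n)"
    using h_fresh_var[of A H q p] by (auto simp: Let_def)
  obtain n where n: "\<forall>m\<ge>n. hha (tctx m) (h_inst (HVar y) p # H) q" using hhD[OF assms(2)[OF y(1)]] by blast
  obtain n' where n': "\<forall>m\<ge>n'. hha (tctx m) H (HEx A p)" using hhD[OF assms(1)] by blast
  let ?m = "max n n'"
  have "hha (A # tctx ?m) (p # map h_lift H) (h_lift q)"
    using hha_ren[OF n[rule_format, of ?m] y(5)] y(2-4) by simp
  then have "hha (tctx ?m) H q" by (intro hha.H_ExE[OF n'[rule_format, of ?m]]) simp_all
  then show ?thesis by (auto simp: hh_def)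
qed

lemma ht_default: "\<exists>t. h_has_type G t A"
proof (induction A)
  case (HPow A)
  show ?case by (rule exI[of _ "HCompr A HBot"]) (intro h_has_type.intros)
qed (auto intro: h_has_type.intros)

text \<open>Every type has a term in every context, by \<open>ht_default\<close>. Hence the context
  is emptied variable by variable: generalise over the variable, which the empty list of hypotheses
  permits, and instantiate again. A closed formula is unaffected.\<close>

lemma hha_closed:
  assumes "hh [] p" "\<And>f. h_sub f p = p"
  shows "hha [] [] p"
proof -
  have "hha G [] p \<Longrightarrow> hha [] [] p" for G
  proof (induction G)
    case (Cons A G)
    obtain t where t: "h_has_type G t A" using ht_default by blast
    have "hha G [] (HAll A p)" using Cons.prems by (auto intro: hha.H_AllI)
    from hha.H_AllE[OF this t] show ?case using Cons.IH by (simp add: assms(2))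
  qed simp
  then show ?thesis using assms(1) by (auto simp: hh_def)
qed

section \<open>Families of higher-order expressions and their typing\<close>

abbreviation hv :: "nat \<Rightarrow> hexp" where "hv y \<equiv> (\<lambda>m. HVar (y + m))"
abbreviation hb :: "nat \<Rightarrow> hexp" where "hb i \<equiv> (\<lambda>m. HVar (m - Suc i))"

text \<open>Compound terms are substituted here, and weakening is required besides instantiation.
  Hence there are separate depths \<open>N\<close> before and \<open>M\<close> after the
  substitution: the pair \<open>(1, 0)\<close> belongs to instantiation, \<open>(0, k)\<close> to
  weakening under \<open>k\<close> binders.\<close>

definition h_rel :: "(nat \<Rightarrow> htm) \<Rightarrow> nat \<Rightarrow> nat \<Rightarrow> nat \<Rightarrow> hexp \<Rightarrow> hexp \<Rightarrow> bool" where
  "h_rel f N M k a b \<longleftrightarrow> h_sub ((h_up ^^ k) f) (a (N + k)) = b (M + k)"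
text \<open>Characterises expressions built over global variables only: passing under
  \<open>k\<close> binders merely shifts them.\<close>

definition h_stab :: "hexp \<Rightarrow> bool" where
  "h_stab a \<longleftrightarrow> (\<forall>k. a k = h_ren (\<lambda>i. i + k) (a 0))"
text \<open>Formulated through the effect of \<open>f\<close> on stable expressions instead of
  through its values, the condition can be used directly by the simplifier for every stable
  subterm.\<close>

definition h_keeps :: "(nat \<Rightarrow> htm) \<Rightarrow> nat \<Rightarrow> nat \<Rightarrow> bool" where
  "h_keeps f N M \<longleftrightarrow> (\<forall>a k. h_stab a \<longrightarrow> h_rel f N M k a a)"
definition h_fam :: "(hexp \<Rightarrow> hexp) \<Rightarrow> bool" where
  "h_fam F \<longleftrightarrow> (\<forall>f N M k x x'. h_keeps f N M \<longrightarrow> (\<forall>j\<ge>k. h_rel f N M j x x') \<longrightarrow>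
     h_rel f N M k (F x) (F x'))"

named_theorems hrel

text \<open>The first \<open>N\<close> indices belong to the bound variables, whose images are
  unrestricted. On the global variables above them \<open>f\<close> has to act as the passage from
  depth \<open>N\<close> to depth \<open>M\<close>.\<close>

lemma h_keepsI:
  assumes f: "\<And>i. f (i + N) = HVar (i + M)"
  shows "h_keeps f N M"
proof -
  have up: "(h_up ^^ k) f (i + (N + k)) = HVar (i + (M + k))" for i k
    using f[of i] by (simp add: h_up_pow add.assoc[symmetric])
  show ?thesis
    unfolding h_keeps_def
  proof (intro allI impI)
    fix a k assume "h_stab a"
    then have "a (N + k) = h_ren (\<lambda>i. i + (N + k)) (a 0)" "a (M + k) = h_ren (\<lambda>i. i + (M + k)) (a 0)"
      unfolding h_stab_def by blast+
    then show "h_rel f N M k a a"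
      unfolding h_rel_def by (simp only: h_sub_ren comp_def up h_ren_eq_sub[of "\<lambda>i. i + (M + k)"])
  qed
qed

lemma h_stabI: "(\<And>f N M. h_keeps f N M \<Longrightarrow> h_rel f N M 0 a a) \<Longrightarrow> h_stab a"
  unfolding h_stab_def
proof
  fix k assume *: "\<And>f N M. h_keeps f N M \<Longrightarrow> h_rel f N M 0 a a"
  have "h_rel (\<lambda>i. HVar (i + k)) 0 k 0 a a" by (rule *, rule h_keepsI) simp
  then show "a k = h_ren (\<lambda>i. i + k) (a 0)" by (simp add: h_rel_def h_ren_eq_sub)
qed

text \<open>Levels count binders from the outside, so a binder inside the expression keeps its
  distance from the base depth when \<open>N\<close> becomes \<open>M\<close>. The equation
  expresses this without subtraction, which suits the simplifier.\<close>

lemma h_rel_hb [hrel]: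
  assumes "N \<le> i" "i < N + k" "i + M = i' + N"
  shows "h_rel f N M k (hb i) (hb i')"
proof -
  have "N + k - Suc i < k" "N + k - Suc i = M + k - Suc i'" using assms by auto
  then show ?thesis by (simp add: h_rel_def h_up_pow)
qed

lemma h_rel_rules [hrel]:
  "h_rel f N M k h_star h_star" "h_rel f N M k h_zero h_zero" "h_rel f N M k h_bot h_bot"
  "h_rel f N M k a a' \<Longrightarrow> h_rel f N M k (h_suc a) (h_suc a')"
  "h_rel f N M k a a' \<Longrightarrow> h_rel f N M k b b' \<Longrightarrow> h_rel f N M k (h_pair a b) (h_pair a' b')"
  "h_rel f N M k a a' \<Longrightarrow> h_rel f N M k b b' \<Longrightarrow> h_rel f N M k (a \<in>\<^sub>h b) (a' \<in>\<^sub>h b')"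
  "h_rel f N M k a a' \<Longrightarrow> h_rel f N M k b b' \<Longrightarrow> h_rel f N M k (a =\<^sub>h b) (a' =\<^sub>h b')"
  "h_rel f N M k a a' \<Longrightarrow> h_rel f N M k b b' \<Longrightarrow> h_rel f N M k (a \<and>\<^sub>h b) (a' \<and>\<^sub>h b')"
  "h_rel f N M k a a' \<Longrightarrow> h_rel f N M k b b' \<Longrightarrow> h_rel f N M k (a \<or>\<^sub>h b) (a' \<or>\<^sub>h b')"
  "h_rel f N M k a a' \<Longrightarrow> h_rel f N M k b b' \<Longrightarrow> h_rel f N M k (a \<longrightarrow>\<^sub>h b) (a' \<longrightarrow>\<^sub>h b')"
  "h_rel f N M (Suc k) (P (hb (N + k))) (P' (hb (M + k))) \<Longrightarrow> h_rel f N M k (h_all A P) (h_all A P')"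
  "h_rel f N M (Suc k) (P (hb (N + k))) (P' (hb (M + k))) \<Longrightarrow> h_rel f N M k (h_ex A P) (h_ex A P')"
  "h_rel f N M (Suc k) (P (hb (N + k))) (P' (hb (M + k))) \<Longrightarrow> h_rel f N M k (h_compr A P) (h_compr A P')"
  by (simp_all add: h_rel_def h_star_def h_zero_def h_bot_def h_suc_def h_pair_def h_mem_def h_eq_def h_and_def
      h_or_def h_imp_def h_all_def h_ex_def h_compr_def)

lemmas [hrel] = h_fam_def h_keeps_def h_iff_def h_not_def h_ball_def h_sub_eq_def h_all_subsets_def
  h_none_def h_sing_def h_union_def h_cov_def h_covs_def h_down_def h_pseudocompl_def h_formal_space_def
  h_nontrivial_def h_boolean_space_def h_less_def h_finitely_listed_def h_compact_space_def

lemma h_fam_rel: "h_fam F \<Longrightarrow> h_keeps f N M \<Longrightarrow> (\<And>j. j \<ge> k \<Longrightarrow> h_rel f N M j x x') \<Longrightarrow> h_rel f N M k (F x) (F x')"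
  by (auto simp: h_fam_def)

lemma h_stab_rules [hrel]:
  "h_stab h_star" "h_stab h_zero" "h_stab h_bot"
  "h_stab a \<Longrightarrow> h_stab (h_suc a)"
  "h_stab a \<Longrightarrow> h_stab b \<Longrightarrow> h_stab (h_pair a b)"
  "h_stab a \<Longrightarrow> h_stab b \<Longrightarrow> h_stab (a \<in>\<^sub>h b)"
  "h_stab a \<Longrightarrow> h_stab b \<Longrightarrow> h_stab (a =\<^sub>h b)"
  "h_stab a \<Longrightarrow> h_stab b \<Longrightarrow> h_stab (a \<and>\<^sub>h b)"
  "h_stab a \<Longrightarrow> h_stab b \<Longrightarrow> h_stab (a \<or>\<^sub>h b)"
  "h_stab a \<Longrightarrow> h_stab b \<Longrightarrow> h_stab (a \<longrightarrow>\<^sub>h b)"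
  by (auto intro!: h_stabI h_rel_rules simp: h_keeps_def)

lemma h_stab_binder [hrel]:
  assumes "h_fam P"
  shows "h_stab (h_all A P)" "h_stab (h_ex A P)" "h_stab (h_compr A P)"
proof -
  have "h_rel f N M (Suc 0) (P (hb (N + 0))) (P (hb (M + 0)))" if "h_keeps f N M" for f N M
    by (rule h_fam_rel[OF assms that]) (simp add: hrel)
  note * = this[simplified]
  show "h_stab (h_all A P)" "h_stab (h_ex A P)" "h_stab (h_compr A P)"
    by (rule h_stabI, rule h_rel_rules, simp add: *)+
qed

lemma h_stab_hv [hrel]: "h_stab (hv y)"
  by (simp add: h_stab_def)

text \<open>Replaces de Bruijn instantiation in the quantifier and comprehension rules by
  application of the family, for any stable expression \<open>e\<close>.\<close>

lemma h_fam_inst: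
  assumes "h_fam P" "h_stab e"
  shows "h_inst (e 0) (P (hb 0) (Suc 0)) = P e 0"
proof -
  have "h_keeps (case_nat (e 0) HVar) (Suc 0) 0" by (rule h_keepsI) simp
  moreover have "h_rel (case_nat (e 0) HVar) (Suc 0) 0 j (hb 0) e" for j
    using assms(2)[unfolded h_stab_def, rule_format, of j, symmetric] by (simp add: h_rel_def h_up_pow)
  ultimately have "h_rel (case_nat (e 0) HVar) (Suc 0) 0 0 (P (hb 0)) (P e)"
    using h_fam_rel[OF assms(1)] by blast
  then show ?thesis by (simp add: h_rel_def)
qed

definition wt :: "hexp \<Rightarrow> hty \<Rightarrow> bool" where
  "wt e A \<longleftrightarrow> h_stab e \<and> ht (e 0) A"

text \<open>It suffices to test the family on variables: one variable of type \<open>A\<close> is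
  fresh for the body, and renaming it back types the body under its binder, as in
  \<open>ht_binder\<close>.\<close>

definition wt_fam :: "hty \<Rightarrow> (hexp \<Rightarrow> hexp) \<Rightarrow> hty \<Rightarrow> bool" where
  "wt_fam A P B \<longleftrightarrow> h_fam P \<and> (\<forall>y. wt (hv y) A \<longrightarrow> wt (P (hv y)) B)"

lemma wt_stab: "wt e A \<Longrightarrow> h_stab e"
  by (simp add: wt_def)

lemma wt_famI: "h_fam P \<Longrightarrow> (\<And>y. wt (hv y) A \<Longrightarrow> wt (P (hv y)) B) \<Longrightarrow> wt_fam A P B"
  by (simp add: wt_fam_def)

lemma wt_fam_fam: "wt_fam A P B \<Longrightarrow> h_fam P"
  by (simp add: wt_fam_def)

lemma wt_hv: "tau y = A \<Longrightarrow> wt (hv y) A"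
  unfolding wt_def ht_def
  by (intro conjI h_stab_hv exI[of _ "Suc y"])
    (use h_has_type.intros(1)[of y "tctx (Suc y)"] in \<open>simp add: tctx_def del: upt_Suc\<close>)

lemma wt_fam_binder:
  assumes "wt_fam A P B"
  shows "\<exists>n. \<forall>m\<ge>n. h_has_type (A # tctx m) (P (hb 0) (Suc 0)) B"
proof (rule ht_binder)
  fix y assume "tau y = A"
  then have "wt (hv y) A" by (rule wt_hv)
  then have "ht (P (hv y) 0) B" using assms unfolding wt_fam_def wt_def by blast
  then show "ht (h_inst (HVar y) (P (hb 0) (Suc 0))) B"
    using h_fam_inst[OF wt_fam_fam[OF assms] h_stab_hv[of y]] by simp
qed

lemma ht2: "ht a A \<Longrightarrow> ht b B \<Longrightarrow> \<exists>n. h_has_type (tctx n) a A \<and> h_has_type (tctx n) b B"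
  by (meson htD nle_le order_refl)

lemma ht_rules:
  "ht HStar HOne" "ht HZero HNat" "ht HBot HOmega"
  "ht a HNat \<Longrightarrow> ht (HSuc a) HNat"
  "ht a A \<Longrightarrow> ht b B \<Longrightarrow> ht (HPair a b) (HProd A B)"
  "ht a A \<Longrightarrow> ht b (HPow A) \<Longrightarrow> ht (HMem a b) HOmega"
  "ht a A \<Longrightarrow> ht b A \<Longrightarrow> ht (HEq a b) HOmega"
  "ht p HOmega \<Longrightarrow> ht q HOmega \<Longrightarrow> ht (HAnd p q) HOmega"
  "ht p HOmega \<Longrightarrow> ht q HOmega \<Longrightarrow> ht (HOr p q) HOmega"
  "ht p HOmega \<Longrightarrow> ht q HOmega \<Longrightarrow> ht (HImp p q) HOmega"
proof -
  have ht2E: P if "ht a A" "ht b B" "\<And>n. h_has_type (tctx n) a A \<Longrightarrow> h_has_type (tctx n) b B \<Longrightarrow> P" for a b A B P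
    using ht2[OF that(1,2)] that(3) by blast
  show "ht HStar HOne" "ht HZero HNat" "ht HBot HOmega" "ht a HNat \<Longrightarrow> ht (HSuc a) HNat"
    by (auto simp: ht_def intro: h_has_type.intros)
  show "ht a A \<Longrightarrow> ht b B \<Longrightarrow> ht (HPair a b) (HProd A B)"
    by (erule (1) ht2E) (unfold ht_def, rule exI, rule h_has_type.intros)
  show "ht a A \<Longrightarrow> ht b (HPow A) \<Longrightarrow> ht (HMem a b) HOmega"
    by (erule (1) ht2E) (unfold ht_def, rule exI, rule h_has_type.intros)
  show "ht a A \<Longrightarrow> ht b A \<Longrightarrow> ht (HEq a b) HOmega"
    by (erule (1) ht2E) (unfold ht_def, rule exI, rule h_has_type.intros)
  show "ht p HOmega \<Longrightarrow> ht q HOmega \<Longrightarrow> ht (HAnd p q) HOmega"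
    by (erule (1) ht2E) (unfold ht_def, rule exI, rule h_has_type.intros)
  show "ht p HOmega \<Longrightarrow> ht q HOmega \<Longrightarrow> ht (HOr p q) HOmega"
    by (erule (1) ht2E) (unfold ht_def, rule exI, rule h_has_type.intros)
  show "ht p HOmega \<Longrightarrow> ht q HOmega \<Longrightarrow> ht (HImp p q) HOmega"
    by (erule (1) ht2E) (unfold ht_def, rule exI, rule h_has_type.intros)
qed

lemma wt_rules:
  "wt h_star HOne" "wt h_zero HNat" "wt h_bot HOmega"
  "wt a HNat \<Longrightarrow> wt (h_suc a) HNat"
  "wt a A \<Longrightarrow> wt b B \<Longrightarrow> wt (h_pair a b) (HProd A B)"
  "wt a A \<Longrightarrow> wt b (HPow A) \<Longrightarrow> wt (a \<in>\<^sub>h b) HOmega"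
  "wt a A \<Longrightarrow> wt b A \<Longrightarrow> wt (a =\<^sub>h b) HOmega"
  "wt p HOmega \<Longrightarrow> wt q HOmega \<Longrightarrow> wt (p \<and>\<^sub>h q) HOmega"
  "wt p HOmega \<Longrightarrow> wt q HOmega \<Longrightarrow> wt (p \<or>\<^sub>h q) HOmega"
  "wt p HOmega \<Longrightarrow> wt q HOmega \<Longrightarrow> wt (p \<longrightarrow>\<^sub>h q) HOmega"
  unfolding wt_def
  by (simp_all add: h_stab_rules, simp_all add: h_star_def h_zero_def h_bot_def h_suc_def h_pair_def
      h_mem_def h_eq_def h_and_def h_or_def h_imp_def ht_rules, auto intro: ht_rules)

lemma wt_binders:
  assumes "wt_fam A P HOmega"
  shows "wt (h_all A P) HOmega" "wt (h_ex A P) HOmega" "wt (h_compr A P) (HPow A)"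
proof -
  obtain n where "h_has_type (A # tctx n) (P (hb 0) (Suc 0)) HOmega" using wt_fam_binder[OF assms] by blast
  then show "wt (h_all A P) HOmega" "wt (h_ex A P) HOmega" "wt (h_compr A P) (HPow A)"
    unfolding wt_def ht_def using h_stab_binder[OF wt_fam_fam[OF assms]]
    by (auto simp: h_all_def h_ex_def h_compr_def intro: h_has_type.intros)
qed

section \<open>Derived rules for well-typed expressions\<close>

definition h_entails :: "htm list \<Rightarrow> hexp \<Rightarrow> bool" (infix "\<turnstile>" 20) where
  "(H \<turnstile> p) \<longleftrightarrow> hh H (p 0)"

lemma h_entailsD: "H \<turnstile> p \<Longrightarrow> \<exists>n. \<forall>m\<ge>n. hha (tctx m) H (p 0)"
  unfolding h_entails_def by (rule hhD)

lemma wt_D: "wt a A \<Longrightarrow> \<exists>n. \<forall>m\<ge>n. h_has_type (tctx m) (a 0) A"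
  unfolding wt_def by (blast dest: htD)

lemma h_hyp: "p 0 \<in> set H \<Longrightarrow> H \<turnstile> p"
  by (auto simp: h_entails_def hh_def intro: hha.H_Hyp)

lemma h_hd: "p 0 # H \<turnstile> p"
  by (simp add: h_hyp)

lemma h_mono: "H \<turnstile> p \<Longrightarrow> set H \<subseteq> set K \<Longrightarrow> K \<turnstile> p"
  by (auto simp: h_entails_def hh_def intro: hha_weak)

lemma h_wk: "H \<turnstile> p \<Longrightarrow> q # H \<turnstile> p"
  by (erule h_mono) auto

lemma hh2: "hh H p \<Longrightarrow> hh K q \<Longrightarrow> \<exists>n. hha (tctx n) H p \<and> hha (tctx n) K q"
  by (meson hhD nle_le order_refl)

lemma hh_ht: "hh H p \<Longrightarrow> ht t A \<Longrightarrow> \<exists>n. hha (tctx n) H p \<and> h_has_type (tctx n) t A"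
  by (meson hhD htD nle_le order_refl)

lemma h_botE: "H \<turnstile> h_bot \<Longrightarrow> wt p HOmega \<Longrightarrow> H \<turnstile> p"
  unfolding h_entails_def h_bot_def wt_def using hh_ht[of H HBot "p 0" HOmega] by (auto simp: hh_def intro: hha.H_BotE)

lemma h_andI: "H \<turnstile> p \<Longrightarrow> H \<turnstile> q \<Longrightarrow> H \<turnstile> (p \<and>\<^sub>h q)"
  and h_andE1: "H \<turnstile> (p \<and>\<^sub>h q) \<Longrightarrow> H \<turnstile> p"
  and h_andE2: "H \<turnstile> (p \<and>\<^sub>h q) \<Longrightarrow> H \<turnstile> q"
  unfolding h_entails_def h_and_def using hh2[of H "p 0" H "q 0"]
  by (auto simp: hh_def intro: hha.H_AndI hha.H_AndE1 hha.H_AndE2)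

lemma h_orI1: "H \<turnstile> p \<Longrightarrow> wt q HOmega \<Longrightarrow> H \<turnstile> (p \<or>\<^sub>h q)"
  and h_orI2: "H \<turnstile> q \<Longrightarrow> wt p HOmega \<Longrightarrow> H \<turnstile> (p \<or>\<^sub>h q)"
  unfolding h_entails_def h_or_def wt_def using hh_ht[of H "p 0" "q 0" HOmega] hh_ht[of H "q 0" "p 0" HOmega]
  by (auto simp: hh_def intro: hha.H_OrI1 hha.H_OrI2)

text \<open>The three derivations may come with different context lengths. Each is available from
  some length on, so the maximum serves all of them; the other rules with several premises proceed
  likewise.\<close>

lemma h_orE:
  assumes "H \<turnstile> (p \<or>\<^sub>h q)" "p 0 # H \<turnstile> r" "q 0 # H \<turnstile> r"
  shows "H \<turnstile> r"
proof -
  obtain a b c where "\<forall>m\<ge>a. hha (tctx m) H (HOr (p 0) (q 0))" "\<forall>m\<ge>b. hha (tctx m) (p 0 # H) (r 0)"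
    "\<forall>m\<ge>c. hha (tctx m) (q 0 # H) (r 0)"
    using assms[unfolded h_entails_def, THEN hhD] by (auto simp: h_or_def)
  then have "hha (tctx (max a (max b c))) H (r 0)" by (auto intro: hha.H_OrE[of _ _ "p 0" "q 0"])
  then show ?thesis by (auto simp: h_entails_def hh_def)
qed

lemma h_impI: "p 0 # H \<turnstile> q \<Longrightarrow> wt p HOmega \<Longrightarrow> H \<turnstile> (p \<longrightarrow>\<^sub>h q)"
  unfolding h_entails_def h_imp_def wt_def using hh_ht[of "p 0 # H" "q 0" "p 0" HOmega]
  by (auto simp: hh_def intro: hha.H_ImpI)

lemma h_impE: "H \<turnstile> (p \<longrightarrow>\<^sub>h q) \<Longrightarrow> H \<turnstile> p \<Longrightarrow> H \<turnstile> q"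
  unfolding h_entails_def h_imp_def using hh2[of H "HImp (p 0) (q 0)" H "p 0"]
  by (auto simp: hh_def intro: hha.H_ImpE)

lemma h_iffE1: "H \<turnstile> (p \<longleftrightarrow>\<^sub>h q) \<Longrightarrow> H \<turnstile> p \<Longrightarrow> H \<turnstile> q"
  and h_iffE2: "H \<turnstile> (p \<longleftrightarrow>\<^sub>h q) \<Longrightarrow> H \<turnstile> q \<Longrightarrow> H \<turnstile> p"
  unfolding h_iff_def by (auto intro: h_andE1 h_andE2 h_impE)

lemma h_notI: "p 0 # H \<turnstile> h_bot \<Longrightarrow> wt p HOmega \<Longrightarrow> H \<turnstile> (\<not>\<^sub>h p)"
  and h_notE: "H \<turnstile> (\<not>\<^sub>h p) \<Longrightarrow> H \<turnstile> p \<Longrightarrow> wt q HOmega \<Longrightarrow> H \<turnstile> q"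
  unfolding h_not_def by (auto intro: h_impI h_impE h_botE)

lemma h_allI:
  assumes "h_fam P" "\<And>y. wt (hv y) A \<Longrightarrow> H \<turnstile> P (hv y)"
  shows "H \<turnstile> h_all A P"
  unfolding h_entails_def h_all_def
proof (rule hh_AllI)
  fix y assume "tau y = A"
  from assms(2)[OF wt_hv[OF this]] show "hh H (h_inst (HVar y) (P (hb 0) (Suc 0)))"
    using h_fam_inst[OF assms(1) h_stab_hv[of y]] by (simp add: h_entails_def)
qed

lemma h_allE:
  assumes "H \<turnstile> h_all A P" "h_fam P" "wt a A"
  shows "H \<turnstile> P a"
proof -
  obtain n where "hha (tctx n) H (HAll A (P (hb 0) (Suc 0)))" "h_has_type (tctx n) (a 0) A"
    using hh_ht[of H "h_all A P 0" "a 0" A] assms(1,3) by (auto simp: h_entails_def wt_def h_all_def)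
  from hha.H_AllE[OF this] show ?thesis
    using h_fam_inst[OF assms(2) wt_stab[OF assms(3)]] by (auto simp: h_entails_def hh_def)
qed

lemma h_exI:
  assumes "H \<turnstile> P a" "wt_fam A P HOmega" "wt a A"
  shows "H \<turnstile> h_ex A P"
proof -
  obtain n where n: "\<forall>m\<ge>n. h_has_type (A # tctx m) (P (hb 0) (Suc 0)) HOmega" using wt_fam_binder[OF assms(2)] by blast
  obtain n' where n': "\<forall>m\<ge>n'. hha (tctx m) H (P a 0)" using h_entailsD[OF assms(1)] by auto
  obtain n'' where n'': "\<forall>m\<ge>n''. h_has_type (tctx m) (a 0) A" using wt_D[OF assms(3)] by auto
  let ?m = "max n (max n' n'')"
  have "hha (tctx ?m) H (HEx A (P (hb 0) (Suc 0)))"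
    by (rule hha.H_ExI[of _ _ _ "a 0"])
      (use n n' n'' h_fam_inst[OF wt_fam_fam[OF assms(2)] wt_stab[OF assms(3)]] in simp_all)
  then show ?thesis by (auto simp: h_entails_def hh_def h_ex_def)
qed

lemma h_exE:
  assumes "H \<turnstile> h_ex A P" "h_fam P" "\<And>y. wt (hv y) A \<Longrightarrow> P (hv y) 0 # H \<turnstile> q"
  shows "H \<turnstile> q"
  unfolding h_entails_def
proof (rule hh_ExE[OF assms(1)[unfolded h_entails_def h_ex_def]])
  fix y assume "tau y = A"
  from assms(3)[OF wt_hv[OF this]] show "hh (h_inst (HVar y) (P (hb 0) (Suc 0)) # H) (q 0)"
    using h_fam_inst[OF assms(2) h_stab_hv[of y]] by (simp add: h_entails_def)
qed

lemma h_eqI: "wt a A \<Longrightarrow> H \<turnstile> (a =\<^sub>h a)"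
  by (auto simp: h_entails_def hh_def wt_def ht_def h_eq_def intro: hha.H_EqI)

lemma h_eqE:
  assumes "H \<turnstile> (a =\<^sub>h b)" "H \<turnstile> P a" "wt_fam A P HOmega" "wt a A" "wt b A"
  shows "H \<turnstile> P b"
proof -
  obtain n where n: "\<forall>m\<ge>n. h_has_type (A # tctx m) (P (hb 0) (Suc 0)) HOmega" using wt_fam_binder[OF assms(3)] by blast
  obtain n1 where n1: "\<forall>m\<ge>n1. hha (tctx m) H (HEq (a 0) (b 0))" using h_entailsD[OF assms(1)] by (auto simp: h_eq_def)
  obtain n2 where n2: "\<forall>m\<ge>n2. hha (tctx m) H (P a 0)" using h_entailsD[OF assms(2)] by auto
  obtain n3 where n3: "\<forall>m\<ge>n3. h_has_type (tctx m) (a 0) A" using wt_D[OF assms(4)] by auto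
  obtain n4 where n4: "\<forall>m\<ge>n4. h_has_type (tctx m) (b 0) A" using wt_D[OF assms(5)] by auto
  let ?m = "n + n1 + n2 + n3 + n4"
  note i = h_fam_inst[OF wt_fam_fam[OF assms(3)]]
  have "hha (tctx ?m) H (h_inst (b 0) (P (hb 0) (Suc 0)))"
    by (rule hha.H_EqE[of A _ _ "a 0"])
      (use n n1 n2 n3 n4 i[OF wt_stab[OF assms(4)]] in simp_all)
  then show ?thesis using i[OF wt_stab[OF assms(5)]] by (auto simp: h_entails_def hh_def)
qed

lemma h_comprI:
  assumes "H \<turnstile> P a" "wt_fam A P HOmega" "wt a A"
  shows "H \<turnstile> (a \<in>\<^sub>h h_compr A P)"
proof -
  obtain n where n: "\<forall>m\<ge>n. h_has_type (A # tctx m) (P (hb 0) (Suc 0)) HOmega" using wt_fam_binder[OF assms(2)] by blast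
  obtain n' where n': "\<forall>m\<ge>n'. hha (tctx m) H (P a 0)" using h_entailsD[OF assms(1)] by auto
  obtain n'' where n'': "\<forall>m\<ge>n''. h_has_type (tctx m) (a 0) A" using wt_D[OF assms(3)] by auto
  let ?m = "max n (max n' n'')"
  have "hha (tctx ?m) H (HMem (a 0) (HCompr A (P (hb 0) (Suc 0))))"
    by (rule hha.H_ComprI)
      (use n n' n'' h_fam_inst[OF wt_fam_fam[OF assms(2)] wt_stab[OF assms(3)]] in simp_all)
  then show ?thesis by (auto simp: h_entails_def hh_def h_mem_def h_compr_def)
qed

lemma h_comprE:
  assumes "H \<turnstile> (a \<in>\<^sub>h h_compr A P)" "wt_fam A P HOmega" "wt a A"
  shows "H \<turnstile> P a"
proof -
  obtain n where n: "\<forall>m\<ge>n. h_has_type (A # tctx m) (P (hb 0) (Suc 0)) HOmega" using wt_fam_binder[OF assms(2)] by blast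
  obtain n' where n': "\<forall>m\<ge>n'. hha (tctx m) H (HMem (a 0) (HCompr A (P (hb 0) (Suc 0))))"
    using h_entailsD[OF assms(1)] by (auto simp: h_mem_def h_compr_def)
  obtain n'' where n'': "\<forall>m\<ge>n''. h_has_type (tctx m) (a 0) A" using wt_D[OF assms(3)] by auto
  let ?m = "max n (max n' n'')"
  have "hha (tctx ?m) H (h_inst (a 0) (P (hb 0) (Suc 0)))"
    by (rule hha.H_ComprE[of A]) (use n n' n'' in simp_all)
  then show ?thesis
    using h_fam_inst[OF wt_fam_fam[OF assms(2)] wt_stab[OF assms(3)]] by (auto simp: h_entails_def hh_def)
qed

lemma h_ax: "p 0 \<in> HHA_axioms \<Longrightarrow> H \<turnstile> p"
  by (auto simp: h_entails_def hh_def intro: hha.H_Ax)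

named_theorems wts

text \<open>The rules mirror the term formers, so typing goals are solved by repeated resolution.
  The compatibility conditions that remain at binders are left to simplification with
  \<open>hrel\<close>.\<close>

lemmas [wts] = wt_rules wt_binders wt_famI

lemma wt_iff [wts]: "wt p HOmega \<Longrightarrow> wt q HOmega \<Longrightarrow> wt (p \<longleftrightarrow>\<^sub>h q) HOmega"
  and wt_not [wts]: "wt p HOmega \<Longrightarrow> wt (\<not>\<^sub>h p) HOmega"
  unfolding h_iff_def h_not_def by (assumption | rule wts  | (simp add: hrel; fail))+

lemma wt_less [wts]:
  assumes "wt i HNat" "wt n HNat"
  shows "wt (h_less i n) HOmega"
  unfolding h_less_def
  by (assumption | rule wts assms | (simp add: hrel assms[THEN wt_stab]; fail))+

lemma wt_ball [wts]:
  assumes "wt S (HPow A)" "wt_fam A P HOmega"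
  shows "wt (h_ball A S P) HOmega"
  unfolding h_ball_def
proof (intro wts)
  show "h_fam (\<lambda>x. x \<in>\<^sub>h S \<longrightarrow>\<^sub>h P x)"
    using wt_fam_fam[OF assms(2)] by (simp add: hrel assms(1)[THEN wt_stab])
  fix y assume "wt (hv y) A"
  then show "wt (hv y) A" "wt (P (hv y)) HOmega" using assms(2) by (simp_all add: wt_fam_def)
qed (rule assms(1))

lemma h_ballI:
  assumes "wt S (HPow A)" "h_fam P" "\<And>y. wt (hv y) A \<Longrightarrow> (hv y \<in>\<^sub>h S) 0 # H \<turnstile> P (hv y)"
  shows "H \<turnstile> h_ball A S P"
  unfolding h_ball_def
proof (intro h_allI h_impI)
  show "h_fam (\<lambda>x. x \<in>\<^sub>h S \<longrightarrow>\<^sub>h P x)" using assms(2) by (simp add: hrel assms(1)[THEN wt_stab])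
  show "wt (hv y \<in>\<^sub>h S) HOmega" if "wt (hv y) A" for y
    by (rule wts that assms(1))+
qed (rule assms(3))

lemma h_ballE:
  assumes "H \<turnstile> h_ball A S P" "h_fam P" "wt S (HPow A)" "wt a A" "H \<turnstile> (a \<in>\<^sub>h S)"
  shows "H \<turnstile> P a"
proof -
  have "h_fam (\<lambda>x. x \<in>\<^sub>h S \<longrightarrow>\<^sub>h P x)" using assms(2) by (simp add: hrel assms(3)[THEN wt_stab])
  then show ?thesis using h_allE[OF assms(1)[unfolded h_ball_def] _ assms(4)] assms(5) by (blast intro: h_impE)
qed

lemma h_eq_sym: "H \<turnstile> (a =\<^sub>h b) \<Longrightarrow> wt a A \<Longrightarrow> wt b A \<Longrightarrow> H \<turnstile> (b =\<^sub>h a)"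
proof (rule h_eqE[where P = "\<lambda>z. z =\<^sub>h a"])
  assume a: "wt a A"
  show "H \<turnstile> (a =\<^sub>h a)" by (rule h_eqI[OF a])
  show "wt_fam A (\<lambda>z. z =\<^sub>h a) HOmega" by (assumption | rule wts a | (simp add: hrel a[THEN wt_stab]; fail))+
qed

section \<open>Natural numbers, order and finite choice in HHA\<close>

lemma h_nat_induct:
  assumes Q: "wt_fam HNat Q HOmega" and n: "wt n HNat" and zero: "H \<turnstile> Q h_zero"
    and suc: "\<And>y. wt (hv y) HNat \<Longrightarrow> Q (hv y) 0 # H \<turnstile> Q (h_suc (hv y))"
  shows "H \<turnstile> Q n"
proof -
  let ?X = "h_compr HNat Q"
  have X: "wt ?X (HPow HNat)" by (intro wts Q)
  have Qw: "wt (Q (hv y)) HOmega" if "wt (hv y) HNat" for y using Q that by (simp add: wt_fam_def)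
  have "H \<turnstile> h_all (HPow HNat) (\<lambda>u.
        h_zero \<in>\<^sub>h u \<and>\<^sub>h h_all HNat (\<lambda>x. x \<in>\<^sub>h u \<longrightarrow>\<^sub>h h_suc x \<in>\<^sub>h u) \<longrightarrow>\<^sub>h
        h_all HNat (\<lambda>x. x \<in>\<^sub>h u))"
    by (rule h_ax) (simp add: HHA_axioms_def)
  then have "H \<turnstile> (h_zero \<in>\<^sub>h ?X \<and>\<^sub>h h_all HNat (\<lambda>x. x \<in>\<^sub>h ?X \<longrightarrow>\<^sub>h h_suc x \<in>\<^sub>h ?X) \<longrightarrow>\<^sub>h
        h_all HNat (\<lambda>x. x \<in>\<^sub>h ?X))"
    by (rule h_allE[OF _ _ X]) (simp add: hrel)
  moreover have "H \<turnstile> (h_zero \<in>\<^sub>h ?X)" by (rule h_comprI[OF zero Q]) (intro wts)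
  moreover have "H \<turnstile> h_all HNat (\<lambda>x. x \<in>\<^sub>h ?X \<longrightarrow>\<^sub>h h_suc x \<in>\<^sub>h ?X)"
  proof (intro h_allI h_impI)
    fix y assume y: "wt (hv y) HNat"
    let ?H = "(hv y \<in>\<^sub>h ?X) 0 # H"
    have "?H \<turnstile> Q (hv y)" by (rule h_comprE[OF h_hd Q y])
    moreover have "H \<turnstile> (Q (hv y) \<longrightarrow>\<^sub>h Q (h_suc (hv y)))" by (rule h_impI[OF suc[OF y] Qw[OF y]])
    ultimately have "?H \<turnstile> Q (h_suc (hv y))" by (blast intro: h_impE h_wk)
    then show "?H \<turnstile> (h_suc (hv y) \<in>\<^sub>h ?X)" by (rule h_comprI[OF _ Q]) (intro wts y)
    show "wt (hv y \<in>\<^sub>h ?X) HOmega" by (rule wts X y Q)+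
  qed (simp add: hrel X[THEN wt_stab])
  ultimately have "H \<turnstile> h_all HNat (\<lambda>x. x \<in>\<^sub>h ?X)" by (blast intro: h_impE h_andI)
  then have "H \<turnstile> (n \<in>\<^sub>h ?X)" by (rule h_allE[OF _ _ n]) (simp add: hrel X[THEN wt_stab])
  then show ?thesis by (rule h_comprE[OF _ Q n])
qed

text \<open>\<open>h_less\<close> is a second-order definition: the closure of \<open>i + 1\<close>
  under successor. Facts about it result from choosing a set to instantiate it with, here the
  comprehension of \<open>Q\<close>.\<close>

lemma less_set:
  assumes "H \<turnstile> h_less i n" "wt i HNat" "wt n HNat" "wt_fam HNat Q HOmega" "H \<turnstile> Q (h_suc i)"
    "\<And>y. wt (hv y) HNat \<Longrightarrow> Q (hv y) 0 # H \<turnstile> Q (h_suc (hv y))"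
  shows "H \<turnstile> Q n"
proof -
  let ?X = "h_compr HNat Q"
  note Q = assms(4)
  have X: "wt ?X (HPow HNat)" by (intro wts Q)
  have Qw: "wt (Q (hv y)) HOmega" if "wt (hv y) HNat" for y using Q that by (simp add: wt_fam_def)
  have "H \<turnstile> (h_suc i \<in>\<^sub>h ?X \<and>\<^sub>h h_all HNat (\<lambda>m. m \<in>\<^sub>h ?X \<longrightarrow>\<^sub>h h_suc m \<in>\<^sub>h ?X) \<longrightarrow>\<^sub>h n \<in>\<^sub>h ?X)"
    using assms(1) unfolding h_less_def by (rule h_allE[OF _ _ X]) (simp add: hrel assms(2,3)[THEN wt_stab])
  moreover have "H \<turnstile> (h_suc i \<in>\<^sub>h ?X)" by (rule h_comprI[OF assms(5) Q]) (intro wts assms)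
  moreover have "H \<turnstile> h_all HNat (\<lambda>x. x \<in>\<^sub>h ?X \<longrightarrow>\<^sub>h h_suc x \<in>\<^sub>h ?X)"
  proof (intro h_allI h_impI)
    fix y assume y: "wt (hv y) HNat"
    let ?H = "(hv y \<in>\<^sub>h ?X) 0 # H"
    have "?H \<turnstile> Q (hv y)" by (rule h_comprE[OF h_hd Q y])
    moreover have "H \<turnstile> (Q (hv y) \<longrightarrow>\<^sub>h Q (h_suc (hv y)))" by (rule h_impI[OF assms(6)[OF y] Qw[OF y]])
    ultimately have "?H \<turnstile> Q (h_suc (hv y))" by (blast intro: h_impE h_wk)
    then show "?H \<turnstile> (h_suc (hv y) \<in>\<^sub>h ?X)" by (rule h_comprI[OF _ Q]) (intro wts y)
    show "wt (hv y \<in>\<^sub>h ?X) HOmega" by (rule wts X y Q)+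
  qed (simp add: hrel X[THEN wt_stab])
  ultimately have "H \<turnstile> (n \<in>\<^sub>h ?X)" by (blast intro: h_impE h_andI)
  then show ?thesis by (rule h_comprE[OF _ Q assms(3)])
qed

lemma less_sucI:
  assumes i: "wt i HNat" and n: "wt n HNat"
  shows "H \<turnstile> h_less i (h_suc i)" "H \<turnstile> h_less i n \<Longrightarrow> H \<turnstile> h_less i (h_suc n)"
proof -
  let ?P = "\<lambda>X. h_suc i \<in>\<^sub>h X \<and>\<^sub>h h_all HNat (\<lambda>m. m \<in>\<^sub>h X \<longrightarrow>\<^sub>h h_suc m \<in>\<^sub>h X)"
  have P: "wt (?P X) HOmega" if "wt X (HPow HNat)" for X
    by (assumption | rule wts i that | (simp add: hrel i[THEN wt_stab] that[THEN wt_stab]; fail))+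
  show "H \<turnstile> h_less i (h_suc i)"
    unfolding h_less_def
    by (intro h_allI h_impI P) (auto intro: h_andE1[OF h_hd] simp: hrel i[THEN wt_stab])
  assume l: "H \<turnstile> h_less i n"
  show "H \<turnstile> h_less i (h_suc n)"
    unfolding h_less_def
  proof (intro h_allI h_impI P)
    fix y assume y: "wt (hv y) (HPow HNat)"
    let ?H = "?P (hv y) 0 # H"
    have "?H \<turnstile> (?P (hv y) \<longrightarrow>\<^sub>h n \<in>\<^sub>h hv y)"
      using h_wk[OF l] unfolding h_less_def by (rule h_allE[OF _ _ y]) (simp add: hrel i[THEN wt_stab] n[THEN wt_stab])
    then have "?H \<turnstile> (n \<in>\<^sub>h hv y)" by (rule h_impE[OF _ h_hd])
    moreover have "?H \<turnstile> (n \<in>\<^sub>h hv y \<longrightarrow>\<^sub>h h_suc n \<in>\<^sub>h hv y)"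
      by (rule h_allE[OF h_andE2[OF h_hd] _ n]) (simp add: hrel)
    ultimately show "?H \<turnstile> (h_suc n \<in>\<^sub>h hv y)" by (blast intro: h_impE)
  qed (simp_all add: hrel i[THEN wt_stab] n[THEN wt_stab])
qed

lemma suc_not_zero: "wt n HNat \<Longrightarrow> H \<turnstile> (\<not>\<^sub>h h_suc n =\<^sub>h h_zero)"
proof -
  assume n: "wt n HNat"
  have "H \<turnstile> h_all HNat (\<lambda>x. \<not>\<^sub>h h_suc x =\<^sub>h h_zero)" by (rule h_ax) (simp add: HHA_axioms_def)
  then show ?thesis by (rule h_allE[OF _ _ n]) (simp add: hrel)
qed

lemma suc_inject:
  assumes a: "wt a HNat" and b: "wt b HNat" and e: "H \<turnstile> (h_suc a =\<^sub>h h_suc b)"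
  shows "H \<turnstile> (a =\<^sub>h b)"
proof -
  have "H \<turnstile> h_all HNat (\<lambda>x. h_all HNat (\<lambda>y. h_suc x =\<^sub>h h_suc y \<longrightarrow>\<^sub>h x =\<^sub>h y))"
    by (rule h_ax) (simp add: HHA_axioms_def)
  then have "H \<turnstile> h_all HNat (\<lambda>y. h_suc a =\<^sub>h h_suc y \<longrightarrow>\<^sub>h a =\<^sub>h y)"
    by (rule h_allE[OF _ _ a]) (simp add: hrel)
  then have "H \<turnstile> (h_suc a =\<^sub>h h_suc b \<longrightarrow>\<^sub>h a =\<^sub>h b)"
    by (rule h_allE[OF _ _ b]) (simp add: hrel a[THEN wt_stab])
  then show ?thesis using e by (rule h_impE)
qed

text \<open>The nonzero numbers contain \<open>i + 1\<close> and are closed under successor, so they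
  would contain zero.\<close>

lemma not_less_zero:
  assumes i: "wt i HNat" and l: "H \<turnstile> h_less i h_zero" and p: "wt p HOmega"
  shows "H \<turnstile> p"
proof -
  have "H \<turnstile> (\<not>\<^sub>h h_zero =\<^sub>h h_zero)"
    by (rule less_set[OF l i, where Q = "\<lambda>k. \<not>\<^sub>h k =\<^sub>h h_zero"])
      (assumption | rule wts suc_not_zero i | (simp add: hrel; fail))+
  then show ?thesis by (rule h_notE[OF _ h_eqI p]) (rule wts)
qed

text \<open>The set \<open>?Q\<close> consists of the successors of numbers \<open>j\<close> with
  \<open>i \<le> j\<close>. It contains \<open>i + 1\<close> with witness \<open>i\<close>. If
  \<open>y\<close> belongs to it, then \<open>i < y\<close>, so \<open>y\<close> itself is the
  witness for \<open>y + 1\<close>. Injectivity of the successor identifies the witness for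
  \<open>n + 1\<close> with \<open>n\<close>.\<close>

lemma less_sucD:
  assumes i: "wt i HNat" and n: "wt n HNat" and l: "H \<turnstile> h_less i (h_suc n)"
  shows "H \<turnstile> (h_less i n \<or>\<^sub>h i =\<^sub>h n)"
proof -
  let ?R = "\<lambda>j. h_less i j \<or>\<^sub>h i =\<^sub>h j"
  let ?Q = "\<lambda>k. h_ex HNat (\<lambda>j. k =\<^sub>h h_suc j \<and>\<^sub>h ?R j)"
  have R: "wt (?R j) HOmega" if "wt j HNat" for j by (rule wts i that)+
  have Qf: "wt_fam HNat (\<lambda>j. k =\<^sub>h h_suc j \<and>\<^sub>h ?R j) HOmega" if "wt k HNat" for k
    by (assumption | rule wts i that | (simp add: hrel i[THEN wt_stab] that[THEN wt_stab]; fail))+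
  have Q: "wt_fam HNat ?Q HOmega"
    by (assumption | rule wts i | (simp add: hrel i[THEN wt_stab]; fail))+
  have "H \<turnstile> ?Q (h_suc n)"
  proof (rule less_set[OF l i _ Q])
    show "wt (h_suc n) HNat" by (intro wts n)
    show "H \<turnstile> ?Q (h_suc i)"
      by (rule h_exI[where a = i, OF h_andI[OF h_eqI h_orI2[OF h_eqI]] Qf i]) (rule i wts)+
    fix y assume y: "wt (hv y) HNat"
    show "?Q (hv y) 0 # H \<turnstile> ?Q (h_suc (hv y))"
    proof (rule h_exE[OF h_hd])
      show "h_fam (\<lambda>j. hv y =\<^sub>h h_suc j \<and>\<^sub>h ?R j)" by (rule wt_fam_fam[OF Qf[OF y]])
      fix j assume j: "wt (hv j) HNat"
      let ?K = "(hv y =\<^sub>h h_suc (hv j) \<and>\<^sub>h ?R (hv j)) 0 # ?Q (hv y) 0 # H"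
      have e: "?K \<turnstile> (hv y =\<^sub>h h_suc (hv j))" by (rule h_andE1[OF h_hd])
      have "?K \<turnstile> ?R (hv j)" by (rule h_andE2[OF h_hd])
      then have "?K \<turnstile> h_less i (h_suc (hv j))"
      proof (rule h_orE)
        show "h_less i (hv j) 0 # ?K \<turnstile> h_less i (h_suc (hv j))" by (rule less_sucI(2)[OF i j h_hd])
        show "(i =\<^sub>h hv j) 0 # ?K \<turnstile> h_less i (h_suc (hv j))"
          by (rule h_eqE[where P = "\<lambda>z. h_less i (h_suc z)" and a = i, OF h_hd less_sucI(1)[OF i i] _ i j])
            ((assumption | rule wts i | (simp add: hrel i[THEN wt_stab]; fail))+)
      qed
      moreover have sj: "wt (h_suc (hv j)) HNat" by (rule wts j)+
      ultimately have "?K \<turnstile> h_less i (hv y)"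
        by (intro h_eqE[where P = "\<lambda>z. h_less i z", OF h_eq_sym[OF e y sj] _ _ sj y])
          ((assumption | rule wts i j y | (simp add: hrel i[THEN wt_stab] j[THEN wt_stab] y[THEN wt_stab]; fail))+)
      then have r: "?K \<turnstile> ?R (hv y)" by (rule h_orI1) (rule wts i y)+
      show "?K \<turnstile> ?Q (h_suc (hv y))"
        by (rule h_exI[where a = "hv y", OF h_andI[OF h_eqI r] Qf y]) (rule wts y)+
    qed
  qed
  then show ?thesis
  proof (rule h_exE)
    show "h_fam (\<lambda>j. h_suc n =\<^sub>h h_suc j \<and>\<^sub>h ?R j)" by (rule wt_fam_fam[OF Qf]) (intro wts n)
    fix j assume j: "wt (hv j) HNat"
    let ?K = "(h_suc n =\<^sub>h h_suc (hv j) \<and>\<^sub>h ?R (hv j)) 0 # H"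
    have "?K \<turnstile> (hv j =\<^sub>h n)" by (rule h_eq_sym[OF suc_inject[OF n j h_andE1[OF h_hd]] n j])
    then show "?K \<turnstile> ?R n"
      by (rule h_eqE[where P = ?R, OF _ h_andE2[OF h_hd] _ j n])
        ((assumption | rule wts i | (simp add: hrel i[THEN wt_stab]; fail))+)
  qed
qed

lemma wt_famD: "wt_fam A P B \<Longrightarrow> wt (hv y) A \<Longrightarrow> wt (P (hv y)) B"
  by (simp add: wt_fam_def)

text \<open>The induction of \<open>omega_choice\<close> on numbers: \<open>not_less_zero\<close>
  makes the base case vacuous, and \<open>less_sucD\<close> splits off the last index.\<close>

lemma nat_choice:
  assumes q: "wt q HOmega" and B: "wt_fam HNat B HOmega" and n: "wt n HNat"
    and p: "H \<turnstile> h_all HNat (\<lambda>i. h_less i n \<longrightarrow>\<^sub>h q \<or>\<^sub>h B i)"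
  shows "H \<turnstile> (q \<or>\<^sub>h h_all HNat (\<lambda>i. h_less i n \<longrightarrow>\<^sub>h B i))"
proof -
  let ?P = "\<lambda>n. h_all HNat (\<lambda>i. h_less i n \<longrightarrow>\<^sub>h q \<or>\<^sub>h B i)"
  let ?R = "\<lambda>n. h_all HNat (\<lambda>i. h_less i n \<longrightarrow>\<^sub>h B i)"
  note Bf = wt_fam_fam[OF B] and Bw = wt_famD[OF B]
  have wP: "wt (?P n) HOmega" and wR: "wt (?R n) HOmega" if n: "wt n HNat" for n
    by (assumption | rule wts n q Bw | (insert Bf, simp add: hrel n[THEN wt_stab] q[THEN wt_stab]; fail))+
  have fP: "h_fam (\<lambda>i. h_less i n \<longrightarrow>\<^sub>h q \<or>\<^sub>h B i)" and fR: "h_fam (\<lambda>i. h_less i n \<longrightarrow>\<^sub>h B i)" if n: "wt n HNat" for n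
    by (insert Bf, simp_all add: hrel n[THEN wt_stab] q[THEN wt_stab])
  have "H \<turnstile> (?P n \<longrightarrow>\<^sub>h q \<or>\<^sub>h ?R n)"
  proof (rule h_nat_induct[OF _ n])
    show "wt_fam HNat (\<lambda>n. ?P n \<longrightarrow>\<^sub>h q \<or>\<^sub>h ?R n) HOmega"
      by (assumption | rule wts q Bw | (insert Bf, simp add: hrel q[THEN wt_stab]; fail))+
    have z: "wt h_zero HNat" by (rule wts)
    show "H \<turnstile> (?P h_zero \<longrightarrow>\<^sub>h q \<or>\<^sub>h ?R h_zero)"
    proof (rule h_impI[OF h_orI2[OF h_allI[OF fR[OF z] h_impI] q] wP[OF z]])
      fix i assume i: "wt (hv i) HNat"
      show "h_less (hv i) h_zero 0 # ?P h_zero 0 # H \<turnstile> B (hv i)"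
        by (rule not_less_zero[OF i h_hd Bw[OF i]])
      show "wt (h_less (hv i) h_zero) HOmega" by (rule wts i)+
    qed
    fix y assume y: "wt (hv y) HNat"
    have sy: "wt (h_suc (hv y)) HNat" by (rule wts y)+
    let ?H = "?P (h_suc (hv y)) 0 # (?P (hv y) \<longrightarrow>\<^sub>h q \<or>\<^sub>h ?R (hv y)) 0 # H"
    have Pu: "K \<turnstile> (q \<or>\<^sub>h B i)" if "set ?H \<subseteq> set K" "wt i HNat" "K \<turnstile> h_less i (h_suc (hv y))" for K i
    proof -
      have "K \<turnstile> ?P (h_suc (hv y))" by (rule h_hyp) (use that(1) in auto)
      then have "K \<turnstile> (h_less i (h_suc (hv y)) \<longrightarrow>\<^sub>h q \<or>\<^sub>h B i)" by (rule h_allE[OF _ fP[OF sy] that(2)])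
      then show ?thesis using that(3) by (rule h_impE)
    qed
    have "?H \<turnstile> ?P (hv y)"
    proof (rule h_allI[OF fP[OF y] h_impI])
      fix i assume i: "wt (hv i) HNat"
      show "h_less (hv i) (hv y) 0 # ?H \<turnstile> (q \<or>\<^sub>h B (hv i))"
        by (rule Pu[OF _ i less_sucI(2)[OF i y h_hd]]) auto
      show "wt (h_less (hv i) (hv y)) HOmega" by (rule wts i y)+
    qed
    moreover have "?H \<turnstile> (?P (hv y) \<longrightarrow>\<^sub>h q \<or>\<^sub>h ?R (hv y))" by (rule h_hyp) simp
    ultimately have "?H \<turnstile> (q \<or>\<^sub>h ?R (hv y))" by (blast intro: h_impE)
    then have "?H \<turnstile> (q \<or>\<^sub>h ?R (h_suc (hv y)))"
    proof (rule h_orE)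
      show "q 0 # ?H \<turnstile> (q \<or>\<^sub>h ?R (h_suc (hv y)))" by (rule h_orI1[OF h_hd wR[OF sy]])
      let ?K = "?R (hv y) 0 # ?H"
      have "?K \<turnstile> (q \<or>\<^sub>h B (hv y))"
        by (rule Pu[OF _ y less_sucI(1)[OF y y]]) auto
      then show "?K \<turnstile> (q \<or>\<^sub>h ?R (h_suc (hv y)))"
      proof (rule h_orE)
        show "q 0 # ?K \<turnstile> (q \<or>\<^sub>h ?R (h_suc (hv y)))" by (rule h_orI1[OF h_hd wR[OF sy]])
        show "B (hv y) 0 # ?K \<turnstile> (q \<or>\<^sub>h ?R (h_suc (hv y)))"
        proof (rule h_orI2[OF h_allI[OF fR[OF sy] h_impI] q])
          fix i assume i: "wt (hv i) HNat"
          let ?L = "h_less (hv i) (h_suc (hv y)) 0 # B (hv y) 0 # ?K"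
          show "wt (h_less (hv i) (h_suc (hv y))) HOmega" by (rule wts i y)+
          have "?L \<turnstile> (h_less (hv i) (hv y) \<or>\<^sub>h hv i =\<^sub>h hv y)" by (rule less_sucD[OF i y h_hd])
          then show "?L \<turnstile> B (hv i)"
          proof (rule h_orE)
            let ?M = "h_less (hv i) (hv y) 0 # ?L"
            have "?M \<turnstile> ?R (hv y)" by (rule h_hyp) simp
            then have "?M \<turnstile> (h_less (hv i) (hv y) \<longrightarrow>\<^sub>h B (hv i))" by (rule h_allE[OF _ fR[OF y] i])
            then show "?M \<turnstile> B (hv i)" by (rule h_impE[OF _ h_hd])
            show "(hv i =\<^sub>h hv y) 0 # ?L \<turnstile> B (hv i)"
              by (rule h_eqE[OF h_eq_sym[OF h_hd i y] _ B y i]) (rule h_hyp, simp)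
          qed
        qed
      qed
    qed
    then show "(?P (hv y) \<longrightarrow>\<^sub>h q \<or>\<^sub>h ?R (hv y)) 0 # H \<turnstile> (?P (h_suc (hv y)) \<longrightarrow>\<^sub>h q \<or>\<^sub>h ?R (h_suc (hv y)))"
      by (rule h_impI[OF _ wP[OF sy]])
  qed
  then show ?thesis using p by (rule h_impE)
qed

lemma h_finitely_listed_choice:
  assumes q: "wt q HOmega" and D: "wt_fam A D HOmega" and u: "wt u (HPow A)"
    and l: "H \<turnstile> h_finitely_listed A u"
    and dec: "\<And>x. wt (hv x) A \<Longrightarrow> (hv x \<in>\<^sub>h u) 0 # H \<turnstile> (q \<or>\<^sub>h D (hv x))"
  shows "H \<turnstile> (q \<or>\<^sub>h h_ball A u D)" (is "_ \<turnstile> ?G")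
  using l unfolding h_finitely_listed_def
proof (rule h_exE)
  note Df = wt_fam_fam[OF D] and Dw = wt_famD[OF D]
  let ?fun = "\<lambda>n f. h_all HNat (\<lambda>i. h_less i n \<longrightarrow>\<^sub>h
         h_ex A (\<lambda>x. h_pair i x \<in>\<^sub>h f \<and>\<^sub>h h_all A (\<lambda>y. h_pair i y \<in>\<^sub>h f \<longrightarrow>\<^sub>h y =\<^sub>h x)))"
  let ?ran = "\<lambda>n f. h_all A (\<lambda>x. x \<in>\<^sub>h u \<longleftrightarrow>\<^sub>h h_ex HNat (\<lambda>i. h_less i n \<and>\<^sub>h h_pair i x \<in>\<^sub>h f))"
  let ?F = "HPow (HProd HNat A)"
  show "h_fam (\<lambda>n. h_ex ?F (\<lambda>f. ?fun n f \<and>\<^sub>h ?ran n f))" by (simp add: hrel u[THEN wt_stab])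
  fix n assume n: "wt (hv n) HNat"
  let ?H1 = "h_ex ?F (\<lambda>f. ?fun (hv n) f \<and>\<^sub>h ?ran (hv n) f) 0 # H"
  show "?H1 \<turnstile> ?G"
  proof (rule h_exE[OF h_hd])
    show "h_fam (\<lambda>f. ?fun (hv n) f \<and>\<^sub>h ?ran (hv n) f)" by (simp add: hrel u[THEN wt_stab])
    fix f assume f: "wt (hv f) ?F"
    let ?H = "(?fun (hv n) (hv f) \<and>\<^sub>h ?ran (hv n) (hv f)) 0 # ?H1"
    have fn: "?H \<turnstile> (h_less i (hv n) \<longrightarrow>\<^sub>h
         h_ex A (\<lambda>x. h_pair i x \<in>\<^sub>h hv f \<and>\<^sub>h h_all A (\<lambda>y. h_pair i y \<in>\<^sub>h hv f \<longrightarrow>\<^sub>h y =\<^sub>h x)))" if "wt i HNat" for i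
      by (rule h_allE[OF h_andE1[OF h_hd] _ that]) (simp add: hrel)
    have ran: "?H \<turnstile> (x \<in>\<^sub>h u \<longleftrightarrow>\<^sub>h h_ex HNat (\<lambda>i. h_less i (hv n) \<and>\<^sub>h h_pair i x \<in>\<^sub>h hv f))" if "wt x A" for x
      by (rule h_allE[OF h_andE2[OF h_hd] _ that]) (simp add: hrel u[THEN wt_stab])
    have wran: "wt_fam HNat (\<lambda>i. h_less i (hv n) \<and>\<^sub>h h_pair i x \<in>\<^sub>h hv f) HOmega" if x: "wt x A" for x
      by (assumption | rule wts n x f | (simp add: hrel n[THEN wt_stab] x[THEN wt_stab] f[THEN wt_stab]; fail))+
    \<comment> \<open>The sequence is a relation, so the predicate ranges over all values at
      \<open>i\<close>; below \<open>n\<close> the relation is functional, which reduces them to a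
      single one.\<close>
    define B where "B = (\<lambda>i. h_all A (\<lambda>x. h_pair i x \<in>\<^sub>h hv f \<longrightarrow>\<^sub>h D x))"
    have B: "wt_fam HNat B HOmega"
      unfolding B_def by (assumption | rule wts f Dw | (insert Df, simp add: hrel f[THEN wt_stab]; fail))+
    have fB: "h_fam (\<lambda>x. h_pair i x \<in>\<^sub>h hv f \<longrightarrow>\<^sub>h D x)" if "wt i HNat" for i
      by (insert Df, simp add: hrel that[THEN wt_stab])
    note Bf = wt_fam_fam[OF B] and Bw = wt_famD[OF B]
    have wB: "wt (h_all HNat (\<lambda>i. h_less i (hv n) \<longrightarrow>\<^sub>h B i)) HOmega"
      by (assumption | rule wts n Bw | (insert Bf, simp add: hrel n[THEN wt_stab]; fail))+
    have wG: "wt (h_ball A u D) HOmega" by (rule wts u D)+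
    have "?H \<turnstile> h_all HNat (\<lambda>i. h_less i (hv n) \<longrightarrow>\<^sub>h q \<or>\<^sub>h B i)"
    proof (rule h_allI[OF _ h_impI])
      show "h_fam (\<lambda>i. h_less i (hv n) \<longrightarrow>\<^sub>h q \<or>\<^sub>h B i)"
        by (insert Bf, simp add: hrel q[THEN wt_stab])
      fix i assume i: "wt (hv i) HNat"
      show "wt (h_less (hv i) (hv n)) HOmega" by (rule wts i n)+
      let ?K = "h_less (hv i) (hv n) 0 # ?H"
      have "?K \<turnstile> h_ex A (\<lambda>x. h_pair (hv i) x \<in>\<^sub>h hv f \<and>\<^sub>h h_all A (\<lambda>y. h_pair (hv i) y \<in>\<^sub>h hv f \<longrightarrow>\<^sub>h y =\<^sub>h x))"
        by (rule h_impE[OF h_wk[OF fn[OF i]] h_hd])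
      then show "?K \<turnstile> (q \<or>\<^sub>h B (hv i))"
      proof (rule h_exE)
        show "h_fam (\<lambda>x. h_pair (hv i) x \<in>\<^sub>h hv f \<and>\<^sub>h h_all A (\<lambda>y. h_pair (hv i) y \<in>\<^sub>h hv f \<longrightarrow>\<^sub>h y =\<^sub>h x))"
          by (simp add: hrel)
        fix x assume x: "wt (hv x) A"
        let ?L = "(h_pair (hv i) (hv x) \<in>\<^sub>h hv f \<and>\<^sub>h h_all A (\<lambda>y. h_pair (hv i) y \<in>\<^sub>h hv f \<longrightarrow>\<^sub>h y =\<^sub>h hv x)) 0 # ?K"
        have ix: "?L \<turnstile> (h_pair (hv i) (hv x) \<in>\<^sub>h hv f)" by (rule h_andE1[OF h_hd])
        have uniq: "?L \<turnstile> (h_pair (hv i) y \<in>\<^sub>h hv f \<longrightarrow>\<^sub>h y =\<^sub>h hv x)" if "wt y A" for y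
          by (rule h_allE[OF h_andE2[OF h_hd] _ that]) (simp add: hrel)
        have "?L \<turnstile> h_ex HNat (\<lambda>i. h_less i (hv n) \<and>\<^sub>h h_pair i (hv x) \<in>\<^sub>h hv f)"
          by (rule h_exI[OF h_andI[OF h_hyp ix] wran[OF x] i]) simp
        note h_iffE2[OF h_mono[OF ran[OF x]] this]
        then have xl: "?L \<turnstile> (hv x \<in>\<^sub>h u)" by auto
        have "H \<turnstile> (hv x \<in>\<^sub>h u \<longrightarrow>\<^sub>h q \<or>\<^sub>h D (hv x))"
          by (rule h_impI, rule dec[OF x]) (rule wts x u)+
        then have "?L \<turnstile> (hv x \<in>\<^sub>h u \<longrightarrow>\<^sub>h q \<or>\<^sub>h D (hv x))" by (rule h_mono) auto
        then have "?L \<turnstile> (q \<or>\<^sub>h D (hv x))" using xl by (rule h_impE)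
        then show "?L \<turnstile> (q \<or>\<^sub>h B (hv i))"
        proof (rule h_orE)
          show "q 0 # ?L \<turnstile> (q \<or>\<^sub>h B (hv i))" by (rule h_orI1[OF h_hd Bw[OF i]])
          have "D (hv x) 0 # ?L \<turnstile> B (hv i)"
            unfolding B_def
          proof (rule h_allI[OF fB[OF i] h_impI])
            fix y assume y: "wt (hv y) A"
            show "wt (h_pair (hv i) (hv y) \<in>\<^sub>h hv f) HOmega" by (rule wts i y f)+
            let ?M = "(h_pair (hv i) (hv y) \<in>\<^sub>h hv f) 0 # D (hv x) 0 # ?L"
            have "?M \<turnstile> (hv y =\<^sub>h hv x)"
              by (rule h_impE[OF h_mono[OF uniq[OF y]] h_hd]) auto
            then show "?M \<turnstile> D (hv y)"
              by (rule h_eqE[OF h_eq_sym[OF _ y x] h_hyp D x y]) simp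
          qed
          then show "D (hv x) 0 # ?L \<turnstile> (q \<or>\<^sub>h B (hv i))" by (rule h_orI2[OF _ q])
        qed
      qed
    qed
    from nat_choice[OF q B n this]
    show "?H \<turnstile> ?G"
    proof (rule h_orE)
      show "q 0 # ?H \<turnstile> ?G" by (rule h_orI1[OF h_hd wG])
      let ?K = "h_all HNat (\<lambda>i. h_less i (hv n) \<longrightarrow>\<^sub>h B i) 0 # ?H"
      show "?K \<turnstile> ?G"
      proof (rule h_orI2[OF h_ballI[OF u Df] q])
        fix x assume x: "wt (hv x) A"
        let ?L = "(hv x \<in>\<^sub>h u) 0 # ?K"
        have "?L \<turnstile> h_ex HNat (\<lambda>i. h_less i (hv n) \<and>\<^sub>h h_pair i (hv x) \<in>\<^sub>h hv f)"
          by (rule h_iffE1[OF h_mono[OF ran[OF x]] h_hd]) auto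
        then show "?L \<turnstile> D (hv x)"
        proof (rule h_exE)
          show "h_fam (\<lambda>i. h_less i (hv n) \<and>\<^sub>h h_pair i (hv x) \<in>\<^sub>h hv f)" by (simp add: hrel)
          fix i assume i: "wt (hv i) HNat"
          let ?M = "(h_less (hv i) (hv n) \<and>\<^sub>h h_pair (hv i) (hv x) \<in>\<^sub>h hv f) 0 # ?L"
          have "?M \<turnstile> h_all HNat (\<lambda>i. h_less i (hv n) \<longrightarrow>\<^sub>h B i)" by (rule h_hyp) simp
          then have "?M \<turnstile> (h_less (hv i) (hv n) \<longrightarrow>\<^sub>h B (hv i))"
            by (rule h_allE[OF _ _ i]) (insert Bf, simp add: hrel)
          then have "?M \<turnstile> B (hv i)" by (rule h_impE[OF _ h_andE1[OF h_hd]])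
          then have "?M \<turnstile> (h_pair (hv i) (hv x) \<in>\<^sub>h hv f \<longrightarrow>\<^sub>h D (hv x))"
            unfolding B_def by (rule h_allE[OF _ fB[OF i] x])
          then show "?M \<turnstile> D (hv x)" by (rule h_impE[OF _ h_andE2[OF h_hd]])
        qed
      qed
    qed
  qed
qed

section \<open>Formal spaces in HHA\<close>

locale hha_space =
  fixes A :: hty and S C :: hexp
  assumes wt_S: "wt S (HPow A)" and wt_C: "wt C (HPow (HProd A (HPow A)))"
begin

lemmas [wts] = wt_S wt_C
lemmas [hrel] = wt_S[THEN wt_stab] wt_C[THEN wt_stab]

lemma wt_none [wts]: "wt (h_none A) (HPow A)"
  unfolding h_none_def by (assumption | rule wts | (simp add: hrel; fail))+

lemma wt_sing [wts]: assumes "wt a A" shows "wt (h_sing A a) (HPow A)"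
  unfolding h_sing_def by (assumption | rule wts assms | (simp add: hrel assms[THEN wt_stab]; fail))+

lemma wt_union [wts]: assumes "wt U (HPow A)" "wt V (HPow A)" shows "wt (h_union A U V) (HPow A)"
  unfolding h_union_def by (assumption | rule wts assms | (simp add: hrel assms[THEN wt_stab]; fail))+

lemma wt_sub_eq [wts]: assumes "wt U (HPow A)" "wt V (HPow A)" shows "wt (h_sub_eq A U V) HOmega"
  unfolding h_sub_eq_def by (assumption | rule wts assms | (simp add: hrel assms[THEN wt_stab]; fail))+

lemma wt_cov [wts]: assumes "wt a A" "wt U (HPow A)" shows "wt (h_cov C a U) HOmega"
  unfolding h_cov_def by (assumption | rule wts assms | (simp add: hrel assms[THEN wt_stab]; fail))+

lemma wt_covs [wts]: assumes "wt U (HPow A)" "wt V (HPow A)" shows "wt (h_covs A C U V) HOmega"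
  unfolding h_covs_def by (assumption | rule wts assms | (simp add: hrel assms[THEN wt_stab]; fail))+

text \<open>The body is typed apart from the comprehension, because \<open>h_comprI\<close> and
  \<open>h_comprE\<close> ask for exactly this when membership is introduced or unfolded.\<close>

lemma wt_down_body:
  assumes "wt U (HPow A)" "wt V (HPow A)"
  shows "wt_fam A (\<lambda>d. d \<in>\<^sub>h S \<and>\<^sub>h
     h_ex A (\<lambda>u. u \<in>\<^sub>h U \<and>\<^sub>h h_cov C d (h_sing A u)) \<and>\<^sub>h
     h_ex A (\<lambda>v. v \<in>\<^sub>h V \<and>\<^sub>h h_cov C d (h_sing A v))) HOmega"
  by (assumption | rule wts assms | (simp add: hrel assms[THEN wt_stab]; fail))+

lemma wt_down [wts]: "wt U (HPow A) \<Longrightarrow> wt V (HPow A) \<Longrightarrow> wt (h_down A S C U V) (HPow A)"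
  unfolding h_down_def by (rule wts wt_down_body | assumption)+

lemma wt_compl_body:
  assumes "wt U (HPow A)"
  shows "wt_fam A (\<lambda>a. a \<in>\<^sub>h S \<and>\<^sub>h h_covs A C (h_down A S C (h_sing A a) U) (h_none A)) HOmega"
  by (assumption | rule wts assms | (simp add: hrel assms[THEN wt_stab]; fail))+

lemma wt_pseudocompl [wts]: "wt U (HPow A) \<Longrightarrow> wt (h_pseudocompl A S C U) (HPow A)"
  unfolding h_pseudocompl_def by (rule wts wt_compl_body | assumption)+

lemma sub_eqE:
  assumes "H \<turnstile> h_sub_eq A U V" "wt U (HPow A)" "wt V (HPow A)" "wt a A" "H \<turnstile> (a \<in>\<^sub>h U)"
  shows "H \<turnstile> (a \<in>\<^sub>h V)"
  using assms(1) unfolding h_sub_eq_def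
  by (rule h_ballE[OF _ _ assms(2,4,5)]) (simp add: hrel assms(3)[THEN wt_stab])

lemma sub_eqI:
  assumes "wt U (HPow A)" "wt V (HPow A)" "\<And>x. wt (hv x) A \<Longrightarrow> (hv x \<in>\<^sub>h U) 0 # H \<turnstile> (hv x \<in>\<^sub>h V)"
  shows "H \<turnstile> h_sub_eq A U V"
  unfolding h_sub_eq_def
  by (rule h_ballI[OF assms(1) _ assms(3)]) (simp_all add: hrel assms(2)[THEN wt_stab])

lemma covsE:
  assumes "H \<turnstile> h_covs A C U V" "wt U (HPow A)" "wt V (HPow A)" "wt a A" "H \<turnstile> (a \<in>\<^sub>h U)"
  shows "H \<turnstile> h_cov C a V"
  using assms(1) unfolding h_covs_def
  by (rule h_ballE[OF _ _ assms(2,4,5)]) (simp add: hrel assms(3)[THEN wt_stab])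

lemma covsI:
  assumes "wt U (HPow A)" "wt V (HPow A)" "\<And>x. wt (hv x) A \<Longrightarrow> (hv x \<in>\<^sub>h U) 0 # H \<turnstile> h_cov C (hv x) V"
  shows "H \<turnstile> h_covs A C U V"
  unfolding h_covs_def
  by (rule h_ballI[OF assms(1) _ assms(3)]) (simp_all add: hrel assms(2)[THEN wt_stab])

lemma all_subsetsE:
  assumes "H \<turnstile> h_all_subsets A S P" "h_fam P" "wt U (HPow A)" "H \<turnstile> h_sub_eq A U S"
  shows "H \<turnstile> P U"
proof -
  have "H \<turnstile> (h_sub_eq A U S \<longrightarrow>\<^sub>h P U)"
    using assms(1) unfolding h_all_subsets_def
    by (rule h_allE[OF _ _ assms(3)]) (insert assms(2), simp add: hrel)
  then show ?thesis using assms(4) by (rule h_impE)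
qed

lemma reflexivity:
  assumes "H \<turnstile> h_formal_space A S C" and a: "wt a A" and U: "wt U (HPow A)"
    and "H \<turnstile> (a \<in>\<^sub>h S)" "H \<turnstile> h_sub_eq A U S" "H \<turnstile> (a \<in>\<^sub>h U)"
  shows "H \<turnstile> h_cov C a U"
proof -
  note [hrel] = a[THEN wt_stab] U[THEN wt_stab]
  have "H \<turnstile> h_all_subsets A S (\<lambda>U. a \<in>\<^sub>h U \<longrightarrow>\<^sub>h h_cov C a U)"
    using h_andE1[OF assms(1)[unfolded h_formal_space_def]]
    by (rule h_ballE[OF _ _ wt_S a assms(4)]) (simp add: hrel)
  then have "H \<turnstile> (a \<in>\<^sub>h U \<longrightarrow>\<^sub>h h_cov C a U)"
    by (rule all_subsetsE[OF _ _ U assms(5)]) (simp add: hrel)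
  then show ?thesis using assms(6) by (rule h_impE)
qed

lemma transitivity:
  assumes "H \<turnstile> h_formal_space A S C" and a: "wt a A" and U: "wt U (HPow A)" and V: "wt V (HPow A)"
    and "H \<turnstile> (a \<in>\<^sub>h S)" "H \<turnstile> h_sub_eq A U S" "H \<turnstile> h_sub_eq A V S" "H \<turnstile> h_cov C a U" "H \<turnstile> h_covs A C U V"
  shows "H \<turnstile> h_cov C a V"
proof -
  note [hrel] = a[THEN wt_stab] U[THEN wt_stab] V[THEN wt_stab]
  have "H \<turnstile> h_all_subsets A S (\<lambda>U. h_all_subsets A S (\<lambda>V.
        h_cov C a U \<and>\<^sub>h h_covs A C U V \<longrightarrow>\<^sub>h h_cov C a V))"
    using h_andE1[OF h_andE2[OF assms(1)[unfolded h_formal_space_def]]]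
    by (rule h_ballE[OF _ _ wt_S a assms(5)]) (simp add: hrel)
  then have "H \<turnstile> h_all_subsets A S (\<lambda>V. h_cov C a U \<and>\<^sub>h h_covs A C U V \<longrightarrow>\<^sub>h h_cov C a V)"
    by (rule all_subsetsE[OF _ _ U assms(6)]) (simp add: hrel)
  then have "H \<turnstile> (h_cov C a U \<and>\<^sub>h h_covs A C U V \<longrightarrow>\<^sub>h h_cov C a V)"
    by (rule all_subsetsE[OF _ _ V assms(7)]) (simp add: hrel)
  then show ?thesis using h_andI[OF assms(8,9)] by (rule h_impE)
qed

lemma cov_sing:
  assumes "H \<turnstile> h_formal_space A S C" and a: "wt a A" and "H \<turnstile> (a \<in>\<^sub>h S)"
  shows "H \<turnstile> (a \<in>\<^sub>h h_sing A a)" "H \<turnstile> h_cov C a (h_sing A a)"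
proof -
  have f: "wt_fam A (\<lambda>x. x =\<^sub>h a) HOmega" by (assumption | rule wts a | (simp add: hrel a[THEN wt_stab]; fail))+
  show 1: "H \<turnstile> (a \<in>\<^sub>h h_sing A a)"
    unfolding h_sing_def by (rule h_comprI[OF h_eqI f a]) (rule a)
  have sa: "wt (h_sing A a) (HPow A)" by (rule wts a)+
  have "H \<turnstile> h_sub_eq A (h_sing A a) S"
  proof (rule sub_eqI[OF sa wt_S])
    fix x assume x: "wt (hv x) A"
    let ?K = "(hv x \<in>\<^sub>h h_sing A a) 0 # H"
    have "?K \<turnstile> (hv x \<in>\<^sub>h h_sing A a)" by (rule h_hd)
    then have "?K \<turnstile> (hv x =\<^sub>h a)" unfolding h_sing_def by (rule h_comprE[OF _ f x])
    then show "?K \<turnstile> (hv x \<in>\<^sub>h S)"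
      by (rule h_eqE[where P = "\<lambda>z. z \<in>\<^sub>h S", OF h_eq_sym[OF _ x a] h_wk[OF assms(3)] _ a x])
        ((assumption | rule wts | (simp add: hrel; fail))+)
  qed
  then show "H \<turnstile> h_cov C a (h_sing A a)" by (rule reflexivity[OF assms(1) a sa assms(3) _ 1])
qed

lemma pseudocompl_cov:
  assumes "H \<turnstile> h_formal_space A S C" and a: "wt a A" and U: "wt U (HPow A)"
    and N: "H \<turnstile> (a \<in>\<^sub>h h_pseudocompl A S C U)" and aU: "H \<turnstile> (a \<in>\<^sub>h U)"
  shows "H \<turnstile> (a \<in>\<^sub>h S)" "H \<turnstile> h_cov C a (h_none A)"
proof -
  note [hrel] = a[THEN wt_stab] U[THEN wt_stab]
  note N' = h_comprE[OF N[unfolded h_pseudocompl_def] wt_compl_body[OF U] a]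
  show S: "H \<turnstile> (a \<in>\<^sub>h S)" by (rule h_andE1[OF N'])
  have c: "H \<turnstile> h_covs A C (h_down A S C (h_sing A a) U) (h_none A)" by (rule h_andE2[OF N'])
  note s = cov_sing[OF assms(1) a S]
  have sa: "wt (h_sing A a) (HPow A)" by (rule wts a)+
  \<comment> \<open>Both existential conjuncts of \<open>h_down\<close> are instances of this, once
    for the singleton and once for \<open>U\<close>, with \<open>a\<close> itself as the
    witness.\<close>
  have half: "H \<turnstile> h_ex A (\<lambda>u. u \<in>\<^sub>h V \<and>\<^sub>h h_cov C a (h_sing A u))" if V: "wt V (HPow A)" "H \<turnstile> (a \<in>\<^sub>h V)" for V
    by (rule h_exI[where P = "\<lambda>u. u \<in>\<^sub>h V \<and>\<^sub>h h_cov C a (h_sing A u)", OF h_andI[OF that(2) s(2)] _ a]) ((assumption | rule wts that(1) a | (simp add: hrel that(1)[THEN wt_stab] a[THEN wt_stab]; fail))+)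
  have d: "H \<turnstile> (a \<in>\<^sub>h h_down A S C (h_sing A a) U)"
    unfolding h_down_def
    by (rule h_comprI[OF h_andI[OF S h_andI[OF half[OF sa s(1)] half[OF U aU]]] wt_down_body[OF sa U] a])
  show "H \<turnstile> h_cov C a (h_none A)"
    by (rule covsE[OF c _ wt_none a d]) (rule wts sa U)+
qed

lemma in_union_E:
  assumes "H \<turnstile> (a \<in>\<^sub>h h_union A U V)" "wt a A" and U: "wt U (HPow A)" and V: "wt V (HPow A)"
  shows "H \<turnstile> (a \<in>\<^sub>h U \<or>\<^sub>h a \<in>\<^sub>h V)"
  using assms(1) unfolding h_union_def by (rule h_comprE[OF _ _ assms(2)]) ((assumption | rule wts U V | (simp add: hrel U[THEN wt_stab] V[THEN wt_stab]; fail))+)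

lemma in_pseudocompl:
  assumes "H \<turnstile> (a \<in>\<^sub>h h_pseudocompl A S C U)" "wt a A" "wt U (HPow A)"
  shows "H \<turnstile> (a \<in>\<^sub>h S)"
  using h_comprE[OF assms(1)[unfolded h_pseudocompl_def] wt_compl_body[OF assms(3)] assms(2)] by (rule h_andE1)

text \<open>Comprehension makes \<open>U\<close>, its pseudocomplement and their union terms of
  power type outright, so compactness applies to the union without a detour through
  collection.\<close>

lemma compact_boolean_decides:
  assumes FS: "H \<turnstile> h_formal_space A S C" and NT: "H \<turnstile> h_nontrivial A S C"
    and BO: "H \<turnstile> h_boolean_space A S C" and CO: "H \<turnstile> h_compact_space A S C"
    and q: "wt q HOmega"
  shows "H \<turnstile> (q \<or>\<^sub>h \<not>\<^sub>h q)" (is "_ \<turnstile> ?G")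
proof -
  let ?U = "h_compr A (\<lambda>x. x \<in>\<^sub>h S \<and>\<^sub>h q)"
  let ?N = "h_pseudocompl A S C ?U"
  let ?W = "h_union A ?U ?N"
  have Uf: "wt_fam A (\<lambda>x. x \<in>\<^sub>h S \<and>\<^sub>h q) HOmega" by (assumption | rule wts q | (simp add: hrel q[THEN wt_stab]; fail))+
  have U: "wt ?U (HPow A)" by (rule wts Uf)+
  have N: "wt ?N (HPow A)" by (rule wts U)+
  have W: "wt ?W (HPow A)" by (rule wts U N)+
  have nq: "wt (\<not>\<^sub>h q) HOmega" by (rule wts q)+
  note [hrel] = q[THEN wt_stab] U[THEN wt_stab] W[THEN wt_stab]
  have inU: "K \<turnstile> (x \<in>\<^sub>h S \<and>\<^sub>h q)" if "K \<turnstile> (x \<in>\<^sub>h ?U)" "wt x A" for K x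
    by (rule h_comprE[OF that(1) Uf that(2)])
  have Us: "H \<turnstile> h_sub_eq A ?U S"
    by (rule sub_eqI[OF U wt_S]) (rule h_andE1[OF inU[OF h_hd]])
  have cW: "H \<turnstile> h_covs A C S ?W"
    using BO unfolding h_boolean_space_def by (rule all_subsetsE[OF _ _ U Us]) (simp add: hrel)
  have Ws: "H \<turnstile> h_sub_eq A ?W S"
  proof (rule sub_eqI[OF W wt_S])
    fix x assume x: "wt (hv x) A"
    show "(hv x \<in>\<^sub>h ?W) 0 # H \<turnstile> (hv x \<in>\<^sub>h S)"
    proof (rule h_orE[OF in_union_E[OF h_hd x U N]])
      show "(hv x \<in>\<^sub>h ?U) 0 # (hv x \<in>\<^sub>h ?W) 0 # H \<turnstile> (hv x \<in>\<^sub>h S)" by (rule h_andE1[OF inU[OF h_hd x]])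
      show "(hv x \<in>\<^sub>h ?N) 0 # (hv x \<in>\<^sub>h ?W) 0 # H \<turnstile> (hv x \<in>\<^sub>h S)" by (rule in_pseudocompl[OF h_hd x U])
    qed
  qed
  let ?L = "\<lambda>l. h_finitely_listed A l \<and>\<^sub>h h_sub_eq A l ?W \<and>\<^sub>h h_covs A C S l"
  have "H \<turnstile> (h_covs A C S ?W \<longrightarrow>\<^sub>h h_ex (HPow A) ?L)"
    using CO unfolding h_compact_space_def by (rule all_subsetsE[OF _ _ W Ws]) (simp add: hrel)
  then have "H \<turnstile> h_ex (HPow A) ?L" using cW by (rule h_impE)
  then show ?thesis
  proof (rule h_exE)
    show "h_fam ?L" by (simp add: hrel)
    fix l assume l: "wt (hv l) (HPow A)"
    let ?H = "?L (hv l) 0 # H"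
    have lW: "?H \<turnstile> h_sub_eq A (hv l) ?W" and cl: "?H \<turnstile> h_covs A C S (hv l)"
      by (rule h_andE1[OF h_andE2[OF h_hd]], rule h_andE2[OF h_andE2[OF h_hd]])
    have "?H \<turnstile> (q \<or>\<^sub>h h_ball A (hv l) (\<lambda>x. x \<in>\<^sub>h ?N))"
    proof (rule h_finitely_listed_choice[OF q _ l h_andE1[OF h_hd]])
      show "wt_fam A (\<lambda>x. x \<in>\<^sub>h ?N) HOmega" by (assumption | rule wts N | (simp add: hrel N[THEN wt_stab]; fail))+
      fix x assume x: "wt (hv x) A"
      let ?K = "(hv x \<in>\<^sub>h hv l) 0 # ?H"
      have "?K \<turnstile> (hv x \<in>\<^sub>h ?W)" by (rule sub_eqE[OF h_wk[OF lW] l W x h_hd])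
      then show "?K \<turnstile> (q \<or>\<^sub>h hv x \<in>\<^sub>h ?N)"
      proof (rule h_orE[OF in_union_E[OF _ x U N]])
        have "wt (hv x \<in>\<^sub>h ?N) HOmega" by (rule wts x N)+
        then show "(hv x \<in>\<^sub>h ?U) 0 # ?K \<turnstile> (q \<or>\<^sub>h hv x \<in>\<^sub>h ?N)"
          by (rule h_orI1[OF h_andE2[OF inU[OF h_hd x]]])
        show "(hv x \<in>\<^sub>h ?N) 0 # ?K \<turnstile> (q \<or>\<^sub>h hv x \<in>\<^sub>h ?N)" by (rule h_orI2[OF h_hd q])
      qed
    qed
    then show "?H \<turnstile> ?G"
    proof (rule h_orE)
      show "q 0 # ?H \<turnstile> ?G" by (rule h_orI1[OF h_hd nq])
      let ?H1 = "h_ball A (hv l) (\<lambda>x. x \<in>\<^sub>h ?N) 0 # ?H"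
      let ?K = "q 0 # ?H1"
      have none: "K \<turnstile> h_sub_eq A (h_none A) S" for K
      proof (rule sub_eqI[OF wt_none wt_S])
        fix x assume x: "wt (hv x) A"
        let ?M = "(hv x \<in>\<^sub>h h_none A) 0 # K"
        have "?M \<turnstile> (hv x \<in>\<^sub>h h_none A)" by (rule h_hd)
        then have "?M \<turnstile> h_bot" unfolding h_none_def by (rule h_comprE[OF _ _ x]) ((assumption | rule wts | (simp add: hrel; fail))+)
        then show "?M \<turnstile> (hv x \<in>\<^sub>h S)" by (rule h_botE) (rule wts x)+
      qed
      have ls: "?K \<turnstile> h_sub_eq A (hv l) S"
      proof (rule sub_eqI[OF l wt_S])
        fix x assume x: "wt (hv x) A"
        have "(hv x \<in>\<^sub>h hv l) 0 # ?K \<turnstile> (hv x \<in>\<^sub>h ?W)" by (rule sub_eqE[OF h_mono[OF lW] l W x h_hd]) auto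
        note sub_eqE[OF h_mono[OF Ws] W wt_S x this]
        then show "(hv x \<in>\<^sub>h hv l) 0 # ?K \<turnstile> (hv x \<in>\<^sub>h S)" by auto
      qed
      have ln: "?K \<turnstile> h_covs A C (hv l) (h_none A)"
      proof (rule covsI[OF l wt_none])
        fix x assume x: "wt (hv x) A"
        let ?M = "(hv x \<in>\<^sub>h hv l) 0 # ?K"
        have "?M \<turnstile> h_ball A (hv l) (\<lambda>x. x \<in>\<^sub>h ?N)" by (rule h_hyp) simp
        then have xN: "?M \<turnstile> (hv x \<in>\<^sub>h ?N)" by (rule h_ballE[OF _ _ l x h_hd]) (simp add: hrel)
        have "?M \<turnstile> q" by (rule h_hyp) simp
        then have "?M \<turnstile> (hv x \<in>\<^sub>h ?U)" by (rule h_comprI[OF h_andI[OF in_pseudocompl[OF xN x U]] Uf x])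
        note pseudocompl_cov(2)[OF h_mono[OF FS] x U xN this]
        then show "?M \<turnstile> h_cov C (hv x) (h_none A)" by auto
      qed
      have "?K \<turnstile> h_covs A C S (h_none A)"
      proof (rule covsI[OF wt_S wt_none])
        fix a assume a: "wt (hv a) A"
        let ?M = "(hv a \<in>\<^sub>h S) 0 # ?K"
        have "?M \<turnstile> h_cov C (hv a) (hv l)" by (rule covsE[OF h_mono[OF cl] wt_S l a h_hd]) auto
        note transitivity[OF h_mono[OF FS] a l wt_none h_hd h_wk[OF ls] none this h_wk[OF ln]]
        then show "?M \<turnstile> h_cov C (hv a) (h_none A)" by auto
      qed
      moreover have "?K \<turnstile> (\<not>\<^sub>h h_covs A C S (h_none A))"
        by (rule h_mono[OF NT[unfolded h_nontrivial_def]]) auto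
      ultimately have bot: "?K \<turnstile> h_bot" by (blast intro: h_notE wt_rules(3))
      show "?H1 \<turnstile> ?G" by (rule h_orI2[OF h_notI[OF bot q] q])
    qed
  qed
qed

lemma wt_all_subsets [wts]: "wt_fam (HPow A) P HOmega \<Longrightarrow> wt (h_all_subsets A S P) HOmega"
  unfolding h_all_subsets_def
  by (rule wts)
    (auto intro!: wt_famI wts simp: hrel dest: wt_fam_fam, auto simp: wt_fam_def)

lemma wt_finitely_listed:
  assumes "wt u (HPow A)"
  shows "wt (h_finitely_listed A u) HOmega"
  unfolding h_finitely_listed_def
  by (assumption | rule wts assms | (simp add: hrel assms[THEN wt_stab]; fail))+

text \<open>Implication introduction in HHA demands a well-typed antecedent, so the complete
  hypothesis about the space has to be type-checked, conjunct by conjunct.\<close>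

lemma wt_formal_space: "wt (h_formal_space A S C) HOmega"
  unfolding h_formal_space_def by (assumption | rule wts | (simp add: hrel; fail))+

lemma wt_nontrivial: "wt (h_nontrivial A S C) HOmega"
  unfolding h_nontrivial_def by (assumption | rule wts | (simp add: hrel; fail))+

lemma wt_boolean_space: "wt (h_boolean_space A S C) HOmega"
  unfolding h_boolean_space_def by (assumption | rule wts | (simp add: hrel; fail))+

lemma wt_compact_space: "wt (h_compact_space A S C) HOmega"
  unfolding h_compact_space_def by (assumption | rule wts wt_finitely_listed | (simp add: hrel; fail))+

end

lemma HHA_compact_boolean: "hha [] [] ((compact_boolean_HHA A \<longrightarrow>\<^sub>h EM_HHA) 0)"
proof (rule hha_closed)
  let ?A = "\<lambda>S C. h_formal_space A S C \<and>\<^sub>h h_nontrivial A S C \<and>\<^sub>h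
       h_boolean_space A S C \<and>\<^sub>h h_compact_space A S C"
  let ?T = "HPow (HProd A (HPow A))"
  show "h_sub f ((compact_boolean_HHA A \<longrightarrow>\<^sub>h EM_HHA) 0) = (compact_boolean_HHA A \<longrightarrow>\<^sub>h EM_HHA) 0" for f
  proof -
    \<comment> \<open>An expression without free variables is related to itself by every
      substitution at depth 0. This is the closedness condition of
      \<open>hha_closed\<close>.\<close>
    have "h_rel f 0 0 0 (compact_boolean_HHA A \<longrightarrow>\<^sub>h EM_HHA) (compact_boolean_HHA A \<longrightarrow>\<^sub>h EM_HHA)"
      by (simp add: compact_boolean_HHA_def EM_HHA_def hrel)
    then show ?thesis by (simp add: h_rel_def)
  qed
  have "wt (compact_boolean_HHA A) HOmega"
    unfolding compact_boolean_HHA_def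
  proof (intro wt_binders wt_famI)
    show "h_fam (\<lambda>S. h_ex ?T (?A S))" by (simp add: hrel)
    fix s assume s: "wt (hv s) (HPow A)"
    show "h_fam (?A (hv s))" by (simp add: hrel)
    fix c assume c: "wt (hv c) ?T"
    interpret hha_space A "hv s" "hv c" by (rule hha_space.intro[OF s c])
    show "wt (?A (hv s) (hv c)) HOmega"
      by (intro wt_rules wt_formal_space wt_nontrivial wt_boolean_space wt_compact_space)
  qed
  moreover have "[compact_boolean_HHA A 0] \<turnstile> EM_HHA"
    unfolding EM_HHA_def
  proof (rule h_allI)
    show "h_fam (\<lambda>p. p \<or>\<^sub>h \<not>\<^sub>h p)" by (simp add: hrel)
    fix y assume q: "wt (hv y) HOmega"
    define H where "H = [compact_boolean_HHA A 0]"
    have "H \<turnstile> h_ex (HPow A) (\<lambda>S. h_ex ?T (?A S))"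
      unfolding H_def compact_boolean_HHA_def by (rule h_hd)
    then have "H \<turnstile> (hv y \<or>\<^sub>h \<not>\<^sub>h hv y)"
    proof (rule h_exE)
      show "h_fam (\<lambda>S. h_ex ?T (?A S))" by (simp add: hrel)
      fix s assume s: "wt (hv s) (HPow A)"
      show "h_ex ?T (?A (hv s)) 0 # H \<turnstile> (hv y \<or>\<^sub>h \<not>\<^sub>h hv y)"
      proof (rule h_exE[OF h_hd])
        show "h_fam (?A (hv s))" by (simp add: hrel)
        fix c assume c: "wt (hv c) ?T"
        interpret hha_space A "hv s" "hv c" by (rule hha_space.intro[OF s c])
        let ?K = "?A (hv s) (hv c) 0 # h_ex ?T (?A (hv s)) 0 # H"
        have A: "?K \<turnstile> ?A (hv s) (hv c)" by (rule h_hd)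
        show "?K \<turnstile> (hv y \<or>\<^sub>h \<not>\<^sub>h hv y)"
          by (rule compact_boolean_decides[OF h_andE1[OF A] h_andE1[OF h_andE2[OF A]] h_andE1[OF h_andE2[OF h_andE2[OF A]]]
                h_andE2[OF h_andE2[OF h_andE2[OF A]]] q])
      qed
    qed
    then show "[compact_boolean_HHA A 0] \<turnstile> (hv y \<or>\<^sub>h \<not>\<^sub>h hv y)" by (simp add: H_def)
  qed
  ultimately have "[] \<turnstile> (compact_boolean_HHA A \<longrightarrow>\<^sub>h EM_HHA)" by (intro h_impI)
  then show "hh [] ((compact_boolean_HHA A \<longrightarrow>\<^sub>h EM_HHA) 0)" by (simp add: h_entails_def)
qed

section \<open>Type theory\<close>

abbreviation lv :: "nat \<Rightarrow> 'c tmx" where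
  "lv n \<equiv> (\<lambda>m. Var (m - Suc n))"

lemma tm_up_simps [simp]: "tm_up f 0 = Var 0" "tm_up f (Suc k) = tm_ren Suc (f k)"
  by (simp_all add: tm_up_def)

lemma tm_up_Var: "tm_up (\<lambda>i. Var (r i)) = (\<lambda>i. Var (up r i))"
  by (auto simp: fun_eq_iff tm_up_def up_def split: nat.split)

lemma tm_ren_eq_sub: "tm_ren r t = tm_sub (\<lambda>i. Var (r i)) t"
  by (induction t arbitrary: r) (simp_all add: tm_up_Var)

lemma tm_ren_ren: "tm_ren r (tm_ren s t) = tm_ren (r \<circ> s) t"
  by (induction t arbitrary: r s) (simp_all add: up_comp)

lemma tm_sub_ren: "tm_sub f (tm_ren r t) = tm_sub (f \<circ> r) t"
proof (induction t arbitrary: f r)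
  case (Lam t)
  have "tm_up f \<circ> up r = tm_up (f \<circ> r)"
    by (auto simp: fun_eq_iff tm_up_def up_def split: nat.split)
  with Lam show ?case by (simp del: comp_apply)
qed simp_all

lemma tm_ren_sub: "tm_ren r (tm_sub f t) = tm_sub (\<lambda>i. tm_ren r (f i)) t"
proof (induction t arbitrary: f r)
  case (Lam t)
  have "(\<lambda>i. tm_ren (up r) (tm_up f i)) = tm_up (\<lambda>i. tm_ren r (f i))"
    by (auto simp: fun_eq_iff tm_up_def tm_ren_ren comp_def split: nat.split)
  with Lam show ?case by simp
qed simp_all

lemma tm_sub_sub: "tm_sub f (tm_sub g t) = tm_sub (\<lambda>i. tm_sub f (g i)) t"
proof (induction t arbitrary: f g)
  case (Lam t)
  have "(\<lambda>i. tm_sub (tm_up f) (tm_up g i)) = tm_up (\<lambda>i. tm_sub f (g i))"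
    by (auto simp: fun_eq_iff tm_up_def tm_sub_ren tm_ren_sub comp_def split: nat.split)
  with Lam show ?case by simp
qed simp_all

lemma ty_sub_sub: "ty_sub f (ty_sub g A) = ty_sub (\<lambda>i. tm_sub f (g i)) A"
proof (induction A arbitrary: f g)
  case (FUN A B)
  have "(\<lambda>i. tm_sub (tm_up f) (tm_up g i)) = tm_up (\<lambda>i. tm_sub f (g i))"
    by (auto simp: fun_eq_iff tm_up_def tm_sub_ren tm_ren_sub comp_def split: nat.split)
  with FUN show ?case by simp
qed (simp_all add: tm_sub_sub)

lemma tm_up_Var_id: "tm_up Var = Var"
  by (auto simp: fun_eq_iff tm_up_def split: nat.split)

lemma tm_sub_Var [simp]: "tm_sub Var t = t"
  by (induction t) (simp_all add: tm_up_Var_id)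

lemma ty_sub_Var [simp]: "ty_sub Var A = A"
  by (induction A) (simp_all add: tm_up_Var_id)

lemma tm_up_pow: "(tm_up ^^ k) f i = (if i < k then Var i else tm_ren (\<lambda>j. j + k) (f (i - k)))"
proof (induction k arbitrary: i)
  case 0
  then show ?case by (simp add: tm_ren_eq_sub)
next
  case (Suc k)
  then show ?case by (cases i) (simp_all add: tm_ren_ren comp_def)
qed

text \<open>
  \<open>tm_rel f N M k a b\<close>: below \<open>k\<close> binders, the substitution \<open>f\<close> turns \<open>a\<close> at depth \<open>N\<close> into \<open>b\<close> at
  depth \<open>M\<close>. The cases \<open>M = N + j\<close> and \<open>N = M + 1\<close> give weakening and instantiation.
\<close>

definition tm_rel :: "(nat \<Rightarrow> 'c tm) \<Rightarrow> nat \<Rightarrow> nat \<Rightarrow> nat \<Rightarrow> 'c tmx \<Rightarrow> 'c tmx \<Rightarrow> bool" where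
  "tm_rel f N M k a b \<longleftrightarrow> tm_sub ((tm_up ^^ k) f) (a (N + k)) = b (M + k)"

definition ty_rel :: "(nat \<Rightarrow> 'c tm) \<Rightarrow> nat \<Rightarrow> nat \<Rightarrow> nat \<Rightarrow> 'c tyx \<Rightarrow> 'c tyx \<Rightarrow> bool" where
  "ty_rel f N M k A B \<longleftrightarrow> ty_sub ((tm_up ^^ k) f) (A (N + k)) = B (M + k)"

lemma tm_rel_app: "tm_rel f N M k c c' \<Longrightarrow> tm_rel f N M k a a' \<Longrightarrow> tm_rel f N M k (c \<cdot> a) (c' \<cdot> a')"
  by (simp add: tm_rel_def t_app_def)

lemma tm_rel_Con: "tm_rel f N M k (\<lambda>n. Con c) (\<lambda>n. Con c)"
  by (simp add: tm_rel_def)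

lemma tm_rel_lam:
  "tm_rel f N M (Suc k) (F (lv (N + k))) (F' (lv (M + k))) \<Longrightarrow> tm_rel f N M k (t_lam F) (t_lam F')"
  by (simp add: tm_rel_def t_lam_def)

lemma tm_rel_lv: "j < k \<Longrightarrow> tm_rel f N M k (lv (N + j)) (lv (M + j))"
  by (simp add: tm_rel_def tm_up_pow)

lemma ty_rel_set: "ty_rel f N M k set_ty set_ty"
  by (simp add: ty_rel_def set_ty_def)

lemma ty_rel_el: "tm_rel f N M k a a' \<Longrightarrow> ty_rel f N M k (el a) (el a')"
  by (simp add: tm_rel_def ty_rel_def el_def)

lemma ty_rel_fun:
  "ty_rel f N M k A A' \<Longrightarrow> ty_rel f N M (Suc k) (F (lv (N + k))) (F' (lv (M + k))) \<Longrightarrow>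
    ty_rel f N M k (fun_ty A F) (fun_ty A' F')"
  by (simp add: ty_rel_def fun_ty_def)

text \<open>Contexts are explicit here, so stability is relative to them: \<open>n\<close> is the
  length of the context over which \<open>a\<close> is an expression, and only the passage to longer
  contexts must be a shift.\<close>

definition stab :: "nat \<Rightarrow> 'c tmx \<Rightarrow> bool" where
  "stab n a \<longleftrightarrow> (\<forall>k. a (n + k) = tm_ren (\<lambda>i. i + k) (a n))"

definition tystab :: "nat \<Rightarrow> 'c tyx \<Rightarrow> bool" where
  "tystab n A \<longleftrightarrow> (\<forall>k. A (n + k) = ty_sub (\<lambda>i. Var (i + k)) (A n))"

lemma stab_le: "stab n a \<Longrightarrow> n \<le> m \<Longrightarrow> stab m a"
  unfolding stab_def by (auto simp: le_iff_add tm_ren_ren comp_def add.assoc) (simp add: add.commute)?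

lemma tystab_le: "tystab n A \<Longrightarrow> n \<le> m \<Longrightarrow> tystab m A"
  unfolding tystab_def by (auto simp: le_iff_add ty_sub_sub add.assoc)

lemma stab_lv: "i < n \<Longrightarrow> stab n (lv i)"
  by (simp add: stab_def)

definition keeps :: "nat \<Rightarrow> (nat \<Rightarrow> 'c tm) \<Rightarrow> nat \<Rightarrow> nat \<Rightarrow> bool" where
  "keeps n f N M \<longleftrightarrow> (\<forall>a k. stab n a \<longrightarrow> tm_rel f N M k a a) \<and> (\<forall>A k. tystab n A \<longrightarrow> ty_rel f N M k A A)"

text \<open>At depth \<open>N\<close> the variables of a context of length \<open>n\<close> have the
  indices from \<open>N - n\<close> on. They must be sent to the same levels at depth
  \<open>M\<close>; the images of the smaller indices are unrestricted. Weakening and instantiation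
  both have this form.\<close>

lemma keepsI:
  assumes "n \<le> N" "n \<le> M" and f: "\<And>i. f (i + (N - n)) = Var (i + (M - n))"
  shows "keeps n f N M"
proof -
  have up: "(tm_up ^^ k) f (i + (N - n + k)) = Var (i + (M - n + k))" for i k
    using f[of i] by (simp add: tm_up_pow)
  have "tm_rel f N M k a a" if "stab n a" for a k
  proof -
    have "a (N + k) = tm_ren (\<lambda>i. i + (N - n + k)) (a n)" "a (M + k) = tm_ren (\<lambda>i. i + (M - n + k)) (a n)"
      using that[unfolded stab_def, rule_format, of "N - n + k"]
        that[unfolded stab_def, rule_format, of "M - n + k"] assms(1,2) by simp_all
    then show ?thesis
      unfolding tm_rel_def by (simp only: tm_sub_sub tm_sub.simps up tm_ren_eq_sub)
  qed
  moreover have "ty_rel f N M k A A" if "tystab n A" for A k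
  proof -
    have "A (N + k) = ty_sub (\<lambda>i. Var (i + (N - n + k))) (A n)"
      "A (M + k) = ty_sub (\<lambda>i. Var (i + (M - n + k))) (A n)"
      using that[unfolded tystab_def, rule_format, of "N - n + k"]
        that[unfolded tystab_def, rule_format, of "M - n + k"] assms(1,2) by simp_all
    then show ?thesis
      unfolding ty_rel_def by (simp only: ty_sub_sub tm_sub.simps up)
  qed
  ultimately show ?thesis by (simp add: keeps_def)
qed

lemma keeps_shift: "keeps n (\<lambda>i. Var (i + j)) n (n + j)"
  by (rule keepsI) auto

lemma keeps_inst: "keeps n (case_nat a Var) (Suc n) n"
  by (rule keepsI) auto

lemma keeps_le: "keeps m f N M \<Longrightarrow> n \<le> m \<Longrightarrow> keeps n f N M"
  by (auto simp: keeps_def dest: stab_le tystab_le)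

definition tmfam :: "nat \<Rightarrow> ('c tmx \<Rightarrow> 'c tmx) \<Rightarrow> bool" where
  "tmfam n F \<longleftrightarrow> (\<forall>f N M k x x'. keeps n f N M \<longrightarrow> (\<forall>j\<ge>k. tm_rel f N M j x x') \<longrightarrow>
     tm_rel f N M k (F x) (F x'))"

definition tyfam :: "nat \<Rightarrow> ('c tmx \<Rightarrow> 'c tyx) \<Rightarrow> bool" where
  "tyfam n F \<longleftrightarrow> (\<forall>f N M k x x'. keeps n f N M \<longrightarrow> (\<forall>j\<ge>k. tm_rel f N M j x x') \<longrightarrow>
     ty_rel f N M k (F x) (F x'))"

lemma tmfam_le: "tmfam n F \<Longrightarrow> n \<le> m \<Longrightarrow> tmfam m F"
  by (auto simp: tmfam_def dest: keeps_le)

lemma tyfam_le: "tyfam n F \<Longrightarrow> n \<le> m \<Longrightarrow> tyfam m F"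
  by (auto simp: tyfam_def dest: keeps_le)

lemma tmfam_rel:
  "tmfam n F \<Longrightarrow> keeps n f N M \<Longrightarrow> (\<And>j. j \<ge> k \<Longrightarrow> tm_rel f N M j x x') \<Longrightarrow> tm_rel f N M k (F x) (F x')"
  by (auto simp: tmfam_def)

lemma tyfam_rel:
  "tyfam n F \<Longrightarrow> keeps n f N M \<Longrightarrow> (\<And>j. j \<ge> k \<Longrightarrow> tm_rel f N M j x x') \<Longrightarrow> ty_rel f N M k (F x) (F x')"
  by (auto simp: tyfam_def)

lemma stabI: "(\<And>f N M. keeps n f N M \<Longrightarrow> tm_rel f N M 0 a a) \<Longrightarrow> stab n a"
  unfolding stab_def
proof
  fix k assume *: "\<And>f N M. keeps n f N M \<Longrightarrow> tm_rel f N M 0 a a"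
  show "a (n + k) = tm_ren (\<lambda>i. i + k) (a n)"
    using *[OF keeps_shift[of n k]] by (simp add: tm_rel_def tm_ren_eq_sub)
qed

lemma tystabI: "(\<And>f N M. keeps n f N M \<Longrightarrow> ty_rel f N M 0 A A) \<Longrightarrow> tystab n A"
  unfolding tystab_def
proof
  fix k assume *: "\<And>f N M. keeps n f N M \<Longrightarrow> ty_rel f N M 0 A A"
  show "A (n + k) = ty_sub (\<lambda>i. Var (i + k)) (A n)"
    using *[OF keeps_shift[of n k]] by (simp add: ty_rel_def)
qed

lemma stab_rel: "stab n a \<Longrightarrow> keeps n f N M \<Longrightarrow> tm_rel f N M k a a"
  by (auto simp: keeps_def)

lemma tystab_rel: "tystab n A \<Longrightarrow> keeps n f N M \<Longrightarrow> ty_rel f N M k A A"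
  by (auto simp: keeps_def)

lemma tmfam_stab: "tmfam n F \<Longrightarrow> stab n a \<Longrightarrow> stab n (F a)"
  by (rule stabI, erule tmfam_rel) (auto intro: stab_rel)

lemma tyfam_stab: "tyfam n F \<Longrightarrow> stab n a \<Longrightarrow> tystab n (F a)"
  by (rule tystabI, erule tyfam_rel) (auto intro: stab_rel)

lemma tmfam_stab_lv: "tmfam n F \<Longrightarrow> stab (Suc n) (F (lv n))"
  by (rule tmfam_stab[OF tmfam_le]) (auto intro: stab_lv)

lemma tyfam_stab_lv: "tyfam n F \<Longrightarrow> tystab (Suc n) (F (lv n))"
  by (rule tyfam_stab[OF tyfam_le]) (auto intro: stab_lv)

lemma tmfam_const: "stab n a \<Longrightarrow> tmfam n (\<lambda>x. a)"
  by (auto simp: tmfam_def intro: stab_rel)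

lemma tyfam_const: "tystab n A \<Longrightarrow> tyfam n (\<lambda>x. A)"
  by (auto simp: tyfam_def intro: tystab_rel)

lemma stab_t_lam: "tmfam n F \<Longrightarrow> stab n (t_lam F)"
  by (rule stabI, rule tm_rel_lam, erule tmfam_rel) (auto intro: tm_rel_lv[where j = 0, simplified])

lemma tystab_fun: "tystab n A \<Longrightarrow> tyfam n F \<Longrightarrow> tystab n (fun_ty A F)"
  by (rule tystabI, rule ty_rel_fun, erule tystab_rel, assumption, erule tyfam_rel)
    (auto intro: tm_rel_lv[where j = 0, simplified])

lemma rel_lv_inst: "stab n a \<Longrightarrow> tm_rel (case_nat (a n) Var) (Suc n) n j (lv n) a"
  by (simp add: tm_rel_def tm_up_pow stab_def)

lemma tmfam_inst: "tmfam n F \<Longrightarrow> stab n a \<Longrightarrow> tm_inst (a n) (F (lv n) (Suc n)) = F a n"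
  using tmfam_rel[of n F "case_nat (a n) Var" "Suc n" n 0 "lv n" a, OF _ keeps_inst rel_lv_inst] by (simp add: tm_rel_def rel_lv_inst[unfolded tm_rel_def])

lemma tyfam_inst: "tyfam n F \<Longrightarrow> stab n a \<Longrightarrow> ty_inst (a n) (F (lv n) (Suc n)) = F a n"
  using tyfam_rel[of n F "case_nat (a n) Var" "Suc n" n 0 "lv n" a, OF _ keeps_inst rel_lv_inst]
  by (simp add: ty_rel_def)

text \<open>The framework yields bare de Bruijn terms over a context of length \<open>n\<close>.
  Shifting turns such a term into a stable expression without any knowledge of its shape.\<close>

definition raise :: "nat \<Rightarrow> 'c tm \<Rightarrow> 'c tmx" where
  "raise n t = (\<lambda>m. tm_ren (\<lambda>i. i + (m - n)) t)"

lemma raise_same [simp]: "raise n t n = t"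
  by (simp add: raise_def tm_ren_eq_sub)

lemma stab_raise: "stab n (raise n t)"
  by (simp add: stab_def raise_def tm_ren_eq_sub)

section \<open>Judgements about stable expressions\<close>

locale ctt =
  fixes R :: "'c rule set"
  assumes CTT_sub: "CTT \<subseteq> R"
begin

definition ctx :: "'c ty list \<Rightarrow> bool" where "ctx G \<longleftrightarrow> lf R G Ctx"

text \<open>Stability is part of the judgement, so weakening leaves the expressions \<open>a\<close>
  and \<open>A\<close> themselves unchanged and only the depth at which they are read
  increases.\<close>

definition has :: "'c ty list \<Rightarrow> 'c tmx \<Rightarrow> 'c tyx \<Rightarrow> bool" where
  "has G a A \<longleftrightarrow> lf R G (HasTy (a (length G)) (A (length G))) \<and> stab (length G) a \<and> tystab (length G) A"

definition isty :: "'c ty list \<Rightarrow> 'c tyx \<Rightarrow> bool" where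
  "isty G A \<longleftrightarrow> lf R G (IsTy (A (length G))) \<and> tystab (length G) A"

definition eq :: "'c ty list \<Rightarrow> 'c tmx \<Rightarrow> 'c tmx \<Rightarrow> 'c tyx \<Rightarrow> bool" where
  "eq G a b A \<longleftrightarrow> lf R G (TmEq (a (length G)) (b (length G)) (A (length G))) \<and>
     stab (length G) a \<and> stab (length G) b \<and> tystab (length G) A"

definition ext :: "'c ty list \<Rightarrow> 'c tyx \<Rightarrow> 'c ty list" (infixl "\<triangleright>" 55) where
  "G \<triangleright> A = A (length G) # G"

lemma length_ext [simp]: "length (G \<triangleright> A) = Suc (length G)"
  by (simp add: ext_def)

lemma ctx_ext: "isty G A \<Longrightarrow> ctx (G \<triangleright> A)"
  by (simp add: ctx_def isty_def ext_def LF_cons)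

lemma has_stab: "has G a A \<Longrightarrow> stab (length G) a" and has_tystab: "has G a A \<Longrightarrow> tystab (length G) A"
  by (simp_all add: has_def)

text \<open>Weakening is not a primitive rule of \<open>lf\<close>; it is the simultaneous
  substitution by shifted variables.\<close>

lemma lf_weak:
  assumes "lf R G J" "ctx (G \<triangleright> B)"
  shows "lf R (G \<triangleright> B) (j_sub (\<lambda>i. Var (Suc i)) J)"
proof (rule LF_subst[OF assms(1)])
  show "lf R (G \<triangleright> B) Ctx" using assms(2) by (simp add: ctx_def)
  fix k assume "k < length G"
  then show "lf R (G \<triangleright> B) (HasTy (Var (Suc k)) (ty_sub (\<lambda>i. Var (Suc i)) (ctx_ty G k)))"
    using LF_var[OF \<open>lf R (G \<triangleright> B) Ctx\<close>, of "Suc k"] by (simp add: ctx_ty_def ext_def ty_sub_sub)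
qed

lemma stab_Suc: "stab n a \<Longrightarrow> tm_sub (\<lambda>i. Var (Suc i)) (a n) = a (Suc n)"
  by (drule stab_def[THEN iffD1, rule_format, of _ _ 1]) (simp add: tm_ren_eq_sub)

lemma tystab_Suc: "tystab n A \<Longrightarrow> ty_sub (\<lambda>i. Var (Suc i)) (A n) = A (Suc n)"
  by (drule tystab_def[THEN iffD1, rule_format, of _ _ 1]) simp

lemma has_weak: "has G a A \<Longrightarrow> ctx (G \<triangleright> B) \<Longrightarrow> has (G \<triangleright> B) a A"
  using lf_weak[of G _ B] by (fastforce simp: has_def stab_Suc tystab_Suc intro: stab_le tystab_le)

lemma isty_weak: "isty G A \<Longrightarrow> ctx (G \<triangleright> B) \<Longrightarrow> isty (G \<triangleright> B) A"
  using lf_weak[of G _ B] by (fastforce simp: isty_def stab_Suc tystab_Suc intro: stab_le tystab_le)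

lemma eq_weak: "eq G a b A \<Longrightarrow> ctx (G \<triangleright> B) \<Longrightarrow> eq (G \<triangleright> B) a b A"
  using lf_weak[of G _ B] by (fastforce simp: eq_def stab_Suc tystab_Suc intro: stab_le tystab_le)

lemma has_var: "isty G A \<Longrightarrow> has (G \<triangleright> A) (lv (length G)) A"
  using LF_var[of R "G \<triangleright> A" 0] ctx_ext[of G A]
  by (auto simp: has_def isty_def ctx_def ext_def ctx_ty_def tystab_Suc stab_lv intro: tystab_le)

lemma has_lam:
  assumes "isty G A" "has (G \<triangleright> A) (F (lv (length G))) (B (lv (length G)))"
    "tmfam (length G) F" "tyfam (length G) B"
  shows "has G (t_lam F) (fun_ty A B)"
  using assms LF_lam[of R G "A (length G)"]
  by (auto simp: has_def isty_def ext_def t_lam_def[of F, THEN fun_cong] fun_ty_def[THEN fun_cong]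
      intro: stab_t_lam tystab_fun)

lemma has_app:
  assumes "has G c (fun_ty A B)" "has G a A" "tyfam (length G) B"
  shows "has G (c \<cdot> a) (B a)"
  using LF_app[of R G "c (length G)" "A (length G)" "B (lv (length G)) (Suc (length G))" "a (length G)"] assms
  by (auto simp: has_def fun_ty_def tyfam_inst t_app_def[of c a, THEN fun_cong] intro: tyfam_stab stabI tm_rel_app stab_rel)

lemma isty_set: "ctx G \<Longrightarrow> isty G set_ty"
  by (auto simp: isty_def ctx_def set_ty_def LF_set tystab_def)

lemma isty_el: "has G A set_ty \<Longrightarrow> isty G (el A)"
  by (auto simp: isty_def has_def set_ty_def el_def[of A, THEN fun_cong] LF_el intro: tystabI ty_rel_el stab_rel)

lemma isty_fun:
  assumes "isty G A" "isty (G \<triangleright> A) (B (lv (length G)))" "tyfam (length G) B"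
  shows "isty G (fun_ty A B)"
  using assms LF_fun[of R G "A (length G)"]
  by (auto simp: isty_def ext_def fun_ty_def[THEN fun_cong] intro: tystab_fun)

lemma eq_refl: "has G a A \<Longrightarrow> eq G a a A" and eq_sym: "eq G a b A \<Longrightarrow> eq G b a A"
  by (auto simp: eq_def has_def intro: LF_tm_refl LF_tm_sym)

lemma eq_trans: "eq G a b A \<Longrightarrow> eq G b c A \<Longrightarrow> eq G a c A"
  by (auto simp: eq_def intro: LF_tm_trans)

lemma eq_app:
  assumes "eq G c c' (fun_ty A B)" "eq G a a' A" "tyfam (length G) B"
  shows "eq G (c \<cdot> a) (c' \<cdot> a') (B a)"
  using LF_app_eq[of R G "c (length G)" "c' (length G)" "A (length G)" "B (lv (length G)) (Suc (length G))"
     "a (length G)" "a' (length G)"] assms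
  by (auto simp: eq_def fun_ty_def tyfam_inst t_app_def[THEN fun_cong] intro: tyfam_stab stabI tm_rel_app stab_rel)

lemma eq_beta:
  assumes "has (G \<triangleright> A) (F (lv (length G))) (B (lv (length G)))" "has G a A"
    "tmfam (length G) F" "tyfam (length G) B"
  shows "eq G (t_lam F \<cdot> a) (F a) (B a)"
  using LF_beta[of R "A (length G)" G "F (lv (length G)) (Suc (length G))" "B (lv (length G)) (Suc (length G))"
      "a (length G)"] assms
  by (auto simp: eq_def has_def ext_def t_app_def[THEN fun_cong] t_lam_def[THEN fun_cong] tyfam_inst tmfam_inst
    intro: tyfam_stab tmfam_stab stab_t_lam stabI tm_rel_app stab_rel)

lemma has_conv: "has G a (el A) \<Longrightarrow> eq G A B set_ty \<Longrightarrow> has G a (el B)"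
  by (auto simp: has_def eq_def el_def[THEN fun_cong] set_ty_def intro: LF_conv LF_el_eq tystabI ty_rel_el stab_rel)

lemma eq_conv: "eq G a b (el A) \<Longrightarrow> eq G A B set_ty \<Longrightarrow> eq G a b (el B)"
  by (auto simp: eq_def el_def[THEN fun_cong] set_ty_def intro: LF_conv_eq LF_el_eq tystabI ty_rel_el stab_rel)

lemma has_raise: "lf R G (HasTy t (A (length G))) \<Longrightarrow> tystab (length G) A \<Longrightarrow> has G (raise (length G) t) A"
  by (simp add: has_def stab_raise)

lemma lf_closed_weak: "lf R [] J \<Longrightarrow> ctx G \<Longrightarrow> lf R G (j_sub f J)"
  by (rule LF_subst) (auto simp: ctx_def)

end

named_theorems fam

lemma tm_rel_level [fam]:
  assumes "N \<le> i" "i < N + k" "i + M = i' + N"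
  shows "tm_rel f N M k (lv i) (lv i')"
proof -
  have "tm_rel f N M k (lv (N + (i - N))) (lv (M + (i - N)))"
    by (rule tm_rel_lv) (use assms in simp)
  then show ?thesis using assms by (simp add: add.commute)
qed

lemmas [fam] = tm_rel_app tm_rel_Con tm_rel_lam ty_rel_set ty_rel_el ty_rel_fun
  tmfam_def tyfam_def keeps_def t_con_def arrow_def stab_lv stab_t_lam tystab_fun

lemma stab_app [fam]: "stab n c \<Longrightarrow> stab n a \<Longrightarrow> stab n (c \<cdot> a)"
  by (auto intro: stabI tm_rel_app stab_rel)

lemma stab_Con [fam]: "stab n (\<lambda>n. Con c)"
  by (simp add: stab_def)

lemma tystab_el [fam]: "stab n a \<Longrightarrow> tystab n (el a)"
  by (auto intro: tystabI ty_rel_el stab_rel)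

lemma tystab_set [fam]: "tystab n set_ty"
  by (simp add: tystab_def set_ty_def)

lemma stab_SucI [fam]: "stab n a \<Longrightarrow> stab (Suc n) a" and tystab_SucI [fam]: "tystab n A \<Longrightarrow> tystab (Suc n) A"
  by (auto elim: stab_le tystab_le)

lemmas [fam] = p_all_def p_ex_def p_imp_def p_and_def p_or_def p_bot_def p_not_def subset_ty_def
  t_none_def t_sing_def t_union_def t_subset_def t_covs_def t_covers_space_def t_down_def
  t_pseudocompl_def cover_ty_def Fin_def t_listed_def

lemma tystab_con_ty: "tystab 0 (con_ty c)"
  by (cases c; simp add: fam)

context ctt
begin

text \<open>Constants are declared in the empty context. Their types are stable from depth 0, so
  weakening to \<open>G\<close> leaves them as they are.\<close>

lemma has_con:
  assumes "ctx G" "c \<noteq> cGup" "c \<noteq> cGupProof"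
  shows "has G (\<lambda>n. Con c) (con_ty c)"
proof -
  have "([], ([], HasTy (Con c) (con_ty c 0))) \<in> R"
    using CTT_sub assms(2,3) by (auto simp: CTT_def con_decl_def)
  then have "lf R [] (HasTy (Con c) (con_ty c 0))"
    by (rule LF_rule) simp
  then have "lf R G (j_sub (\<lambda>i. Var (i + length G)) (HasTy (Con c) (con_ty c 0)))"
    by (rule lf_closed_weak[OF _ assms(1)])
  moreover have "(con_ty c :: 'c tyx) (0 + length G) = ty_sub (\<lambda>i. Var (i + length G)) (con_ty c 0)"
    using tystab_con_ty[of c] unfolding tystab_def by blast
  ultimately show ?thesis
    using tystab_le[OF tystab_con_ty, of "length G" c] by (simp add: has_def stab_Con)
qed

text \<open>The new variable is inserted before the argument of the family, which
  \<open>has_weak\<close> cannot do. This is required whenever a family is used again under a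
  further hypothesis.\<close>

lemma has_fam_weak:
  assumes "has (G \<triangleright> A) (F (lv (length G))) (B (lv (length G)))" "ctx (G \<triangleright> X)" "isty G A"
    "tmfam (length G) F" "tyfam (length G) B"
  shows "has (G \<triangleright> X \<triangleright> A) (F (lv (Suc (length G)))) (B (lv (Suc (length G))))"
proof -
  let ?f = "\<lambda>i. Var (Suc i)"
  have k: "keeps (length G) ?f (length G) (Suc (length G))"
    using keeps_shift[of "length G" 1] by simp
  have r: "tm_rel ?f (length G) (Suc (length G)) j (lv (length G)) (lv (Suc (length G)))" if "Suc 0 \<le> j" for j
    using that by (simp add: fam)
  have ctx: "ctx (G \<triangleright> X \<triangleright> A)"
    by (intro ctx_ext isty_weak assms)
  \<comment> \<open>The lifted shift keeps the innermost variable, which is the argument of the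
    family, and moves all others past \<open>X\<close>.\<close>
  have "lf R (G \<triangleright> X \<triangleright> A) (j_sub (tm_up ?f) (HasTy (F (lv (length G)) (Suc (length G))) (B (lv (length G)) (Suc (length G)))))"
  proof (rule LF_subst)
    show "lf R (G \<triangleright> A) (HasTy (F (lv (length G)) (Suc (length G))) (B (lv (length G)) (Suc (length G))))"
      using assms(1) by (simp add: has_def)
    show "lf R (G \<triangleright> X \<triangleright> A) Ctx" using ctx by (simp add: ctx_def)
    fix i assume "i < length (G \<triangleright> A)"
    then show "lf R (G \<triangleright> X \<triangleright> A) (HasTy (tm_up ?f i) (ty_sub (tm_up ?f) (ctx_ty (G \<triangleright> A) i)))"
    proof (cases i)
      case 0
      have "ctx_ty (G \<triangleright> X \<triangleright> A) 0 = ty_sub (tm_up ?f) (ctx_ty (G \<triangleright> A) 0)"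
        using tystab_Suc[of "length G" A] assms(3) by (simp add: ctx_ty_def ext_def ty_sub_sub isty_def flip: tystab_Suc)
      then show ?thesis
        using LF_var[OF \<open>lf R (G \<triangleright> X \<triangleright> A) Ctx\<close>, of 0] 0 by simp
    next
      case (Suc j)
      then show ?thesis
        using LF_var[OF \<open>lf R (G \<triangleright> X \<triangleright> A) Ctx\<close>, of "Suc (Suc j)"] \<open>i < length (G \<triangleright> A)\<close>
        by (simp add: ctx_ty_def ext_def ty_sub_sub)
    qed
  qed
  moreover have "tm_rel ?f (length G) (Suc (length G)) 1 (F (lv (length G))) (F (lv (Suc (length G))))"
    by (rule tmfam_rel[OF assms(4) k]) (simp add: r)
  moreover have "ty_rel ?f (length G) (Suc (length G)) 1 (B (lv (length G))) (B (lv (Suc (length G))))"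
    by (rule tyfam_rel[OF assms(5) k]) (simp add: r)
  ultimately show ?thesis
    using tmfam_stab_lv[OF tmfam_le[OF assms(4)], of "Suc (length G)"]
      tyfam_stab_lv[OF tyfam_le[OF assms(5)], of "Suc (length G)"]
    by (simp add: has_def tm_rel_def ty_rel_def)
qed

lemma has_inst:
  assumes "has (G \<triangleright> A) (F (lv (length G))) (B (lv (length G)))" "has G a A" "ctx G"
    "tmfam (length G) F" "tyfam (length G) B"
  shows "has G (F a) (B a)"
proof -
  let ?f = "case_nat (a (length G)) Var"
  have "lf R G (j_sub ?f (HasTy (F (lv (length G)) (Suc (length G))) (B (lv (length G)) (Suc (length G)))))"
  proof (rule LF_subst)
    show "lf R (G \<triangleright> A) (HasTy (F (lv (length G)) (Suc (length G))) (B (lv (length G)) (Suc (length G))))"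
      using assms(1) by (simp add: has_def)
    show "lf R G Ctx" using assms(3) by (simp add: ctx_def)
    fix i assume "i < length (G \<triangleright> A)"
    then show "lf R G (HasTy (?f i) (ty_sub ?f (ctx_ty (G \<triangleright> A) i)))"
    proof (cases i)
      case 0
      then show ?thesis using assms(2) by (simp add: has_def ctx_ty_def ext_def ty_sub_sub)
    next
      case (Suc j)
      have "ty_sub (\<lambda>x. Var (x + Suc j)) (G ! j) = ctx_ty G j" by (simp add: ctx_ty_def)
      with Suc show ?thesis
        using LF_var[OF \<open>lf R G Ctx\<close>, of j] \<open>i < length (G \<triangleright> A)\<close>
        by (simp add: ctx_ty_def ext_def ty_sub_sub)
    qed
  qed
  then show ?thesis
    using assms has_stab[OF assms(2)] by (simp add: has_def tmfam_inst tyfam_inst tmfam_stab tyfam_stab)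
qed

text \<open>
  The theorem only claims that a type is inhabited. Reasoning with \<open>inh\<close> and \<open>tru\<close> hides the proof
  terms, which would otherwise have to be written down.
\<close>

definition inh :: "'c ty list \<Rightarrow> 'c tyx \<Rightarrow> bool" where
  "inh G A \<longleftrightarrow> (\<exists>t. has G t A)"

abbreviation tru :: "'c ty list \<Rightarrow> 'c tmx \<Rightarrow> bool" where
  "tru G A \<equiv> inh G (el A)"

abbreviation isset :: "'c ty list \<Rightarrow> 'c tmx \<Rightarrow> bool" where
  "isset G A \<equiv> has G A set_ty"

lemma inhI: "has G t A \<Longrightarrow> inh G A"
  by (auto simp: inh_def)

text \<open>Only the existence of an inhabitant of the body is known. It is abstracted as a raw term
  by \<open>LF_lam\<close> and made stable by \<open>has_raise\<close>, so it need not be presented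
  as a family.\<close>

lemma inh_lam:
  assumes "isty G A" "inh (G \<triangleright> A) (B (lv (length G)))" "tyfam (length G) B"
  shows "inh G (fun_ty A B)"
proof -
  obtain t where "lf R (G \<triangleright> A) (HasTy t (B (lv (length G)) (Suc (length G))))"
    using assms(2) by (auto simp: inh_def has_def)
  then have "lf R G (HasTy (Lam t) (fun_ty A B (length G)))"
    using assms(1) by (simp add: fun_ty_def ext_def isty_def LF_lam)
  then show ?thesis
    using assms by (auto simp: isty_def intro!: inhI has_raise tystab_fun)
qed

lemma inh_app: "inh G (fun_ty A B) \<Longrightarrow> has G a A \<Longrightarrow> tyfam (length G) B \<Longrightarrow> inh G (B a)"
  by (auto simp: inh_def intro: has_app)

lemma inh_weak: "inh G A \<Longrightarrow> ctx (G \<triangleright> B) \<Longrightarrow> inh (G \<triangleright> B) A"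
  by (auto simp: inh_def intro: has_weak)

lemma tru_conv: "tru G A \<Longrightarrow> eq G A B set_ty \<Longrightarrow> tru G B"
  by (auto simp: inh_def intro: has_conv)

lemma tru_hyp: "isset G A \<Longrightarrow> tru (G \<triangleright> el A) A"
  by (rule inhI, rule has_var, erule isty_el)

lemma eq_beta_set:
  "isset (G \<triangleright> el A) (F (lv (length G))) \<Longrightarrow> has G a (el A) \<Longrightarrow> tmfam (length G) F \<Longrightarrow>
    eq G (t_lam F \<cdot> a) (F a) set_ty"
  by (erule eq_beta[where B = "\<lambda>x. set_ty"]) (auto simp: fam)

lemma tru_beta:
  "isset (G \<triangleright> el A) (F (lv (length G))) \<Longrightarrow> has G a (el A) \<Longrightarrow> tmfam (length G) F \<Longrightarrow>
    tru G (t_lam F \<cdot> a) \<longleftrightarrow> tru G (F a)"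
  using eq_beta_set eq_sym tru_conv by blast

section \<open>Propositions as sets: connectives and quantifiers\<close>

lemma set_Pi:
  assumes "ctx G" "isset G A" "isset (G \<triangleright> el A) (F (lv (length G)))" "tmfam (length G) F"
  shows "isset G (p_all A F)"
proof -
  note [fam] = assms(2)[THEN has_stab]
  have "has G (\<lambda>n. Con cPi) (con_ty cPi)" by (rule has_con) (simp_all add: assms)
  then have 1: "has G (\<lambda>n. Con cPi) (fun_ty set_ty (\<lambda>A. fun_ty (fun_ty (el A) (\<lambda>x. set_ty)) (\<lambda>B. set_ty)))"
    by (simp add: arrow_def)
  have L: "has G (t_lam F) (fun_ty (el A) (\<lambda>x. set_ty))"
    by (rule has_lam) (use assms in \<open>auto intro: isty_el simp: fam\<close>)
  have "has G ((\<lambda>n. Con cPi) \<cdot> A \<cdot> t_lam F) set_ty"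
    by (rule has_app[OF has_app[OF 1 assms(2)] L]) (simp_all add: fam)
  then show ?thesis by (simp add: p_all_def t_con_def)
qed

lemma lam_set: "ctx G \<Longrightarrow> isset G A \<Longrightarrow> isset (G \<triangleright> el A) (F (lv (length G))) \<Longrightarrow> tmfam (length G) F \<Longrightarrow>
    has G (t_lam F) (fun_ty (el A) (\<lambda>x. set_ty))"
  by (rule has_lam) (auto intro: isty_el simp: fam)

lemma has_Lam:
  assumes "ctx G" "isset G A" "isset (G \<triangleright> el A) (F (lv (length G)))" "tmfam (length G) F"
    and b: "has G b (fun_ty (el A) (\<lambda>x. el (t_lam F \<cdot> x)))"
  shows "has G (cLam $$ [A, t_lam F, b]) (el (p_all A F))"
proof -
  note [fam] = assms(2)[THEN has_stab]
  have 1: "has G (\<lambda>n. Con cLam) (fun_ty set_ty (\<lambda>A. fun_ty (fun_ty (el A) (\<lambda>x. set_ty)) (\<lambda>B.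
     fun_ty (fun_ty (el A) (\<lambda>x. el (B \<cdot> x))) (\<lambda>b. el (cPi $$ [A, B])))))"
    using has_con[of G cLam] assms by (simp add: arrow_def)
  show ?thesis
    using has_app[OF has_app[OF has_app[OF 1 assms(2)] lam_set[OF assms(1-4)]] b] assms(4)[THEN stab_t_lam]
    by (simp add: fam)
qed

lemma isset_fam_weak:
  "isset (G \<triangleright> A) (F (lv (length G))) \<Longrightarrow> ctx (G \<triangleright> X) \<Longrightarrow> isty G A \<Longrightarrow> tmfam (length G) F \<Longrightarrow>
    isset (G \<triangleright> X \<triangleright> A) (F (lv (Suc (length G))))"
  by (rule has_fam_weak[where B = "\<lambda>x. set_ty"]) (simp_all add: tyfam_def ty_rel_set)

text \<open>The constants of CTT receive a family as the abstraction \<open>t_lam F\<close>, whereas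
  rules are stated with \<open>F\<close> applied. This equation mediates between the two at a
  generic element.\<close>

lemma tru_fam_beta:
  assumes "ctx G" "isset G A" "isset (G \<triangleright> el A) (F (lv (length G)))" "tmfam (length G) F"
  shows "eq (G \<triangleright> el A) (t_lam F \<cdot> lv (length G)) (F (lv (length G))) set_ty"
  using has_fam_weak[of G "el A" F "\<lambda>x. set_ty" "el A"] assms
  by (intro eq_beta_set[where A = A]) (auto intro!: has_var isty_el ctx_ext tmfam_le simp: fam)

lemma all_I:
  assumes "ctx G" "isset G A" "isset (G \<triangleright> el A) (F (lv (length G)))" "tmfam (length G) F"
    and "tru (G \<triangleright> el A) (F (lv (length G)))"
  shows "tru G (p_all A F)"
proof -
  note [fam] = assms(2)[THEN has_stab] assms(4)[THEN stab_t_lam]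
  have "inh G (fun_ty (el A) (\<lambda>x. el (t_lam F \<cdot> x)))"
    by (rule inh_lam[OF isty_el[OF assms(2)]])
      (simp_all add: tru_conv[OF assms(5) eq_sym[OF tru_fam_beta[OF assms(1-4)]]] fam)
  then show ?thesis
    using has_Lam[OF assms(1-4)] by (auto simp: inh_def)
qed

lemma has_Apply:
  assumes "ctx G" "isset G A" "isset (G \<triangleright> el A) (F (lv (length G)))" "tmfam (length G) F"
    and t: "has G t (el (p_all A F))" and a: "has G a (el A)"
  shows "has G (cApply $$ [A, t_lam F, t, a]) (el (F a))"
proof -
  note [fam] = assms(2)[THEN has_stab] assms(4)[THEN stab_t_lam]
  have 1: "has G (\<lambda>n. Con cApply) (fun_ty set_ty (\<lambda>A. fun_ty (fun_ty (el A) (\<lambda>x. set_ty)) (\<lambda>B.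
     fun_ty (el (cPi $$ [A, B])) (\<lambda>c. fun_ty (el A) (\<lambda>x. el (B \<cdot> x))))))"
    using has_con[of G cApply] assms by (simp add: arrow_def)
  have "has G (cApply $$ [A, t_lam F, t, a]) (el (t_lam F \<cdot> a))"
    using has_app[OF has_app[OF has_app[OF has_app[OF 1 assms(2)] lam_set[OF assms(1-4)]] t[unfolded p_all_def]] a]
    by (simp add: fam)
  then show ?thesis
    using eq_beta_set[OF assms(3) a assms(4)] has_conv by blast
qed

lemma all_E:
  assumes "ctx G" "isset G A" "isset (G \<triangleright> el A) (F (lv (length G)))" "tmfam (length G) F"
    and "tru G (p_all A F)" "has G a (el A)"
  shows "tru G (F a)"
  using assms(5) has_Apply[OF assms(1-4) _ assms(6)] by (auto simp: inh_def)

lemma set_Sigma: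
  assumes "ctx G" "isset G A" "isset (G \<triangleright> el A) (F (lv (length G)))" "tmfam (length G) F"
  shows "isset G (p_ex A F)"
proof -
  note [fam] = assms(2)[THEN has_stab] assms(4)[THEN stab_t_lam]
  have 1: "has G (\<lambda>n. Con cSigma) (fun_ty set_ty (\<lambda>A. fun_ty (fun_ty (el A) (\<lambda>x. set_ty)) (\<lambda>B. set_ty)))"
    using has_con[of G cSigma] assms by (simp add: arrow_def)
  show ?thesis
    using has_app[OF has_app[OF 1 assms(2)] lam_set[OF assms(1-4)]] by (simp add: fam)
qed

lemma has_Pair:
  assumes "ctx G" "isset G A" "isset (G \<triangleright> el A) (F (lv (length G)))" "tmfam (length G) F"
    and a: "has G a (el A)" and b: "has G b (el (t_lam F \<cdot> a))"
  shows "has G (cPair $$ [A, t_lam F, a, b]) (el (p_ex A F))"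
proof -
  note [fam] = assms(2,5)[THEN has_stab] assms(4)[THEN stab_t_lam]
  have 1: "has G (\<lambda>n. Con cPair) (fun_ty set_ty (\<lambda>A. fun_ty (fun_ty (el A) (\<lambda>x. set_ty)) (\<lambda>B.
     fun_ty (el A) (\<lambda>x. fun_ty (el (B \<cdot> x)) (\<lambda>y. el (cSigma $$ [A, B]))))))"
    using has_con[of G cPair] assms by (simp add: arrow_def)
  show ?thesis
    using has_app[OF has_app[OF has_app[OF has_app[OF 1 assms(2)] lam_set[OF assms(1-4)]] a] b]
    by (simp add: fam)
qed

lemma ex_I:
  assumes "ctx G" "isset G A" "isset (G \<triangleright> el A) (F (lv (length G)))" "tmfam (length G) F"
    and a: "has G a (el A)" and "tru G (F a)"
  shows "tru G (p_ex A F)"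
  using has_Pair[OF assms(1-5)] assms(6) tru_beta[OF assms(3) a assms(4)] by (auto simp: inh_def)

lemma isset_weak: "isset G A \<Longrightarrow> isset G B \<Longrightarrow> isset (G \<triangleright> el A) B"
  by (rule has_weak) (auto intro: ctx_ext isty_el)

lemma imp_I:
  assumes "ctx G" "isset G A" "isset G B" "tru (G \<triangleright> el A) B"
  shows "tru G (p_imp A B)"
  unfolding p_imp_def using assms has_stab[OF assms(3)]
  by (intro all_I) (auto intro: isset_weak simp: fam)

lemma imp_E:
  assumes "ctx G" "isset G A" "isset G B" "tru G (p_imp A B)" "tru G A"
  shows "tru G B"
proof -
  obtain a where "has G a (el A)" using assms(5) by (auto simp: inh_def)
  then show ?thesis
    using all_E[of G A "\<lambda>x. B" a] assms has_stab[OF assms(3)] by (auto intro: isset_weak simp: fam)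
qed

lemma set_imp: "ctx G \<Longrightarrow> isset G A \<Longrightarrow> isset G B \<Longrightarrow> isset G (p_imp A B)"
  unfolding p_imp_def using has_stab[of G B] by (intro set_Pi) (auto intro: isset_weak simp: fam)

lemma set_and: "ctx G \<Longrightarrow> isset G A \<Longrightarrow> isset G B \<Longrightarrow> isset G (p_and A B)"
  unfolding p_and_def using has_stab[of G B] by (intro set_Sigma) (auto intro: isset_weak simp: fam)

lemma tru_const: "isset G A \<Longrightarrow> isset G Q \<Longrightarrow> has G a (el A) \<Longrightarrow> tru G (t_lam (\<lambda>z. Q) \<cdot> a) \<longleftrightarrow> tru G Q"
  by (rule tru_beta[of G A "\<lambda>z. Q" a]) (auto intro: isset_weak has_stab[of G Q] simp: fam has_stab)

lemma eq_const: "isset G A \<Longrightarrow> has (G \<triangleright> el A) Q B \<Longrightarrow> stab (length G) Q \<Longrightarrow> tystab (length G) B \<Longrightarrow>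
    has G a (el A) \<Longrightarrow> eq G (t_lam (\<lambda>z. Q) \<cdot> a) Q B"
  by (rule eq_beta[of G "el A" "\<lambda>z. Q" "\<lambda>z. B" a]) (auto intro: tmfam_const tyfam_const)

text \<open>With a motive that is constant in the pair, the dependent eliminator
  \<open>cSplit\<close> becomes existential elimination.\<close>

lemma ex_E:
  assumes "ctx G" "isset G A" "isset (G \<triangleright> el A) (F (lv (length G)))" "tmfam (length G) F"
    and p: "tru G (p_ex A F)" and Q: "isset G Q"
    and d: "tru (G \<triangleright> el A \<triangleright> el (F (lv (length G)))) Q"
  shows "tru G Q"
proof -
  obtain z where z: "has G z (el (cSigma $$ [A, t_lam F]))"
    using p by (auto simp: inh_def p_ex_def)
  note [fam] = assms(2)[THEN has_stab] Q[THEN has_stab] assms(4)[THEN stab_t_lam] z[THEN has_stab]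
  have 1: "has G (\<lambda>n. Con cSplit) (fun_ty set_ty (\<lambda>A. fun_ty (fun_ty (el A) (\<lambda>x. set_ty)) (\<lambda>B.
     fun_ty (fun_ty (el (cSigma $$ [A, B])) (\<lambda>x. set_ty)) (\<lambda>C.
     fun_ty (fun_ty (el A) (\<lambda>x. fun_ty (el (B \<cdot> x)) (\<lambda>y. el (C \<cdot> (cPair $$ [A, B, x, y]))))) (\<lambda>d.
     fun_ty (el (cSigma $$ [A, B])) (\<lambda>z. el (C \<cdot> z)))))))"
    using has_con[of G cSplit] assms by (simp add: arrow_def)
  let ?x = "lv (length G)" and ?y = "lv (Suc (length G))"
  let ?G1 = "G \<triangleright> el A" and ?B = "t_lam F"
  let ?G2 = "?G1 \<triangleright> el (?B \<cdot> ?x)"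
  have c1: "ctx ?G1" by (intro ctx_ext isty_el assms)
  have x1: "has ?G1 ?x (el A)" by (intro has_var isty_el assms)
  have E: "eq ?G1 (t_lam F \<cdot> ?x) (F ?x) set_ty"
    by (rule tru_fam_beta[OF assms(1-4)])
  have s: "isset ?G1 (t_lam F \<cdot> ?x)"
    using has_app[OF has_weak[OF lam_set[OF assms(1-4)] c1] x1] by (simp add: fam)
  have c2: "ctx ?G2" by (intro ctx_ext isty_el s)
  have P: "isset G (p_ex A F)" by (rule set_Sigma[OF assms(1-4)])
  have C: "has G (t_lam (\<lambda>z. Q)) (fun_ty (el (cSigma $$ [A, t_lam F])) (\<lambda>x. set_ty))"
    using lam_set[OF assms(1) P, of "\<lambda>z. Q"] isset_weak[OF P Q] by (simp add: fam)
  have w: "isset ?G2 X" if "isset G X" for X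
    by (intro has_weak[OF _ c2] has_weak[OF _ c1] that)
  have Q1: "isset ?G1 Q" by (rule has_weak[OF Q c1])
  \<comment> \<open>The given derivation assumes \<open>F x\<close>, but the eliminator offers the
    unreduced hypothesis \<open>t_lam F \<cdot> x\<close>. An implication replaces one hypothesis by
    the other, avoiding conversion inside a context.\<close>
  have "tru ?G1 (p_imp (F ?x) Q)" by (rule imp_I[OF c1 assms(3) Q1 d])
  then have "tru ?G2 (p_imp (F ?x) Q)" by (rule inh_weak[OF _ c2])
  moreover have "tru ?G2 (F ?x)"
    by (rule tru_conv[OF tru_hyp eq_weak[OF E c2]]) (rule s)
  ultimately have Q2: "tru ?G2 Q"
    by (rule imp_E[OF c2 has_weak[OF assms(3) c2] w[OF Q]])
  have "has ?G2 (cPair $$ [A, ?B, ?x, ?y]) (el (p_ex A F))"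
  proof (rule has_Pair[OF c2 w[OF assms(2)]])
    show "isset (?G2 \<triangleright> el A) (F (lv (length ?G2)))"
      using isset_fam_weak[of ?G1 "el A" F "el (?B \<cdot> ?x)"]
        isset_fam_weak[OF assms(3) c1 isty_el[OF assms(2)] assms(4)] c2 isty_weak[OF isty_el[OF assms(2)] c1]
        tmfam_le[OF assms(4), of "Suc (length G)"]
      by simp
    show "tmfam (length ?G2) F" by (simp add: tmfam_le[OF assms(4)])
    show "has ?G2 ?x (el A)" by (rule has_weak[OF x1 c2])
    show "has ?G2 ?y (el (?B \<cdot> ?x))" using has_var[OF isty_el[OF s]] by simp
  qed
  then have Q3: "tru ?G2 (t_lam (\<lambda>z. Q) \<cdot> (cPair $$ [A, ?B, ?x, ?y]))"
    using tru_const[OF w[OF P] w[OF Q]] Q2 by blast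
  have "inh G (fun_ty (el A) (\<lambda>x. fun_ty (el (?B \<cdot> x)) (\<lambda>y. el (t_lam (\<lambda>z. Q) \<cdot> (cPair $$ [A, ?B, x, y])))))"
    by (intro inh_lam isty_el assms s) (use Q3 in \<open>simp_all add: fam\<close>)
  then obtain d where "has G d (fun_ty (el A) (\<lambda>x. fun_ty (el (?B \<cdot> x)) (\<lambda>y. el (t_lam (\<lambda>z. Q) \<cdot> (cPair $$ [A, ?B, x, y])))))"
    by (auto simp: inh_def)
  then have "tru G (t_lam (\<lambda>z. Q) \<cdot> z)"
    using has_app[OF has_app[OF has_app[OF has_app[OF has_app[OF 1 assms(2)] lam_set[OF assms(1-4)]] C] _] z, of d]
    by (auto simp: fam inh_def)
  then show ?thesis using tru_const[OF P Q] z by (simp add: p_ex_def)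
qed

lemma and_I:
  assumes "ctx G" "isset G A" "isset G B" "tru G A" "tru G B"
  shows "tru G (p_and A B)"
proof -
  obtain a where "has G a (el A)" using assms(4) by (auto simp: inh_def)
  then show ?thesis
    unfolding p_and_def using assms has_stab[OF assms(3)] by (intro ex_I) (auto intro: isset_weak simp: fam)
qed

lemma and_E:
  assumes "ctx G" "isset G A" "isset G B" "tru G (p_and A B)"
  shows "tru G A" "tru G B"
proof -
  have B: "isset (G \<triangleright> el A) B" by (rule isset_weak[OF assms(2,3)])
  have c: "ctx (G \<triangleright> el A)" by (intro ctx_ext isty_el assms)
  have A: "isset (G \<triangleright> el A) A" by (rule isset_weak[OF assms(2,2)])
  note E = ex_E[OF assms(1,2) B tmfam_const[OF has_stab[OF assms(3)]] assms(4)[unfolded p_and_def]]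
  show "tru G A"
    by (rule E[OF assms(2)], rule inh_weak[OF tru_hyp[OF assms(2)] ctx_ext[OF isty_el[OF B]]])
  show "tru G B"
    by (rule E[OF assms(3)], rule tru_hyp[OF B])
qed

lemma set_or:
  assumes "ctx G" "isset G A" "isset G B"
  shows "isset G (p_or A B)"
proof -
  have 1: "has G (\<lambda>n. Con cPlus) (fun_ty set_ty (\<lambda>A. fun_ty set_ty (\<lambda>B. set_ty)))"
    using has_con[of G cPlus] assms by (simp add: arrow_def)
  show ?thesis
    using has_app[OF has_app[OF 1 assms(2)] assms(3)] by (simp add: fam)
qed

lemma has_Inl:
  assumes "ctx G" "isset G A" "isset G B" "has G a (el A)"
  shows "has G (cInl $$ [A, B, a]) (el (p_or A B))"
proof -
  note [fam] = assms(2-4)[THEN has_stab]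
  have 1: "has G (\<lambda>n. Con cInl) (fun_ty set_ty (\<lambda>A. fun_ty set_ty (\<lambda>B. fun_ty (el A) (\<lambda>x. el (cPlus $$ [A, B])))))"
    using has_con[of G cInl] assms by (simp add: arrow_def)
  show ?thesis
    using has_app[OF has_app[OF has_app[OF 1 assms(2)] assms(3)] assms(4)] by (simp add: fam)
qed

lemma has_Inr:
  assumes "ctx G" "isset G A" "isset G B" "has G b (el B)"
  shows "has G (cInr $$ [A, B, b]) (el (p_or A B))"
proof -
  note [fam] = assms(2-4)[THEN has_stab]
  have 1: "has G (\<lambda>n. Con cInr) (fun_ty set_ty (\<lambda>A. fun_ty set_ty (\<lambda>B. fun_ty (el B) (\<lambda>x. el (cPlus $$ [A, B])))))"
    using has_con[of G cInr] assms by (simp add: arrow_def)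
  show ?thesis
    using has_app[OF has_app[OF has_app[OF 1 assms(2)] assms(3)] assms(4)] by (simp add: fam)
qed

lemma or_I:
  assumes "ctx G" "isset G A" "isset G B"
  shows "tru G A \<Longrightarrow> tru G (p_or A B)" "tru G B \<Longrightarrow> tru G (p_or A B)"
  using has_Inl[OF assms] has_Inr[OF assms] by (auto simp: inh_def)

text \<open>Kept dependent, since it is used not only for disjunctions but also for case distinction
  on an index of a finite set, which occurs in the goal.\<close>

lemma Plus_cases:
  assumes "ctx G" "isset G A" "isset G B"
    and F: "isset (G \<triangleright> el (p_or A B)) (F (lv (length G)))" "tmfam (length G) F"
    and "tru (G \<triangleright> el A) (F (cInl $$ [A, B, lv (length G)]))"
    and "tru (G \<triangleright> el B) (F (cInr $$ [A, B, lv (length G)]))"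
    and z: "has G z (el (p_or A B))"
  shows "tru G (F z)"
proof -
  note [fam] = assms(2,3)[THEN has_stab] z[THEN has_stab] F(2)[THEN stab_t_lam]
  have P: "isset G (p_or A B)" by (rule set_or[OF assms(1-3)])
  have C: "has G (t_lam F) (fun_ty (el (cPlus $$ [A, B])) (\<lambda>x. set_ty))"
    using lam_set[OF assms(1) P F] by (simp add: p_or_def)
  have 1: "has G (\<lambda>n. Con cWhen) (fun_ty set_ty (\<lambda>A. fun_ty set_ty (\<lambda>B.
     fun_ty (fun_ty (el (cPlus $$ [A, B])) (\<lambda>x. set_ty)) (\<lambda>C.
     fun_ty (fun_ty (el A) (\<lambda>x. el (C \<cdot> (cInl $$ [A, B, x])))) (\<lambda>d.
     fun_ty (fun_ty (el B) (\<lambda>y. el (C \<cdot> (cInr $$ [A, B, y])))) (\<lambda>e.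
     fun_ty (el (cPlus $$ [A, B])) (\<lambda>z. el (C \<cdot> z))))))))"
    using has_con[of G cWhen] assms by (simp add: arrow_def)
  have beta: "tru (G \<triangleright> el X) (t_lam F \<cdot> a)"
    if "isset G X" "has (G \<triangleright> el X) a (el (p_or A B))" "tru (G \<triangleright> el X) (F a)" for X a
  proof -
    have "isset (G \<triangleright> el X \<triangleright> el (p_or A B)) (F (lv (length (G \<triangleright> el X))))"
      using isset_fam_weak[OF F(1) ctx_ext[OF isty_el[OF that(1)]] isty_el[OF P] F(2)] by simp
    then show ?thesis
      using tru_beta[OF _ that(2), of F] tmfam_le[OF F(2), of "Suc (length G)"] that(3) by simp
  qed
  have cA: "ctx (G \<triangleright> el A)" and cB: "ctx (G \<triangleright> el B)" by (intro ctx_ext isty_el assms)+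
  have "inh G (fun_ty (el A) (\<lambda>x. el (t_lam F \<cdot> (cInl $$ [A, B, x]))))"
    using has_var[OF isty_el[OF assms(2)]] assms(2,3,6) cA
    by (intro inh_lam isty_el assms beta has_Inl isset_weak) (simp_all add: fam)
  then obtain d where d: "has G d (fun_ty (el A) (\<lambda>x. el (t_lam F \<cdot> (cInl $$ [A, B, x]))))"
    by (auto simp: inh_def)
  have "inh G (fun_ty (el B) (\<lambda>x. el (t_lam F \<cdot> (cInr $$ [A, B, x]))))"
    using has_var[OF isty_el[OF assms(3)]] assms(2,3,7) cB
    by (intro inh_lam isty_el assms beta has_Inr isset_weak) (simp_all add: fam)
  then obtain e where e: "has G e (fun_ty (el B) (\<lambda>x. el (t_lam F \<cdot> (cInr $$ [A, B, x]))))"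
    by (auto simp: inh_def)
  have "tru G (t_lam F \<cdot> z)"
    using has_app[OF has_app[OF has_app[OF has_app[OF has_app[OF has_app[OF 1 assms(2)] assms(3)] C] d] e] z[unfolded p_or_def]]
      d[THEN has_stab] e[THEN has_stab]
    by (auto simp: fam inh_def)
  then show ?thesis using tru_beta[OF F(1) z F(2)] by blast
qed

lemma or_E:
  assumes "ctx G" "isset G A" "isset G B" "isset G Q"
    and "tru G (p_or A B)" "tru (G \<triangleright> el A) Q" "tru (G \<triangleright> el B) Q"
  shows "tru G Q"
proof -
  obtain z where "has G z (el (p_or A B))" using assms(5) by (auto simp: inh_def)
  then show ?thesis
    using Plus_cases[of G A B "\<lambda>x. Q" z] assms isset_weak[OF set_or[OF assms(1-3)] assms(4)]
      tmfam_const[OF has_stab[OF assms(4)]] by blast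
qed

lemma set_bot: "ctx G \<Longrightarrow> isset G p_bot"
  using has_con[of G cN0] by (simp add: fam)

lemma set_not: "ctx G \<Longrightarrow> isset G A \<Longrightarrow> isset G (p_not A)"
  unfolding p_not_def by (intro set_imp set_bot)

lemma bot_E:
  assumes "ctx G" "isset G Q" "tru G p_bot"
  shows "tru G Q"
proof -
  obtain z where z: "has G z (el (cN0 $$ []))" using assms(3) by (auto simp: inh_def p_bot_def)
  note [fam] = assms(2)[THEN has_stab]
  have N: "isset G p_bot" by (rule set_bot[OF assms(1)])
  have 1: "has G (\<lambda>n. Con cCase0) (fun_ty (fun_ty (el (cN0 $$ [])) (\<lambda>x. set_ty)) (\<lambda>C.
     fun_ty (el (cN0 $$ [])) (\<lambda>z. el (C \<cdot> z))))"
    using has_con[of G cCase0] assms by (simp add: arrow_def)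
  have C: "has G (t_lam (\<lambda>z. Q)) (fun_ty (el (cN0 $$ [])) (\<lambda>x. set_ty))"
    using lam_set[OF assms(1) N, of "\<lambda>z. Q"] isset_weak[OF N assms(2)] by (simp add: fam)
  have "tru G (t_lam (\<lambda>z. Q) \<cdot> z)"
    using has_app[OF has_app[OF 1 C] z] by (auto simp: fam inh_def)
  then show ?thesis using tru_const[OF N assms(2), of z] z by (simp add: p_bot_def)
qed

lemma N1_cases:
  assumes "ctx G" and F: "isset (G \<triangleright> el (cN1 $$ [])) (F (lv (length G)))" "tmfam (length G) F"
    and "tru G (F (cStar $$ []))" and z: "has G z (el (cN1 $$ []))"
  shows "tru G (F z)"
proof -
  have N: "isset G (cN1 $$ [])" using has_con[of G cN1] assms by (simp add: fam)
  have star: "has G (cStar $$ []) (el (cN1 $$ []))" using has_con[of G cStar] assms by (simp add: t_con_def)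
  have 1: "has G (\<lambda>n. Con cCase1) (fun_ty (fun_ty (el (cN1 $$ [])) (\<lambda>x. set_ty)) (\<lambda>C.
     fun_ty (el (C \<cdot> (cStar $$ []))) (\<lambda>d. fun_ty (el (cN1 $$ [])) (\<lambda>z. el (C \<cdot> z)))))"
    using has_con[of G cCase1] assms by (simp add: arrow_def)
  obtain d where d: "has G d (el (t_lam F \<cdot> (cStar $$ [])))"
    using assms(4) tru_beta[OF F(1) star F(2)] by (auto simp: inh_def)
  note [fam] = F(2)[THEN stab_t_lam] d[THEN has_stab]
  have "tru G (t_lam F \<cdot> z)"
    using has_app[OF has_app[OF has_app[OF 1 lam_set[OF assms(1) N F]] d] z] by (auto simp: fam inh_def)
  then show ?thesis using tru_beta[OF F(1) z F(2)] by blast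
qed
end

text \<open>The computation rules are given over generic variables. When a rule is instantiated,
  this replaces the variable of level \<open>i\<close> by the actual argument.\<close>

lemma tm_rel_var_arg:
  assumes "i < N" "f (N - Suc i) = a M" "stab M a"
  shows "tm_rel f N M k (lv i) a"
proof -
  have "\<not> N + k - Suc i < k" "N + k - Suc i - k = N - Suc i" using assms(1) by simp_all
  then show ?thesis using assms by (simp add: tm_rel_def tm_up_pow stab_def)
qed

context ctt
begin

section \<open>Identity sets and natural numbers\<close>

lemma set_Id:
  assumes "ctx G" "isset G A" "has G a (el A)" "has G b (el A)"
  shows "isset G (cId $$ [A, a, b])"
proof -
  note [fam] = assms(2-4)[THEN has_stab]
  have 1: "has G (\<lambda>n. Con cId) (fun_ty set_ty (\<lambda>A. fun_ty (el A) (\<lambda>x. fun_ty (el A) (\<lambda>y. set_ty))))"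
    using has_con[of G cId] assms by (simp add: arrow_def)
  show ?thesis
    using has_app[OF has_app[OF has_app[OF 1 assms(2)] assms(3)] assms(4)] by (simp add: fam)
qed

lemma has_refl:
  assumes "ctx G" "isset G A" "has G a (el A)"
  shows "has G (cRefl $$ [A, a]) (el (cId $$ [A, a, a]))"
proof -
  note [fam] = assms(2-3)[THEN has_stab]
  have 1: "has G (\<lambda>n. Con cRefl) (fun_ty set_ty (\<lambda>A. fun_ty (el A) (\<lambda>x. el (cId $$ [A, x, x]))))"
    using has_con[of G cRefl] assms by (simp add: arrow_def)
  show ?thesis
    using has_app[OF has_app[OF 1 assms(2)] assms(3)] by (simp add: fam)
qed

text \<open>Types the motive of \<open>id_subst\<close> after its first argument has been fixed. The
  conclusion \<open>q\<close> stands for \<open>Q\<close> at that argument, so the same lemma serves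
  for a variable and for a given element.\<close>

lemma has_id_motive:
  assumes "ctx G" "isset G A" "isset (G \<triangleright> el A) (Q (lv (length G)))" "tmfam (length G) Q"
    and "isset G q" "has G a (el A)"
  shows "has G (t_lam (\<lambda>y. t_lam (\<lambda>e. p_imp (Q y) q)))
    (fun_ty (el A) (\<lambda>y. fun_ty (el (cId $$ [A, a, y])) (\<lambda>e. set_ty)))"
    and "has (G \<triangleright> el A) (t_lam (\<lambda>e. p_imp (Q (lv (length G))) q))
      (fun_ty (el (cId $$ [A, a, lv (length G)])) (\<lambda>e. set_ty))"
    and "tmfam (length G) (\<lambda>y. t_lam (\<lambda>e. p_imp (Q y) q))"
proof -
  note [fam] = assms(2,5,6)[THEN has_stab]
  let ?G1 = "G \<triangleright> el A"
  have c1: "ctx ?G1" by (intro ctx_ext isty_el assms)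
  have a1: "has ?G1 a (el A)" by (rule has_weak[OF assms(6) c1])
  have x1: "has ?G1 (lv (length G)) (el A)" by (rule has_var[OF isty_el[OF assms(2)]])
  have i: "isset ?G1 (cId $$ [A, a, lv (length G)])"
    by (intro set_Id c1 isset_weak[OF assms(2,2)] a1 x1)
  have imp: "isset ?G1 (p_imp (Q (lv (length G))) q)"
    by (intro set_imp c1 assms(3) isset_weak[OF assms(2,5)])
  have fam1: "tmfam n (\<lambda>e. p_imp (Q y) q)" if "stab n (Q y)" "length G \<le> n" for n y
    using that stab_le[OF has_stab[OF assms(5)] that(2)] by (simp add: fam)
  show 2: "tmfam (length G) (\<lambda>y. t_lam (\<lambda>e. p_imp (Q y) q))"
    using assms(4) by (simp add: fam)
  show 3: "has ?G1 (t_lam (\<lambda>e. p_imp (Q (lv (length G))) q))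
      (fun_ty (el (cId $$ [A, a, lv (length G)])) (\<lambda>e. set_ty))"
    by (rule has_lam[OF isty_el[OF i]]) (auto intro!: isset_weak[OF i imp] fam1 tmfam_stab_lv assms(4) simp: tyfam_def ty_rel_set)
  show "has G (t_lam (\<lambda>y. t_lam (\<lambda>e. p_imp (Q y) q)))
    (fun_ty (el A) (\<lambda>y. fun_ty (el (cId $$ [A, a, y])) (\<lambda>e. set_ty)))"
    by (rule has_lam[OF isty_el[OF assms(2)]]) (use 2 3 in \<open>simp_all add: fam\<close>)
qed

text \<open>With the motive \<open>Q y \<longrightarrow> Q x\<close> the case of reflexivity is the
  identity implication. Transport goes from right to left, the direction suited to listed subsets,
  where an element \<open>x\<close> comes with a proof that it equals an entry.\<close>

lemma id_subst:
  assumes c: "ctx G" and A: "isset G A" and Q: "isset (G \<triangleright> el A) (Q (lv (length G)))" "tmfam (length G) Q"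
    and a: "has G a (el A)" and b: "has G b (el A)"
    and e: "tru G (cId $$ [A, a, b])" and Qb: "tru G (Q b)"
  shows "tru G (Q a)"
proof -
  note Qs = has_inst[where B = "\<lambda>x. set_ty", OF Q(1) _ c Q(2)]
  let ?M = "t_lam (\<lambda>x. t_lam (\<lambda>y. t_lam (\<lambda>e. p_imp (Q y) (Q x))))"
  let ?T = "\<lambda>A. fun_ty (el A) (\<lambda>x. fun_ty (el A) (\<lambda>y. fun_ty (el (cId $$ [A, x, y])) (\<lambda>e. set_ty)))"
  \<comment> \<open>Stated for an arbitrary context because it is used twice: in \<open>G\<close>,
    and in \<open>G\<close> extended by a variable for the case of reflexivity.\<close>
  have motive: "has H ?M (?T A) \<and> (\<forall>a b e. has H a (el A) \<longrightarrow> has H b (el A) \<longrightarrow> has H e (el (cId $$ [A, a, b])) \<longrightarrow>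
      eq H (?M \<cdot> a \<cdot> b \<cdot> e) (p_imp (Q b) (Q a)) set_ty)"
    if c: "ctx H" and A: "isset H A" and Q: "isset (H \<triangleright> el A) (Q (lv (length H)))" "tmfam (length H) Q" for H
  proof (intro conjI allI impI)
    let ?x = "lv (length H)"
    note [fam] = A[THEN has_stab]
    have c1: "ctx (H \<triangleright> el A)" by (intro ctx_ext isty_el A)
    have x1: "has (H \<triangleright> el A) ?x (el A)" by (rule has_var[OF isty_el[OF A]])
    have A1: "isset (H \<triangleright> el A) A" by (rule isset_weak[OF A A])
    have Q1: "isset (H \<triangleright> el A \<triangleright> el A) (Q (lv (length (H \<triangleright> el A))))"
      using isset_fam_weak[OF Q(1) c1 isty_el[OF A] Q(2)] by simp
    have F1: "tmfam (length (H \<triangleright> el A)) Q" using tmfam_le[OF Q(2)] by simp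
    note m1 = has_id_motive[OF c1 A1 Q1 F1 Q(1) x1]
    have FM: "tmfam (length H) (\<lambda>x. t_lam (\<lambda>y. t_lam (\<lambda>e. p_imp (Q y) (Q x))))"
      using Q(2) by (simp add: fam)
    have FT: "tyfam (length H) (\<lambda>x. fun_ty (el A) (\<lambda>y. fun_ty (el (cId $$ [A, x, y])) (\<lambda>e. set_ty)))"
      by (simp add: fam)
    show "has H ?M (?T A)"
      by (rule has_lam[OF isty_el[OF A]]) (use m1(1) FM FT in simp_all)
    fix a b e
    assume a: "has H a (el A)" and b: "has H b (el A)" and e: "has H e (el (cId $$ [A, a, b]))"
    note [fam] = a[THEN has_stab] b[THEN has_stab] e[THEN has_stab]
    note Qs = has_inst[where B = "\<lambda>x. set_ty", OF Q(1) _ c Q(2)]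
    have Qa: "isset H (Q a)" and Qb: "isset H (Q b)"
      by (rule Qs; simp add: a b tyfam_def ty_rel_set)+
    have "eq H (?M \<cdot> a) (t_lam (\<lambda>y. t_lam (\<lambda>e. p_imp (Q y) (Q a))))
       (fun_ty (el A) (\<lambda>y. fun_ty (el (cId $$ [A, a, y])) (\<lambda>e. set_ty)))"
      by (rule eq_beta[OF m1(1) a FM FT])
    then have E1: "eq H (?M \<cdot> a \<cdot> b) (t_lam (\<lambda>y. t_lam (\<lambda>e. p_imp (Q y) (Q a))) \<cdot> b)
       (fun_ty (el (cId $$ [A, a, b])) (\<lambda>e. set_ty))"
      by (rule eq_app[OF _ eq_refl[OF b]]) (simp add: fam)
    note m2 = has_id_motive[OF c A Q Qa a]
    have E2: "eq H (t_lam (\<lambda>y. t_lam (\<lambda>e. p_imp (Q y) (Q a))) \<cdot> b) (t_lam (\<lambda>e. p_imp (Q b) (Q a)))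
       (fun_ty (el (cId $$ [A, a, b])) (\<lambda>e. set_ty))"
      by (rule eq_beta[where B = "\<lambda>y. fun_ty (el (cId $$ [A, a, y])) (\<lambda>e. set_ty)", OF m2(2) b m2(3)])
        (simp add: fam)
    have E3: "eq H (?M \<cdot> a \<cdot> b \<cdot> e) (t_lam (\<lambda>e. p_imp (Q b) (Q a)) \<cdot> e) set_ty"
      by (rule eq_app[OF eq_trans[OF E1 E2] eq_refl[OF e]]) (simp add: fam)
    have ii: "isset H (cId $$ [A, a, b])" by (intro set_Id c A a b)
    have i: "isset H (p_imp (Q b) (Q a))" by (intro set_imp c Qa Qb)
    have "eq H (t_lam (\<lambda>e. p_imp (Q b) (Q a)) \<cdot> e) (p_imp (Q b) (Q a)) set_ty"
      by (rule eq_const[OF ii isset_weak[OF ii i] has_stab[OF i] tystab_set e])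
    then show "eq H (?M \<cdot> a \<cdot> b \<cdot> e) (p_imp (Q b) (Q a)) set_ty"
      by (rule eq_trans[OF E3])
  qed
  let ?G1 = "G \<triangleright> el A" and ?x = "lv (length G)"
  note [fam] = A[THEN has_stab] a[THEN has_stab] b[THEN has_stab]
  have c1: "ctx ?G1" by (intro ctx_ext isty_el A)
  have x1: "has ?G1 ?x (el A)" by (rule has_var[OF isty_el[OF A]])
  have A1: "isset ?G1 A" by (rule isset_weak[OF A A])
  have Q1: "isset (?G1 \<triangleright> el A) (Q (lv (length ?G1)))"
    using isset_fam_weak[OF Q(1) c1 isty_el[OF A] Q(2)] by simp
  have F1: "tmfam (length ?G1) Q" using tmfam_le[OF Q(2)] by simp
  have Qa: "isset G (Q a)" and Qb': "isset G (Q b)"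
    by (rule Qs; simp add: a b tyfam_def ty_rel_set)+
  define M where "M = ?M"
  note Mdef = motive[folded M_def]
  note M0 = Mdef[OF c A Q, THEN conjunct1] and M1 = Mdef[OF c A Q, THEN conjunct2, rule_format]
  note [fam] = M0[THEN has_stab]
  have "tru ?G1 (p_imp (Q ?x) (Q ?x))"
    by (rule imp_I[OF c1 Q(1) Q(1) tru_hyp[OF Q(1)]])
  then have "tru ?G1 (M \<cdot> ?x \<cdot> ?x \<cdot> (cRefl $$ [A, ?x]))"
    using Mdef[OF c1 A1 Q1 F1, THEN conjunct2, rule_format, OF x1 x1 has_refl[OF c1 A1 x1]]
    by (blast intro: tru_conv eq_sym)
  then have "inh G (fun_ty (el A) (\<lambda>x. el (M \<cdot> x \<cdot> x \<cdot> (cRefl $$ [A, x]))))"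
    by (intro inh_lam isty_el A) (simp_all add: fam)
  then obtain d where d: "has G d (fun_ty (el A) (\<lambda>x. el (M \<cdot> x \<cdot> x \<cdot> (cRefl $$ [A, x]))))"
    by (auto simp: inh_def)
  obtain z where z: "has G z (el (cId $$ [A, a, b]))" using e by (auto simp: inh_def)
  note [fam] = d[THEN has_stab] z[THEN has_stab]
  have 1: "has G (\<lambda>n. Con cIdpeel) (fun_ty set_ty (\<lambda>A.
     fun_ty (?T A) (\<lambda>C.
     fun_ty (fun_ty (el A) (\<lambda>x. el (C \<cdot> x \<cdot> x \<cdot> (cRefl $$ [A, x])))) (\<lambda>d.
     fun_ty (el A) (\<lambda>x. fun_ty (el A) (\<lambda>y.
       fun_ty (el (cId $$ [A, x, y])) (\<lambda>e. el (C \<cdot> x \<cdot> y \<cdot> e))))))))"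
    using has_con[of G cIdpeel] c by (simp add: arrow_def)
  have "has G ((\<lambda>n. Con cIdpeel) \<cdot> A) (fun_ty (?T A) (\<lambda>C.
     fun_ty (fun_ty (el A) (\<lambda>x. el (C \<cdot> x \<cdot> x \<cdot> (cRefl $$ [A, x])))) (\<lambda>d.
     fun_ty (el A) (\<lambda>x. fun_ty (el A) (\<lambda>y.
       fun_ty (el (cId $$ [A, x, y])) (\<lambda>e. el (C \<cdot> x \<cdot> y \<cdot> e)))))))"
    by (rule has_app[OF 1 A]) (simp add: fam)
  then have "has G ((\<lambda>n. Con cIdpeel) \<cdot> A \<cdot> M) (
     fun_ty (fun_ty (el A) (\<lambda>x. el (M \<cdot> x \<cdot> x \<cdot> (cRefl $$ [A, x])))) (\<lambda>d.
     fun_ty (el A) (\<lambda>x. fun_ty (el A) (\<lambda>y.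
       fun_ty (el (cId $$ [A, x, y])) (\<lambda>e. el (M \<cdot> x \<cdot> y \<cdot> e))))))"
    by (rule has_app[OF _ M0]) (simp add: fam)
  then have "has G ((\<lambda>n. Con cIdpeel) \<cdot> A \<cdot> M \<cdot> d) (
     fun_ty (el A) (\<lambda>x. fun_ty (el A) (\<lambda>y.
       fun_ty (el (cId $$ [A, x, y])) (\<lambda>e. el (M \<cdot> x \<cdot> y \<cdot> e)))))"
    by (rule has_app[OF _ d]) (simp add: fam)
  then have "has G ((\<lambda>n. Con cIdpeel) \<cdot> A \<cdot> M \<cdot> d \<cdot> a) (
     fun_ty (el A) (\<lambda>y. fun_ty (el (cId $$ [A, a, y])) (\<lambda>e. el (M \<cdot> a \<cdot> y \<cdot> e))))"
    by (rule has_app[OF _ a]) (simp add: fam)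
  then have "has G ((\<lambda>n. Con cIdpeel) \<cdot> A \<cdot> M \<cdot> d \<cdot> a \<cdot> b) (
       fun_ty (el (cId $$ [A, a, b])) (\<lambda>e. el (M \<cdot> a \<cdot> b \<cdot> e)))"
    by (rule has_app[OF _ b]) (simp add: fam)
  then have "has G ((\<lambda>n. Con cIdpeel) \<cdot> A \<cdot> M \<cdot> d \<cdot> a \<cdot> b \<cdot> z) (el (M \<cdot> a \<cdot> b \<cdot> z))"
    by (rule has_app[OF _ z]) (simp add: fam)
  then have "tru G (p_imp (Q b) (Q a))"
    using M1[OF a b z] by (blast intro: tru_conv inhI)
  then show ?thesis by (rule imp_E[OF c Qb' Qa _ Qb])
qed

lemma set_Nat: "ctx G \<Longrightarrow> isset G (cNat $$ [])"
  using has_con[of G cNat] by (simp add: fam)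

lemma has_zero: "ctx G \<Longrightarrow> has G (cZero $$ []) (el (cNat $$ []))"
  using has_con[of G cZero] by (simp add: t_con_def)

lemma has_succ:
  assumes "ctx G" "has G a (el (cNat $$ []))"
  shows "has G (cSucc $$ [a]) (el (cNat $$ []))"
proof -
  have 1: "has G (\<lambda>n. Con cSucc) (fun_ty (el (cNat $$ [])) (\<lambda>x. el (cNat $$ [])))"
    using has_con[of G cSucc] assms by (simp add: arrow_def)
  show ?thesis
    using has_app[OF 1 assms(2)] by (simp add: fam)
qed

lemma has_natrec:
  assumes "ctx G" "has G C (fun_ty (el (cNat $$ [])) (\<lambda>x. set_ty))" "has G d (el (C \<cdot> (cZero $$ [])))"
    "has G e (fun_ty (el (cNat $$ [])) (\<lambda>x. fun_ty (el (C \<cdot> x)) (\<lambda>y. el (C \<cdot> (cSucc $$ [x])))))"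
    "has G k (el (cNat $$ []))"
  shows "has G (cNatrec $$ [C, d, e, k]) (el (C \<cdot> k))"
proof -
  note [fam] = assms(2-5)[THEN has_stab]
  have 1: "has G (\<lambda>n. Con cNatrec) (fun_ty (fun_ty (el (cNat $$ [])) (\<lambda>x. set_ty)) (\<lambda>C.
     fun_ty (el (C \<cdot> (cZero $$ []))) (\<lambda>d.
     fun_ty (fun_ty (el (cNat $$ [])) (\<lambda>x. fun_ty (el (C \<cdot> x)) (\<lambda>y. el (C \<cdot> (cSucc $$ [x]))))) (\<lambda>e.
     fun_ty (el (cNat $$ [])) (\<lambda>n. el (C \<cdot> n))))))"
    using has_con[of G cNatrec] assms by (simp add: arrow_def)
  show ?thesis
    using has_app[OF has_app[OF has_app[OF has_app[OF 1 assms(2)] assms(3)] assms(4)] assms(5)] by (simp add: fam)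
qed

lemma nat_induct:
  assumes c: "ctx G" and F: "isset (G \<triangleright> el (cNat $$ [])) (F (lv (length G)))" "tmfam (length G) F"
    and zero: "tru G (F (cZero $$ []))"
    and succ: "tru (G \<triangleright> el (cNat $$ []) \<triangleright> el (F (lv (length G)))) (F (cSucc $$ [lv (length G)]))"
    and k: "has G k (el (cNat $$ []))"
  shows "tru G (F k)"
proof -
  let ?N = "cNat $$ []" and ?x = "lv (length G)"
  let ?G1 = "G \<triangleright> el ?N" and ?S = "cSucc $$ [?x]"
  have N: "isset G ?N" by (rule set_Nat[OF c])
  have c1: "ctx ?G1" by (intro ctx_ext isty_el N)
  have x1: "has ?G1 ?x (el ?N)" by (rule has_var[OF isty_el[OF N]])
  have S1: "has ?G1 ?S (el ?N)" by (rule has_succ[OF c1 x1])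
  have C: "has G (t_lam F) (fun_ty (el ?N) (\<lambda>x. set_ty))" by (rule lam_set[OF c N F])
  have F1: "isset (?G1 \<triangleright> el ?N) (F (lv (length ?G1)))"
    using isset_fam_weak[OF F(1) c1 isty_el[OF N] F(2)] by simp
  have f1: "tmfam (length ?G1) F" using tmfam_le[OF F(2)] by simp
  have FS: "isset ?G1 (F ?S)"
    by (rule has_inst[where B = "\<lambda>x. set_ty", OF F1 S1 c1 f1]) (simp add: tyfam_def ty_rel_set)
  note [fam] = C[THEN has_stab]
  obtain d where d: "has G d (el (t_lam F \<cdot> (cZero $$ [])))"
    using zero tru_beta[OF F(1) has_zero[OF c] F(2)] by (auto simp: inh_def)
  have Cx: "eq ?G1 (t_lam F \<cdot> ?x) (F ?x) set_ty" and CS: "eq ?G1 (t_lam F \<cdot> ?S) (F ?S) set_ty"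
    by (rule eq_beta_set[OF F1 x1 f1] eq_beta_set[OF F1 S1 f1])+
  have sx: "isset ?G1 (t_lam F \<cdot> ?x)"
    using has_app[OF has_weak[OF C c1] x1] by (simp add: fam)
  let ?G2 = "?G1 \<triangleright> el (t_lam F \<cdot> ?x)"
  have c2: "ctx ?G2" by (intro ctx_ext isty_el sx)
  \<comment> \<open>As in \<open>ex_E\<close>, an implication trades the induction hypothesis
    \<open>F x\<close> for its unreduced form, which is the one that \<open>cNatrec\<close>
    provides.\<close>
  have "tru ?G1 (p_imp (F ?x) (F ?S))"
    by (rule imp_I[OF c1 F(1) FS succ])
  then have "tru ?G2 (F ?S)"
    using imp_E[OF c2 isset_weak[OF sx F(1)] isset_weak[OF sx FS] inh_weak[OF _ c2]]
      tru_conv[OF tru_hyp[OF sx] eq_weak[OF Cx c2]] by blast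
  then have "tru ?G2 (t_lam F \<cdot> ?S)"
    by (rule tru_conv[OF _ eq_weak[OF eq_sym[OF CS] c2]])
  then have "inh G (fun_ty (el ?N) (\<lambda>x. fun_ty (el (t_lam F \<cdot> x)) (\<lambda>y. el (t_lam F \<cdot> (cSucc $$ [x])))))"
    by (intro inh_lam isty_el N sx) (simp_all add: fam)
  then obtain e where "has G e (fun_ty (el ?N) (\<lambda>x. fun_ty (el (t_lam F \<cdot> x)) (\<lambda>y. el (t_lam F \<cdot> (cSucc $$ [x])))))"
    by (auto simp: inh_def)
  then have "tru G (t_lam F \<cdot> k)"
    by (rule inhI[OF has_natrec[OF c C d _ k]])
  then show ?thesis using tru_beta[OF F(1) k F(2)] by blast
qed

section \<open>Instances of the computation rules\<close>

definition subst_into :: "'c ty list \<Rightarrow> (nat \<Rightarrow> 'c tm) \<Rightarrow> 'c ty list \<Rightarrow> bool" where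
  "subst_into D f G \<longleftrightarrow> (\<forall>k<length G. lf R D (HasTy (f k) (ty_sub f (ctx_ty G k))))"

lemma subst_into_Nil: "subst_into D f []"
  by (simp add: subst_into_def)

lemma subst_into_Cons:
  assumes "subst_into D f G" "ty_sub f B = A (length D)" "has D a A"
  shows "subst_into D (case_nat (a (length D)) f) (B # G)"
  unfolding subst_into_def
proof (intro allI impI)
  fix k assume "k < length (B # G)"
  then show "lf R D (HasTy (case_nat (a (length D)) f k) (ty_sub (case_nat (a (length D)) f) (ctx_ty (B # G) k)))"
    using assms by (cases k) (auto simp: subst_into_def has_def ctx_ty_def ty_sub_sub)
qed

text \<open>Each rule is derivable in the context of its own generic variables; simultaneous
  substitution carries the equation over to \<open>D\<close>.\<close>

lemma computation_rule:
  assumes "s \<in> computation_rules" "s [] = (G, TmEq a b A)" "subst_into D f G" "ctx D"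
  shows "lf R D (TmEq (tm_sub f a) (tm_sub f b) (ty_sub f A))"
proof -
  have "([], s []) \<in> CTT"
    unfolding CTT_def using assms(1) by blast
  then have "([], (G, TmEq a b A)) \<in> R"
    using CTT_sub assms(2) by auto
  then have "lf R G (TmEq a b A)" by (rule LF_rule) simp
  from LF_subst[OF this, of D f] show ?thesis
    using assms(3,4) by (simp add: subst_into_def ctx_def)
qed

lemma set_U: "ctx G \<Longrightarrow> isset G (cU $$ [])"
  using has_con[of G cU] by (simp add: fam)

lemma set_T:
  assumes "ctx G" "has G a (el (cU $$ []))"
  shows "isset G (cT $$ [a])"
proof -
  have 1: "has G (\<lambda>n. Con cT) (fun_ty (el (cU $$ [])) (\<lambda>x. set_ty))"
    using has_con[of G cT] assms by (simp add: arrow_def)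
  show ?thesis
    using has_app[OF 1 assms(2)] by (simp add: fam)
qed

lemma eq_T:
  assumes "ctx G" "eq G a b (el (cU $$ []))"
  shows "eq G (cT $$ [a]) (cT $$ [b]) set_ty"
proof -
  have 1: "has G (\<lambda>n. Con cT) (fun_ty (el (cU $$ [])) (\<lambda>x. set_ty))"
    using has_con[of G cT] assms by (simp add: arrow_def)
  show ?thesis
    using eq_app[OF eq_refl[OF 1] assms(2)] by (simp add: fam)
qed

lemma has_uPlus:
  assumes "ctx G" "has G a (el (cU $$ []))" "has G b (el (cU $$ []))"
  shows "has G (cuPlus $$ [a, b]) (el (cU $$ []))"
proof -
  have 1: "has G (\<lambda>n. Con cuPlus) (fun_ty (el (cU $$ [])) (\<lambda>x. fun_ty (el (cU $$ [])) (\<lambda>x. el (cU $$ []))))"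
    using has_con[of G cuPlus] assms by (simp add: arrow_def)
  show ?thesis
    using has_app[OF has_app[OF 1 assms(2)] assms(3)] by (simp add: fam)
qed

lemma eq_Plus:
  assumes "ctx G" "eq G A A' set_ty" "eq G B B' set_ty"
  shows "eq G (p_or A B) (p_or A' B') set_ty"
proof -
  have 1: "has G (\<lambda>n. Con cPlus) (fun_ty set_ty (\<lambda>x. fun_ty set_ty (\<lambda>x. set_ty)))"
    using has_con[of G cPlus] assms by (simp add: arrow_def)
  show ?thesis
    using eq_app[OF eq_app[OF eq_refl[OF 1] assms(2)] assms(3)] by (simp add: fam)
qed

lemma has_uN0: "ctx G \<Longrightarrow> has G (cuN0 $$ []) (el (cU $$ []))"
  and has_uN1: "ctx G \<Longrightarrow> has G (cuN1 $$ []) (el (cU $$ []))"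
  using has_con[of G cuN0] has_con[of G cuN1] by (simp_all add: t_con_def)

lemma eq_T_uN0:
  assumes "ctx G" shows "eq G (cT $$ [cuN0 $$ []]) p_bot set_ty"
proof -
  have "equation (cT $$ [cuN0 $$ []]) (cN0 $$ []) set_ty \<in> computation_rules"
    unfolding computation_rules_def by (simp only: insert_iff) simp
  from computation_rule[OF this equation_def[THEN fun_cong] subst_into_Nil assms] show ?thesis
    by (simp add: eq_def fam t_app_def[THEN fun_cong]) (simp add: set_ty_def)
qed

lemma eq_T_uN1:
  assumes "ctx G" shows "eq G (cT $$ [cuN1 $$ []]) (cN1 $$ []) set_ty"
proof -
  have "equation (cT $$ [cuN1 $$ []]) (cN1 $$ []) set_ty \<in> computation_rules"
    unfolding computation_rules_def by (simp only: insert_iff) simp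
  from computation_rule[OF this equation_def[THEN fun_cong] subst_into_Nil assms] show ?thesis
    by (simp add: eq_def fam t_app_def[THEN fun_cong]) (simp add: set_ty_def)
qed

lemma subst_into_ext:
  "subst_into D f G \<Longrightarrow> ty_rel f (length G) (length D) 0 A A' \<Longrightarrow> has D a A' \<Longrightarrow>
    subst_into D (case_nat (a (length D)) f) (A (length G) # G)"
  by (rule subst_into_Cons) (simp_all add: ty_rel_def)

lemma eq_T_uPlus:
  assumes "ctx G" "has G a (el (cU $$ []))" "has G b (el (cU $$ []))"
  shows "eq G (cT $$ [cuPlus $$ [a, b]]) (p_or (cT $$ [a]) (cT $$ [b])) set_ty"
proof -
  note [fam] = assms(2-3)[THEN has_stab]
  let ?s = "given (el (cU $$ [])) (\<lambda>a. given (el (cU $$ [])) (\<lambda>b.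
       equation (cT $$ [cuPlus $$ [a, b]]) (cPlus $$ [cT $$ [a], cT $$ [b]]) set_ty))"
  \<comment> \<open>Index 0 is the innermost variable of the rule, so the last argument comes first.
    The remaining indices can be chosen freely, here by \<open>Var\<close>.\<close>
  let ?f = "case_nat (b (length G)) (case_nat (a (length G)) Var)"
  have s: "?s \<in> computation_rules"
    unfolding computation_rules_def by (simp only: insert_iff) simp
  have 1: "subst_into G (case_nat (a (length G)) Var) [el (cU $$ []) 0]"
    using subst_into_ext[OF subst_into_Nil _ assms(2), where A = "el (cU $$ [])" and f = Var] by (simp add: fam)
  have "subst_into G ?f [el (cU $$ []) 1, el (cU $$ []) 0]"
    using subst_into_ext[OF 1 _ assms(3), where A = "el (cU $$ [])"] by (simp add: fam)
  then have "subst_into G ?f (fst (?s []))"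
    by (simp add: given_def equation_def)
  from computation_rule[OF s _ this assms(1)]
  have "lf R G (TmEq (tm_sub ?f ((cT $$ [cuPlus $$ [lv 0, lv 1]]) 2)) (tm_sub ?f ((cPlus $$ [cT $$ [lv 0], cT $$ [lv 1]]) 2)) SET)"
    by (simp add: given_def equation_def set_ty_def numeral_2_eq_2)
  moreover have "tm_rel ?f 2 (length G) 0 (cT $$ [cuPlus $$ [lv 0, lv 1]]) (cT $$ [cuPlus $$ [a, b]])"
    "tm_rel ?f 2 (length G) 0 (cPlus $$ [cT $$ [lv 0], cT $$ [lv 1]]) (p_or (cT $$ [a]) (cT $$ [b]))"
    by (simp_all add: fam tm_rel_var_arg)
  moreover have "stab (length G) (cT $$ [cuPlus $$ [a, b]])" "stab (length G) (p_or (cT $$ [a]) (cT $$ [b]))"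
    by (simp_all add: fam)
  ultimately show ?thesis
    by (simp add: eq_def tm_rel_def tystab_set) (simp add: set_ty_def)
qed

lemma eq_natrec_zero:
  assumes "ctx G" "has G C (fun_ty (el (cNat $$ [])) (\<lambda>x. set_ty))" "has G d (el (C \<cdot> (cZero $$ [])))"
    "has G e (fun_ty (el (cNat $$ [])) (\<lambda>x. fun_ty (el (C \<cdot> x)) (\<lambda>y. el (C \<cdot> (cSucc $$ [x])))))"
  shows "eq G (cNatrec $$ [C, d, e, cZero $$ []]) d (el (C \<cdot> (cZero $$ [])))"
proof -
  note [fam] = assms(2-4)[THEN has_stab]
  let ?s = "given (el (cNat $$ []) \<rightarrow> set_ty) (\<lambda>C. given (el (C \<cdot> (cZero $$ []))) (\<lambda>d.
     given (fun_ty (el (cNat $$ [])) (\<lambda>x. el (C \<cdot> x) \<rightarrow> el (C \<cdot> (cSucc $$ [x])))) (\<lambda>e.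
       equation (cNatrec $$ [C, d, e, cZero $$ []]) d (el (C \<cdot> (cZero $$ []))))))"
  let ?f1 = "case_nat (C (length G)) Var"
  let ?f2 = "case_nat (d (length G)) ?f1"
  let ?f = "case_nat (e (length G)) ?f2"
  have s: "?s \<in> computation_rules"
    unfolding computation_rules_def by (simp only: insert_iff) simp
  let ?c1 = "[(el (cNat $$ []) \<rightarrow> set_ty) 0]"
  let ?c2 = "el (lv 0 \<cdot> (cZero $$ [])) 1 # ?c1"
  let ?c3 = "fun_ty (el (cNat $$ [])) (\<lambda>x. el (lv 0 \<cdot> x) \<rightarrow> el (lv 0 \<cdot> (cSucc $$ [x]))) 2 # ?c2"
  have 1: "subst_into G ?f1 ?c1"
    using subst_into_ext[OF subst_into_Nil _ assms(2), where A = "el (cNat $$ []) \<rightarrow> set_ty" and f = Var] by (simp add: fam)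
  have 2: "subst_into G ?f2 ?c2"
    using subst_into_ext[OF 1 _ assms(3), where A = "el (lv 0 \<cdot> (cZero $$ []))"]
      by (simp add: fam tm_rel_var_arg)
  have 3: "subst_into G ?f ?c3"
    using subst_into_ext[OF 2 _ assms(4), where A = "fun_ty (el (cNat $$ [])) (\<lambda>x. el (lv 0 \<cdot> x) \<rightarrow> el (lv 0 \<cdot> (cSucc $$ [x])))"]
      by (simp add: fam tm_rel_var_arg numeral_2_eq_2)
  have "?s [] = (?c3, TmEq ((cNatrec $$ [lv 0, lv 1, lv 2, cZero $$ []]) 3) (lv 1 3) (el (lv 0 \<cdot> (cZero $$ [])) 3))"
    by (simp add: given_def equation_def numeral_2_eq_2 numeral_3_eq_3)
  from computation_rule[OF s this 3 assms(1)]
  have "lf R G (TmEq (tm_sub ?f ((cNatrec $$ [lv 0, lv 1, lv 2, cZero $$ []]) 3)) (tm_sub ?f (lv 1 3))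
      (ty_sub ?f (el (lv 0 \<cdot> (cZero $$ [])) 3)))" .
  moreover have "tm_rel ?f 3 (length G) 0 (cNatrec $$ [lv 0, lv 1, lv 2, cZero $$ []]) (cNatrec $$ [C, d, e, cZero $$ []])"
    "tm_rel ?f 3 (length G) 0 (lv 1) d"
    "ty_rel ?f 3 (length G) 0 (el (lv 0 \<cdot> (cZero $$ []))) (el (C \<cdot> (cZero $$ [])))"
    by (simp_all add: fam tm_rel_var_arg numeral_2_eq_2 numeral_3_eq_3)
  moreover have "stab (length G) (cNatrec $$ [C, d, e, cZero $$ []])" "stab (length G) d"
      "tystab (length G) (el (C \<cdot> (cZero $$ [])))"
    by (simp_all add: fam)
  ultimately show ?thesis
    by (simp add: eq_def tm_rel_def ty_rel_def)
qed

lemma eq_natrec_succ: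
  assumes "ctx G" "has G C (fun_ty (el (cNat $$ [])) (\<lambda>x. set_ty))" "has G d (el (C \<cdot> (cZero $$ [])))"
    "has G e (fun_ty (el (cNat $$ [])) (\<lambda>x. fun_ty (el (C \<cdot> x)) (\<lambda>y. el (C \<cdot> (cSucc $$ [x])))))"
    "has G k (el (cNat $$ []))"
  shows "eq G (cNatrec $$ [C, d, e, cSucc $$ [k]]) (e \<cdot> k \<cdot> (cNatrec $$ [C, d, e, k])) (el (C \<cdot> (cSucc $$ [k])))"
proof -
  note [fam] = assms(2-5)[THEN has_stab]
  let ?s = "given (el (cNat $$ []) \<rightarrow> set_ty) (\<lambda>C. given (el (C \<cdot> (cZero $$ []))) (\<lambda>d.
     given (fun_ty (el (cNat $$ [])) (\<lambda>x. el (C \<cdot> x) \<rightarrow> el (C \<cdot> (cSucc $$ [x])))) (\<lambda>e.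
     given (el (cNat $$ [])) (\<lambda>n.
       equation (cNatrec $$ [C, d, e, cSucc $$ [n]]) (e \<cdot> n \<cdot> (cNatrec $$ [C, d, e, n]))
         (el (C \<cdot> (cSucc $$ [n])))))))"
  let ?f1 = "case_nat (C (length G)) Var"
  let ?f2 = "case_nat (d (length G)) ?f1"
  let ?f3 = "case_nat (e (length G)) ?f2"
  let ?f = "case_nat (k (length G)) ?f3"
  have s: "?s \<in> computation_rules"
    unfolding computation_rules_def by (simp only: insert_iff) simp
  let ?c1 = "[(el (cNat $$ []) \<rightarrow> set_ty) 0]"
  let ?c2 = "el (lv 0 \<cdot> (cZero $$ [])) 1 # ?c1"
  let ?c3 = "fun_ty (el (cNat $$ [])) (\<lambda>x. el (lv 0 \<cdot> x) \<rightarrow> el (lv 0 \<cdot> (cSucc $$ [x]))) 2 # ?c2"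
  let ?c4 = "el (cNat $$ []) 3 # ?c3"
  have 1: "subst_into G ?f1 ?c1"
    using subst_into_ext[OF subst_into_Nil _ assms(2), where A = "el (cNat $$ []) \<rightarrow> set_ty" and f = Var] by (simp add: fam)
  have 2: "subst_into G ?f2 ?c2"
    using subst_into_ext[OF 1 _ assms(3), where A = "el (lv 0 \<cdot> (cZero $$ []))"]
      by (simp add: fam tm_rel_var_arg)
  have 3: "subst_into G ?f3 ?c3"
    using subst_into_ext[OF 2 _ assms(4), where A = "fun_ty (el (cNat $$ [])) (\<lambda>x. el (lv 0 \<cdot> x) \<rightarrow> el (lv 0 \<cdot> (cSucc $$ [x])))"]
      by (simp add: fam tm_rel_var_arg numeral_2_eq_2)
  have 4: "subst_into G ?f ?c4"
    using subst_into_ext[OF 3 _ assms(5), where A = "el (cNat $$ [])"]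
      by (simp add: fam numeral_3_eq_3)
  let ?l = "cNatrec $$ [lv 0, lv 1, lv 2, cSucc $$ [lv 3]]"
  let ?r = "lv 2 \<cdot> lv 3 \<cdot> (cNatrec $$ [lv 0, lv 1, lv 2, lv 3])"
  let ?T = "el (lv 0 \<cdot> (cSucc $$ [lv 3]))"
  have "?s [] = (?c4, TmEq (?l 4) (?r 4) (?T 4))"
    by (simp add: given_def equation_def eval_nat_numeral)
  from computation_rule[OF s this 4 assms(1)]
  have "lf R G (TmEq (tm_sub ?f (?l 4)) (tm_sub ?f (?r 4)) (ty_sub ?f (?T 4)))" .
  moreover have "tm_rel ?f 4 (length G) 0 ?l (cNatrec $$ [C, d, e, cSucc $$ [k]])"
    "tm_rel ?f 4 (length G) 0 ?r (e \<cdot> k \<cdot> (cNatrec $$ [C, d, e, k]))"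
    "ty_rel ?f 4 (length G) 0 ?T (el (C \<cdot> (cSucc $$ [k])))"
    by (simp_all add: fam tm_rel_var_arg eval_nat_numeral)
  moreover have "stab (length G) (cNatrec $$ [C, d, e, cSucc $$ [k]])" "stab (length G) (e \<cdot> k \<cdot> (cNatrec $$ [C, d, e, k]))"
      "tystab (length G) (el (C \<cdot> (cSucc $$ [k])))"
    by (simp_all add: fam)
  ultimately show ?thesis
    by (simp add: eq_def tm_rel_def ty_rel_def)
qed

end

section \<open>Standard finite sets\<close>

definition fin_step :: "'c tmx" where
  "fin_step = t_lam (\<lambda>x. t_lam (\<lambda>c. cuPlus $$ [c, cuN1 $$ []]))"
definition fin_code :: "'c tmx \<Rightarrow> 'c tmx" where
  "fin_code k = cNatrec $$ [t_lam (\<lambda>x. cU $$ []), cuN0 $$ [], fin_step, k]"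

lemma Fin_code: "Fin k = cT $$ [fin_code k]"
  by (simp add: Fin_def fin_code_def fin_step_def)

context ctt
begin

text \<open>The recursion behind \<open>Fin\<close> does not depend on the number, yet
  \<open>cNatrec\<close> types its result by the motive applied to the number. These facts convert
  between that type and the universe.\<close>

lemma fin_motive:
  assumes "ctx G"
  shows "has G (t_lam (\<lambda>x. cU $$ [])) (fun_ty (el (cNat $$ [])) (\<lambda>x. set_ty))"
    and "has G a (el (cNat $$ [])) \<Longrightarrow> eq G (t_lam (\<lambda>x. cU $$ []) \<cdot> a) (cU $$ []) set_ty"
proof -
  have N: "isset G (cNat $$ [])" by (rule set_Nat[OF assms])
  have U: "isset (G \<triangleright> el (cNat $$ [])) (cU $$ [])" by (intro set_U ctx_ext isty_el N)
  show "has G (t_lam (\<lambda>x. cU $$ [])) (fun_ty (el (cNat $$ [])) (\<lambda>x. set_ty))"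
    by (rule lam_set[OF assms N U]) (simp add: fam)
  show "eq G (t_lam (\<lambda>x. cU $$ []) \<cdot> a) (cU $$ []) set_ty" if "has G a (el (cNat $$ []))"
    by (rule eq_const[OF N U _ _ that]) (simp_all add: fam)
qed

lemma has_fin_step:
  fixes G :: "'c ty list"
  assumes c: "ctx G"
  defines "C \<equiv> t_lam (\<lambda>x. cU $$ []) :: 'c tmx"
  shows "has G fin_step (fun_ty (el (cNat $$ [])) (\<lambda>x. fun_ty (el (C \<cdot> x)) (\<lambda>y. el (C \<cdot> (cSucc $$ [x])))))"
    and "has G m (el (cNat $$ [])) \<Longrightarrow> has G r (el (C \<cdot> m)) \<Longrightarrow>
      eq G (fin_step \<cdot> m \<cdot> r) (cuPlus $$ [r, cuN1 $$ []]) (el (C \<cdot> (cSucc $$ [m])))"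
proof -
  let ?N = "cNat $$ []" and ?T = "\<lambda>x. fun_ty (el (C \<cdot> x)) (\<lambda>y. el (C \<cdot> (cSucc $$ [x])))"
  let ?F = "\<lambda>c. cuPlus $$ [c, cuN1 $$ []]"
  note C = fin_motive[folded C_def]
  have [fam]: "stab n C" for n by (simp add: C_def fam)
  \<comment> \<open>Needed in two contexts: under the variable of the recursion, to type the step,
    and at the given \<open>m\<close>, to compute it.\<close>
  have inner: "has (H \<triangleright> el (C \<cdot> a)) (?F (lv (length H))) (el (C \<cdot> (cSucc $$ [a])))"
    "has H (t_lam ?F) (?T a)" if c: "ctx H" and a: "has H a (el ?N)" for H a
  proof -
    note [fam] = a[THEN has_stab]
    have s: "isset H (C \<cdot> a)"
      using has_app[OF C(1)[OF c] a] by (simp add: fam)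
    have c1: "ctx (H \<triangleright> el (C \<cdot> a))" by (intro ctx_ext isty_el s)
    note a1 = has_weak[OF a c1]
    have "has (H \<triangleright> el (C \<cdot> a)) (lv (length H)) (el (cU $$ []))"
      by (rule has_conv[OF has_var[OF isty_el[OF s]] C(2)[OF c1 a1]])
    then have "has (H \<triangleright> el (C \<cdot> a)) (?F (lv (length H))) (el (cU $$ []))"
      by (intro has_uPlus c1 has_uN1)
    then show 1: "has (H \<triangleright> el (C \<cdot> a)) (?F (lv (length H))) (el (C \<cdot> (cSucc $$ [a])))"
      by (rule has_conv[OF _ eq_sym[OF C(2)[OF c1 has_succ[OF c1 a1]]]])
    show "has H (t_lam ?F) (?T a)"
      by (rule has_lam[where F = ?F and B = "\<lambda>y. el (C \<cdot> (cSucc $$ [a]))", OF isty_el[OF s] 1]) (simp_all add: fam)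
  qed
  have N: "isset G ?N" by (rule set_Nat[OF c])
  have fs: "fin_step = t_lam (\<lambda>x. t_lam ?F)" by (simp add: fin_step_def)
  note i1 = inner(2)[OF ctx_ext[OF isty_el[OF N]] has_var[OF isty_el[OF N]]]
  show "has G fin_step (fun_ty (el ?N) ?T)"
    unfolding fs by (rule has_lam[where F = "\<lambda>x. t_lam ?F" and B = ?T, OF isty_el[OF N] i1]) (simp_all add: fam)
  assume m: "has G m (el ?N)" and r: "has G r (el (C \<cdot> m))"
  note [fam] = m[THEN has_stab] r[THEN has_stab]
  have "eq G (fin_step \<cdot> m) (t_lam ?F) (?T m)"
    unfolding fs by (rule eq_beta[where F = "\<lambda>x. t_lam ?F" and B = ?T, OF i1 m]) (simp_all add: fam)
  then have "eq G (fin_step \<cdot> m \<cdot> r) (t_lam ?F \<cdot> r) (el (C \<cdot> (cSucc $$ [m])))"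
    by (rule eq_app[OF _ eq_refl[OF r]]) (simp add: fam)
  moreover have "eq G (t_lam ?F \<cdot> r) (?F r) (el (C \<cdot> (cSucc $$ [m])))"
    by (rule eq_beta[where F = ?F and B = "\<lambda>y. el (C \<cdot> (cSucc $$ [m]))", OF inner(1)[OF c m] r]) (simp_all add: fam)
  ultimately show "eq G (fin_step \<cdot> m \<cdot> r) (?F r) (el (C \<cdot> (cSucc $$ [m])))"
    by (rule eq_trans)
qed

lemma has_fin_code:
  assumes "ctx G" "has G k (el (cNat $$ []))"
  shows "has G (fin_code k) (el (t_lam (\<lambda>x. cU $$ []) \<cdot> k))" "has G (fin_code k) (el (cU $$ []))"
proof -
  note z = has_conv[OF has_uN0 eq_sym[OF fin_motive(2)[OF _ has_zero]], OF assms(1) assms(1) assms(1)]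
  show 1: "has G (fin_code k) (el (t_lam (\<lambda>x. cU $$ []) \<cdot> k))"
    unfolding fin_code_def
    by (rule has_natrec[OF assms(1) fin_motive(1)[OF assms(1)] z has_fin_step(1)[OF assms(1)] assms(2)])
  show "has G (fin_code k) (el (cU $$ []))"
    by (rule has_conv[OF 1 fin_motive(2)[OF assms]])
qed

lemma set_Fin: "ctx G \<Longrightarrow> has G k (el (cNat $$ [])) \<Longrightarrow> isset G (Fin k)"
  unfolding Fin_code by (intro set_T has_fin_code)

lemma eq_Fin_zero:
  assumes c: "ctx G"
  shows "eq G (Fin (cZero $$ [])) p_bot set_ty"
proof -
  note z = has_conv[OF has_uN0 eq_sym[OF fin_motive(2)[OF _ has_zero]], OF c c c]
  have "eq G (fin_code (cZero $$ [])) (cuN0 $$ []) (el (t_lam (\<lambda>x. cU $$ []) \<cdot> (cZero $$ [])))"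
    unfolding fin_code_def by (rule eq_natrec_zero[OF c fin_motive(1)[OF c] z has_fin_step(1)[OF c]])
  then have "eq G (fin_code (cZero $$ [])) (cuN0 $$ []) (el (cU $$ []))"
    by (rule eq_conv[OF _ fin_motive(2)[OF c has_zero[OF c]]])
  then show ?thesis
    unfolding Fin_code by (rule eq_trans[OF eq_T[OF c] eq_T_uN0[OF c]])
qed

text \<open>A judgemental equality and not only a bijection, so indices pass between
  \<open>Fin (m + 1)\<close> and the sum by conversion alone. It combines the computation of the
  recursion with the decoding of the universe.\<close>

lemma eq_Fin_succ:
  assumes c: "ctx G" and m: "has G m (el (cNat $$ []))"
  shows "eq G (Fin (cSucc $$ [m])) (p_or (Fin m) (cN1 $$ [])) set_ty"
proof -
  note z = has_conv[OF has_uN0 eq_sym[OF fin_motive(2)[OF _ has_zero]], OF c c c]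
  have "eq G (fin_code (cSucc $$ [m])) (fin_step \<cdot> m \<cdot> fin_code m) (el (t_lam (\<lambda>x. cU $$ []) \<cdot> (cSucc $$ [m])))"
    unfolding fin_code_def by (rule eq_natrec_succ[OF c fin_motive(1)[OF c] z has_fin_step(1)[OF c] m])
  note eq_trans[OF this has_fin_step(2)[OF c m has_fin_code(1)[OF c m]]]
  then have "eq G (fin_code (cSucc $$ [m])) (cuPlus $$ [fin_code m, cuN1 $$ []]) (el (cU $$ []))"
    by (rule eq_conv[OF _ fin_motive(2)[OF c has_succ[OF c m]]])
  then have "eq G (Fin (cSucc $$ [m])) (cT $$ [cuPlus $$ [fin_code m, cuN1 $$ []]]) set_ty"
    unfolding Fin_code by (rule eq_T[OF c])
  moreover have "eq G (cT $$ [cuPlus $$ [fin_code m, cuN1 $$ []]]) (p_or (Fin m) (cT $$ [cuN1 $$ []])) set_ty"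
    unfolding Fin_code by (rule eq_T_uPlus[OF c has_fin_code(2)[OF c m] has_uN1[OF c]])
  moreover have "eq G (p_or (Fin m) (cT $$ [cuN1 $$ []])) (p_or (Fin m) (cN1 $$ [])) set_ty"
    by (rule eq_Plus[OF c eq_refl[OF set_Fin[OF c m]] eq_T_uN1[OF c]])
  ultimately show ?thesis by (blast intro: eq_trans)
qed

end

section \<open>Finite choice in type theory\<close>

definition entry :: "'c tmx \<Rightarrow> 'c tmx \<Rightarrow> 'c tmx \<Rightarrow> 'c tmx \<Rightarrow> 'c tmx" where
  [fam]: "entry S m f i = cApply $$ [Fin m, t_lam (\<lambda>j. S), f, i]"
definition all_in :: "'c tmx \<Rightarrow> 'c tmx \<Rightarrow> 'c tmx \<Rightarrow> 'c tmx \<Rightarrow> 'c tmx" where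
  [fam]: "all_in S D m f = p_all (Fin m) (\<lambda>i. D \<cdot> entry S m f i)"
definition all_or :: "'c tmx \<Rightarrow> 'c tmx \<Rightarrow> 'c tmx \<Rightarrow> 'c tmx \<Rightarrow> 'c tmx \<Rightarrow> 'c tmx" where
  [fam]: "all_or S D P m f = p_all (Fin m) (\<lambda>i. p_or P (D \<cdot> entry S m f i))"
text \<open>Quantified over all sequences, because the inductive step applies the statement to the
  restriction of a given one. \<open>P\<close> and \<open>D\<close> stay fixed, so only elements of
  sets are quantified over and the statement can be a motive of \<open>cNatrec\<close>.\<close>

definition choice_stmt :: "'c tmx \<Rightarrow> 'c tmx \<Rightarrow> 'c tmx \<Rightarrow> 'c tmx \<Rightarrow> 'c tmx" where
  [fam]: "choice_stmt S D P m = p_all (p_imp (Fin m) S) (\<lambda>f. p_imp (all_or S D P m f) (p_or P (all_in S D m f)))"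

definition restrict_seq :: "'c tmx \<Rightarrow> 'c tmx \<Rightarrow> 'c tmx \<Rightarrow> 'c tmx" where
  "restrict_seq S m f = cLam $$ [Fin m, t_lam (\<lambda>j. S), t_lam (\<lambda>i. entry S (cSucc $$ [m]) f (cInl $$ [Fin m, cN1 $$ [], i]))]"

context ctt
begin

text \<open>This concerns elements of the set \<open>cPi\<close>, to which sequences belong;
  \<open>eq_beta\<close> is about functions of the framework.\<close>

lemma eq_Pi_beta:
  assumes "ctx G" "isset G A" "has G B (fun_ty (el A) (\<lambda>x. set_ty))" "has G b (fun_ty (el A) (\<lambda>x. el (B \<cdot> x)))"
    "has G a (el A)"
  shows "eq G (cApply $$ [A, B, cLam $$ [A, B, b], a]) (b \<cdot> a) (el (B \<cdot> a))"
proof -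
  note [fam] = assms(2-5)[THEN has_stab]
  let ?s = "given set_ty (\<lambda>A. given (el A \<rightarrow> set_ty) (\<lambda>B.
     given (fun_ty (el A) (\<lambda>x. el (B \<cdot> x))) (\<lambda>b. given (el A) (\<lambda>a.
       equation (cApply $$ [A, B, cLam $$ [A, B, b], a]) (b \<cdot> a) (el (B \<cdot> a))))))"
  let ?f1 = "case_nat (A (length G)) Var"
  let ?f2 = "case_nat (B (length G)) ?f1"
  let ?f3 = "case_nat (b (length G)) ?f2"
  let ?f = "case_nat (a (length G)) ?f3"
  have s: "?s \<in> computation_rules"
    unfolding computation_rules_def by (simp only: insert_iff) simp
  let ?c1 = "[set_ty 0]"
  let ?c2 = "(el (lv 0) \<rightarrow> set_ty) 1 # ?c1"
  let ?c3 = "fun_ty (el (lv 0)) (\<lambda>x. el (lv 1 \<cdot> x)) 2 # ?c2"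
  let ?c4 = "el (lv 0) 3 # ?c3"
  have 1: "subst_into G ?f1 ?c1"
    using subst_into_ext[OF subst_into_Nil _ assms(2), where A = set_ty and f = Var] by (simp add: fam)
  have 2: "subst_into G ?f2 ?c2"
    using subst_into_ext[OF 1 _ assms(3), where A = "el (lv 0) \<rightarrow> set_ty"] by (simp add: fam tm_rel_var_arg)
  have 3: "subst_into G ?f3 ?c3"
    using subst_into_ext[OF 2 _ assms(4), where A = "fun_ty (el (lv 0)) (\<lambda>x. el (lv 1 \<cdot> x))"]
    by (simp add: fam tm_rel_var_arg numeral_2_eq_2)
  have 4: "subst_into G ?f ?c4"
    using subst_into_ext[OF 3 _ assms(5), where A = "el (lv 0)"] by (simp add: fam tm_rel_var_arg numeral_3_eq_3)
  let ?l = "cApply $$ [lv 0, lv 1, cLam $$ [lv 0, lv 1, lv 2], lv 3]"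
  let ?r = "lv 2 \<cdot> lv 3"
  let ?T = "el (lv 1 \<cdot> lv 3)"
  have "?s [] = (?c4, TmEq (?l 4) (?r 4) (?T 4))"
    by (simp add: given_def equation_def eval_nat_numeral)
  from computation_rule[OF s this 4 assms(1)]
  have "lf R G (TmEq (tm_sub ?f (?l 4)) (tm_sub ?f (?r 4)) (ty_sub ?f (?T 4)))" .
  moreover have "tm_rel ?f 4 (length G) 0 ?l (cApply $$ [A, B, cLam $$ [A, B, b], a])"
    "tm_rel ?f 4 (length G) 0 ?r (b \<cdot> a)" "ty_rel ?f 4 (length G) 0 ?T (el (B \<cdot> a))"
    by (simp_all add: fam tm_rel_var_arg eval_nat_numeral)
  moreover have "stab (length G) (cApply $$ [A, B, cLam $$ [A, B, b], a])" "stab (length G) (b \<cdot> a)"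
      "tystab (length G) (el (B \<cdot> a))"
    by (simp_all add: fam)
  ultimately show ?thesis
    by (simp add: eq_def tm_rel_def ty_rel_def)
qed

text \<open>Bundles the typing facts that are carried through every context extension of the
  induction on the length.\<close>

definition pred_data :: "'c ty list \<Rightarrow> 'c tmx \<Rightarrow> 'c tmx \<Rightarrow> 'c tmx \<Rightarrow> bool" where
  "pred_data H S D P \<longleftrightarrow> ctx H \<and> isset H S \<and> has H D (fun_ty (el S) (\<lambda>x. set_ty)) \<and> isset H P"

lemma pred_data_dest: "pred_data H S D P \<Longrightarrow> ctx H" "pred_data H S D P \<Longrightarrow> isset H S"
    "pred_data H S D P \<Longrightarrow> has H D (fun_ty (el S) (\<lambda>x. set_ty))" "pred_data H S D P \<Longrightarrow> isset H P"
  by (simp_all add: pred_data_def)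

lemma pred_data_weak: "pred_data H S D P \<Longrightarrow> isset H X \<Longrightarrow> pred_data (H \<triangleright> el X) S D P"
  by (auto simp: pred_data_def intro: has_weak ctx_ext isty_el)

lemma set_app: "pred_data H S D P \<Longrightarrow> has H a (el S) \<Longrightarrow> isset H (D \<cdot> a)"
  using has_app[of H D "el S" "\<lambda>x. set_ty" a] by (auto simp: pred_data_def fam)

lemma eq_set_app: "pred_data H S D P \<Longrightarrow> eq H a b (el S) \<Longrightarrow> eq H (D \<cdot> a) (D \<cdot> b) set_ty"
  using eq_app[of H D D "el S" "\<lambda>x. set_ty" a b] by (auto simp: pred_data_def fam intro: eq_refl)

lemma pred_data_fin: "pred_data H S D P \<Longrightarrow> has H m (el (cNat $$ [])) \<Longrightarrow> pred_data (H \<triangleright> el (Fin m)) S D P"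
  by (rule pred_data_weak) (auto simp: pred_data_def intro: set_Fin)

lemma set_seq: "pred_data H S D P \<Longrightarrow> has H m (el (cNat $$ [])) \<Longrightarrow> isset H (p_imp (Fin m) S)"
  by (auto simp: pred_data_def intro: set_imp set_Fin)

lemma has_entry:
  assumes "pred_data H S D P" "has H m (el (cNat $$ []))" "has H f (el (p_imp (Fin m) S))" "has H i (el (Fin m))"
  shows "has H (entry S m f i) (el S)"
proof -
  have F: "isset H (Fin m)" using assms(1,2) by (auto simp: pred_data_def intro: set_Fin)
  show ?thesis
    using has_Apply[of H "Fin m" "\<lambda>j. S" f i] F assms isset_weak[OF F, of S] has_stab[of H S]
    by (auto simp: pred_data_def p_imp_def entry_def tmfam_const)
qed

lemma entry_family:
  assumes "pred_data H S D P" "has H m (el (cNat $$ []))" "has H f (el (p_imp (Fin m) S))"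
  shows "isset (H \<triangleright> el (Fin m)) (D \<cdot> entry S m f (lv (length H)))"
    and "tmfam (length H) (\<lambda>i. D \<cdot> entry S m f i)"
    and "isset (H \<triangleright> el (Fin m)) (p_or P (D \<cdot> entry S m f (lv (length H))))"
    and "tmfam (length H) (\<lambda>i. p_or P (D \<cdot> entry S m f i))"
proof -
  have F: "isset H (Fin m)" using assms(1,2) by (auto simp: pred_data_def intro: set_Fin)
  note b = pred_data_fin[OF assms(1,2)]
  note w = has_weak[OF _ pred_data_dest(1)[OF b]]
  show 1: "isset (H \<triangleright> el (Fin m)) (D \<cdot> entry S m f (lv (length H)))"
    by (intro set_app[OF b] has_entry[OF b] w[OF assms(2)] w[OF assms(3)] has_var isty_el F)
  show "isset (H \<triangleright> el (Fin m)) (p_or P (D \<cdot> entry S m f (lv (length H))))"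
    using pred_data_dest[OF b] by (intro set_or 1)
  show "tmfam (length H) (\<lambda>i. D \<cdot> entry S m f i)" "tmfam (length H) (\<lambda>i. p_or P (D \<cdot> entry S m f i))"
    using assms(1)[THEN pred_data_dest(2), THEN has_stab] assms(1)[THEN pred_data_dest(3), THEN has_stab]
      assms(1)[THEN pred_data_dest(4), THEN has_stab] assms(2,3)[THEN has_stab] by (simp_all add: fam)
qed

lemma set_all_in: "pred_data H S D P \<Longrightarrow> has H m (el (cNat $$ [])) \<Longrightarrow> has H f (el (p_imp (Fin m) S)) \<Longrightarrow>
    isset H (all_in S D m f)"
  and set_all_or: "pred_data H S D P \<Longrightarrow> has H m (el (cNat $$ [])) \<Longrightarrow> has H f (el (p_imp (Fin m) S)) \<Longrightarrow>
    isset H (all_or S D P m f)"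
  unfolding all_in_def all_or_def using entry_family[of H S D P m f]
  by (auto simp: pred_data_def intro!: set_Pi set_Fin)

lemma all_in_E:
  assumes "pred_data H S D P" "has H m (el (cNat $$ []))" "has H f (el (p_imp (Fin m) S))"
    and "tru H (all_in S D m f)" "has H i (el (Fin m))"
  shows "tru H (D \<cdot> entry S m f i)"
  using all_E[of H "Fin m" "\<lambda>i. D \<cdot> entry S m f i" i] entry_family[OF assms(1-3)] assms
  by (auto simp: pred_data_def all_in_def intro: set_Fin)

lemma all_or_E:
  assumes "pred_data H S D P" "has H m (el (cNat $$ []))" "has H f (el (p_imp (Fin m) S))"
    and "tru H (all_or S D P m f)" "has H i (el (Fin m))"
  shows "tru H (p_or P (D \<cdot> entry S m f i))"
  using all_E[of H "Fin m" "\<lambda>i. p_or P (D \<cdot> entry S m f i)" i] entry_family[OF assms(1-3)] assms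
  by (auto simp: pred_data_def all_or_def intro: set_Fin)

lemma all_in_I:
  assumes "pred_data H S D P" "has H m (el (cNat $$ []))" "has H f (el (p_imp (Fin m) S))"
    and "tru (H \<triangleright> el (Fin m)) (D \<cdot> entry S m f (lv (length H)))"
  shows "tru H (all_in S D m f)"
  using all_I[of H "Fin m" "\<lambda>i. D \<cdot> entry S m f i"] entry_family[OF assms(1-3)] assms
  by (auto simp: pred_data_def all_in_def intro: set_Fin)

lemma all_or_I:
  assumes "pred_data H S D P" "has H m (el (cNat $$ []))" "has H f (el (p_imp (Fin m) S))"
    and "tru (H \<triangleright> el (Fin m)) (p_or P (D \<cdot> entry S m f (lv (length H))))"
  shows "tru H (all_or S D P m f)"
  using all_I[of H "Fin m" "\<lambda>i. p_or P (D \<cdot> entry S m f i)"] entry_family[OF assms(1-3)] assms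
  by (auto simp: pred_data_def all_or_def intro: set_Fin)

lemma choice_stmt_family:
  assumes b: "pred_data H S D P" and m: "has H m (el (cNat $$ []))"
  defines "H1 \<equiv> H \<triangleright> el (p_imp (Fin m) S)"
  shows "isset H1 (p_imp (all_or S D P m (lv (length H))) (p_or P (all_in S D m (lv (length H)))))"
    and "tmfam (length H) (\<lambda>f. p_imp (all_or S D P m f) (p_or P (all_in S D m f)))"
proof -
  note q = set_seq[OF b m]
  note b1 = pred_data_weak[OF b q, folded H1_def]
  note m1 = has_weak[OF m pred_data_dest(1)[OF b1[unfolded H1_def]], folded H1_def]
  note f1 = has_var[OF isty_el[OF q], folded H1_def]
  show "isset H1 (p_imp (all_or S D P m (lv (length H))) (p_or P (all_in S D m (lv (length H)))))"
    by (intro set_imp set_or set_all_or[OF b1 m1 f1] set_all_in[OF b1 m1 f1] pred_data_dest[OF b1])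
  show "tmfam (length H) (\<lambda>f. p_imp (all_or S D P m f) (p_or P (all_in S D m f)))"
    using b[THEN pred_data_dest(2), THEN has_stab] b[THEN pred_data_dest(3), THEN has_stab]
      b[THEN pred_data_dest(4), THEN has_stab] m[THEN has_stab] by (simp add: fam)
qed

lemma choice_stmt_E:
  assumes b: "pred_data H S D P" and m: "has H m (el (cNat $$ []))" and d: "tru H (choice_stmt S D P m)"
    and f: "has H f (el (p_imp (Fin m) S))" and e: "tru H (all_or S D P m f)"
  shows "tru H (p_or P (all_in S D m f))"
proof -
  have "tru H (p_imp (all_or S D P m f) (p_or P (all_in S D m f)))"
    using all_E[OF pred_data_dest(1)[OF b] set_seq[OF b m] choice_stmt_family[OF b m] _ f] d by (simp add: choice_stmt_def)
  then show ?thesis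
    by (rule imp_E[OF pred_data_dest(1)[OF b] set_all_or[OF b m f]
          set_or[OF pred_data_dest(1)[OF b] pred_data_dest(4)[OF b] set_all_in[OF b m f]] _ e])
qed

text \<open>The premise quantifies over contexts \<open>K\<close> in which all typings over
  \<open>H\<close> persist. This hides the two extensions, by the sequence and by its hypothesis,
  from the proofs of the base case and the inductive step.\<close>

lemma choice_stmt_I:
  assumes b: "pred_data H S D P" and m: "has H m (el (cNat $$ []))"
    and *: "\<And>K f. pred_data K S D P \<Longrightarrow> has K m (el (cNat $$ [])) \<Longrightarrow> has K f (el (p_imp (Fin m) S)) \<Longrightarrow>
      tru K (all_or S D P m f) \<Longrightarrow> (\<And>a A. has H a A \<Longrightarrow> has K a A) \<Longrightarrow> tru K (p_or P (all_in S D m f))"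
  shows "tru H (choice_stmt S D P m)"
proof -
  define H1 where "H1 = H \<triangleright> el (p_imp (Fin m) S)"
  note q = set_seq[OF b m]
  note b1 = pred_data_weak[OF b q, folded H1_def]
  note c1 = pred_data_dest(1)[OF b1]
  note m1 = has_weak[OF m c1[unfolded H1_def], folded H1_def]
  note f1 = has_var[OF isty_el[OF q], folded H1_def]
  note e1 = set_all_or[OF b1 m1 f1]
  note b2 = pred_data_weak[OF b1 e1]
  note w = has_weak[OF _ pred_data_dest(1)[OF b2]]
  have "tru (H1 \<triangleright> el (all_or S D P m (lv (length H)))) (p_or P (all_in S D m (lv (length H))))"
    by (rule *[OF b2 w[OF m1] w[OF f1] tru_hyp[OF e1]])
      (rule w, unfold H1_def, erule has_weak, rule c1[unfolded H1_def])
  then have "tru H1 (p_imp (all_or S D P m (lv (length H))) (p_or P (all_in S D m (lv (length H)))))"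
    by (intro imp_I c1 e1 set_or set_all_in[OF b1 m1 f1] pred_data_dest[OF b1])
  then show ?thesis
    using all_I[OF pred_data_dest(1)[OF b] set_seq[OF b m] choice_stmt_family[OF b m]] by (simp add: choice_stmt_def H1_def)
qed

text \<open>By conversion an index into the empty sequence is an element of the empty set, so the
  second disjunct holds vacuously.\<close>

lemma choice_stmt_zero:
  assumes "pred_data H S D P"
  shows "tru H (choice_stmt S D P (cZero $$ []))"
proof (rule choice_stmt_I[OF assms has_zero[OF pred_data_dest(1)[OF assms]] ])
  fix H f let ?z = "cZero $$ [] :: 'c tmx"
  assume b: "pred_data H S D P" and z: "has H ?z (el (cNat $$ []))" and f: "has H f (el (p_imp (Fin ?z) S))"
  note b1 = pred_data_fin[OF b z]
  note F = set_Fin[OF pred_data_dest(1)[OF b] z]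
  have "tru (H \<triangleright> el (Fin ?z)) p_bot"
    by (rule tru_conv[OF tru_hyp[OF F] eq_Fin_zero[OF pred_data_dest(1)[OF b1]]])
  then have "tru H (all_in S D ?z f)"
    by (rule all_in_I[OF b z f bot_E[OF pred_data_dest(1)[OF b1] entry_family(1)[OF b z f]]])
  then show "tru H (p_or P (all_in S D ?z f))"
    by (intro or_I(2) pred_data_dest[OF b] set_all_in[OF b z f])
qed

lemma set_one: "ctx K \<Longrightarrow> isset K (cN1 $$ [])"
  using has_con[of K cN1] by (simp add: fam)

lemma has_fin_inl: "ctx K \<Longrightarrow> has K m (el (cNat $$ [])) \<Longrightarrow> has K i (el (Fin m)) \<Longrightarrow>
    has K (cInl $$ [Fin m, cN1 $$ [], i]) (el (Fin (cSucc $$ [m])))"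
  by (rule has_conv[OF has_Inl[OF _ set_Fin set_one] eq_sym[OF eq_Fin_succ]])

lemma has_fin_inr: "ctx K \<Longrightarrow> has K m (el (cNat $$ [])) \<Longrightarrow> has K i (el (cN1 $$ [])) \<Longrightarrow>
    has K (cInr $$ [Fin m, cN1 $$ [], i]) (el (Fin (cSucc $$ [m])))"
  by (rule has_conv[OF has_Inr[OF _ set_Fin set_one] eq_sym[OF eq_Fin_succ]])

text \<open>The second part is one beta step in the set of functions and one in the framework. The
  conversion between them is due to the codomain, which appears as a constant family applied to the
  index.\<close>

lemma restrict_seq:
  assumes b: "pred_data K S D P" and m: "has K m (el (cNat $$ []))"
    and f: "has K f (el (p_imp (Fin (cSucc $$ [m])) S))"
  shows "has K (restrict_seq S m f) (el (p_imp (Fin m) S))"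
    and "has K i (el (Fin m)) \<Longrightarrow>
      eq K (entry S m (restrict_seq S m f) i) (entry S (cSucc $$ [m]) f (cInl $$ [Fin m, cN1 $$ [], i])) (el S)"
proof -
  let ?K1 = "K \<triangleright> el (Fin m)" and ?i = "lv (length K)" and ?S = "\<lambda>i. S"
  let ?g = "\<lambda>i. entry S (cSucc $$ [m]) f (cInl $$ [Fin m, cN1 $$ [], i])"
  note c = pred_data_dest(1)[OF b] and S = pred_data_dest(2)[OF b]
  note F = set_Fin[OF c m]
  note [fam] = S[THEN has_stab] m[THEN has_stab] f[THEN has_stab]
  note b1 = pred_data_fin[OF b m]
  note c1 = pred_data_dest(1)[OF b1] and w1 = has_weak[OF _ pred_data_dest(1)[OF b1]]
  note i1 = has_var[OF isty_el[OF F]]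
  have g1: "has ?K1 (?g ?i) (el S)"
    by (intro has_entry[OF b1] w1 f has_fin_inl has_succ c1 m i1)
  have gf: "tmfam (length K) ?g" by (simp add: fam)
  have Sc: "isset ?K1 S" "tmfam (length K) ?S" by (rule w1[OF S]) (simp add: fam)
  note L = lam_set[OF c F, of ?S, OF Sc]
  have "has ?K1 (?g ?i) (el (t_lam ?S \<cdot> ?i))"
    by (rule has_conv[OF g1 eq_sym[OF tru_fam_beta[OF c F, of ?S, OF Sc]]])
  then have g': "has K (t_lam ?g) (fun_ty (el (Fin m)) (\<lambda>i. el (t_lam ?S \<cdot> i)))"
    by (rule has_lam[where F = ?g and B = "\<lambda>i. el (t_lam ?S \<cdot> i)", OF isty_el[OF F] _ gf])
      (simp add: fam)
  show "has K (restrict_seq S m f) (el (p_imp (Fin m) S))"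
    unfolding restrict_seq_def p_imp_def by (rule has_Lam[OF c F Sc g'])
  assume i: "has K i (el (Fin m))"
  have "eq K (entry S m (restrict_seq S m f) i) (t_lam ?g \<cdot> i) (el (t_lam ?S \<cdot> i))"
    unfolding entry_def[of S m] restrict_seq_def by (rule eq_Pi_beta[OF c F L g' i])
  then have "eq K (entry S m (restrict_seq S m f) i) (t_lam ?g \<cdot> i) (el S)"
    by (rule eq_conv[OF _ eq_beta_set[where F = ?S, OF Sc(1) i Sc(2)]])
  moreover have "eq K (t_lam ?g \<cdot> i) (?g i) (el S)"
    by (rule eq_beta[where F = ?g and B = "\<lambda>i. el S", OF g1 i gf]) (simp add: fam)
  ultimately show "eq K (entry S m (restrict_seq S m f) i) (?g i) (el S)" by (rule eq_trans)
qed

text \<open>The statement for \<open>m\<close> settles the first \<open>m\<close> entries. One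
  further decision, at the right injection of the point of the unit set, settles the last
  entry.\<close>

lemma choice_stmt_succ:
  assumes b: "pred_data H S D P" and m: "has H m (el (cNat $$ []))" and d: "tru H (choice_stmt S D P m)"
  shows "tru H (choice_stmt S D P (cSucc $$ [m]))"
proof (rule choice_stmt_I[OF b has_succ[OF pred_data_dest(1)[OF b] m]])
  let ?M = "cSucc $$ [m]" and ?one = "cN1 $$ [] :: 'c tmx"
  fix K f
  assume b: "pred_data K S D P" and M: "has K ?M (el (cNat $$ []))" and f: "has K f (el (p_imp (Fin ?M) S))"
    and e: "tru K (all_or S D P ?M f)" and w: "\<And>a A. has H a A \<Longrightarrow> has K a A"
  let ?f = "restrict_seq S m f" and ?last = "cInr $$ [Fin m, ?one, cStar $$ []]"
  note c = pred_data_dest(1)[OF b] and S = pred_data_dest(2)[OF b] and P = pred_data_dest(4)[OF b]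
  have d: "tru K (choice_stmt S D P m)" using d w by (auto simp: inh_def)
  have m: "has K m (el (cNat $$ []))" by (rule w[OF m])
  note r = restrict_seq[OF b m f]
  note F = set_Fin[OF c m]
  note b1 = pred_data_fin[OF b m]
  note c1 = pred_data_dest(1)[OF b1] and w1 = has_weak[OF _ pred_data_dest(1)[OF b1]]
  note i1 = has_var[OF isty_el[OF F]]
  have star: "has K' (cStar $$ []) (el ?one)" if "ctx K'" for K'
    using has_con[of K' cStar] that by (simp add: t_con_def)
  note [fam] = S[THEN has_stab] P[THEN has_stab] m[THEN has_stab] f[THEN has_stab] pred_data_dest(3)[OF b, THEN has_stab]
  have "tru (K \<triangleright> el (Fin m)) (p_or P (D \<cdot> entry S ?M f (cInl $$ [Fin m, ?one, lv (length K)])))"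
    by (intro all_or_E[OF b1 w1[OF M] w1[OF f] inh_weak[OF e c1]] has_fin_inl c1 w1[OF m] i1)
  moreover have "eq (K \<triangleright> el (Fin m)) (p_or P (D \<cdot> entry S ?M f (cInl $$ [Fin m, ?one, lv (length K)])))
      (p_or P (D \<cdot> entry S m ?f (lv (length K)))) set_ty"
    by (intro eq_Plus c1 eq_refl pred_data_dest(4)[OF b1] eq_set_app[OF b1] eq_sym[OF restrict_seq(2)[OF b1]] w1 m f i1)
  ultimately have e': "tru K (all_or S D P m ?f)"
    by (intro all_or_I[OF b m r(1)]) (rule tru_conv)
  note A = set_all_in[OF b m r(1)] and AM = set_all_in[OF b M f]
  note goal = set_or[OF c P AM]
  show "tru K (p_or P (all_in S D ?M f))"
  proof (rule or_E[OF c P A goal choice_stmt_E[OF b m d r(1) e']])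
    show "tru (K \<triangleright> el P) (p_or P (all_in S D ?M f))"
      using pred_data_weak[OF b P] by (intro or_I(1) tru_hyp P isset_weak[OF P] AM pred_data_dest)
    let ?K1 = "K \<triangleright> el (all_in S D m ?f)"
    note b1 = pred_data_weak[OF b A]
    note c1 = pred_data_dest(1)[OF b1] and P1 = pred_data_dest(4)[OF b1] and w1 = has_weak[OF _ pred_data_dest(1)[OF b1]]
    note last = has_fin_inr[OF c m star[OF c]]
    note L = set_app[OF b has_entry[OF b M f last]]
    show "tru ?K1 (p_or P (all_in S D ?M f))"
    proof (rule or_E[OF c1 P1 w1[OF L] w1[OF goal]])
      show "tru ?K1 (p_or P (D \<cdot> entry S ?M f ?last))"
        by (rule all_or_E[OF b1 w1[OF M] w1[OF f] inh_weak[OF e c1] w1[OF last]])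
      show "tru (?K1 \<triangleright> el P) (p_or P (all_in S D ?M f))"
        using pred_data_weak[OF b1 P1] by (intro or_I(1) tru_hyp P1 isset_weak[OF P1] w1 AM pred_data_dest)
      let ?K2 = "?K1 \<triangleright> el (D \<cdot> entry S ?M f ?last)"
      note b2 = pred_data_weak[OF b1 w1[OF L]]
      note c2 = pred_data_dest(1)[OF b2] and P2 = pred_data_dest(4)[OF b2] and w2 = has_weak[OF _ pred_data_dest(1)[OF b2]]
      note F2 = set_Fin[OF c2 w2[OF w1[OF M]]]
      let ?K3 = "?K2 \<triangleright> el (Fin ?M)"
      note b3 = pred_data_fin[OF b2 w2[OF w1[OF M]]]
      note c3 = pred_data_dest(1)[OF b3] and w3 = has_weak[OF _ pred_data_dest(1)[OF b3]]
      note m3 = w3[OF w2[OF w1[OF m]]] and M3 = w3[OF w2[OF w1[OF M]]] and f3 = w3[OF w2[OF w1[OF f]]]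
      note F3 = set_Fin[OF c3 m3] and one3 = set_one[OF c3]
      note O3 = set_or[OF c3 F3 one3]
      let ?G = "\<lambda>z. D \<cdot> entry S ?M f z"
      have fin: "isset (K' \<triangleright> el (p_or (Fin m) ?one)) (?G (lv (length K')))"
        if b': "pred_data K' S D P" "has K' m (el (cNat $$ []))" "has K' f (el (p_imp (Fin ?M) S))" for K'
      proof -
        note c' = pred_data_dest(1)[OF b'(1)]
        note O = set_or[OF c' set_Fin[OF c' b'(2)] set_one[OF c']]
        note b'' = pred_data_weak[OF b'(1) O]
        note c'' = pred_data_dest(1)[OF b''] and w'' = has_weak[OF _ pred_data_dest(1)[OF b'']]
        note mm = w''[OF b'(2)]
        show ?thesis
          by (intro set_app[OF b''] has_entry[OF b''] has_succ c'' mm w''[OF b'(3)]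
              has_conv[OF has_var[OF isty_el[OF O]] eq_sym[OF eq_Fin_succ[OF c'' mm]]])
      qed
      \<comment> \<open>The index is converted to an element of the sum, so the proof is a dependent
        case distinction on it.\<close>
      have "tru ?K3 (?G (lv (length ?K2)))"
      proof (rule Plus_cases[where F = ?G, OF c3 F3 one3])
        show "isset (?K3 \<triangleright> el (p_or (Fin m) ?one)) (?G (lv (length ?K3)))"
          by (rule fin[OF b3 m3 f3])
        show "tmfam (length ?K3) ?G" by (simp add: fam)
        show "has ?K3 (lv (length ?K2)) (el (p_or (Fin m) ?one))"
          by (rule has_conv[OF has_var[OF isty_el[OF F2]] eq_Fin_succ[OF c3 m3]])
        note b4 = pred_data_weak[OF b3 F3]
        note c4 = pred_data_dest(1)[OF b4] and w4 = has_weak[OF _ pred_data_dest(1)[OF b4]]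
        note i4 = has_var[OF isty_el[OF F3]]
        have "tru (?K3 \<triangleright> el (Fin m)) (D \<cdot> entry S m ?f (lv (length ?K3)))"
          by (intro all_in_E[OF b4 w4[OF m3] _ _ i4] w4 w3 w2 w1 r(1)
              inh_weak[OF _ c4] inh_weak[OF _ c3] inh_weak[OF _ c2] tru_hyp A)
        then show "tru (?K3 \<triangleright> el (Fin m)) (?G (cInl $$ [Fin m, ?one, lv (length ?K3)]))"
          by (rule tru_conv[OF _ eq_set_app[OF b4 restrict_seq(2)[OF b4 w4[OF m3] w4[OF f3] i4]]])
        note b5 = pred_data_weak[OF b3 one3]
        note c5 = pred_data_dest(1)[OF b5] and w5 = has_weak[OF _ pred_data_dest(1)[OF b5]]
        note i5 = has_var[OF isty_el[OF one3]]
        let ?K5 = "?K3 \<triangleright> el ?one"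
        let ?H = "\<lambda>u. ?G (cInr $$ [Fin m, ?one, u])"
        note one5 = set_one[OF c5]
        note b6 = pred_data_weak[OF b5 one5]
        note c6 = pred_data_dest(1)[OF b6] and w6 = has_weak[OF _ pred_data_dest(1)[OF b6]]
        \<comment> \<open>The last entry was decided at \<open>cStar\<close> only; elimination on
          the unit set extends this to the generic element in the right summand.\<close>
        show "tru ?K5 (?H (lv (length ?K3)))"
        proof (rule N1_cases[where F = ?H, OF c5 _ _ _ i5])
          show "isset (?K5 \<triangleright> el ?one) (?H (lv (length ?K5)))"
            by (intro set_app[OF b6] has_entry[OF b6] has_fin_inr c6 w6 w5 m3 M3 f3 has_var isty_el one5)
          show "tmfam (length ?K5) ?H" by (simp add: fam)
          show "tru ?K5 (?H (cStar $$ []))"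
            by (intro inh_weak[OF _ c5] inh_weak[OF _ c3] tru_hyp w1 L)
        qed
      qed
      then have "tru ?K2 (all_in S D ?M f)"
        by (intro all_in_I[OF b2 w2[OF w1[OF M]] w2[OF w1[OF f]]])
      then show "tru ?K2 (p_or P (all_in S D ?M f))"
        by (intro or_I(2) c2 P2 w2 w1 AM)
    qed
  qed
qed

lemma finite_choice:
  assumes b: "pred_data H S D P" and n: "has H n (el (cNat $$ []))"
  shows "tru H (choice_stmt S D P n)"
proof -
  note c = pred_data_dest(1)[OF b]
  note N = set_Nat[OF c]
  note b1 = pred_data_weak[OF b N]
  note c1 = pred_data_dest(1)[OF b1] and x1 = has_var[OF isty_el[OF N]]
  note [fam] = pred_data_dest(2)[OF b, THEN has_stab] pred_data_dest(3)[OF b, THEN has_stab] pred_data_dest(4)[OF b, THEN has_stab]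
  have d1: "isset (H \<triangleright> el (cNat $$ [])) (choice_stmt S D P (lv (length H)))"
    unfolding choice_stmt_def by (rule set_Pi[OF c1 set_seq[OF b1 x1] choice_stmt_family[OF b1 x1]])
  note b2 = pred_data_weak[OF b1 d1]
  show ?thesis
    by (rule nat_induct[where F = "choice_stmt S D P", OF c d1 _ choice_stmt_zero[OF b]
          choice_stmt_succ[OF b2 has_weak[OF x1 pred_data_dest(1)[OF b2]] tru_hyp[OF d1]] n])
      (simp add: fam)
qed

section \<open>Formal spaces in type theory\<close>

definition space :: "'c ty list \<Rightarrow> 'c tmx \<Rightarrow> 'c tmx \<Rightarrow> 'c tmx \<Rightarrow> bool" where
  "space H S C P \<longleftrightarrow> ctx H \<and> isset H S \<and> has H C (cover_ty S) \<and> isset H P"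

text \<open>The axioms enter as inhabited types and not as true propositions, because quantification
  over all subsets does not form a set.\<close>

definition fspace :: "'c ty list \<Rightarrow> 'c tmx \<Rightarrow> 'c tmx \<Rightarrow> 'c tmx \<Rightarrow> bool" where
  "fspace H S C P \<longleftrightarrow> space H S C P \<and> inh H (t_reflexivity S C) \<and> inh H (t_transitivity S C)"

abbreviation sub :: "'c ty list \<Rightarrow> 'c tmx \<Rightarrow> 'c tmx \<Rightarrow> bool" where
  "sub H S U \<equiv> has H U (fun_ty (el S) (\<lambda>x. set_ty))"

lemma space_weak: "space H S C P \<Longrightarrow> isset H X \<Longrightarrow> space (H \<triangleright> el X) S C P"
  by (auto simp: space_def intro: has_weak inh_weak ctx_ext isty_el)

lemma fspace_weak: "fspace H S C P \<Longrightarrow> isset H X \<Longrightarrow> fspace (H \<triangleright> el X) S C P"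
  by (auto simp: fspace_def intro: space_weak inh_weak ctx_ext isty_el)

lemma fspace_space: "fspace H S C P \<Longrightarrow> space H S C P"
  by (simp add: fspace_def)

lemma space_dest: "space H S C P \<Longrightarrow> ctx H" "space H S C P \<Longrightarrow> isset H S"
    "space H S C P \<Longrightarrow> has H C (cover_ty S)" "space H S C P \<Longrightarrow> isset H P"
  by (simp_all add: space_def)

lemma space_stab: "space H S C P \<Longrightarrow> stab (length H) S" "space H S C P \<Longrightarrow> stab (length H) C"
    "space H S C P \<Longrightarrow> stab (length H) P"
  by (simp_all add: space_def has_def)

lemma sub_app:
  assumes "sub H S U" "has H a (el S)"
  shows "isset H (U \<cdot> a)"
  using has_app[OF assms] by (simp add: fam)

lemma set_cov:
  assumes "space H S C P" "has H a (el S)" "sub H S U"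
  shows "isset H (C \<cdot> a \<cdot> U)"
proof -
  note [fam] = space_stab[OF assms(1)]
  have 1: "has H C (fun_ty (el S) (\<lambda>x. fun_ty (fun_ty (el S) (\<lambda>x. set_ty)) (\<lambda>x. set_ty)))"
    using space_dest(3)[OF assms(1)] by (simp add: cover_ty_def subset_ty_def arrow_def)
  show ?thesis
    using has_app[OF has_app[OF 1 assms(2)] assms(3)] by (simp add: fam)
qed

lemma refl_E:
  assumes fs: "fspace H S C P" and a: "has H a (el S)" and U: "sub H S U" and "tru H (U \<cdot> a)"
  shows "tru H (C \<cdot> a \<cdot> U)"
proof -
  note s = fspace_space[OF fs]
  note [fam] = space_stab[OF s] a[THEN has_stab] U[THEN has_stab]
  have 1: "inh H (fun_ty (el S) (\<lambda>a. fun_ty (fun_ty (el S) (\<lambda>x. set_ty)) (\<lambda>U. el (p_imp (U \<cdot> a) (C \<cdot> a \<cdot> U)))))"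
    using fs by (simp add: fspace_def t_reflexivity_def subset_ty_def arrow_def)
  have "tru H (p_imp (U \<cdot> a) (C \<cdot> a \<cdot> U))"
    using inh_app[OF inh_app[OF 1 a] U] by (simp add: fam)
  then show ?thesis
    by (rule imp_E[OF space_dest(1)[OF s] sub_app[OF U a] set_cov[OF s a U] _ assms(4)])
qed

lemma covs_family:
  assumes s: "space H S C P" and U: "sub H S U" and V: "sub H S V"
  shows "isset (H \<triangleright> el S) (p_imp (U \<cdot> lv (length H)) (C \<cdot> lv (length H) \<cdot> V))"
    "tmfam (length H) (\<lambda>u. p_imp (U \<cdot> u) (C \<cdot> u \<cdot> V))"
proof -
  note [fam] = space_stab[OF s] V[THEN has_stab] U[THEN has_stab]
  note s1 = space_weak[OF s space_dest(2)[OF s]]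
  note w1 = has_weak[OF _ space_dest(1)[OF s1]]
  note x1 = has_var[OF isty_el[OF space_dest(2)[OF s]]]
  show "isset (H \<triangleright> el S) (p_imp (U \<cdot> lv (length H)) (C \<cdot> lv (length H) \<cdot> V))"
    by (rule set_imp[OF space_dest(1)[OF s1] sub_app[OF w1[OF U] x1] set_cov[OF s1 x1 w1[OF V]]])
  show "tmfam (length H) (\<lambda>u. p_imp (U \<cdot> u) (C \<cdot> u \<cdot> V))" by (simp add: fam)
qed

lemma set_covs:
  assumes s: "space H S C P" and U: "sub H S U" and V: "sub H S V"
  shows "isset H (t_covs S C U V)"
  unfolding t_covs_def by (rule set_Pi[OF space_dest(1)[OF s] space_dest(2)[OF s] covs_family[OF assms]])

lemma covs_I:
  assumes s: "space H S C P" and U: "sub H S U" and V: "sub H S V"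
    and "tru (H \<triangleright> el S \<triangleright> el (U \<cdot> lv (length H))) (C \<cdot> lv (length H) \<cdot> V)"
  shows "tru H (t_covs S C U V)"
proof -
  note s1 = space_weak[OF s space_dest(2)[OF s]]
  note w1 = has_weak[OF _ space_dest(1)[OF s1]]
  note x1 = has_var[OF isty_el[OF space_dest(2)[OF s]]]
  have "tru (H \<triangleright> el S) (p_imp (U \<cdot> lv (length H)) (C \<cdot> lv (length H) \<cdot> V))"
    by (rule imp_I[OF space_dest(1)[OF s1] sub_app[OF w1[OF U] x1] set_cov[OF s1 x1 w1[OF V]] assms(4)])
  then show ?thesis
    unfolding t_covs_def by (rule all_I[OF space_dest(1)[OF s] space_dest(2)[OF s] covs_family[OF s U V]])
qed

lemma covs_E:
  assumes s: "space H S C P" and U: "sub H S U" and V: "sub H S V"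
    and "tru H (t_covs S C U V)" "has H a (el S)" "tru H (U \<cdot> a)"
  shows "tru H (C \<cdot> a \<cdot> V)"
proof -
  have "tru H (p_imp (U \<cdot> a) (C \<cdot> a \<cdot> V))"
    using all_E[OF space_dest(1)[OF s] space_dest(2)[OF s] covs_family[OF s U V] _ assms(5)] assms(4)
    by (simp add: t_covs_def)
  then show ?thesis
    by (rule imp_E[OF space_dest(1)[OF s] sub_app[OF U assms(5)] set_cov[OF s assms(5) V] _ assms(6)])
qed

lemma trans_E:
  assumes fs: "fspace H S C P" and a: "has H a (el S)" and U: "sub H S U" and V: "sub H S V"
    and "tru H (C \<cdot> a \<cdot> U)" "tru H (t_covs S C U V)"
  shows "tru H (C \<cdot> a \<cdot> V)"
proof -
  note s = fspace_space[OF fs]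
  note [fam] = space_stab[OF s] a[THEN has_stab] U[THEN has_stab] V[THEN has_stab]
  let ?T = "fun_ty (el S) (\<lambda>x. set_ty)"
  have 1: "inh H (fun_ty (el S) (\<lambda>a. fun_ty ?T (\<lambda>U. fun_ty ?T (\<lambda>V.
     el (p_imp (p_and (C \<cdot> a \<cdot> U) (t_covs S C U V)) (C \<cdot> a \<cdot> V))))))"
    using fs by (simp add: fspace_def t_transitivity_def subset_ty_def arrow_def)
  have "inh H (fun_ty ?T (\<lambda>U. fun_ty ?T (\<lambda>V.
     el (p_imp (p_and (C \<cdot> a \<cdot> U) (t_covs S C U V)) (C \<cdot> a \<cdot> V)))))"
    by (rule inh_app[OF 1 a]) (simp add: fam)
  then have "inh H (fun_ty ?T (\<lambda>V. el (p_imp (p_and (C \<cdot> a \<cdot> U) (t_covs S C U V)) (C \<cdot> a \<cdot> V))))"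
    by (rule inh_app[OF _ U]) (simp add: fam)
  then have "tru H (p_imp (p_and (C \<cdot> a \<cdot> U) (t_covs S C U V)) (C \<cdot> a \<cdot> V))"
    by (rule inh_app[OF _ V]) (simp add: fam)
  note c = space_dest(1)[OF s]
  from \<open>tru H (p_imp (p_and (C \<cdot> a \<cdot> U) (t_covs S C U V)) (C \<cdot> a \<cdot> V))\<close> show ?thesis
    by (rule imp_E[OF c set_and[OF c set_cov[OF s a U] set_covs[OF s U V]] set_cov[OF s a V]
          _ and_I[OF c set_cov[OF s a U] set_covs[OF s U V] assms(5,6)]])
qed

lemma sub_lam: "space H S C P \<Longrightarrow> isset (H \<triangleright> el S) (F (lv (length H))) \<Longrightarrow> tmfam (length H) F \<Longrightarrow> sub H S (t_lam F)"
  by (rule lam_set) (auto simp: space_def)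

lemma sub_none: "space H S C P \<Longrightarrow> sub H S t_none"
  unfolding t_none_def
  by (rule sub_lam[where F = "\<lambda>x. p_bot"], assumption, rule set_bot)
    (auto intro: ctx_ext isty_el space_dest simp: fam)

lemma sing_family:
  assumes s: "space H S C P" and a: "has H a (el S)"
  shows "isset (H \<triangleright> el S) (cId $$ [S, lv (length H), a])" "tmfam (length H) (\<lambda>x. cId $$ [S, x, a])"
proof -
  note [fam] = space_stab[OF s] a[THEN has_stab]
  note s1 = space_weak[OF s space_dest(2)[OF s]]
  note x1 = has_var[OF isty_el[OF space_dest(2)[OF s]]]
  show "isset (H \<triangleright> el S) (cId $$ [S, lv (length H), a])"
    by (rule set_Id[OF space_dest(1)[OF s1] space_dest(2)[OF s1] x1 has_weak[OF a space_dest(1)[OF s1]]])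
  show "tmfam (length H) (\<lambda>x. cId $$ [S, x, a])" by (simp add: fam)
qed

lemma sub_sing: "space H S C P \<Longrightarrow> has H a (el S) \<Longrightarrow> sub H S (t_sing S a)"
  unfolding t_sing_def by (rule sub_lam) (auto intro: sing_family)

lemma sing_self:
  assumes fs: "fspace H S C P" and a: "has H a (el S)"
  shows "tru H (t_sing S a \<cdot> a)" "tru H (C \<cdot> a \<cdot> t_sing S a)"
proof -
  note s = fspace_space[OF fs]
  show 1: "tru H (t_sing S a \<cdot> a)"
    unfolding t_sing_def
    using tru_beta[OF sing_family(1)[OF s a] a sing_family(2)[OF s a]] has_refl[OF space_dest(1)[OF s] space_dest(2)[OF s] a]
    by (auto simp: inh_def)
  show "tru H (C \<cdot> a \<cdot> t_sing S a)"
    by (rule refl_E[OF fs a sub_sing[OF s a] 1])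
qed

text \<open>Both halves of \<open>t_down\<close> have this form, so their typing is settled once for
  an arbitrary subset.\<close>

lemma below_family:
  assumes s: "space H S C P" and U: "sub H S U" and d: "has H d (el S)"
  shows "isset (H \<triangleright> el S) (p_and (U \<cdot> lv (length H)) (C \<cdot> d \<cdot> t_sing S (lv (length H))))"
    "tmfam (length H) (\<lambda>u. p_and (U \<cdot> u) (C \<cdot> d \<cdot> t_sing S u))"
    "isset H (p_ex S (\<lambda>u. p_and (U \<cdot> u) (C \<cdot> d \<cdot> t_sing S u)))"
proof -
  note [fam] = space_stab[OF s] d[THEN has_stab] U[THEN has_stab]
  note s1 = space_weak[OF s space_dest(2)[OF s]]
  note w1 = has_weak[OF _ space_dest(1)[OF s1]]
  note x1 = has_var[OF isty_el[OF space_dest(2)[OF s]]]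
  show 1: "isset (H \<triangleright> el S) (p_and (U \<cdot> lv (length H)) (C \<cdot> d \<cdot> t_sing S (lv (length H))))"
    by (rule set_and[OF space_dest(1)[OF s1] sub_app[OF w1[OF U] x1] set_cov[OF s1 w1[OF d] sub_sing[OF s1 x1]]])
  show 2: "tmfam (length H) (\<lambda>u. p_and (U \<cdot> u) (C \<cdot> d \<cdot> t_sing S u))" by (simp add: fam)
  show "isset H (p_ex S (\<lambda>u. p_and (U \<cdot> u) (C \<cdot> d \<cdot> t_sing S u)))"
    by (rule set_Sigma[OF space_dest(1)[OF s] space_dest(2)[OF s] 1 2])
qed

lemma below_I:
  assumes fs: "fspace H S C P" and U: "sub H S U" and d: "has H d (el S)" and "tru H (U \<cdot> d)"
  shows "tru H (p_ex S (\<lambda>u. p_and (U \<cdot> u) (C \<cdot> d \<cdot> t_sing S u)))"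
  by (rule ex_I[where F = "\<lambda>u. p_and (U \<cdot> u) (C \<cdot> d \<cdot> t_sing S u)",
        OF space_dest(1)[OF fspace_space[OF fs]] space_dest(2)[OF fspace_space[OF fs]] below_family(1,2)[OF fspace_space[OF fs] U d] d
        and_I[OF space_dest(1)[OF fspace_space[OF fs]] sub_app[OF U d] set_cov[OF fspace_space[OF fs] d sub_sing[OF fspace_space[OF fs] d]] assms(4) sing_self(2)[OF fs d]]])

lemma down_family:
  assumes s: "space H S C P" and U: "sub H S U" and V: "sub H S V"
  defines "F \<equiv> \<lambda>d. p_and (p_ex S (\<lambda>u. p_and (U \<cdot> u) (C \<cdot> d \<cdot> t_sing S u))) (p_ex S (\<lambda>v. p_and (V \<cdot> v) (C \<cdot> d \<cdot> t_sing S v)))"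
  shows "isset (H \<triangleright> el S) (F (lv (length H)))" "tmfam (length H) F" "sub H S (t_down S C U V)"
proof -
  note [fam] = space_stab[OF s] V[THEN has_stab] U[THEN has_stab]
  note s1 = space_weak[OF s space_dest(2)[OF s]]
  note w1 = has_weak[OF _ space_dest(1)[OF s1]]
  note x1 = has_var[OF isty_el[OF space_dest(2)[OF s]]]
  show 1: "isset (H \<triangleright> el S) (F (lv (length H)))"
    unfolding F_def
    by (rule set_and[OF space_dest(1)[OF s1] below_family(3)[OF s1 w1[OF U] x1] below_family(3)[OF s1 w1[OF V] x1]])
  show 2: "tmfam (length H) F" by (simp add: F_def fam)
  show "sub H S (t_down S C U V)"
    unfolding t_down_def F_def[symmetric] by (rule sub_lam[OF s 1 2])
qed

lemma down_I:
  assumes fs: "fspace H S C P" and U: "sub H S U" and V: "sub H S V" and d: "has H d (el S)"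
    and "tru H (U \<cdot> d)" "tru H (V \<cdot> d)"
  shows "tru H (t_down S C U V \<cdot> d)"
  unfolding t_down_def
  using tru_beta[OF down_family(1)[OF fspace_space[OF fs] U V] d down_family(2)[OF fspace_space[OF fs] U V]]
    and_I[OF space_dest(1)[OF fspace_space[OF fs]] below_family(3)[OF fspace_space[OF fs] U d] below_family(3)[OF fspace_space[OF fs] V d] below_I[OF fs U d] below_I[OF fs V d]]
    assms(5,6) by blast

lemma compl_family:
  assumes s: "space H S C P" and U: "sub H S U"
  shows "isset (H \<triangleright> el S) (t_covs S C (t_down S C (t_sing S (lv (length H))) U) t_none)"
    "tmfam (length H) (\<lambda>a. t_covs S C (t_down S C (t_sing S a) U) t_none)"
    "sub H S (t_pseudocompl S C U)"
proof -
  note [fam] = space_stab[OF s] U[THEN has_stab]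
  note s1 = space_weak[OF s space_dest(2)[OF s]]
  note w1 = has_weak[OF _ space_dest(1)[OF s1]]
  note x1 = has_var[OF isty_el[OF space_dest(2)[OF s]]]
  show 1: "isset (H \<triangleright> el S) (t_covs S C (t_down S C (t_sing S (lv (length H))) U) t_none)"
    by (rule set_covs[OF s1 down_family(3)[OF s1 sub_sing[OF s1 x1] w1[OF U]] sub_none[OF s1]])
  show 2: "tmfam (length H) (\<lambda>a. t_covs S C (t_down S C (t_sing S a) U) t_none)" by (simp add: fam)
  show "sub H S (t_pseudocompl S C U)"
    unfolding t_pseudocompl_def by (rule sub_lam[OF s 1 2])
qed

lemma compl_E:
  assumes fs: "fspace H S C P" and U: "sub H S U" and a: "has H a (el S)"
    and "tru H (t_pseudocompl S C U \<cdot> a)" "tru H (U \<cdot> a)"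
  shows "tru H (C \<cdot> a \<cdot> t_none)"
proof -
  note s = fspace_space[OF fs]
  have "tru H (t_covs S C (t_down S C (t_sing S a) U) t_none)"
    using assms(4) tru_beta[OF compl_family(1)[OF s U] a compl_family(2)[OF s U]]
    by (simp add: t_pseudocompl_def)
  then show ?thesis
    by (rule covs_E[OF s down_family(3)[OF s sub_sing[OF s a] U] sub_none[OF s] _ a
          down_I[OF fs sub_sing[OF s a] U a sing_self(1)[OF fs a] assms(5)]])
qed

lemma union_family:
  assumes s: "space H S C P" and U: "sub H S U" and V: "sub H S V"
  shows "isset (H \<triangleright> el S) (p_or (U \<cdot> lv (length H)) (V \<cdot> lv (length H)))"
    "tmfam (length H) (\<lambda>x. p_or (U \<cdot> x) (V \<cdot> x))" "sub H S (t_union U V)"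
proof -
  note [fam] = space_stab[OF s] V[THEN has_stab] U[THEN has_stab]
  note s1 = space_weak[OF s space_dest(2)[OF s]]
  note w1 = has_weak[OF _ space_dest(1)[OF s1]]
  note x1 = has_var[OF isty_el[OF space_dest(2)[OF s]]]
  show 1: "isset (H \<triangleright> el S) (p_or (U \<cdot> lv (length H)) (V \<cdot> lv (length H)))"
    by (rule set_or[OF space_dest(1)[OF s1] sub_app[OF w1[OF U] x1] sub_app[OF w1[OF V] x1]])
  show 2: "tmfam (length H) (\<lambda>x. p_or (U \<cdot> x) (V \<cdot> x))" by (simp add: fam)
  show "sub H S (t_union U V)"
    unfolding t_union_def by (rule sub_lam[OF s 1 2])
qed

lemma listed_family:
  assumes b: "pred_data H S D P" and n: "has H n (el (cNat $$ []))" and f: "has H f (el (p_imp (Fin n) S))"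
    and x: "has H x (el S)"
  shows "isset (H \<triangleright> el (Fin n)) (cId $$ [S, x, entry S n f (lv (length H))])"
    "tmfam (length H) (\<lambda>i. cId $$ [S, x, entry S n f i])"
    "isset H (p_ex (Fin n) (\<lambda>i. cId $$ [S, x, entry S n f i]))"
proof -
  note [fam] = pred_data_dest(2)[OF b, THEN has_stab] n[THEN has_stab] f[THEN has_stab] x[THEN has_stab]
  note F = set_Fin[OF pred_data_dest(1)[OF b] n]
  note b1 = pred_data_fin[OF b n]
  note w1 = has_weak[OF _ pred_data_dest(1)[OF b1]]
  show 1: "isset (H \<triangleright> el (Fin n)) (cId $$ [S, x, entry S n f (lv (length H))])"
    by (rule set_Id[OF pred_data_dest(1)[OF b1] pred_data_dest(2)[OF b1] w1[OF x] has_entry[OF b1 w1[OF n] w1[OF f] has_var[OF isty_el[OF F]]]])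
  show 2: "tmfam (length H) (\<lambda>i. cId $$ [S, x, entry S n f i])" by (simp add: fam)
  show "isset H (p_ex (Fin n) (\<lambda>i. cId $$ [S, x, entry S n f i]))"
    by (rule set_Sigma[OF pred_data_dest(1)[OF b] F 1 2])
qed

lemma listed_family':
  assumes b: "pred_data H S D P" and n: "has H n (el (cNat $$ []))" and f: "has H f (el (p_imp (Fin n) S))"
  defines "F \<equiv> \<lambda>x. p_ex (Fin n) (\<lambda>i. cId $$ [S, x, entry S n f i])"
  shows "isset (H \<triangleright> el S) (F (lv (length H)))" "tmfam (length H) F" "sub H S (t_listed S n f)"
    "t_listed S n f = t_lam F"
proof -
  note [fam] = pred_data_dest(2)[OF b, THEN has_stab] n[THEN has_stab] f[THEN has_stab]
  note b1 = pred_data_weak[OF b pred_data_dest(2)[OF b]]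
  note w1 = has_weak[OF _ pred_data_dest(1)[OF b1]]
  show 1: "isset (H \<triangleright> el S) (F (lv (length H)))"
    unfolding F_def by (rule listed_family(3)[OF b1 w1[OF n] w1[OF f] has_var[OF isty_el[OF pred_data_dest(2)[OF b]]]])
  show 2: "tmfam (length H) F" by (simp add: F_def fam)
  show 3: "t_listed S n f = t_lam F" by (simp add: t_listed_def F_def entry_def)
  show "sub H S (t_listed S n f)"
    unfolding 3 by (rule lam_set[OF pred_data_dest(1)[OF b] pred_data_dest(2)[OF b] 1 2])
qed

lemma listed_I:
  assumes b: "pred_data H S D P" and n: "has H n (el (cNat $$ []))" and f: "has H f (el (p_imp (Fin n) S))"
    and i: "has H i (el (Fin n))"
  shows "tru H (t_listed S n f \<cdot> entry S n f i)"
proof -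
  note F = set_Fin[OF pred_data_dest(1)[OF b] n]
  note x = has_entry[OF b n f i]
  have "tru H (p_ex (Fin n) (\<lambda>j. cId $$ [S, entry S n f i, entry S n f j]))"
    by (rule ex_I[where F = "\<lambda>j. cId $$ [S, entry S n f i, entry S n f j]",
          OF pred_data_dest(1)[OF b] F listed_family(1,2)[OF b n f x] i])
      (rule inhI[OF has_refl[OF pred_data_dest(1)[OF b] pred_data_dest(2)[OF b] x]])
  then show ?thesis
    using tru_beta[OF listed_family'(1)[OF b n f] x listed_family'(2)[OF b n f]] listed_family'(4)[OF b n f]
    by simp
qed

lemma covers_family:
  assumes s: "space H S C P" and V: "sub H S V"
  shows "isset (H \<triangleright> el S) (C \<cdot> lv (length H) \<cdot> V)" "tmfam (length H) (\<lambda>a. C \<cdot> a \<cdot> V)"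
    "isset H (t_covers_space S C V)"
proof -
  note [fam] = space_stab[OF s] V[THEN has_stab]
  note s1 = space_weak[OF s space_dest(2)[OF s]]
  note w1 = has_weak[OF _ space_dest(1)[OF s1]]
  show 1: "isset (H \<triangleright> el S) (C \<cdot> lv (length H) \<cdot> V)"
    by (rule set_cov[OF s1 has_var[OF isty_el[OF space_dest(2)[OF s]]] w1[OF V]])
  show 2: "tmfam (length H) (\<lambda>a. C \<cdot> a \<cdot> V)" by (simp add: fam)
  show "isset H (t_covers_space S C V)"
    unfolding t_covers_space_def by (rule set_Pi[OF space_dest(1)[OF s] space_dest(2)[OF s] 1 2])
qed

lemma subset_family:
  assumes s: "space H S C P" and U: "sub H S U" and V: "sub H S V"
  shows "isset (H \<triangleright> el S) (p_imp (U \<cdot> lv (length H)) (V \<cdot> lv (length H)))"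
    "tmfam (length H) (\<lambda>x. p_imp (U \<cdot> x) (V \<cdot> x))" "isset H (t_subset S U V)"
proof -
  note [fam] = space_stab[OF s] U[THEN has_stab] V[THEN has_stab]
  note s1 = space_weak[OF s space_dest(2)[OF s]]
  note w1 = has_weak[OF _ space_dest(1)[OF s1]]
  note x1 = has_var[OF isty_el[OF space_dest(2)[OF s]]]
  show 1: "isset (H \<triangleright> el S) (p_imp (U \<cdot> lv (length H)) (V \<cdot> lv (length H)))"
    by (rule set_imp[OF space_dest(1)[OF s1] sub_app[OF w1[OF U] x1] sub_app[OF w1[OF V] x1]])
  show 2: "tmfam (length H) (\<lambda>x. p_imp (U \<cdot> x) (V \<cdot> x))" by (simp add: fam)
  show "isset H (t_subset S U V)"
    unfolding t_subset_def by (rule set_Pi[OF space_dest(1)[OF s] space_dest(2)[OF s] 1 2])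
qed

lemma subset_E:
  assumes s: "space H S C P" and U: "sub H S U" and V: "sub H S V"
    and "tru H (t_subset S U V)" "has H a (el S)" "tru H (U \<cdot> a)"
  shows "tru H (V \<cdot> a)"
proof -
  have "tru H (p_imp (U \<cdot> a) (V \<cdot> a))"
    using all_E[OF space_dest(1)[OF s] space_dest(2)[OF s] subset_family(1,2)[OF s U V] _ assms(5)] assms(4)
    by (simp add: t_subset_def)
  then show ?thesis
    by (rule imp_E[OF space_dest(1)[OF s] sub_app[OF U assms(5)] sub_app[OF V assms(5)] _ assms(6)])
qed

lemma sub_const:
  assumes s: "space H S C P"
  shows "sub H S (t_lam (\<lambda>x. P))" "has H a (el S) \<Longrightarrow> eq H (t_lam (\<lambda>x. P) \<cdot> a) P set_ty"
proof -
  note S = space_dest(2)[OF s] and P = space_dest(4)[OF s]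
  show "sub H S (t_lam (\<lambda>x. P))"
    by (rule sub_lam[where F = "\<lambda>x. P", OF s isset_weak[OF S P] tmfam_const[OF has_stab[OF P]]])
  show "eq H (t_lam (\<lambda>x. P) \<cdot> a) P set_ty" if "has H a (el S)"
    by (rule eq_const[OF S isset_weak[OF S P] has_stab[OF P] tystab_set that])
qed

text \<open>Turns a finite list that covers the space into a decision of \<open>P\<close>. The
  existential data of compactness are assumed to be opened already, so \<open>n\<close> and
  \<open>f\<close> are given elements.\<close>

lemma decides_of_listed_cover:
  assumes fs: "fspace H S C P" and n: "has H n (el (cNat $$ []))" and f: "has H f (el (p_imp (Fin n) S))"
  defines "U \<equiv> t_lam (\<lambda>x. P)"
  assumes sub: "tru H (t_subset S (t_listed S n f) (t_union U (t_pseudocompl S C U)))"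
    and cov: "tru H (t_covers_space S C (t_listed S n f))"
    and nt: "tru H (p_not (t_covers_space S C t_none))"
  shows "tru H (p_or P (p_not P))"
proof -
  note s = fspace_space[OF fs]
  let ?D = "t_pseudocompl S C U"
  note c = space_dest(1)[OF s] and S = space_dest(2)[OF s] and P = space_dest(4)[OF s]
  note U = sub_const(1)[OF s, folded U_def]
  note D = compl_family(3)[OF s U]
  have b: "pred_data H S ?D P" by (simp add: pred_data_def c S P D)
  note F = set_Fin[OF c n]
  note i1 = has_var[OF isty_el[OF F]]
  have s1: "space (H \<triangleright> el (Fin n)) S C P" by (rule space_weak[OF s F])
  note b1 = pred_data_fin[OF b n]
  note w1 = has_weak[OF _ pred_data_dest(1)[OF b1]]
  note x1 = has_entry[OF b1 w1[OF n] w1[OF f] i1]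
  note U1 = sub_const(1)[OF s1, folded U_def] and PU1 = sub_const(2)[OF s1 x1, folded U_def]
  have "tru (H \<triangleright> el (Fin n)) (t_union U ?D \<cdot> entry S n f (lv (length H)))"
    by (rule subset_E[OF s1 listed_family'(3)[OF b1 w1[OF n] w1[OF f]] union_family(3)[OF s1 U1 w1[OF D]]
          inh_weak[OF sub pred_data_dest(1)[OF b1]] x1 listed_I[OF b1 w1[OF n] w1[OF f] i1]])
  then have "tru (H \<triangleright> el (Fin n)) (p_or (U \<cdot> entry S n f (lv (length H))) (?D \<cdot> entry S n f (lv (length H))))"
    using tru_beta[OF union_family(1)[OF s1 U1 w1[OF D]] x1 union_family(2)[OF s1 U1 w1[OF D]]]
    by (simp add: t_union_def)
  then have "tru (H \<triangleright> el (Fin n)) (p_or P (?D \<cdot> entry S n f (lv (length H))))"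
    by (rule tru_conv[OF _ eq_Plus[OF pred_data_dest(1)[OF b1] PU1 eq_refl[OF set_app[OF b1 x1]]]])
  then have "tru H (all_or S ?D P n f)" by (rule all_or_I[OF b n f])
  then have or: "tru H (p_or P (all_in S ?D n f))"
    by (rule choice_stmt_E[OF b n finite_choice[OF b n] f])
  note A = set_all_in[OF b n f] and N = set_not[OF c P]
  note goal = set_or[OF c P N]
  show ?thesis
  proof (rule or_E[OF c P A goal or])
    show "tru (H \<triangleright> el P) (p_or P (p_not P))"
      using pred_data_weak[OF b P] by (intro or_I(1) tru_hyp P isset_weak[OF P] N pred_data_dest)
    let ?H1 = "H \<triangleright> el (all_in S ?D n f)"
    note fs1 = fspace_weak[OF fs A]
    note s1 = space_weak[OF s A] and b1 = pred_data_weak[OF b A]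
    note c1 = space_dest(1)[OF s1] and P1 = space_dest(4)[OF s1]
    \<comment> \<open>From here on the contexts accumulate the data for refuting \<open>P\<close>:
      the assumption \<open>P\<close>, a point \<open>a\<close> of the base, a point
      \<open>u\<close> with a proof that it is listed, an index \<open>i\<close>, and an identity of
      \<open>u\<close> with the entry at \<open>i\<close>.\<close>
    let ?H2 = "?H1 \<triangleright> el P"
    note fs2 = fspace_weak[OF fs1 P1]
    note s2 = space_weak[OF s1 P1] and b2 = pred_data_weak[OF b1 P1]
    note c2 = space_dest(1)[OF s2] and S2 = space_dest(2)[OF s2]
    let ?H3 = "?H2 \<triangleright> el S"
    let ?a = "lv (length ?H2)"
    note fs3 = fspace_weak[OF fs2 S2]
    note s3 = space_weak[OF s2 S2] and b3 = pred_data_weak[OF b2 S2]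
    note c3 = space_dest(1)[OF s3] and S3 = space_dest(2)[OF s3]
    note a3 = has_var[OF isty_el[OF S2]]
    let ?H4 = "?H3 \<triangleright> el S"
    let ?u = "lv (length ?H3)"
    note fs4 = fspace_weak[OF fs3 S3]
    note s4 = space_weak[OF s3 S3] and b4 = pred_data_weak[OF b3 S3]
    note c4 = space_dest(1)[OF s4]
    note u4 = has_var[OF isty_el[OF S3]]
    have w2: "has ?H2 t T" if "has H t T" for t T
      by (intro has_weak[OF _ c1] has_weak[OF _ c2] that)
    have w3: "has ?H3 t T" if "has H t T" for t T
      by (intro has_weak[OF _ c3] w2 that)
    have w4: "has ?H4 t T" if "has H t T" for t T
      by (intro has_weak[OF _ c4] w3 that)
    let ?L = "t_listed S n f"
    have L: "sub K S ?L" if "pred_data K S ?D P" "has K n (el (cNat $$ []))" "has K f (el (p_imp (Fin n) S))" for K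
      by (rule listed_family'(3)[OF that])
    note L4 = sub_app[OF L[OF b4 w4[OF n] w4[OF f]] u4]
    let ?H5 = "?H4 \<triangleright> el (?L \<cdot> ?u)"
    note fs5 = fspace_weak[OF fs4 L4]
    note s5 = space_weak[OF s4 L4] and b5 = pred_data_weak[OF b4 L4]
    note c5 = space_dest(1)[OF s5]
    have w5: "has ?H5 t T" if "has H t T" for t T
      by (intro has_weak[OF _ c5] w4 that)
    note u5 = has_weak[OF u4 c5]
    note F5 = set_Fin[OF c5 w5[OF n]]
    let ?H6 = "?H5 \<triangleright> el (Fin n)"
    let ?i = "lv (length ?H5)"
    note fs6 = fspace_weak[OF fs5 F5]
    note s6 = space_weak[OF s5 F5] and b6 = pred_data_weak[OF b5 F5]
    note c6 = space_dest(1)[OF s6]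
    note E6 = listed_family(1)[OF b5 w5[OF n] w5[OF f] u5]
    let ?H7 = "?H6 \<triangleright> el (cId $$ [S, ?u, entry S n f ?i])"
    note fs7 = fspace_weak[OF fs6 E6]
    note s7 = space_weak[OF s6 E6] and b7 = pred_data_weak[OF b6 E6]
    note c7 = space_dest(1)[OF s7]
    have w7: "has ?H7 t T" if "has H t T" for t T
      by (intro has_weak[OF _ c6] has_weak[OF _ c7] w5 that)
    note u7 = has_weak[OF has_weak[OF u5 c6] c7]
    note i7 = has_weak[OF has_var[OF isty_el[OF F5]] c7]
    note x7 = has_entry[OF b7 w7[OF n] w7[OF f] i7]
    have "tru ?H7 P"
      by (intro inh_weak[OF _ c7] inh_weak[OF _ c6] inh_weak[OF _ c5] inh_weak[OF _ c4] inh_weak[OF _ c3] tru_hyp P1)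
    then have U7: "tru ?H7 (U \<cdot> entry S n f ?i)"
      by (rule tru_conv[OF _ eq_sym[OF sub_const(2)[OF s7 x7, folded U_def]]])
    have "tru ?H7 (all_in S ?D n f)"
      by (intro inh_weak[OF _ c7] inh_weak[OF _ c6] inh_weak[OF _ c5] inh_weak[OF _ c4] inh_weak[OF _ c3]
          inh_weak[OF _ c2] tru_hyp A)
    then have "tru ?H7 (?D \<cdot> entry S n f ?i)"
      by (rule all_in_E[OF b7 w7[OF n] w7[OF f] _ i7])
    then have C7: "tru ?H7 (C \<cdot> entry S n f ?i \<cdot> t_none)"
      by (rule compl_E[OF fs7 w7[OF U] x7 _ U7])
    \<comment> \<open>Being listed means identity with an entry in the propositional sense, so the
      covering of the entry has to be transported to \<open>u\<close>.\<close>
    have "tru ?H7 (C \<cdot> ?u \<cdot> t_none)"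
      by (rule id_subst[where Q = "\<lambda>x. C \<cdot> x \<cdot> t_none", OF c7 space_dest(2)[OF s7]
            covers_family(1,2)[OF s7 sub_none[OF s7]] u7 x7 tru_hyp[OF E6] C7])
    moreover have "tru ?H5 (p_ex (Fin n) (\<lambda>i. cId $$ [S, ?u, entry S n f i]))"
    proof -
      have "tru ?H5 (?L \<cdot> ?u)" by (rule tru_hyp[OF L4])
      then show ?thesis
        using tru_beta[OF listed_family'(1)[OF b5 w5[OF n] w5[OF f]] u5 listed_family'(2)[OF b5 w5[OF n] w5[OF f]]]
          listed_family'(4)[OF b5 w5[OF n] w5[OF f]] by simp
    qed
    ultimately have "tru ?H5 (C \<cdot> ?u \<cdot> t_none)"
      by (intro ex_E[where F = "\<lambda>i. cId $$ [S, ?u, entry S n f i]", OF c5 F5 listed_family(1,2)[OF b5 w5[OF n] w5[OF f] u5]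
            _ set_cov[OF s5 u5 sub_none[OF s5]]])
    then have covs: "tru ?H3 (t_covs S C ?L t_none)"
      by (rule covs_I[OF s3 L[OF b3 w3[OF n] w3[OF f]] sub_none[OF s3]])
    have "tru ?H3 (t_covers_space S C ?L)"
      by (intro inh_weak[OF _ c3] inh_weak[OF _ c2] inh_weak[OF _ c1] cov)
    then have "tru ?H3 (C \<cdot> ?a \<cdot> ?L)"
      using all_E[where F = "\<lambda>a. C \<cdot> a \<cdot> ?L", OF c3 S3 covers_family(1,2)[OF s3 L[OF b3 w3[OF n] w3[OF f]]] _ a3]
      by (simp add: t_covers_space_def)
    then have "tru ?H3 (C \<cdot> ?a \<cdot> t_none)"
      by (rule trans_E[OF fs3 a3 L[OF b3 w3[OF n] w3[OF f]] sub_none[OF s3] _ covs])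
    then have "tru ?H2 (t_covers_space S C t_none)"
      unfolding t_covers_space_def
      by (rule all_I[where F = "\<lambda>a. C \<cdot> a \<cdot> t_none", OF c2 S2 covers_family(1,2)[OF s2 sub_none[OF s2]]])
    moreover have "tru ?H2 (p_not (t_covers_space S C t_none))"
      by (intro inh_weak[OF _ c2] inh_weak[OF _ c1] nt)
    ultimately have "tru ?H2 p_bot"
      unfolding p_not_def using imp_E[OF c2 covers_family(3)[OF s2 sub_none[OF s2]] set_bot[OF c2]] by blast
    then have "tru ?H1 (p_not P)"
      unfolding p_not_def by (rule imp_I[OF c1 P1 set_bot[OF c1]])
    then show "tru ?H1 (p_or P (p_not P))"
      by (rule or_I(2)[OF c1 P1 set_not[OF c1 P1]])
  qed
qed

text \<open>Eliminating the existential quantifiers of compactness requires that their bodies are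
  families of sets; this treats the inner one, over sequences.\<close>

lemma compact_family:
  assumes s: "space K S C P" and W: "sub K S W" and n: "has K n (el (cNat $$ []))"
  defines "B \<equiv> \<lambda>f. p_and (t_subset S (t_listed S n f) W) (t_covers_space S C (t_listed S n f))"
  shows "isset (K \<triangleright> el (p_imp (Fin n) S)) (B (lv (length K)))" "tmfam (length K) B"
      "isset K (p_ex (p_imp (Fin n) S) B)"
proof -
  \<comment> \<open>The facts on lists are stated for \<open>pred_data\<close>, whose predicate slot
    is filled with \<open>W\<close> here, the predicate at hand.\<close>
  have b: "pred_data K S W P" using s W by (simp add: pred_data_def space_def)
  note q = set_seq[OF b n]
  note s1 = space_weak[OF s q] and b1 = pred_data_weak[OF b q]
  note w = has_weak[OF _ space_dest(1)[OF s1]]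
  note L = listed_family'(3)[OF b1 w[OF n] has_var[OF isty_el[OF q]]]
  show 1: "isset (K \<triangleright> el (p_imp (Fin n) S)) (B (lv (length K)))"
    unfolding B_def by (rule set_and[OF space_dest(1)[OF s1] subset_family(3)[OF s1 L w[OF W]] covers_family(3)[OF s1 L]])
  show 2: "tmfam (length K) B"
    using space_stab[OF s] n[THEN has_stab] W[THEN has_stab] by (simp add: B_def fam)
  show "isset K (p_ex (p_imp (Fin n) S) B)" by (rule set_Sigma[OF space_dest(1)[OF s] q 1 2])
qed

lemma compact_family':
  assumes s: "space K S C P" and W: "sub K S W"
  defines "B \<equiv> \<lambda>n. p_ex (p_imp (Fin n) S) (\<lambda>f. p_and (t_subset S (t_listed S n f) W) (t_covers_space S C (t_listed S n f)))"
  shows "tmfam (length K) B" "isset K (p_ex (cNat $$ []) B)"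
proof -
  note N = set_Nat[OF space_dest(1)[OF s]]
  note s1 = space_weak[OF s N]
  show 1: "tmfam (length K) B"
    using space_stab[OF s] W[THEN has_stab] by (simp add: B_def fam)
  show "isset K (p_ex (cNat $$ []) B)"
    by (rule set_Sigma[OF space_dest(1)[OF s] N _ 1], unfold B_def,
        rule compact_family(3)[OF s1 has_weak[OF W space_dest(1)[OF s1]] has_var[OF isty_el[OF N]]])
qed

lemma compact_boolean_decides:
  assumes fs: "fspace H S C P" and nt: "inh H (t_nontrivial S C)" and bo: "inh H (t_boolean_space S C)"
    and co: "inh H (t_compact_space S C)"
  shows "tru H (p_or P (p_not P))"
proof -
  note s = fspace_space[OF fs]
  note c = space_dest(1)[OF s] and S = space_dest(2)[OF s] and P = space_dest(4)[OF s]
  define U where "U = t_lam (\<lambda>x. P)"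
  define W where "W = t_union U (t_pseudocompl S C U)"
  note U = sub_const(1)[OF s, folded U_def]
  note W = union_family(3)[OF s U compl_family(3)[OF s U], folded W_def]
  note [fam] = space_stab[OF s] U[THEN has_stab] W[THEN has_stab]
  let ?sub = "fun_ty (el S) (\<lambda>x. set_ty)"
  let ?body = "\<lambda>n f. p_and (t_subset S (t_listed S n f) W) (t_covers_space S C (t_listed S n f))"
  let ?inner = "\<lambda>n. p_ex (p_imp (Fin n) S) (?body n)"
  have "inh H (fun_ty ?sub (\<lambda>U. el (t_covers_space S C (t_union U (t_pseudocompl S C U)))))"
    using bo by (simp add: t_boolean_space_def subset_ty_def arrow_def)
  then have "tru H (t_covers_space S C (t_union U (t_pseudocompl S C U)))"
    by (rule inh_app[OF _ U]) (simp add: fam)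
  then have cov: "tru H (t_covers_space S C W)" by (simp add: W_def)
  have "inh H (fun_ty ?sub (\<lambda>U. el (p_imp (t_covers_space S C U)
       (p_ex (cNat $$ []) (\<lambda>n. p_ex (p_imp (Fin n) S) (\<lambda>f.
         p_and (t_subset S (t_listed S n f) U) (t_covers_space S C (t_listed S n f))))))))"
    using co by (simp add: t_compact_space_def subset_ty_def arrow_def)
  then have imp: "tru H (p_imp (t_covers_space S C W) (p_ex (cNat $$ []) ?inner))"
    by (rule inh_app[OF _ W]) (simp add: fam)
  let ?H1 = "H \<triangleright> el (cNat $$ [])" and ?n = "lv (length H)"
  note N = set_Nat[OF c]
  note goal = set_or[OF c P set_not[OF c P]]
  have b: "pred_data H S U P" by (simp add: pred_data_def c S P U)
  note s1 = space_weak[OF s N] and b1 = pred_data_weak[OF b N]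
  note c1 = space_dest(1)[OF s1] and w1 = has_weak[OF _ space_dest(1)[OF s1]]
  note n1 = has_var[OF isty_el[OF N]]
  note q1 = set_seq[OF b1 n1]
  note I1 = compact_family(3)[OF s1 w1[OF W] n1]
  note If = compact_family'(1)[OF s W] and ex1 = compact_family'(2)[OF s W]
  have main: "tru H (p_ex (cNat $$ []) ?inner)"
    by (rule imp_E[OF c covers_family(3)[OF s W] ex1 imp cov])
  \<comment> \<open>The contexts for two nested existential eliminations: after the length come the
    remaining existential statement, the sequence, and finally its two properties.\<close>
  let ?H2 = "?H1 \<triangleright> el (?inner ?n)"
  note s2 = space_weak[OF s1 I1] and b2 = pred_data_weak[OF b1 I1]
  note c2 = space_dest(1)[OF s2] and w2 = has_weak[OF _ space_dest(1)[OF s2]]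
  note n2 = w2[OF n1] and W2 = w2[OF w1[OF W]]
  note q2 = set_seq[OF b2 n2]
  let ?f = "lv (length ?H2)"
  let ?H3 = "?H2 \<triangleright> el (p_imp (Fin ?n) S)"
  note s3 = space_weak[OF s2 q2] and b3 = pred_data_weak[OF b2 q2]
  note c3 = space_dest(1)[OF s3] and w3 = has_weak[OF _ space_dest(1)[OF s3]]
  note f3 = has_var[OF isty_el[OF q2]]
  note B3 = compact_family(1)[OF s2 W2 n2]
  let ?H4 = "?H3 \<triangleright> el (?body ?n ?f)"
  note s4 = space_weak[OF s3 B3] and b4 = pred_data_weak[OF b3 B3]
  note c4 = space_dest(1)[OF s4] and w4 = has_weak[OF _ space_dest(1)[OF s4]]
  note n4 = w4[OF w3[OF n2]] and f4 = w4[OF f3] and W4 = w4[OF w3[OF W2]]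
  note L4 = listed_family'(3)[OF b4 n4 f4]
  note fs4 = fspace_weak[OF fspace_weak[OF fspace_weak[OF fspace_weak[OF fs N] I1] q2] B3]
  note and4 = and_E[OF c4 subset_family(3)[OF s4 L4 W4] covers_family(3)[OF s4 L4] tru_hyp[OF B3]]
  have nt4: "tru ?H4 (p_not (t_covers_space S C t_none))"
    by (intro inh_weak[OF _ c4] inh_weak[OF _ c3] inh_weak[OF _ c2] inh_weak[OF _ c1])
      (use nt in \<open>simp add: t_nontrivial_def\<close>)
  have "tru ?H4 (p_or P (p_not P))"
    by (rule decides_of_listed_cover[OF fs4 n4 f4, folded U_def, folded W_def, OF and4 nt4])
  then have "tru ?H2 (p_or P (p_not P))"
    by (rule ex_E[OF c2 q2 compact_family(1,2)[OF s2 W2 n2] tru_hyp[OF I1] w2[OF w1[OF goal]]])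
  then show ?thesis
    by (rule ex_E[OF c N I1 If main goal])
qed

section \<open>Well-formedness of the hypotheses and their discharge\<close>

lemma isty_subset: "isset G S \<Longrightarrow> ctx G \<Longrightarrow> isty G (fun_ty (el S) (\<lambda>x. set_ty))"
  by (rule isty_fun[OF isty_el isty_set]) (auto intro: ctx_ext isty_el simp: fam)

lemma space_weak': "space H S C P \<Longrightarrow> ctx (H \<triangleright> X) \<Longrightarrow> space (H \<triangleright> X) S C P"
  by (auto simp: space_def intro: has_weak)

text \<open>Abstraction by \<open>inh_lam\<close> asks for a well-formed domain at each step, so all
  axioms must be shown to be types. The proposition slot of \<open>space\<close> is filled with
  \<open>S\<close>, as no proposition has entered the context yet.\<close>

lemma isty_axioms:
  assumes s: "space H S C S"
  shows "isty H (t_reflexivity S C)" "isty H (t_transitivity S C)" "isty H (t_down_right S C)"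
    "isty H (t_nontrivial S C)" "isty H (t_boolean_space S C)" "isty H (t_compact_space S C)"
proof -
  note [fam] = space_stab(1,2)[OF s]
  let ?T = "fun_ty (el S) (\<lambda>x. set_ty)"
  note c = space_dest(1)[OF s] and S = space_dest(2)[OF s]
  let ?H1 = "H \<triangleright> el S" and ?a = "lv (length H)"
  note s1 = space_weak[OF s S]
  note c1 = space_dest(1)[OF s1]
  note a1 = has_var[OF isty_el[OF S]]
  have T: "isty K ?T" if "space K S C S" for K
    by (rule isty_subset[OF space_dest(2)[OF that] space_dest(1)[OF that]])
  let ?H2 = "?H1 \<triangleright> ?T" and ?U = "lv (length ?H1)"
  note T1 = T[OF s1]
  note s2 = space_weak'[OF s1 ctx_ext[OF T1]]
  note c2 = space_dest(1)[OF s2]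
  note a2 = has_weak[OF a1 c2] and U2 = has_var[OF T1]
  let ?H3 = "?H2 \<triangleright> ?T" and ?V = "lv (length ?H2)"
  note T2 = T[OF s2]
  note s3 = space_weak'[OF s2 ctx_ext[OF T2]]
  note c3 = space_dest(1)[OF s3]
  note a3 = has_weak[OF a2 c3] and U3 = has_weak[OF U2 c3] and V3 = has_var[OF T2]
  have "isty ?H2 (el (p_imp (?U \<cdot> ?a) (C \<cdot> ?a \<cdot> ?U)))"
    by (intro isty_el set_imp[OF c2 sub_app[OF U2 a2] set_cov[OF s2 a2 U2]])
  then have "isty ?H1 (fun_ty ?T (\<lambda>U. el (p_imp (U \<cdot> ?a) (C \<cdot> ?a \<cdot> U))))"
    by (rule isty_fun[OF T1]) (simp_all add: fam)
  then have "isty H (fun_ty (el S) (\<lambda>a. fun_ty ?T (\<lambda>U. el (p_imp (U \<cdot> a) (C \<cdot> a \<cdot> U)))))"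
    by (rule isty_fun[OF isty_el[OF S]]) (simp_all add: fam)
  then show "isty H (t_reflexivity S C)"
    by (simp add: t_reflexivity_def subset_ty_def arrow_def)
  have "isty ?H3 (el (p_imp (p_and (C \<cdot> ?a \<cdot> ?U) (t_covs S C ?U ?V)) (C \<cdot> ?a \<cdot> ?V)))"
    by (intro isty_el set_imp[OF c3] set_and[OF c3] set_cov[OF s3 a3] set_covs[OF s3] U3 V3)
  then have "isty ?H2 (fun_ty ?T (\<lambda>V. el (p_imp (p_and (C \<cdot> ?a \<cdot> ?U) (t_covs S C ?U V)) (C \<cdot> ?a \<cdot> V))))"
    by (rule isty_fun[OF T2]) (simp_all add: fam)
  then have "isty ?H1 (fun_ty ?T (\<lambda>U. fun_ty ?T (\<lambda>V. el (p_imp (p_and (C \<cdot> ?a \<cdot> U) (t_covs S C U V)) (C \<cdot> ?a \<cdot> V)))))"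
    by (rule isty_fun[OF T1]) (simp_all add: fam)
  then have "isty H (fun_ty (el S) (\<lambda>a. fun_ty ?T (\<lambda>U. fun_ty ?T (\<lambda>V.
      el (p_imp (p_and (C \<cdot> a \<cdot> U) (t_covs S C U V)) (C \<cdot> a \<cdot> V))))))"
    by (rule isty_fun[OF isty_el[OF S]]) (simp_all add: fam)
  then show "isty H (t_transitivity S C)"
    by (simp add: t_transitivity_def subset_ty_def arrow_def)
  have "isty ?H3 (el (p_imp (p_and (C \<cdot> ?a \<cdot> ?U) (C \<cdot> ?a \<cdot> ?V)) (C \<cdot> ?a \<cdot> t_down S C ?U ?V)))"
    by (intro isty_el set_imp[OF c3] set_and[OF c3] set_cov[OF s3 a3] down_family(3)[OF s3] U3 V3)
  then have "isty ?H2 (fun_ty ?T (\<lambda>V. el (p_imp (p_and (C \<cdot> ?a \<cdot> ?U) (C \<cdot> ?a \<cdot> V)) (C \<cdot> ?a \<cdot> t_down S C ?U V))))"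
    by (rule isty_fun[OF T2]) (simp_all add: fam)
  then have "isty ?H1 (fun_ty ?T (\<lambda>U. fun_ty ?T (\<lambda>V. el (p_imp (p_and (C \<cdot> ?a \<cdot> U) (C \<cdot> ?a \<cdot> V)) (C \<cdot> ?a \<cdot> t_down S C U V)))))"
    by (rule isty_fun[OF T1]) (simp_all add: fam)
  then have "isty H (fun_ty (el S) (\<lambda>a. fun_ty ?T (\<lambda>U. fun_ty ?T (\<lambda>V.
      el (p_imp (p_and (C \<cdot> a \<cdot> U) (C \<cdot> a \<cdot> V)) (C \<cdot> a \<cdot> t_down S C U V))))))"
    by (rule isty_fun[OF isty_el[OF S]]) (simp_all add: fam)
  then show "isty H (t_down_right S C)"
    by (simp add: t_down_right_def subset_ty_def arrow_def)
  show "isty H (t_nontrivial S C)"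
    unfolding t_nontrivial_def by (intro isty_el set_not[OF c] covers_family(3)[OF s sub_none[OF s]])
  let ?K = "H \<triangleright> ?T" and ?X = "lv (length H)"
  note k = space_weak'[OF s ctx_ext[OF T[OF s]]]
  note X = has_var[OF T[OF s]]
  have "isty ?K (el (t_covers_space S C (t_union ?X (t_pseudocompl S C ?X))))"
    by (intro isty_el covers_family(3)[OF k] union_family(3)[OF k] compl_family(3)[OF k] X)
  then have "isty H (fun_ty ?T (\<lambda>U. el (t_covers_space S C (t_union U (t_pseudocompl S C U)))))"
    by (rule isty_fun[OF T[OF s]]) (simp_all add: fam)
  then show "isty H (t_boolean_space S C)"
    by (simp add: t_boolean_space_def subset_ty_def arrow_def)
  have "isty ?K (el (p_imp (t_covers_space S C ?X)
       (p_ex (cNat $$ []) (\<lambda>n. p_ex (p_imp (Fin n) S) (\<lambda>f.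
         p_and (t_subset S (t_listed S n f) ?X) (t_covers_space S C (t_listed S n f)))))))"
    by (intro isty_el set_imp[OF space_dest(1)[OF k]] covers_family(3)[OF k X] compact_family'(2)[OF k X])
  then have "isty H (fun_ty ?T (\<lambda>U. el (p_imp (t_covers_space S C U)
       (p_ex (cNat $$ []) (\<lambda>n. p_ex (p_imp (Fin n) S) (\<lambda>f.
         p_and (t_subset S (t_listed S n f) U) (t_covers_space S C (t_listed S n f))))))))"
    by (rule isty_fun[OF T[OF s]]) (simp_all add: fam)
  then show "isty H (t_compact_space S C)"
    by (simp add: t_compact_space_def subset_ty_def arrow_def)
qed

lemma inh_arrow:
  assumes "isty G A" "tystab (length G) B" "inh (G \<triangleright> A) B"
  shows "inh G (A \<rightarrow> B)"
  unfolding arrow_def by (rule inh_lam[where B = "\<lambda>x. B", OF assms(1,3) tyfam_const[OF assms(2)]])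

lemma inh_hyp: "isty G A \<Longrightarrow> inh (G \<triangleright> A) A"
  by (rule inhI[OF has_var])

text \<open>The context grows by the base, the cover, the six hypotheses and the proposition. Every
  hypothesis is well formed over the context before it, and all are discharged again from the inside
  out.\<close>

lemma inh_compact_boolean: "inh [] compact_boolean_imp_EM_CTT"
proof -
  have c0: "ctx []" by (simp add: ctx_def LF_nil)
  let ?S = "lv 0 :: 'c tmx" and ?C = "lv 1 :: 'c tmx"
  let ?G1 = "[] \<triangleright> set_ty"
  have S1: "isset ?G1 ?S" using has_var[OF isty_set[OF c0]] by simp
  have c1: "ctx ?G1" by (intro ctx_ext isty_set c0)
  have cty: "isty ?G1 (cover_ty ?S)"
  proof -
    note T = isty_subset[OF S1 c1]
    have "isty (?G1 \<triangleright> el ?S) (fun_ty (fun_ty (el ?S) (\<lambda>x. set_ty)) (\<lambda>x. set_ty))"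
      by (rule isty_fun[OF isty_weak[OF T]]) (auto intro!: isty_set ctx_ext isty_weak[OF T] isty_el S1 simp: fam)
    then show ?thesis
      unfolding cover_ty_def subset_ty_def arrow_def
      by (rule isty_fun[OF isty_el[OF S1]]) (simp add: fam)
  qed
  let ?G2 = "?G1 \<triangleright> cover_ty ?S"
  have s2: "space ?G2 ?S ?C ?S"
    using has_var[OF cty] has_weak[OF S1 ctx_ext[OF cty]] ctx_ext[OF cty] by (simp add: space_def)
  let ?ax1 = "t_reflexivity ?S ?C" and ?ax2 = "t_transitivity ?S ?C" and ?ax3 = "t_down_right ?S ?C"
    and ?ax4 = "t_nontrivial ?S ?C" and ?ax5 = "t_boolean_space ?S ?C" and ?ax6 = "t_compact_space ?S ?C"
  let ?G3 = "?G2 \<triangleright> ?ax1"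
  note i2 = isty_axioms(1)[OF s2]
  note s3 = space_weak'[OF s2 ctx_ext[OF i2]] and h3 = inh_hyp[OF i2]
  let ?G4 = "?G3 \<triangleright> ?ax2"
  note i3 = isty_axioms(2)[OF s3]
  note s4 = space_weak'[OF s3 ctx_ext[OF i3]] and h4 = inh_hyp[OF i3]
  let ?G5 = "?G4 \<triangleright> ?ax3"
  note i4 = isty_axioms(3)[OF s4]
  note s5 = space_weak'[OF s4 ctx_ext[OF i4]]
  let ?G6 = "?G5 \<triangleright> ?ax4"
  note i5 = isty_axioms(4)[OF s5]
  note s6 = space_weak'[OF s5 ctx_ext[OF i5]] and h6 = inh_hyp[OF i5]
  let ?G7 = "?G6 \<triangleright> ?ax5"
  note i6 = isty_axioms(5)[OF s6]
  note s7 = space_weak'[OF s6 ctx_ext[OF i6]] and h7 = inh_hyp[OF i6]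
  let ?G8 = "?G7 \<triangleright> ?ax6"
  note i7 = isty_axioms(6)[OF s7]
  note s8 = space_weak'[OF s7 ctx_ext[OF i7]] and h8 = inh_hyp[OF i7]
  let ?G9 = "?G8 \<triangleright> set_ty" and ?P = "lv (length ?G8)"
  note c3 = space_dest(1)[OF s3] and c4 = space_dest(1)[OF s4] and c5 = space_dest(1)[OF s5]
    and c6 = space_dest(1)[OF s6] and c7 = space_dest(1)[OF s7] and c8 = space_dest(1)[OF s8]
  note i8 = isty_set[OF c8]
  note c9 = ctx_ext[OF i8]
  \<comment> \<open>The proposition slot, so far occupied by \<open>S\<close>, now receives the
    variable for the proposition to be decided.\<close>
  have s9: "space ?G9 ?S ?C ?P"
    using space_weak'[OF s8 c9] has_var[OF i8] by (simp add: space_def)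
  have fs9: "fspace ?G9 ?S ?C ?P"
    unfolding fspace_def
    by (intro conjI s9 inh_weak[OF _ c9] inh_weak[OF _ c8] inh_weak[OF _ c7] inh_weak[OF _ c6]
        inh_weak[OF _ c5] h4) (intro inh_weak[OF _ c4] h3)
  have "tru ?G9 (p_or ?P (p_not ?P))"
    by (rule compact_boolean_decides[OF fs9]) (intro inh_weak[OF _ c9] h8 inh_weak[OF _ c8] h7 inh_weak[OF _ c7] h6)+
  then have "inh ?G8 EM_CTT"
    unfolding EM_CTT_def by (rule inh_lam[where B = "\<lambda>P. el (p_or P (p_not P))", OF i8]) (simp add: fam)
  \<comment> \<open>The hypotheses mention the variables of levels 0 and 1, so they are stable from
    depth 2 on; \<open>EM_CTT\<close> is closed and stable from every depth.\<close>
  moreover have st: "tystab n (EM_CTT :: 'c tyx)" "tystab (Suc (Suc n)) ?ax2" "tystab (Suc (Suc n)) ?ax3" "tystab (Suc (Suc n)) ?ax4"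
      "tystab (Suc (Suc n)) ?ax5" "tystab (Suc (Suc n)) ?ax6" for n
    by (simp_all add: EM_CTT_def t_transitivity_def t_down_right_def t_nontrivial_def t_boolean_space_def
        t_compact_space_def fam)
  ultimately have g2: "inh ?G2 (?ax1 \<rightarrow> ?ax2 \<rightarrow> ?ax3 \<rightarrow> ?ax4 \<rightarrow> ?ax5 \<rightarrow> ?ax6 \<rightarrow> EM_CTT)"
    by (intro inh_arrow i2 i3 i4 i5 i6 i7) (simp_all add: arrow_def tystab_fun tyfam_const)
  let ?T = "\<lambda>S C. t_reflexivity S C \<rightarrow> t_transitivity S C \<rightarrow> t_down_right S C \<rightarrow>
     t_nontrivial S C \<rightarrow> t_boolean_space S C \<rightarrow> t_compact_space S C \<rightarrow> EM_CTT"
  have g1: "inh ?G1 (fun_ty (cover_ty ?S) (?T ?S))"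
  proof (rule inh_lam[OF cty])
    show "inh ?G2 (?T ?S (lv (length ?G1)))" using g2 by simp
    show "tyfam (length ?G1) (?T ?S)"
      by (simp add: EM_CTT_def t_reflexivity_def t_transitivity_def t_down_right_def
        t_nontrivial_def t_boolean_space_def t_compact_space_def fam)
  qed
  show ?thesis
    unfolding compact_boolean_imp_EM_CTT_def
  proof (rule inh_lam[OF isty_set[OF c0]])
    show "inh ?G1 (fun_ty (cover_ty (lv (length []))) (?T (lv (length []))))" using g1 by simp
    show "tyfam (length []) (\<lambda>S. fun_ty (cover_ty S) (?T S))"
      by (simp add: EM_CTT_def t_reflexivity_def t_transitivity_def t_down_right_def
        t_nontrivial_def t_boolean_space_def t_compact_space_def fam)
  qed
qed

end

lemma CTT_compact_boolean:
  fixes Y :: "'c rule set"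
  shows "inhabited (CTT \<union> Y) compact_boolean_imp_EM_CTT"
proof -
  interpret ctt "CTT \<union> Y" by unfold_locales blast
  show ?thesis using inh_compact_boolean by (auto simp: inhabited_def inh_def has_def)
qed

theorem proposition4p7:
  fixes X :: "fm set" and Y :: "'c rule set"
  shows
    "(fm_consistent (CZF \<union> X \<union> GUP_CZF) \<longrightarrow>
        (\<forall>p. nd (CZF \<union> X) [] ((compact_boolean_CZF p \<longrightarrow>\<^sub>s REM) 0))) \<and>
     (ctt_consistent (CTT \<union> Y \<union> GUP_CTT) \<longrightarrow>
        inhabited (CTT \<union> Y) compact_boolean_imp_EM_CTT) \<and>
     (\<forall>A. hha [] [] ((compact_boolean_HHA A \<longrightarrow>\<^sub>h EM_HHA) 0)) \<and>
     (\<forall>p. nd IZF [] ((compact_boolean_IZF \<longrightarrow>\<^sub>s EM_instance p) 0))"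
  using CZF_compact_boolean CTT_compact_boolean HHA_compact_boolean IZF_compact_boolean by blast

end
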